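(* Let $n\ge 2$ and let $\Omega\subset\mathbb{R}^n$ be a bounded $C^{4,\gamma}$-smooth domain. Let $G_\Omega$ denote the biharmonic Green function in $\Omega$ under Dirichlet boundary conditions. Then there exist constants $c_1\ge 0$ and $c_2>0$, depending on the domain $\Omega$, such that $$c_2^{-1}\, H_\Omega(x,y)\le G_\Omega(x,y)+c_1\, d(x)^2 d(y)^2\le c_2\, H_\Omega(x,y)\qquad\text{for all } x,y\in\Omega,$$ where $$H_\Omega(x,y):=\begin{cases}|x-y|^{4-n}\min\left\{1,\dfrac{d(x)^2d(y)^2}{|x-y|^4}\right\} & \text{if } n>4,\\[3mm] \log\left(1+\dfrac{d(x)^2d(y)^2}{|x-y|^4}\right) & \text{if } n=4,\\[3mm] d(x)^{2-n/2}d(y)^{2-n/2}\min\left\{1,\dfrac{d(x)^{n/2}d(y)^{n/2}}{|x-y|^n}\right\} & \text{if } n=2,3.\end{cases}$$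
   Context: Here $\gamma\in(0,1)$. For $x\in\overline\Omega$, $d(x):=\inf\{|x-x^*| : x^*\in\partial\Omega\}$ is the distance to the boundary. The biharmonic Green function $G_\Omega$ under Dirichlet boundary conditions is the function such that, for every sufficiently regular $f$ (e.g. $f\in C^{0,\gamma}(\overline\Omega)$), $u(x)=\int_\Omega G_\Omega(x,y)f(y)\,dy$ solves $\Delta^2u=f$ in $\Omega$, $u=|\nabla u|=0$ on $\partial\Omega$. $G_\Omega$ is taken to be its continuous representative: continuous off the diagonal, and, for $n=2,3$, continuous also on the diagonal. Conventions on the diagonal $x=y$: for $n\ge4$ both $G_\Omega$ and $H_\Omega$ are $+\infty$ there, so the estimate is understood for $x\ne y$; for $n=2,3$ the minimum in $H_\Omega$ is read as $1$ when $x=y$. *)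

theory Defs
  imports "HOL-Analysis.Analysis"
begin

definition partial_deriv :: "'a::euclidean_space \<Rightarrow> ('a \<Rightarrow> real) \<Rightarrow> 'a \<Rightarrow> real" where
  "partial_deriv b f x = frechet_derivative f (at x) b"

definition laplacian :: "('a::euclidean_space \<Rightarrow> real) \<Rightarrow> 'a \<Rightarrow> real" where
  "laplacian f x = (\<Sum>b\<in>Basis. partial_deriv b (partial_deriv b f) x)"

text \<open>Only meaningful on open sets.\<close>

primrec C_k_on :: "nat \<Rightarrow> 'a::euclidean_space set \<Rightarrow> ('a \<Rightarrow> real) \<Rightarrow> bool" where
  "C_k_on 0 S f \<longleftrightarrow> continuous_on S f"
| "C_k_on (Suc k) S f \<longleftrightarrow>
     (\<forall>x\<in>S. f differentiable (at x)) \<and> (\<forall>b\<in>Basis. C_k_on k S (partial_deriv b f))"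

text \<open>The partial derivatives of order \<open>k\<close> are uniformly Hoelder continuous on \<open>S\<close> with
  exponent \<open>\<gamma>\<close>. For \<open>k > 0\<close> this is only meaningful on open sets; it is used there for balls,
  where boundedness of all derivatives of order at most \<open>k\<close> is automatic. For \<open>k = 0\<close> the set
  \<open>S\<close> is arbitrary; it is used for the closure of a bounded set, where boundedness is again
  automatic.\<close>

primrec C_k_holder_on ::
    "nat \<Rightarrow> real \<Rightarrow> 'a::euclidean_space set \<Rightarrow> ('a \<Rightarrow> real) \<Rightarrow> bool" where
  "C_k_holder_on 0 \<gamma> S f \<longleftrightarrow>
     (\<exists>C. \<forall>x\<in>S. \<forall>y\<in>S. \<bar>f x - f y\<bar> \<le> C * dist x y powr \<gamma>)"
| "C_k_holder_on (Suc k) \<gamma> S f \<longleftrightarrow>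
     (\<forall>x\<in>S. f differentiable (at x)) \<and> (\<forall>b\<in>Basis. C_k_holder_on k \<gamma> S (partial_deriv b f))"

text \<open>Near each boundary point, \<open>\<Omega>\<close> is the strict epigraph, in some unit direction \<open>e\<close>, of a
  \<open>C\<^sup>k\<^sup>,\<^sup>\<gamma>\<close> function on the hyperplane orthogonal to \<open>e\<close>. Such a function is encoded as a
  function \<open>g\<close> on the whole space that is constant along \<open>e\<close>. This forces the boundary to be
  locally the graph of \<open>g\<close>, with \<open>\<Omega>\<close> on one side only.\<close>

definition C_k_holder_domain :: "nat \<Rightarrow> real \<Rightarrow> 'a::euclidean_space set \<Rightarrow> bool" where
  "C_k_holder_domain k \<gamma> \<Omega> \<longleftrightarrow>
     open \<Omega> \<and> connected \<Omega> \<and> \<Omega> \<noteq> {} \<and>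
     (\<forall>p\<in>frontier \<Omega>. \<exists>r>0. \<exists>e g.
        norm e = 1 \<and> (\<forall>x t. g (x + t *\<^sub>R e) = g x) \<and>
        C_k_holder_on k \<gamma> (ball p r) g \<and>
        (\<forall>x\<in>ball p r. x \<in> \<Omega> \<longleftrightarrow> g x < x \<bullet> e))"

text \<open>Classical solutions of \<open>\<Delta>\<^sup>2 u = f\<close> in \<open>\<Omega>\<close> with \<open>u = |\<nabla>u| = 0\<close> on the boundary, in the class
  of functions that are \<open>C\<^sup>4\<close> inside and \<open>C\<^sup>1\<close> up to the boundary. Boundary values of \<open>u\<close> and
  \<open>\<nabla>u\<close> are those of the continuous extensions from \<open>\<Omega>\<close>; the values of the total function \<open>u\<close>
  outside \<open>\<Omega>\<close> play no role.\<close>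

definition solves_biharmonic_dirichlet ::
    "'a::euclidean_space set \<Rightarrow> ('a \<Rightarrow> real) \<Rightarrow> ('a \<Rightarrow> real) \<Rightarrow> bool" where
  "solves_biharmonic_dirichlet \<Omega> f u \<longleftrightarrow>
     C_k_on 4 \<Omega> u \<and>
     (\<forall>x\<in>\<Omega>. laplacian (laplacian u) x = f x) \<and>
     (\<forall>p\<in>frontier \<Omega>. (u \<longlongrightarrow> 0) (at p within \<Omega>) \<and>
        (\<forall>b\<in>Basis. (partial_deriv b u \<longlongrightarrow> 0) (at p within \<Omega>)))"

text \<open>The continuity requirements select the continuous representative, which makes \<open>G\<close> unique
  on \<open>\<Omega> \<times> \<Omega>\<close>, except on the diagonal in dimension at least 4. There the value of the Green
  function is \<open>\<infinity>\<close>, and the real value of \<open>G\<close> is left unconstrained.\<close>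

definition biharmonic_green_function ::
    "real \<Rightarrow> 'a::euclidean_space set \<Rightarrow> ('a \<Rightarrow> 'a \<Rightarrow> real) \<Rightarrow> bool" where
  "biharmonic_green_function \<gamma> \<Omega> G \<longleftrightarrow>
     continuous_on {(x, y). x \<in> \<Omega> \<and> y \<in> \<Omega> \<and> x \<noteq> y} (\<lambda>(x, y). G x y) \<and>
     (DIM('a) \<in> {2, 3} \<longrightarrow> continuous_on (\<Omega> \<times> \<Omega>) (\<lambda>(x, y). G x y)) \<and>
     (\<forall>f. C_k_holder_on 0 \<gamma> (closure \<Omega>) f \<longrightarrow>
        (\<forall>x\<in>\<Omega>. set_integrable lborel \<Omega> (\<lambda>y. G x y * f y)) \<and>
        solves_biharmonic_dirichlet \<Omega> f (\<lambda>x. LINT y:\<Omega>|lborel. G x y * f y))"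

definition bdist :: "'a::euclidean_space set \<Rightarrow> 'a \<Rightarrow> real" where
  "bdist \<Omega> x = infdist x (frontier \<Omega>)"

text \<open>In dimensions 2 and 3 the minimum is read as \<open>1\<close> on the diagonal (division by zero would
  make it \<open>0\<close>). In dimension at least 4 only the values off the diagonal are meaningful.\<close>

definition H_kernel :: "'a::euclidean_space set \<Rightarrow> 'a \<Rightarrow> 'a \<Rightarrow> real" where
  "H_kernel \<Omega> x y =
     (let n = DIM('a); dx = bdist \<Omega> x; dy = bdist \<Omega> y; r = norm (x - y) in
      if n > 4 then r powi (4 - int n) * min 1 (dx\<^sup>2 * dy\<^sup>2 / r ^ 4)
      else if n = 4 then ln (1 + dx\<^sup>2 * dy\<^sup>2 / r ^ 4)
      else dx powr (2 - real n / 2) * dy powr (2 - real n / 2) *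
        (if x = y then 1
         else min 1 (dx powr (real n / 2) * dy powr (real n / 2) / r ^ n)))"

end

theory Submission imports Defs begin

text \<open>Let \<open>ph\<close> be a \<open>C\<^sup>4\<close> defining function of the domain, comparable to the distance \<open>d\<close> to the boundary. Boggio's
 formula for the half-space, with the distances replaced by \<open>ph x\<close> and \<open>ph z\<close> over \<open>\<bar>grad ph x\<bar>\<close>, gives a parametrix \<open>P x z\<close>. It
 is comparable to \<open>H\<close>, vanishes to second order at the boundary, and away from \<open>x\<close> its bilaplacian is an error
 kernel \<open>E x z\<close> of size \<open>(d x)\<^sup>2 R\<^bsup>- n - 1\<^esup>\<close>, where \<open>R = \<bar>x - z\<bar> + d x + d z\<close>. Hence every solution of the Dirichlet problem
 satisfies \<open>const * u x = \<integral>P x z * f z - \<integral>E x z * u z\<close>. Iterating this inequality bounds the difference of \<open>u\<close> and the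
 first integral by a kernel that is smaller than \<open>P\<close> by a factor \<open>R\<^bsup>1/2\<^esup>\<close>, up to \<open>(d x)\<^sup>2\<close> times the integral of \<open>\<bar>u\<bar>\<close>.
 A Caccioppoli inequality in boundary strips shows that the solution operator is symmetric, so that
 this integral is controlled by the integral of \<open>\<bar>f\<bar> d\<^sup>2\<close>. With \<open>f\<close> concentrated at \<open>y\<close> this yields
 \<open>G = P / const\<close> up to a small multiple of \<open>P\<close> and a multiple of \<open>(d x)\<^sup>2 (d y)\<^sup>2\<close>.\<close>

text \<open>Of \<open>G\<close> nothing is known beyond its definition: neither a bound nor its
  symmetry, and the solutions it yields are only \<open>C^1\<close> up to the boundary. So every
  estimate is made for arbitrary classical solutions, and \<open>G\<close> is recovered at the end
  by concentrating the right-hand side. The error kernel smooths but is not small, so no Neumann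
  series is available; a finite bootstrap stops at the integral of \<open>|u|\<close>, and some
  global information must bound it. For bounded data this is a blow-up argument: integrability of
  \<open>G z\<close> makes normalised solutions tend to zero pointwise, while the bootstrap prevents
  their mass from vanishing. Duality then turns the sup bound into one for the integral of
  \<open>|u|\<close>; its boundary terms contain second derivatives, of which only an integrated
  bound is available. The scale \<open>R\<close> treats interior and boundary alike: a gain of
  \<open>R^(1/2)\<close> over \<open>P\<close> is absorbed where \<open>R\<close> is small, and
  where \<open>R\<close> is bounded below the remainder is at most a multiple of
  \<open>(d x)^2 * (d y)^2\<close>. This last part is what \<open>c1\<close> pays for.\<close>

abbreviation "en \<equiv> ennreal"
abbreviation "pd \<equiv> partial_deriv"
abbreviation "lap \<equiv> laplacian"
abbreviation "ind \<equiv> indicat_real"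
notation tendsto (infixr "--->" 55) and LIMSEQ ("((_)/ ----> (_))" [60, 60] 60)

subsection \<open>Partial derivatives and symbol estimates\<close>

lemma partial_derivI: "(f has_derivative f') (at x) ==> pd b f x = f' b"
 unfolding partial_deriv_def by (metis frechet_derivative_at)

lemma has_derivative_partial:
 fixes f :: "'a::euclidean_space => real"
 assumes "f differentiable (at x)"
 shows "(f has_derivative (%v. SUM b:Basis. (v \<bullet> b) * pd b f x)) (at x)"
proof -
 have f: "(f has_derivative frechet_derivative f (at x)) (at x)"
  using assms frechet_derivative_works by blast
 interpret bounded_linear "frechet_derivative f (at x)" using f by (rule has_derivative_bounded_linear)
 have "frechet_derivative f (at x) v = (SUM b:Basis. (v \<bullet> b) * pd b f x)" for v
 proof -
  have "frechet_derivative f (at x) v = frechet_derivative f (at x) (SUM b:Basis. (v \<bullet> b) *\<^sub>R b)"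
   by (simp add: euclidean_representation)
  also have "... = (SUM b:Basis. (v \<bullet> b) * pd b f x)"
   by (simp add: sum scaleR partial_deriv_def)
  finally show ?thesis .
 qed
 hence "frechet_derivative f (at x) = (%v. SUM b:Basis. (v \<bullet> b) * pd b f x)"
  by (rule ext)
 with f show ?thesis by simp
qed

lemma partial_deriv_cong:
 assumes "open S" "x : S" "!!y. y : S ==> f y = g y"
 shows "pd b f x = pd b g x"
proof -
 have "(f has_derivative D) (at x) \<longleftrightarrow> (g has_derivative D) (at x)" for D
  using assms by (metis has_derivative_transform_within_open)
 thus ?thesis unfolding partial_deriv_def frechet_derivative_def by simp
qed

lemma differentiable_cong_open:
 assumes "open S" "x : S" "!!y. y : S ==> f y = g y" "f differentiable (at x)"
 shows "g differentiable (at x)"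
 using assms unfolding differentiable_def by (metis has_derivative_transform_within_open)

lemma laplacian_cong:
 assumes "open S" "x : S" "!!y. y : S ==> f y = g y"
 shows "lap f x = lap g x"
 unfolding laplacian_def
 by (intro sum.cong refl partial_deriv_cong[OF assms(1,2)] partial_deriv_cong[OF assms(1)] assms(3))

lemma partial_deriv_const [simp]: "pd b (%x. c) = (%x. 0)"
 by (rule ext) (auto intro: partial_derivI)

lemma partial_deriv_add:
 assumes "f differentiable (at x)" "g differentiable (at x)"
 shows "pd b (%x. f x + g x) x = pd b f x + pd b g x"
proof -
 have "((%x. f x + g x) has_derivative
   (%h. frechet_derivative f (at x) h + frechet_derivative g (at x) h)) (at x)"
  using assms by (intro has_derivative_add) (auto simp: frechet_derivative_works)
 from partial_derivI[OF this, of b] show ?thesis by (simp add: partial_deriv_def)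
qed

lemma partial_deriv_mult:
 fixes f g :: "'a::euclidean_space => real"
 assumes "f differentiable (at x)" "g differentiable (at x)"
 shows "pd b (%x. f x * g x) x = f x * pd b g x + pd b f x * g x"
proof -
 have "((%x. f x * g x) has_derivative
   (%h. f x * frechet_derivative g (at x) h + frechet_derivative f (at x) h * g x)) (at x)"
  using assms by (intro has_derivative_mult) (auto simp: frechet_derivative_works)
 from partial_derivI[OF this, of b] show ?thesis by (simp add: partial_deriv_def)
qed

lemma partial_deriv_cmult:
 fixes f :: "'a::euclidean_space => real"
 assumes "f differentiable (at x)"
 shows "pd b (%x. c * f x) x = c * pd b f x"
 using partial_deriv_mult[of "%x. c" x f b] assms by simp

lemma has_derivative_comp_real:
 fixes f :: "'a::euclidean_space => real"
 assumes "f differentiable (at x)" "(h has_real_derivative h') (at (f x))"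
 shows "((%x. h (f x)) has_derivative (%v. h' * frechet_derivative f (at x) v)) (at x)"
proof -
 have "(h has_derivative (%v. h' * v)) (at (f x))"
  using assms(2) by (simp add: has_field_derivative_def)
 with has_derivative_compose[of f "frechet_derivative f (at x)" x UNIV h "%v. h' * v"] assms(1)
 show ?thesis by (simp add: frechet_derivative_works)
qed

lemma differentiable_comp_real:
 fixes f :: "'a::euclidean_space => real"
 assumes "f differentiable (at x)" "(h has_real_derivative h') (at (f x))"
 shows "(%x. h (f x)) differentiable (at x)"
 using has_derivative_comp_real[OF assms] unfolding differentiable_def by blast

lemma partial_deriv_comp:
 fixes f :: "'a::euclidean_space => real"
 assumes "f differentiable (at x)" "(h has_real_derivative h') (at (f x))"
 shows "pd b (%x. h (f x)) x = h' * pd b f x"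
 using partial_derivI[OF has_derivative_comp_real[OF assms], of b] by (simp add: partial_deriv_def)

lemma partial_deriv_inner: "pd b (%x. x \<bullet> c) = (%x. b \<bullet> c)"
 by (rule ext, rule partial_derivI) (auto intro!: derivative_eq_intros)

text \<open>The weight \<open>M\<close> bounds the function and \<open>M / w\<^sup>j\<close> its derivatives of order \<open>j\<close>, so that
 \<open>w\<close> is the length scale on which the function varies.\<close>

primrec symb :: "nat => 'a::euclidean_space set => ('a => real) => ('a => real) => ('a => real) => bool" where
 "symb 0 S w M f \<longleftrightarrow> continuous_on S f & (ALL x:S. abs (f x) <= M x)"
| "symb (Suc k) S w M f \<longleftrightarrow>
   (ALL x:S. f differentiable (at x)) & (ALL x:S. abs (f x) <= M x) &
   (ALL b:Basis. symb k S w (%x. M x / w x) (pd b f))"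

lemma symb_bound: "symb k S w M f ==> x : S ==> abs (f x) <= M x"
 by (cases k) auto

lemma symb_Suc_D: "symb (Suc k) S w M f ==> symb k S w M f"
proof (induction k arbitrary: M f)
 case 0
 thus ?case
  by (auto intro!: continuous_at_imp_continuous_on differentiable_imp_continuous_within)
next
 case (Suc k)
 have "symb k S w (%x. M x / w x) (pd b f)" if "b : Basis" for b
  using Suc.prems that by (intro Suc.IH) (simp only: symb.simps(2), blast)
 thus ?case using Suc.prems by (simp only: symb.simps(2)) blast
qed

lemma symb_le: "symb k S w M f ==> j <= k ==> symb j S w M f"
proof (induction k)
 case (Suc k) thus ?case by (metis symb_Suc_D le_Suc_eq)
qed auto

lemma symb_mono:
 assumes "symb k S w M f" "!!x. x : S ==> 0 < w x" "!!x. x : S ==> M x <= N x"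
 shows "symb k S w N f"
 using assms
proof (induction k arbitrary: M N f)
 case 0 thus ?case by force
next
 case (Suc k)
 have "symb k S w (%x. N x / w x) (pd b f)" if "b : Basis" for b
  using Suc.IH[of "%x. M x / w x" "pd b f" "%x. N x / w x"] Suc.prems that
  by (auto intro: divide_right_mono less_imp_le)
 with Suc.prems show ?case by (auto intro: order_trans)
qed

lemma symb_subset:
 "symb k S w M f ==> T \<subseteq> S ==> symb k T w M f"
 by (induction k arbitrary: M f) (auto intro: continuous_on_subset)

lemma symb_cong:
 assumes "open S" "symb k S w M f" "!!x. x : S ==> f x = g x"
 shows "symb k S w M g"
 using assms(2,3)
proof (induction k arbitrary: M f g)
 case 0 thus ?case by (auto cong: continuous_on_cong)
next
 case (Suc k)
 have "symb k S w (%x. M x / w x) (pd b g)" if "b : Basis" for b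
 proof (rule Suc.IH)
  show "symb k S w (%x. M x / w x) (pd b f)" using Suc.prems that by simp
  show "pd b f x = pd b g x" if "x : S" for x
   by (rule partial_deriv_cong[OF assms(1) that]) (rule Suc.prems(2))
 qed
 with Suc.prems show ?case by (auto intro: differentiable_cong_open[OF assms(1)])
qed

lemma symb_bounds_cong:
 "symb k S w M f ==> (!!x. x : S ==> M x = N x) ==> (!!x. x : S ==> w x = w' x) ==> symb k S w' N f"
 by (induction k arbitrary: M N f) auto

lemma symb_add:
 assumes "open S" "symb k S w M f" "symb k S w N g"
 shows "symb k S w (%x. M x + N x) (%x. f x + g x)"
 using assms(2,3)
proof (induction k arbitrary: M N f g)
 case 0 thus ?case by (force intro: continuous_intros)
next
 case (Suc k)
 have "symb k S w (%x. (M x + N x) / w x) (pd b (%x. f x + g x))" if b: "b : Basis" for b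
 proof -
  have "symb k S w (%x. M x / w x + N x / w x) (%x. pd b f x + pd b g x)"
   using Suc b by simp
  from symb_cong[OF assms(1) this, of "pd b (%x. f x + g x)"] show ?thesis
   using Suc.prems by (simp add: partial_deriv_add add_divide_distrib)
 qed
 with Suc.prems show ?case by (force intro: differentiable_add)
qed

lemma symb_0:
 assumes "!!x. x : S ==> 0 < w x" "!!x. x : S ==> 0 <= M x"
 shows "symb k S w M (%x. 0)"
 using assms(2)
proof (induction k arbitrary: M)
 case (Suc k)
 have "symb k S w (%x. M x / w x) (%x. 0)"
  using Suc.prems assms(1) by (intro Suc.IH divide_nonneg_pos)
 with Suc.prems show ?case by simp
qed auto

lemma symb_const:
 assumes "!!x. x : S ==> 0 < w x" "!!x. x : S ==> abs c <= M x"
 shows "symb k S w M (%x. c)"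
proof (cases k)
 case (Suc j)
 have "symb j S w (%x. M x / w x) (%x. 0)"
  using assms by (intro symb_0 divide_nonneg_pos) (auto intro: order_trans[OF abs_ge_zero])
 thus ?thesis using assms Suc by simp
qed (use assms in auto)

lemma symb_sum:
 assumes "open S" "!!x. x : S ==> 0 < w x" "finite I" "!!i. i : I ==> symb k S w (M i) (f i)"
 shows "symb k S w (%x. SUM i:I. M i x) (%x. SUM i:I. f i x)"
 using assms(3,4)
proof (induction I rule: finite_induct)
 case empty thus ?case using assms(2) by (auto intro: symb_0)
next
 case (insert i I)
 thus ?case using symb_add[OF assms(1), of k w "M i" "f i"] by simp
qed

text \<open>The factor \<open>2 ^ k\<close> is the number of terms that the Leibniz rule produces
  after \<open>k\<close> derivatives.\<close>

lemma symb_mult: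
 assumes "open S" "!!x. x : S ==> 0 < w x" "symb k S w M f" "symb k S w N g"
 shows "symb k S w (%x. 2 ^ k * (M x * N x)) (%x. f x * g x)"
 using assms(3,4)
proof (induction k arbitrary: M N f g)
 case 0 thus ?case by (auto intro!: continuous_intros mult_mono simp: abs_mult intro: order_trans[OF abs_ge_zero])
next
 case (Suc k)
 have "symb k S w (%x. 2 ^ Suc k * (M x * N x) / w x) (pd b (%x. f x * g x))" if b: "b : Basis" for b
 proof -
  have 1: "symb k S w (%x. 2^k * (M x * (N x / w x))) (%x. f x * pd b g x)"
   using Suc.IH[of M f "%x. N x / w x" "pd b g"] Suc.prems b symb_Suc_D[OF Suc.prems(1)] by auto
  have 2: "symb k S w (%x. 2^k * ((M x / w x) * N x)) (%x. pd b f x * g x)"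
   using Suc.IH[of "%x. M x / w x" "pd b f" N g] Suc.prems b symb_Suc_D[OF Suc.prems(2)] by auto
  have "symb k S w (%x. 2 ^ Suc k * (M x * N x) / w x) (%x. f x * pd b g x + pd b f x * g x)"
   by (rule symb_bounds_cong[OF symb_add[OF assms(1) 1 2]]) (auto simp: algebra_simps)
  from symb_cong[OF assms(1) this, of "pd b (%x. f x * g x)"] show ?thesis
   using Suc.prems by (simp add: partial_deriv_mult)
 qed
 moreover have "abs (f x * g x) <= 2 ^ Suc k * (M x * N x)" if "x : S" for x
 proof -
  have "abs (f x * g x) <= M x * N x"
   using symb_bound[OF Suc.prems(1) that] symb_bound[OF Suc.prems(2) that]
   by (auto simp: abs_mult intro!: mult_mono order_trans[OF abs_ge_zero])
  also have "... = 1 * (M x * N x)" by simp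
  also have "... <= 2 ^ Suc k * (M x * N x)"
   using \<open>\<bar>f x * g x\<bar> <= M x * N x\<close> by (intro mult_right_mono one_le_power) auto
  finally show ?thesis .
 qed
 ultimately show ?case using Suc.prems by (auto intro: differentiable_mult)
qed

text \<open>By the chain rule \<open>h j (f x)\<close> always comes with \<open>j\<close>
  derivatives of \<open>f\<close>, each of which carries one factor \<open>M\<close>; hence the
  hypothesis on \<open>h j (f x) * M x ^ j\<close>. The derivatives of the outer function are given
  as a sequence so that the induction can pass to \<open>%j. h (Suc j)\<close> with the weight
  \<open>N / M\<close>.\<close>

lemma symb_comp:
 assumes "open S" "!!x. x : S ==> 0 < w x" "!!x. x : S ==> 0 < M x"
  and "symb k S w M f"
  and "!!j x. j < k ==> x : S ==> (h j has_real_derivative h (Suc j) (f x)) (at (f x))"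
  and "continuous_on (f ` S) (h k)"
  and "!!j x. j <= k ==> x : S ==> abs (h j (f x)) * M x ^ j <= N x"
 shows "symb k S w (%x. 2 ^ (k * k) * N x) (%x. h 0 (f x))"
 using assms(4-)
proof (induction k arbitrary: h N)
 case 0
 have "continuous_on S (%x. h 0 (f x))"
  using 0 continuous_on_compose2[of "f ` S" "h 0" S f] by auto
 thus ?case using 0 by auto
next
 case (Suc k)
 have fd: "f differentiable (at x)" if "x : S" for x using Suc.prems(1) that by auto
 have sf: "symb k S w M f" by (rule symb_Suc_D[OF Suc.prems(1)])
 have 1: "symb k S w (%x. 2^(k*k) * (N x / M x)) (%x. h (Suc 0) (f x))"
 proof (rule Suc.IH[of "%j. h (Suc j)"])
  show "abs (h (Suc j) (f x)) * M x ^ j <= N x / M x" if "j <= k" "x : S" for j x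
   using Suc.prems(4)[of "Suc j" x] that assms(3)[of x] by (simp add: pos_le_divide_eq algebra_simps)
 qed (use Suc.prems sf in auto)
 have N0: "0 <= N x" if "x : S" for x
  using Suc.prems(4)[of 0 x] that by (auto intro: order_trans[OF abs_ge_zero])
 have "symb k S w (%x. (2 ^ (Suc k * Suc k) * N x) / w x) (pd b (%x. h 0 (f x)))" if b: "b : Basis" for b
 proof -
  have "symb k S w (%x. 2^k * ((2^(k*k) * (N x / M x)) * (M x / w x))) (%x. h (Suc 0) (f x) * pd b f x)"
   using Suc.prems(1) b by (intro symb_mult[OF assms(1,2) 1]) auto
  hence 2: "symb k S w (%x. (2 ^ (Suc k * Suc k) * N x) / w x) (%x. h (Suc 0) (f x) * pd b f x)"
  proof (rule symb_mono[OF _ assms(2)])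
   fix x assume x: "x : S"
   have "2^k * ((2^(k*k) * (N x / M x)) * (M x / w x)) = 2^(k + k*k) * (N x / w x)"
    using assms(3)[OF x] by (simp add: power_add field_simps)
   also have "... <= 2^(Suc k * Suc k) * (N x / w x)"
    using N0[OF x] assms(2)[OF x] by (intro mult_right_mono power_increasing) auto
   finally show "2^k * ((2^(k*k) * (N x / M x)) * (M x / w x)) <= (2 ^ (Suc k * Suc k) * N x) / w x" by simp
  qed auto
  show ?thesis
  proof (rule symb_cong[OF assms(1) 2])
   fix x assume x: "x : S"
   show "h (Suc 0) (f x) * pd b f x = pd b (%x. h 0 (f x)) x"
    using partial_deriv_comp[OF fd[OF x] Suc.prems(2)[of 0 x]] x by simp
  qed
 qed
 moreover have "abs (h 0 (f x)) <= 2 ^ (Suc k * Suc k) * N x" if "x : S" for x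
 proof -
  have "abs (h 0 (f x)) <= 1 * N x" using Suc.prems(4)[of 0 x] that by auto
  also have "... <= 2 ^ (Suc k * Suc k) * N x" using N0[OF that] by (intro mult_right_mono one_le_power) auto
  finally show ?thesis .
 qed
 moreover have "(%x. h 0 (f x)) differentiable (at x)" if "x : S" for x
  using differentiable_comp_real[OF fd[OF that] Suc.prems(2)[of 0 x]] that by simp
 ultimately show ?case by (simp only: symb.simps(2)) blast
qed

lemma symb_laplacian:
 assumes "open S" "!!x. x : S ==> 0 < w x" "symb (Suc (Suc k)) S w M f"
 shows "symb k S w (%x. DIM('a) * (M x / (w x)^2)) (lap (f :: 'a::euclidean_space => real))"
proof -
 have "symb k S w (%x. SUM b:(Basis::'a set). M x / w x / w x) (%x. SUM b:Basis. pd b (pd b f) x)"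
  using assms by (intro symb_sum) auto
 thus ?thesis unfolding laplacian_def[abs_def] by (simp add: power2_eq_square)
qed

section \<open>Functions of class C^k\<close>

lemma symb_imp_C_k_on: "symb k S w M f ==> C_k_on k S f"
 by (induction k arbitrary: M f) auto

text \<open>The majorant may be any positive function of the point, so no uniformity is claimed. In
  this form the closure properties of \<open>C_k_on\<close> are those of
  \<open>symb\<close>.\<close>

lemma C_k_on_iff_symb:
 "C_k_on k S f \<longleftrightarrow> (EX M. (ALL x. 0 < M x) & symb k S (%_. 1) M f)"
proof
 show "EX M. (ALL x. 0 < M x) & symb k S (%_. 1) M f" if "C_k_on k S f"
  using that
 proof (induction k arbitrary: f)
  case 0 thus ?case by (auto intro!: exI[of _ "%x. abs (f x) + 1"])
 next
  case (Suc k)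
  hence "ALL b:Basis. EX M. (ALL x. 0 < M x) & symb k S (%_. 1) M (pd b f)" by simp
  then obtain M where M: "!!b. b : Basis ==> (ALL x. 0 < M b x) & symb k S (%_. 1) (M b) (pd b f)"
   by metis
  let ?M = "%x. abs (f x) + 1 + (SUM b:Basis. M b x)"
  have "symb k S (%_. 1) ?M (pd b f)" if "b : Basis" for b
  proof (rule symb_mono)
   show "symb k S (%_. 1) (M b) (pd b f)" using M that by auto
   show "M b x <= ?M x" for x
    using member_le_sum[of b Basis "%b. M b x"] M that by (force simp: less_imp_le)
  qed auto
  moreover have s0: "0 <= (SUM b:Basis. M b x)" for x by (rule sum_nonneg) (use M less_imp_le in blast)
  moreover have "0 < ?M x" "abs (f x) <= ?M x" for x using s0[of x] by (smt (verit) abs_ge_zero)+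
  ultimately show ?case using Suc.prems by (intro exI[of _ ?M]) auto
 qed
qed (use symb_imp_C_k_on in blast)

lemma C_k_on_le: "C_k_on k S f ==> j <= k ==> C_k_on j S f"
 unfolding C_k_on_iff_symb using symb_le by blast

lemma C_k_on_imp_continuous: "C_k_on k S f ==> continuous_on S f"
 using C_k_on_le[of k S f 0] by simp

lemma C_k_on_subset: "C_k_on k S f ==> T \<subseteq> S ==> C_k_on k T f"
 unfolding C_k_on_iff_symb using symb_subset by blast

lemma C_k_on_cong: "open S ==> C_k_on k S f ==> (!!x. x : S ==> f x = g x) ==> C_k_on k S g"
 unfolding C_k_on_iff_symb using symb_cong by blast

lemma C_k_on_const: "C_k_on k S (%x. c)"
 unfolding C_k_on_iff_symb by (intro exI[of _ "%x. abs c + 1"] conjI symb_const) auto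

lemma C_k_on_add: "open S ==> C_k_on k S f ==> C_k_on k S g ==> C_k_on k S (%x. f x + g x)"
proof -
 assume S: "open S" and "C_k_on k S f" "C_k_on k S g"
 then obtain M N where "symb k S (%_. 1) M f" "symb k S (%_. 1) N g"
  unfolding C_k_on_iff_symb by auto
 from symb_add[OF S this] show ?thesis by (rule symb_imp_C_k_on)
qed

lemma C_k_on_mult:
 assumes "open S" "C_k_on k S f" "C_k_on k S g" shows "C_k_on k S (%x. f x * g x)"
proof -
 obtain M N where "symb k S (%_. 1) M f" "symb k S (%_. 1) N g"
  using assms unfolding C_k_on_iff_symb by auto
 from symb_mult[OF assms(1) _ this] have "symb k S (%_. 1) (%x. 2 ^ k * (M x * N x)) (%x. f x * g x)"
  by simp
 thus ?thesis by (rule symb_imp_C_k_on)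
qed

lemma C_k_on_cmult: "open S ==> C_k_on k S f ==> C_k_on k S (%x. c * f x)"
 by (rule C_k_on_mult[OF _ C_k_on_const])

lemma C_k_on_minus: "open S ==> C_k_on k S f ==> C_k_on k S (%x. - f x)"
 using C_k_on_cmult[of S k f "-1"] by simp

lemma C_k_on_diff: "open S ==> C_k_on k S f ==> C_k_on k S g ==> C_k_on k S (%x. f x - g x)"
 using C_k_on_add[of S k f "%x. - g x"] C_k_on_minus[of S k g] by simp

lemma C_k_on_sum: "open S ==> finite I ==> (!!i. i : I ==> C_k_on k S (f i)) ==> C_k_on k S (%x. SUM i:I. f i x)"
proof -
 assume S: "open S" and "finite I" "!!i. i : I ==> C_k_on k S (f i)"
 from this(2,3) show ?thesis
  by (induction I rule: finite_induct) (simp_all add: C_k_on_const C_k_on_add[OF S])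
qed

lemma C_k_on_power: "open S ==> C_k_on k S f ==> C_k_on k S (%x. f x ^ j)"
 by (induction j) (simp_all add: C_k_on_const C_k_on_mult)

lemma C_k_on_inner: "C_k_on k S (%x. x \<bullet> c)"
 by (cases k) (auto simp: partial_deriv_inner intro: C_k_on_const continuous_intros)

lemma C_k_on_comp:
 assumes "open S" "C_k_on k S f"
  and "!!j x. j < k ==> x : S ==> (h j has_real_derivative h (Suc j) (f x)) (at (f x))"
  and "continuous_on (f ` S) (h k)"
 shows "C_k_on k S (%x. h 0 (f x))"
proof -
 obtain M where M: "!!x. 0 < M x" "symb k S (%_. 1) M f" using assms unfolding C_k_on_iff_symb by auto
 let ?N = "%x. SUM j<=k. abs (h j (f x)) * M x ^ j"
 have "symb k S (%_. 1) (%x. 2 ^ (k * k) * ?N x) (%x. h 0 (f x))"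
 proof (rule symb_comp[OF assms(1) _ M(1) M(2) assms(3,4)])
  show "abs (h j (f x)) * M x ^ j <= ?N x" if "j <= k" for j x
   using that M(1)[of x] by (intro member_le_sum) (auto simp: less_imp_le)
 qed auto
 thus ?thesis by (rule symb_imp_C_k_on)
qed

lemma C_k_on_partial: "C_k_on (Suc k) S f ==> b : Basis ==> C_k_on k S (pd b f)"
 by simp

lemma C_k_on_laplacian:
 "open S ==> C_k_on (Suc (Suc k)) S f ==> C_k_on k S (lap f)"
 unfolding laplacian_def[abs_def] by (intro C_k_on_sum) auto

lemma C_k_on_Un:
 assumes "open S" "open T" "C_k_on k S f" "C_k_on k T f" shows "C_k_on k (S \<union> T) f"
 using assms(3,4) by (induction k arbitrary: f) (use assms in "auto intro: continuous_on_open_Un")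

lemma C_k_on_bounded_compact:
 assumes "compact K" "C_k_on k K f"
 shows "EX C>0. symb k K (%_. 1) (%_. C) f"
 using assms(2)
proof (induction k arbitrary: f)
 case 0
 hence "compact (f ` K)" using assms(1) compact_continuous_image by auto
 then obtain C where "!!x. x : K ==> abs (f x) <= C"
  by (meson bounded_real compact_imp_bounded imageI)
 hence "abs (f x) <= max C 1" if "x : K" for x using that by fastforce
 thus ?case using 0 by (intro exI[of _ "max C 1"]) simp
next
 case (Suc k)
 hence "ALL b:Basis. EX C>0. symb k K (%_. 1) (%_. C) (pd b f)" by simp
 then obtain C where C: "!!b. b : Basis ==> 0 < C b & symb k K (%_. 1) (%_. C b) (pd b f)" by metis
 have "continuous_on K f" using Suc.prems C_k_on_imp_continuous by blast
 hence "compact (f ` K)" using assms(1) compact_continuous_image by auto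
 then obtain D where D: "!!x. x : K ==> abs (f x) <= D"
  by (meson bounded_real compact_imp_bounded imageI)
 let ?C = "max D 1 + (SUM b:Basis. C b)"
 have s0: "0 <= (SUM b:Basis. C b)" by (rule sum_nonneg) (use C less_imp_le in blast)
 have "symb k K (%_. 1) (%_. ?C) (pd b f)" if "b : Basis" for b
 proof (rule symb_mono)
  show "symb k K (%_. 1) (%_. C b) (pd b f)" using C that by blast
  have "C b <= (SUM b:Basis. C b)" using C that by (intro member_le_sum) (auto simp: less_imp_le)
  thus "C b <= ?C" by linarith
 qed auto
 moreover have "abs (f x) <= ?C" if "x : K" for x using D[OF that] s0 by linarith
 moreover have "0 < ?C" using s0 by linarith
 ultimately show ?case using Suc.prems by (intro exI[of _ ?C]) simp
qed

section \<open>Product and chain rules for the Laplacian\<close>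

lemma partial_deriv_sum:
 assumes "!!i. i : I ==> f i differentiable (at x)"
 shows "pd b (%x. SUM i:I. f i x) x = (SUM i:I. pd b (f i) x)"
proof (cases "finite I")
 case True
 have "((%x. SUM i:I. f i x) has_derivative (%v. SUM i:I. frechet_derivative (f i) (at x) v)) (at x)"
  using assms by (intro has_derivative_sum) (auto simp: frechet_derivative_works)
 from partial_derivI[OF this, of b] show ?thesis by (simp add: partial_deriv_def)
qed simp

definition grad_inner :: "('a::euclidean_space => real) => ('a => real) => 'a => real" where
 "grad_inner f g x = (SUM b:Basis. pd b f x * pd b g x)"

lemma laplacian_mult:
 assumes "open S" "C_k_on 2 S f" "C_k_on 2 S g" "x : S"
 shows "lap (%x. f x * g x) x = f x * lap g x + 2 * grad_inner f g x + g x * lap f x"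
proof -
 have d: "f differentiable (at y)" "g differentiable (at y)"
  "b : Basis ==> pd b f differentiable (at y)"
  "b : Basis ==> pd b g differentiable (at y)" if "y : S" for y b
  using assms(2,3) that by (auto simp: numeral_2_eq_2)
 have "pd b (pd b (%x. f x * g x)) x
   = f x * pd b (pd b g) x + 2 * (pd b f x * pd b g x)
    + g x * pd b (pd b f) x" if b: "b : Basis" for b
 proof -
  have "pd b (pd b (%x. f x * g x)) x =
     pd b (%x. f x * pd b g x + pd b f x * g x) x"
   by (rule partial_deriv_cong[OF assms(1,4)]) (auto simp: partial_deriv_mult d)
  thus ?thesis using d[OF assms(4)] b
   by (simp add: partial_deriv_add partial_deriv_mult differentiable_mult algebra_simps)
 qed
 thus ?thesis
  by (simp add: laplacian_def grad_inner_def sum.distrib sum_distrib_left)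
qed

lemma laplacian_comp:
 assumes "open S" "C_k_on 2 S f" "x : S"
  and "!!y. y : S ==> (h has_real_derivative h1 (f y)) (at (f y))"
  and "(h1 has_real_derivative h2) (at (f x))"
 shows "lap (%x. h (f x)) x = h1 (f x) * lap f x + h2 * grad_inner f f x"
proof -
 have d: "f differentiable (at y)"
  "b : Basis ==> pd b f differentiable (at y)" if "y : S" for y b
  using assms(2) that by (auto simp: numeral_2_eq_2)
 have "pd b (pd b (%x. h (f x))) x
   = h1 (f x) * pd b (pd b f) x + h2 * (pd b f x * pd b f x)" if b: "b : Basis" for b
 proof -
  have "pd b (pd b (%x. h (f x))) x =
     pd b (%x. h1 (f x) * pd b f x) x"
   by (rule partial_deriv_cong[OF assms(1,3)]) (auto simp: partial_deriv_comp[OF d(1) assms(4)])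
  thus ?thesis using d[OF assms(3)] b assms(5)
   by (simp add: partial_deriv_comp[where h' = h2] partial_deriv_mult differentiable_comp_real[where h' = h2] algebra_simps)
 qed
 thus ?thesis
  by (simp add: laplacian_def grad_inner_def sum.distrib sum_distrib_left)
qed

lemma laplacian_add:
 assumes "open S" "C_k_on 2 S f" "C_k_on 2 S g" "x : S"
 shows "lap (%x. f x + g x) x = lap f x + lap g x"
proof -
 have d: "f differentiable (at y)" "g differentiable (at y)"
  "b : Basis ==> pd b f differentiable (at y)"
  "b : Basis ==> pd b g differentiable (at y)" if "y : S" for y b
  using assms(2,3) that by (auto simp: numeral_2_eq_2)
 have "pd b (pd b (%x. f x + g x)) x
   = pd b (pd b f) x + pd b (pd b g) x" if b: "b : Basis" for b
 proof -
  have "pd b (pd b (%x. f x + g x)) x =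
     pd b (%x. pd b f x + pd b g x) x"
   by (rule partial_deriv_cong[OF assms(1,4)]) (auto simp: partial_deriv_add d)
  thus ?thesis using d[OF assms(4)] b by (simp add: partial_deriv_add)
 qed
 thus ?thesis by (simp add: laplacian_def sum.distrib)
qed

lemma laplacian_const [simp]: "lap (%x. c) = (%x. 0)"
 by (rule ext) (simp add: laplacian_def)

lemma laplacian_cmult:
 assumes "open S" "C_k_on 2 S f" "x : S"
 shows "lap (%x. c * f x) x = c * lap f x"
 using laplacian_mult[OF assms(1) C_k_on_const assms(2,3), of c] by (simp add: grad_inner_def)

subsection \<open>Green's identities\<close>

lemma compact_support_integrable:
 fixes h :: "'a::euclidean_space => real"
 assumes "open S" "compact C" "C \<subseteq> S" "continuous_on S h" "!!x. x : S - C ==> h x = 0"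
 shows "set_integrable lborel S h" "(LINT x:S|lborel. h x) = (LINT x:C|lborel. h x)"
proof -
 have eq: "ind S x *\<^sub>R h x = ind C x *\<^sub>R h x" for x
  using assms(3,5) by (auto simp: indicator_def)
 show "set_integrable lborel S h"
  unfolding set_integrable_def eq
  using assms by (intro borel_integrable_compact) (auto intro: continuous_on_subset)
 show "(LINT x:S|lborel. h x) = (LINT x:C|lborel. h x)"
  unfolding set_lebesgue_integral_def eq ..
qed

lemma partial_deriv_0_nbhd:
 assumes "open U" "x : U" "!!y. y : U ==> f y = 0"
 shows "pd b f x = 0" "lap f x = 0"
 using partial_deriv_cong[of U x f "%_. 0" b] laplacian_cong[of U x f "%_. 0"] assms by simp_all

lemma partial_deriv_line:
 fixes f :: "'a::euclidean_space => real"
 assumes "f differentiable (at (x + s *\<^sub>R b))"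
 shows "((%s. f (x + s *\<^sub>R b)) has_real_derivative pd b f (x + s *\<^sub>R b)) (at s)"
proof -
 have "frechet_derivative f (at (x + s *\<^sub>R b)) (h *\<^sub>R b) = pd b f (x + s *\<^sub>R b) * h" for h
  using linear_cmul[OF linear_frechet_derivative[OF assms], of h b] by (simp add: partial_deriv_def mult.commute)
 moreover have "((%s. f (x + s *\<^sub>R b)) has_derivative (%h. frechet_derivative f (at (x + s *\<^sub>R b)) (h *\<^sub>R b))) (at s)"
  by (rule has_derivative_compose[of "%s. x + s *\<^sub>R b" "%h. h *\<^sub>R b"])
   (use assms in "auto intro!: derivative_eq_intros simp: frechet_derivative_works[symmetric]")
 ultimately show ?thesis by (simp add: has_field_derivative_def)
qed

text \<open>Lebesgue measure is translation invariant, so the difference quotients of the extension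
  by zero integrate to zero; they vanish outside a fixed ball and converge boundedly to the partial
  derivative.\<close>

lemma integral_partial_deriv_eq_0:
 fixes F :: "'a::euclidean_space => real"
 assumes "open S" "compact C" "C \<subseteq> S" "b : Basis" "!!x. x : S ==> F differentiable (at x)"
  and "continuous_on S (pd b F)" "!!x. x : S - C ==> F x = 0"
 shows "set_integrable lborel S (pd b F)" "(LINT x:S|lborel. pd b F x) = 0"
proof -
 have op: "open (S - C)" "open (- C)" using assms by (auto intro: open_Diff compact_imp_closed simp: open_Compl)
 have pd0: "pd b F x = 0" if "x : S - C" for x
  using partial_deriv_0_nbhd(1)[OF op(1) that] assms(7) by simp
 show "set_integrable lborel S (pd b F)"
  by (rule compact_support_integrable[OF assms(1-3,6) pd0])
 define G where "G x = (if x : S then F x else 0)" for x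
 define g where "g x = (if x : S then pd b F x else 0)" for x
 have SU: "S \<union> - C = UNIV" using assms(3) by auto
 have "continuous_on S g" using assms(6) by (simp add: g_def cong: continuous_on_cong)
 moreover have "continuous_on (- C) g"
  by (rule continuous_on_cong[THEN iffD1, OF refl _ continuous_on_const[of _ 0]]) (use pd0 g_def in auto)
 ultimately have gc: "continuous_on UNIV g" using continuous_on_open_Un[OF assms(1) op(2)] SU by metis
 have Gd: "G differentiable (at x)" "pd b G x = g x" for x
 proof -
  have "G differentiable (at x) & pd b G x = g x"
  proof (cases "x : S")
   case True
   show ?thesis
    using differentiable_cong_open[OF assms(1) True _ assms(5)[OF True], of G] partial_deriv_cong[OF assms(1) True, of G F b] True
    by (simp add: G_def g_def)
  next
   case False
   hence x: "x : - C" using assms(3) by auto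
   have z: "G y = (%_. 0) y" if "y : - C" for y using assms(7)[of y] that by (simp add: G_def)
   show ?thesis
    using differentiable_cong_open[OF op(2) x, of "%_. 0" G] partial_deriv_cong[OF op(2) x z, where b=b] False by (simp add: z g_def)
  qed
  thus "G differentiable (at x)" "pd b G x = g x" by auto
 qed
 have Gc: "continuous_on UNIV G"
  using Gd(1) by (auto intro!: continuous_at_imp_continuous_on differentiable_imp_continuous_within)
 have line: "((%s. G (x + s *\<^sub>R b)) has_real_derivative g (x + s *\<^sub>R b)) (at s)" for x s
  using partial_deriv_line[OF Gd(1), of x b s] unfolding Gd(2) .
 obtain B where B: "!!x. x : C ==> norm x <= B" using compact_imp_bounded[OF assms(2)] bounded_pos by blast
 have Gz: "G x = 0" if "norm x > B" for x using that B(1)[of x] assms(7)[of x] by (cases "x : C") (auto simp: G_def)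
 have "bounded (g ` cball 0 (B + 2))"
  using gc by (intro compact_imp_bounded compact_continuous_image) (auto intro: continuous_on_subset)
 then obtain M where "ALL x:cball 0 (B + 2). abs (g x) <= M" by (auto simp: bounded_real)
 hence M: "abs (g x) <= M" if "norm x <= B + 2" for x using that by simp
 define e where "e k = inverse (real (Suc k))" for k
 have e: "0 < e k" "e k <= 1" for k by (auto simp: e_def inverse_le_1_iff)
 define D where "D k x = (G (x + e k *\<^sub>R b) - G x) / e k" for k x
 have nb: "norm (x + s *\<^sub>R b) <= norm x + 1" "norm x <= norm (x + s *\<^sub>R b) + 1" if "0 < s" "s <= 1" for x s
  using assms(4) that norm_triangle_ineq[of x "s *\<^sub>R b"] norm_triangle_ineq4[of "x + s *\<^sub>R b" "s *\<^sub>R b"] by auto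
 have Db: "abs (D k x) <= M * indicator (cball 0 (B+1)) x" for k x
 proof (cases "norm x <= B + 1")
  case True
  obtain s where "0 < s" "s < e k" "G (x + e k *\<^sub>R b) - G (x + 0 *\<^sub>R b) = (e k - 0) * g (x + s *\<^sub>R b)"
   using MVT2[of 0 "e k" "%s. G (x + s *\<^sub>R b)" "%s. g (x + s *\<^sub>R b)"] line e(1) by blast
  thus ?thesis using M[of "x + s *\<^sub>R b"] nb(1)[of s x] e[of k] True by (auto simp: D_def)
 next
  case False
  thus ?thesis using Gz[of x] Gz[of "x + e k *\<^sub>R b"] nb(2)[of "e k" x] e[of k] by (simp add: D_def)
 qed
 have "filterlim e (at 0) sequentially"
  unfolding filterlim_at using LIMSEQ_inverse_real_of_nat by (auto simp: e_def[abs_def])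
 hence Dlim: "(%k. D k x) ----> g x" for x
  using filterlim_compose[OF line[of x 0, unfolded has_field_derivative_iff]] by (simp add: D_def)
 have [measurable]: "G : borel_measurable borel" "g : borel_measurable borel" using Gc gc by (auto intro: borel_measurable_continuous_onI)
 have Gint: "integrable lborel G"
 proof -
  have "G = (%x. ind C x *\<^sub>R G x)" using assms(7) by (auto simp: G_def indicator_def fun_eq_iff)
  thus ?thesis using borel_integrable_compact[OF assms(2), of G] Gc by (metis continuous_on_subset subset_UNIV)
 qed
 have tr: "integrable lborel (%x. G (x + c))" "integral\<^sup>L lborel (%x. G (x + c)) = integral\<^sup>L lborel G" for c
  using integrable_distr_eq[of "(+) c" lborel borel G] integral_distr[of "(+) c" lborel borel G] Gint
  by (auto simp: lborel_distr_plus add.commute)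
 have "integral\<^sup>L lborel (D k) = 0" for k
  unfolding D_def using tr Gint by simp
 moreover have "(%k. integral\<^sup>L lborel (D k)) ----> integral\<^sup>L lborel g"
 proof (rule integral_dominated_convergence[where w = "%x. M * indicator (cball 0 (B+1)) x"])
  show "integrable lborel (%x. M * ind (cball (0::'a) (B + 1)) x)"
   using emeasure_lborel_cball_finite[of "0::'a" "B+1"] by (auto simp: infinity_ennreal_def)
  show "D k : borel_measurable lborel" for k unfolding D_def by measurable
 qed (use Dlim Db in auto)
 ultimately have "integral\<^sup>L lborel g = 0" using LIMSEQ_unique[OF _ tendsto_const] by auto
 moreover have "g = (%x. ind S x *\<^sub>R pd b F x)" by (auto simp: g_def indicator_def)
 ultimately show "(LINT x:S|lborel. pd b F x) = 0" by (simp add: set_lebesgue_integral_def)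
qed

text \<open>The divergence theorem for the field \<open>f * grad g - g * grad f\<close>. Off the
  compact set one of the two functions has to vanish near each point, and which one may change from
  point to point. So a cut-off at the boundary can be paired with a function that vanishes near a
  singularity.\<close>

lemma Green_second:
 fixes f g :: "'a::euclidean_space => real"
 assumes "open S" "compact C" "C \<subseteq> S" "C_k_on 2 S f" "C_k_on 2 S g"
  and loc: "!!x. x : S - C ==> EX U. open U & x : U & ((ALL y:U. f y = 0) | (ALL y:U. g y = 0))"
 shows "set_integrable lborel S (%x. f x * lap g x)" "set_integrable lborel S (%x. lap f x * g x)"
  "(LINT x:S|lborel. f x * lap g x) = (LINT x:S|lborel. lap f x * g x)"
proof -
 have cl: "continuous_on S (lap f)" "continuous_on S (lap g)"
  using C_k_on_laplacian[of S 0] assms(1,4,5) by (auto simp: numeral_2_eq_2)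
 have cf: "continuous_on S f" "continuous_on S g" using assms(4,5) by (auto intro: C_k_on_imp_continuous)
 have z: "f x * lap g x = 0" "lap f x * g x = 0"
   "f x * pd b g x - pd b f x * g x = 0" if "x : S - C" for x b
  using loc[OF that] partial_deriv_0_nbhd by (metis mult_zero_left mult_zero_right diff_zero)+
 show i1: "set_integrable lborel S (%x. f x * lap g x)"
  by (rule compact_support_integrable[OF assms(1-3)]) (use cl cf z in "auto intro: continuous_intros")
 show i2: "set_integrable lborel S (%x. lap f x * g x)"
  by (rule compact_support_integrable[OF assms(1-3)]) (use cl cf z in "auto intro: continuous_intros")
 have d: "f differentiable (at y)" "g differentiable (at y)"
  "b : Basis ==> pd b f differentiable (at y)"
  "b : Basis ==> pd b g differentiable (at y)" if "y : S" for y b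
  using assms(4,5) that by (auto simp: numeral_2_eq_2)
 have c2: "continuous_on S (pd b (pd b f))" "continuous_on S (pd b (pd b g))"
  if "b : Basis" for b
  using assms(4,5) that by (auto simp: numeral_2_eq_2)
 define h where "h b x = f x * pd b g x - pd b f x * g x" for b x
 have hd: "h b differentiable (at x)"
  "pd b (h b) x = f x * pd b (pd b g) x - pd b (pd b f) x * g x"
  if "x : S" "b : Basis" for x b
 proof -
  note d1 = d[OF that(1)] d(3,4)[OF that]
  have "((%x. f x * pd b g x - pd b f x * g x) has_derivative
    (%v. (f x * frechet_derivative (pd b g) (at x) v + frechet_derivative f (at x) v * pd b g x)
     - (pd b f x * frechet_derivative g (at x) v + frechet_derivative (pd b f) (at x) v * g x))) (at x)"
   using d1 that(2) by (intro has_derivative_diff has_derivative_mult) (auto simp: frechet_derivative_works)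
  note * = this[folded h_def]
  show "h b differentiable (at x)" using * unfolding differentiable_def h_def by blast
  show "pd b (h b) x = f x * pd b (pd b g) x - pd b (pd b f) x * g x"
   using partial_derivI[OF *, of b] unfolding h_def by (simp add: partial_deriv_def)
 qed
 have hi: "set_integrable lborel S (pd b (h b))" "(LINT x:S|lborel. pd b (h b) x) = 0"
  if "b : Basis" for b
 proof -
  have "continuous_on S (%x. f x * pd b (pd b g) x - pd b (pd b f) x * g x)"
   using cf c2[OF that] by (intro continuous_intros)
  hence c: "continuous_on S (pd b (h b))"
   by (rule continuous_on_cong[THEN iffD1, rotated 2]) (use hd that in auto)
  show "set_integrable lborel S (pd b (h b))" "(LINT x:S|lborel. pd b (h b) x) = 0"
   by (rule integral_partial_deriv_eq_0[OF assms(1-3) that hd(1)[OF _ that] c]; simp add: h_def z(3))+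
 qed
 have eq: "(SUM b:Basis. pd b (h b) x) = f x * lap g x - lap f x * g x" if "x : S" for x
  using hd[OF that] by (simp add: laplacian_def sum_subtractf sum_distrib_left sum_distrib_right)
 have "(LINT x:S|lborel. f x * lap g x) - (LINT x:S|lborel. lap f x * g x)
   = (LINT x:S|lborel. f x * lap g x - lap f x * g x)"
  using i1 i2 by (simp add: set_integral_diff)
 also have "... = (LINT x:S|lborel. (SUM b:Basis. pd b (h b) x))"
  using assms(1) eq by (intro set_lebesgue_integral_cong) auto
 also have "... = (SUM b:Basis. (LINT x:S|lborel. pd b (h b) x))"
  using hi(1) unfolding set_lebesgue_integral_def set_integrable_def scaleR_sum_right
  by (intro Bochner_Integration.integral_sum) auto
 also have "... = 0" using hi(2) by simp
 finally show "(LINT x:S|lborel. f x * lap g x) = (LINT x:S|lborel. lap f x * g x)" by simp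
qed

lemma Green_fourth:
 fixes f g :: "'a::euclidean_space => real"
 assumes "open S" "compact C" "C \<subseteq> S" "C_k_on 4 S f" "C_k_on 4 S g"
  and loc: "!!x. x : S - C ==> EX U. open U & x : U & ((ALL y:U. f y = 0) | (ALL y:U. g y = 0))"
 shows "(LINT x:S|lborel. f x * lap (lap g) x) = (LINT x:S|lborel. lap (lap f) x * g x)"
proof -
 have c2: "C_k_on 2 S f" "C_k_on 2 S g" using assms(4,5) by (auto intro: C_k_on_le)
 have l2: "C_k_on 2 S (lap f)" "C_k_on 2 S (lap g)"
  using C_k_on_laplacian[of S 2] assms(1,4,5) by (auto simp: eval_nat_numeral)
 have loc1: "EX U. open U & x : U & ((ALL y:U. f y = 0) | (ALL y:U. lap g y = 0))" if "x : S - C" for x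
  using loc[OF that] partial_deriv_0_nbhd(2) by metis
 have loc2: "EX U. open U & x : U & ((ALL y:U. lap f y = 0) | (ALL y:U. g y = 0))" if "x : S - C" for x
  using loc[OF that] partial_deriv_0_nbhd(2) by metis
 show ?thesis
  using Green_second(3)[OF assms(1-3) c2(1) l2(2) loc1] Green_second(3)[OF assms(1-3) l2(1) c2(2) loc2] by simp
qed

subsection \<open>The fundamental solution\<close>

text \<open>\<open>KK nu (j + 2)\<close> is the \<open>j\<close>-th derivative of \<open>s\<^bsup>-nu/2\<^esup> / 2\<close>; \<open>KK nu 1\<close> and \<open>KK nu 0\<close> are its
 first and second antiderivative. Up to a factor, \<open>KK n 0 (|z - x|\<^sup>2)\<close> is the fundamental solution
 of the bilaplacian in dimension \<open>n\<close>.\<close>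

fun KK :: "real => nat => real => real" where
 "KK nu 0 s = (if nu = 2 then (s * ln s - s) / 2 else if nu = 4 then - ln s / 2
   else s powr (2 - nu/2) / ((2 - nu) * (2 - nu/2)))"
| "KK nu (Suc 0) s = (if nu = 2 then ln s / 2 else s powr (1 - nu/2) / (2 - nu))"
| "KK nu (Suc (Suc j)) s = (\<Prod>i<j. - nu/2 - real i) * s powr (- nu/2 - real j) / 2"

lemma KK_deriv:
 assumes "0 < s" shows "(KK nu j has_real_derivative KK nu (Suc j) s) (at s)"
proof (cases j)
 case 0
 consider "nu = 2" | "nu = 4" | "nu ~= 2" "nu ~= 4" by auto
 thus ?thesis
 proof cases
  case 1
  hence "KK nu j = (%s. (s * ln s - s) / 2)" by (auto simp: 0)
  thus ?thesis using assms 0 1 by (auto intro!: derivative_eq_intros)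
 next
  case 2
  hence "KK nu j = (%s. - ln s / 2)" by (auto simp: 0)
  thus ?thesis using assms 0 2
   by (auto intro!: derivative_eq_intros simp: powr_minus field_simps)
 next
  case 3
  hence e: "KK nu j = (%s. s powr (2 - nu/2) / ((2 - nu) * (2 - nu/2)))" by (auto simp: 0)
  have n: "2 - nu/2 ~= 0" "2 - nu ~= 0" using 3 by auto
  have "((%s. s powr (2 - nu/2) / ((2 - nu) * (2 - nu/2))) has_real_derivative
    ((2 - nu/2) * s powr (2 - nu/2 - 1)) / ((2 - nu) * (2 - nu/2))) (at s)"
   using assms by (intro DERIV_cdivide has_real_derivative_powr)
  moreover have "((2 - nu/2) * s powr (2 - nu/2 - 1)) / ((2 - nu) * (2 - nu/2)) = s powr (1 - nu/2) / (2 - nu)"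
   using n by simp
  ultimately show ?thesis using 3 by (subst e) (simp add: 0)
 qed
next
 case (Suc i)
 show ?thesis
 proof (cases i)
  case 0
  show ?thesis
  proof (cases "nu = 2")
   case True
   hence "KK nu j = (%s. ln s / 2)" by (auto simp: Suc 0)
   thus ?thesis using assms Suc 0 True
    by (auto intro!: derivative_eq_intros simp: powr_minus field_simps)
  next
   case False
   hence e: "KK nu j = (%s. s powr (1 - nu/2) / (2 - nu))" by (auto simp: Suc 0)
   have "((%s. s powr (1 - nu/2) / (2 - nu)) has_real_derivative
     ((1 - nu/2) * s powr (1 - nu/2 - 1)) / (2 - nu)) (at s)"
    using assms by (intro DERIV_cdivide has_real_derivative_powr)
   moreover have "(1 - nu/2) * X / (2 - nu) = X / 2" for X
    using False by (simp add: field_simps)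
   ultimately show ?thesis by (subst e) (simp add: Suc 0)
  qed
 next
  case (Suc l)
  have e: "KK nu (Suc (Suc l)) = (%s. (\<Prod>i<l. - nu/2 - real i) * s powr (- nu/2 - real l) / 2)" by auto
  have "((%s. (\<Prod>i<l. - nu/2 - real i) * s powr (- nu/2 - real l) / 2) has_real_derivative
    ((\<Prod>i<l. - nu/2 - real i) * ((- nu/2 - real l) * s powr (- nu/2 - real l - 1))) / 2) (at s)"
   using assms by (intro DERIV_cdivide DERIV_cmult has_real_derivative_powr)
  moreover have "- nu/2 - real l - 1 = - nu/2 - real (Suc l)" by simp
  ultimately show ?thesis unfolding \<open>j = Suc i\<close> Suc e by (simp add: algebra_simps)
 qed
qed

lemma KK_continuous_on: "continuous_on {0<..} (KK nu j)"
 by (intro continuous_at_imp_continuous_on) (auto intro: DERIV_isCont[OF KK_deriv])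

lemma KK_explicit:
 fixes s nu :: real
 assumes "0 < s"
 defines "X \<equiv> s powr (- nu/2 - 2) / 2"
 shows "KK nu 2 s = s^2 * X" "KK nu 3 s = - (nu/2) * (s * X)" "KK nu 4 s = nu/2 * (nu/2 + 1) * X"
proof -
 have "1 + (- nu/2 - 2) = - nu/2 - 1" by simp
 hence 1: "s powr (- nu/2) = s^2 * s powr (- nu/2 - 2)" "s powr (- nu/2 - 1) = s * s powr (- nu/2 - 2)"
  using assms(1) powr_add[of s 2 "- nu/2 - 2"] powr_add[of s 1 "- nu/2 - 2"] by (simp, metis powr_one less_imp_le)
 show "KK nu 2 s = s^2 * X" "KK nu 3 s = - (nu/2) * (s * X)" "KK nu 4 s = nu/2 * (nu/2 + 1) * X"
  unfolding X_def using 1 by (simp_all add: eval_nat_numeral lessThan_Suc field_simps)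
qed

lemma KK_bound: "abs (KK nu (Suc (Suc j)) s) = abs (\<Prod>i<j. - nu/2 - real i) / 2 * s powr (- nu/2 - real j)"
 by (simp add: abs_mult)

text \<open>One majorant for the logarithmic and the power cases. It is far from sharp, but with
  \<open>s\<close> the squared distance it is the distance to the power \<open>- nu + 1/2\<close>,
  which is locally integrable in dimension \<open>nu\<close>; dominated convergence asks for no
  more.\<close>

lemma KK_0_bound:
 assumes "0 < D" "1 <= nu"
 shows "EX C>0. ALL s. 0 < s & s <= D --> abs (KK nu 0 s) <= C * s powr (- nu/2 + 1/4)"
proof -
 have le: "s powr p <= D powr (p - q) * s powr q" if "0 < s" "s <= D" "q <= p" for s p q :: real
  using that powr_add[of s "p - q" q] powr_mono2[of "p - q" s D] by (simp add: mult_right_mono)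
 \<comment> \<open>From \<open>ln t <= t - 1\<close>, applied to \<open>s powr (1/8)\<close> and to
   its inverse.\<close>
 have ln: "abs (ln s) <= 8 * (s powr (1/8) + s powr (-1/8))" if "0 < s" for s :: real
 proof -
  define u v where "u = s powr (1/8)" and "v = s powr (-1/8)"
  have uv: "0 < u" "0 < v" using that by (simp_all add: u_def v_def)
  have "ln u = ln s / 8" "ln v = - (ln s / 8)" by (simp_all add: ln_powr u_def v_def)
  hence "ln s / 8 <= u" "- (ln s / 8) <= v"
   using ln_le_minus_one[OF uv(1)] ln_le_minus_one[OF uv(2)] by linarith+
  hence "ln s <= 8 * u" "- ln s <= 8 * v" by simp_all
  hence "abs (ln s) <= 8 * (u + v)" using uv by (simp add: abs_le_iff algebra_simps)
  thus ?thesis by (simp add: u_def v_def)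
 qed
 have ln': "abs (ln s) <= 8 * (D powr (3/8) + D powr (1/8)) * s powr (-1/4)" if "0 < s" "s <= D" for s :: real
  using ln[OF that(1)] le[OF that, of "-1/4" "1/8"] le[OF that, of "-1/4" "-1/8"] by (simp add: algebra_simps)
 consider "nu = 2" | "nu = 4" | "nu ~= 2" "nu ~= 4" by auto
 thus ?thesis
 proof cases
  case 1
  let ?L = "8 * (D powr (3/8) + D powr (1/8))"
  let ?C = "D * ?L * D powr (1/2) + D powr (7/4) + 1"
  have "abs (KK nu 0 s) <= ?C * s powr (- nu/2 + 1/4)" if s: "0 < s" "s <= D" for s
  proof -
   have a: "abs (s * ln s) <= D * (?L * s powr (-1/4))"
    using s ln'[OF s] unfolding abs_mult by (intro mult_mono) auto
   have b: "s powr (-1/4) <= D powr (1/2) * s powr (-3/4)" using le[OF s, of "-3/4" "-1/4"] by simp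
   have c: "s <= D powr (7/4) * s powr (-3/4)" using le[OF s, of "-3/4" 1] s by simp
   have L0: "0 <= D * ?L" using assms(1) by (intro mult_nonneg_nonneg) auto
   have "abs (KK nu 0 s) <= abs (s * ln s) + abs s"
    using 1 abs_triangle_ineq4[of "s * ln s" s] by simp
   also have "... <= (D * ?L) * (D powr (1/2) * s powr (-3/4)) + D powr (7/4) * s powr (-3/4)"
    using a c s mult_left_mono[OF b L0] by linarith
   also have "... <= ?C * s powr (-3/4)" by (simp add: algebra_simps)
   finally show ?thesis using 1 by simp
  qed
  moreover have "0 < ?C" using assms(1) by (intro add_nonneg_pos add_nonneg_nonneg mult_nonneg_nonneg) auto
  ultimately show ?thesis by blast
 next
  case 2
  let ?L = "8 * (D powr (3/8) + D powr (1/8))"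
  let ?C = "?L * D powr (3/2)"
  have L0: "0 < ?L" using assms(1) by (simp add: add_pos_pos)
  have "abs (KK nu 0 s) <= ?C * s powr (- nu/2 + 1/4)" if s: "0 < s" "s <= D" for s
  proof -
   have "abs (KK nu 0 s) <= abs (ln s)" using 2 by simp
   also have "... <= ?L * s powr (-1/4)" using ln'[OF s] .
   also have "... <= ?L * (D powr (3/2) * s powr (-7/4))"
    using le[OF s, of "-7/4" "-1/4"] L0 by (intro mult_left_mono) auto
   finally show ?thesis using 2 by (simp add: mult.assoc)
  qed
  moreover have "0 < ?C" using L0 assms(1) by (simp add: add_pos_pos)
  ultimately show ?thesis by blast
 next
  case 3
  let ?c = "abs (1 / ((2 - nu) * (2 - nu/2)))"
  have "abs (KK nu 0 s) <= (?c * D powr (7/4)) * s powr (- nu/2 + 1/4)" if s: "0 < s" "s <= D" for s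
  proof -
   have "abs (KK nu 0 s) = ?c * s powr (2 - nu/2)" using 3 by (simp add: abs_mult abs_divide)
   also have "... <= ?c * (D powr (7/4) * s powr (- nu/2 + 1/4))"
    using le[OF s, of "- nu/2 + 1/4" "2 - nu/2"] by (intro mult_left_mono) auto
   finally show ?thesis by simp
  qed
  moreover have "0 < ?c * D powr (7/4)" using 3 assms(1) by auto
  ultimately show ?thesis by blast
 qed
qed

declare KK.simps [simp del]

section \<open>Integrability of powers of the distance\<close>

lemma term_le_suminf_ennreal: "f k <= (\<Sum>k. f k)" for f :: "nat => ennreal"
 using sum_le_suminf[of f "{k}"] by simp

text \<open>Dyadic shells around \<open>y\<close>: on the \<open>k\<close>-th one the integrand is
  at most \<open>c k\<close>, and the volume shrinks like \<open>2 ^ k\<close> to the power minus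
  the dimension. This gives a geometric series of ratio \<open>q\<close>, with the same constant for
  all centres.\<close>

lemma nn_integral_dist_powr:
 fixes D p :: real
 assumes "0 < D" "0 < p" "p < DIM('a::euclidean_space)"
 shows "EX C>=0. ALL y::'a. (\<integral>\<^sup>+z\<in>ball y D. en (dist z y powr (- p)) \<partial>lborel) <= en C"
proof -
 let ?n = "DIM('a)"
 define c where "c k = (D / 2 ^ Suc k) powr (- p)" for k
 define q where "q = 2 powr (- (?n - p))"
 have q: "0 < q" "q < 1" using assms(3) by (auto simp: q_def powr_less_one)
 define A where "A = D powr (- p) * 2 powr p * unit_ball_vol ?n * D ^ ?n"
 have ck: "c k * (unit_ball_vol ?n * (D / 2 ^ k) ^ ?n) = A * q ^ k" for k
 proof -
  have "c k = D powr (- p) * (2 ^ Suc k) powr p"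
   using assms by (simp add: c_def powr_divide powr_minus_divide)
  also have "(2 ^ Suc k) powr p = 2 powr (real (Suc k) * p)" by (simp only: powr_powr[symmetric] powr_realpow zero_less_numeral)
  also have "... = 2 powr p * (2 powr p) ^ k" by (simp add: powr_realpow[symmetric] powr_powr powr_add algebra_simps)
  finally have 1: "c k = D powr (- p) * (2 powr p * (2 powr p) ^ k)" .
  have "q = 2 powr p / 2 ^ ?n" unfolding q_def by (simp add: powr_diff powr_realpow)
  hence "q ^ k = (2 powr p) ^ k / (2 ^ k) ^ ?n" by (simp add: power_divide power_mult[symmetric] mult.commute)
  thus ?thesis unfolding 1 A_def by (simp add: power_divide)
 qed
 have "(\<integral>\<^sup>+z\<in>ball y D. en (dist z y powr (- p)) \<partial>lborel) <= en (A / (1 - q))" for y :: 'a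
 proof -
  have "(\<integral>\<^sup>+z\<in>ball y D. en (dist z y powr (- p)) \<partial>lborel)
    <= (\<integral>\<^sup>+z. (\<Sum>k. en (c k) * indicator (ball y (D / 2 ^ k)) z) \<partial>lborel)"
  proof (rule nn_integral_mono)
   fix z :: 'a
   show "en (dist z y powr (- p)) * indicator (ball y D) z <= (\<Sum>k. en (c k) * indicator (ball y (D / 2 ^ k)) z)"
   proof (cases "z : ball y D & z ~= y")
    case True
    define r where "r = dist z y"
    have r: "0 < r" "r < D" using True by (auto simp: r_def dist_commute)
    have "EX k. D / 2 ^ k <= r"
    proof -
     obtain k where "D / r < 2 ^ k" using real_arch_pow[of 2 "D/r"] by auto
     hence "D / 2 ^ k <= r" using r by (simp add: field_simps)
     thus ?thesis ..
    qed
    define m where "m = (LEAST k. D / 2 ^ k <= r)"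
    have m: "D / 2 ^ m <= r" unfolding m_def using \<open>EX k. D / 2 ^ k <= r\<close> by (rule LeastI_ex)
    have "m ~= 0" using m r by (intro notI) simp
    then obtain k where k: "m = Suc k" using not0_implies_Suc by blast
    have k2: "r < D / 2 ^ k" using not_less_Least[of k "%k. D / 2 ^ k <= r"] k m_def by auto
    have "r powr (- p) <= c k" unfolding c_def using m k r assms by (intro powr_mono2') auto
    hence "en (dist z y powr (- p)) * indicator (ball y D) z <= en (c k) * indicator (ball y (D / 2 ^ k)) z"
     using True k2 by (auto simp: r_def dist_commute indicator_def intro: ennreal_leI)
    also have "... <= (\<Sum>k. en (c k) * indicator (ball y (D / 2 ^ k)) z)"
     by (rule term_le_suminf_ennreal)
    finally show ?thesis .
   qed (auto simp: indicator_def)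
  qed
  also have "... = (\<Sum>k. \<integral>\<^sup>+z. en (c k) * indicator (ball y (D / 2 ^ k)) z \<partial>lborel)"
   by (intro nn_integral_suminf borel_measurable_times_ennreal borel_measurable_indicator measurable_const) simp_all
  also have "... = (\<Sum>k. en (A * q ^ k))"
  proof (rule suminf_cong)
   fix k
   have "(\<integral>\<^sup>+z. en (c k) * indicator (ball y (D / 2 ^ k)) z \<partial>lborel) = en (c k) * emeasure lborel (ball y (D / 2 ^ k))"
    by (rule nn_integral_cmult_indicator) simp
   also have "emeasure lborel (ball y (D / 2 ^ k)) = en (unit_ball_vol ?n * (D / 2 ^ k) ^ ?n)"
    using assms(1) by (intro emeasure_ball) auto
   also have "en (c k) * ... = en (A * q ^ k)"
    unfolding ck[symmetric] by (rule ennreal_mult'[symmetric]) (simp add: c_def)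
   finally show "(\<integral>\<^sup>+z. en (c k) * indicator (ball y (D / 2 ^ k)) z \<partial>lborel) = en (A * q ^ k)" .
  qed
  also have "... = en (\<Sum>k. A * q ^ k)"
   using q assms(1) by (intro suminf_ennreal2) (auto intro!: summable_mult summable_geometric simp: A_def)
  also have "(\<Sum>k. A * q ^ k) = A / (1 - q)"
   using q by (simp add: suminf_mult summable_geometric suminf_geometric)
  finally show ?thesis .
 qed
 moreover have "0 <= A / (1 - q)" using q assms(1) by (simp add: A_def)
 ultimately show ?thesis by blast
qed

text \<open>Up to the factor \<open>2 * n * (n + 2)\<close>, with \<open>n\<close> the dimension,
  this is the bilaplacian of \<open>KK n 0 (norm y ^ 2 + 1)\<close>: the regularised fundamental
  solution at unit scale.\<close>

definition fsol_profile :: "'a::euclidean_space => real" where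
 "fsol_profile y = (norm y ^ 2 + 1) powr (- real DIM('a) / 2 - 2)"

lemma fsol_profile_measurable [measurable]: "fsol_profile : borel_measurable borel"
 unfolding fsol_profile_def[abs_def] by measurable

text \<open>Dyadic balls: the decay of the profile beats the growth of the volume by four powers,
  hence the ratio \<open>1/16\<close>.\<close>

lemma fsol_profile_integrable: "integrable lborel (fsol_profile :: 'a::euclidean_space => real)"
proof (rule integrableI_nonneg)
 let ?n = "DIM('a)"
 let ?f = "%k y. en ((1/16) ^ k * 2 ^ 4 * (1 / 2 ^ ?n) ^ k) * indicator (ball (0::'a) (2 ^ k)) y"
 have "(\<integral>\<^sup>+y. en (fsol_profile y) \<partial>(lborel :: 'a measure)) <= (\<integral>\<^sup>+y. (\<Sum>k. 2 ^ ?n * ?f k y) \<partial>lborel)"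
 proof (rule nn_integral_mono)
  fix y :: 'a
  have "EX k. norm y < 2 ^ k" using real_arch_pow[of 2 "norm y"] by auto
  define m where "m = (LEAST k. norm y < 2 ^ k)"
  have m: "norm y < 2 ^ m" unfolding m_def using \<open>EX k. norm y < 2 ^ k\<close> by (rule LeastI_ex)
  have l: "(2 ^ m / 2)^2 <= norm y ^ 2 + 1"
  proof (cases m)
   case 0 thus ?thesis by (simp add: power2_eq_square add_increasing)
  next
   case (Suc j)
   hence "2 ^ j <= norm y" using not_less_Least[of j "%k. norm y < 2 ^ k"] m_def by (auto simp: not_less)
   hence "(2 ^ j)^2 <= (norm y)^2" by (rule power_mono) simp
   moreover have "(2 ^ Suc j / 2 :: real)^2 = (2 ^ j)^2" by simp
   ultimately show ?thesis unfolding Suc by linarith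
  qed
  have "fsol_profile y <= ((2 ^ m / 2)^2) powr (- real ?n / 2 - 2)"
   unfolding fsol_profile_def using l by (intro powr_mono2') auto
  also have "... = 1 / (2 ^ m / 2) ^ (?n + 4)"
  proof -
   define B :: real where "B = 2 ^ m / 2"
   have B: "0 < B" by (simp add: B_def)
   have "(B^2) powr (- real ?n / 2 - 2) = (B powr 2) powr (- real ?n / 2 - 2)" using B by (simp only: powr_numeral less_imp_le)
   also have "... = B powr (2 * (- real ?n / 2 - 2))" by (rule powr_powr)
   also have "2 * (- real ?n / 2 - 2) = - real (?n + 4)" by simp
   also have "B powr - real (?n + 4) = 1 / B powr real (?n + 4)" by (rule powr_minus_divide)
   also have "B powr real (?n + 4) = B ^ (?n + 4)" using B by (rule powr_realpow)
   finally show ?thesis unfolding B_def .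
  qed
  also have "... = 2 ^ ?n * ((1/16) ^ m * 2 ^ 4 * (1 / 2 ^ ?n) ^ m)"
  proof -
   have "(2 ^ m :: real) ^ (?n + 4) = (2 ^ ?n) ^ m * 16 ^ m"
   proof -
    have "(2 ^ m :: real) ^ (?n + 4) = 2 ^ (?n * m + 4 * m)"
     by (simp only: power_mult[symmetric] distrib_left mult.commute)
    also have "... = (2 ^ ?n) ^ m * (2 ^ 4) ^ m" by (simp only: power_add power_mult)
    finally show ?thesis by simp
   qed
   thus ?thesis unfolding power_divide by (simp add: power_add)
  qed
  finally have "en (fsol_profile y) <= en (2 ^ ?n * ((1/16) ^ m * 2 ^ 4 * (1 / 2 ^ ?n) ^ m))"
   by (rule ennreal_leI)
  also have "... = 2 ^ ?n * en ((1/16) ^ m * 2 ^ 4 * (1 / 2 ^ ?n) ^ m)"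
   by (subst ennreal_mult') (simp_all add: ennreal_power[symmetric] del: ennreal_power)
  also have "... = 2 ^ ?n * ?f m y" using m by simp
  also have "... <= (\<Sum>k. 2 ^ ?n * ?f k y)"
   by (rule term_le_suminf_ennreal)
  finally show "en (fsol_profile y) <= (\<Sum>k. 2 ^ ?n * ?f k y)" .
 qed
 also have "... = (\<Sum>k. \<integral>\<^sup>+y. 2 ^ ?n * ?f k y \<partial>lborel)"
  by (intro nn_integral_suminf borel_measurable_times_ennreal borel_measurable_indicator measurable_const) simp_all
 also have "... = (\<Sum>k. en (2 ^ ?n * 2 ^ 4 * unit_ball_vol ?n * (1/16) ^ k))"
 proof (rule suminf_cong)
  fix k
  have v: "emeasure lborel (ball (0::'a) (2 ^ k)) = en (unit_ball_vol ?n * (2 ^ k) ^ ?n)" by (intro emeasure_ball) auto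
  have "(\<integral>\<^sup>+y. 2 ^ ?n * ?f k y \<partial>lborel) = 2 ^ ?n * (\<integral>\<^sup>+y. ?f k y \<partial>lborel)"
   by (intro nn_integral_cmult borel_measurable_times_ennreal borel_measurable_indicator measurable_const) (auto intro: borel_open)
  also have "(\<integral>\<^sup>+y. ?f k y \<partial>lborel) = en ((1/16) ^ k * 2 ^ 4 * (1 / 2 ^ ?n) ^ k) * emeasure lborel (ball (0::'a) (2 ^ k))"
   by (rule nn_integral_cmult_indicator) simp
  also have "2 ^ ?n * ... = en (2 ^ ?n) * (en ((1/16) ^ k * 2 ^ 4 * (1 / 2 ^ ?n) ^ k) * en (unit_ball_vol ?n * (2 ^ k) ^ ?n))"
   by (simp only: v ennreal_power[symmetric] zero_le_numeral ennreal_numeral)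
  also have "... = en (2 ^ ?n * (((1/16) ^ k * 2 ^ 4 * (1 / 2 ^ ?n) ^ k) * (unit_ball_vol ?n * (2 ^ k) ^ ?n)))"
   by (simp only: ennreal_mult'[symmetric] zero_le_power zero_le_numeral zero_le_mult_iff zero_le_divide_iff unit_ball_vol_nonneg of_nat_0_le_iff zero_le_one simp_thms)
  also have "2 ^ ?n * (((1/16) ^ k * 2 ^ 4 * (1 / 2 ^ ?n) ^ k) * (unit_ball_vol ?n * (2 ^ k) ^ ?n)) = 2 ^ ?n * 2 ^ 4 * unit_ball_vol ?n * (1/16::real) ^ k"
   by (simp add: power_divide power_mult[symmetric] mult.commute)
  finally show "(\<integral>\<^sup>+y. 2 ^ ?n * ?f k y \<partial>lborel) = en (2 ^ ?n * 2 ^ 4 * unit_ball_vol ?n * (1/16) ^ k)" .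
 qed
 also have "... = en (\<Sum>k. 2 ^ ?n * 2 ^ 4 * unit_ball_vol ?n * (1/16) ^ k)"
  by (intro suminf_ennreal2) (auto intro!: summable_mult summable_geometric)
 also have "... < \<infinity>" by simp
 finally show "(\<integral>\<^sup>+y. en (fsol_profile y) \<partial>(lborel :: 'a measure)) < \<infinity>" .
qed (auto simp: fsol_profile_def)

definition sqdist :: "'a::euclidean_space => 'a => real" where
 "sqdist x z = (z - x) \<bullet> (z - x)"

lemma sqdist_norm: "sqdist x z = (norm (z - x))^2"
 by (simp add: sqdist_def power2_norm_eq_inner)

lemma sqdist_nonneg [simp]: "0 <= sqdist x z" and sqdist_pos: "z ~= x ==> 0 < sqdist x z"
 by (simp_all add: sqdist_def)

lemma C_k_on_sqdist: "open S ==> C_k_on k S (sqdist x)"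
proof -
 assume S: "open S"
 have "C_k_on k S (%z. SUM b:Basis. (z \<bullet> b - x \<bullet> b) ^ 2)"
  by (intro C_k_on_sum C_k_on_power C_k_on_diff C_k_on_inner C_k_on_const S) auto
 moreover have "(SUM b:Basis. (z \<bullet> b - x \<bullet> b) ^ 2) = sqdist x z" for z
  unfolding sqdist_def by (subst euclidean_inner) (simp add: inner_diff_left power2_eq_square)
 ultimately show ?thesis by simp
qed

lemma partial_deriv_sqdist: "pd b (sqdist x) = (%z. 2 * (b \<bullet> (z - x)))"
proof
 fix z
 have "(sqdist x has_derivative (%h. (z - x) \<bullet> h + h \<bullet> (z - x))) (at z)"
  unfolding sqdist_def[abs_def] by (auto intro!: derivative_eq_intros)
 from partial_derivI[OF this, of b] show "pd b (sqdist x) z = 2 * (b \<bullet> (z - x))"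
  by (simp add: inner_commute)
qed

lemma laplacian_sqdist: "lap (sqdist x) = (%z. 2 * real DIM('a))" for x :: "'a::euclidean_space"
proof
 fix z :: 'a
 have "pd b (%z. 2 * (b \<bullet> (z - x))) z = 2" if "b : Basis" for b
 proof -
  have "((%z. 2 * (b \<bullet> (z - x))) has_derivative (%h. 2 * (b \<bullet> h))) (at z)"
   by (auto intro!: derivative_eq_intros)
  from partial_derivI[OF this, of b] show ?thesis using that by simp
 qed
 thus "lap (sqdist x) z = 2 * real DIM('a)"
  by (simp add: laplacian_def partial_deriv_sqdist)
qed

lemma grad_inner_sqdist: "grad_inner (sqdist x) (sqdist x) z = 4 * sqdist x z"
proof -
 have "(SUM b:Basis. (2 * (b \<bullet> (z - x))) * (2 * (b \<bullet> (z - x)))) = 4 * (SUM b:Basis. ((z - x) \<bullet> b) * ((z - x) \<bullet> b))"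
  unfolding sum_distrib_left by (intro sum.cong refl) (simp add: inner_commute)
 also have "(SUM b:Basis. ((z - x) \<bullet> b) * ((z - x) \<bullet> b)) = sqdist x z"
  unfolding sqdist_def by (rule euclidean_inner[symmetric])
 finally show ?thesis by (simp add: grad_inner_def partial_deriv_sqdist)
qed

lemma partial_deriv_add_const: "pd b (%z. f z + c) = pd b f"
proof -
 have "((%z. f z + c) has_derivative D) (at z) \<longleftrightarrow> (f has_derivative D) (at z)" for D z
  using has_derivative_add_const[of f D "at z" c] has_derivative_add_const[of "%z. f z + c" D "at z" "- c"] by auto
 thus ?thesis unfolding partial_deriv_def frechet_derivative_def by auto
qed

text \<open>The case \<open>eps = 0\<close>, away from \<open>x\<close>, says that the fundamental solution is biharmonic; for \<open>eps > 0\<close>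
 the right-hand side is an approximate identity.\<close>

lemma bilaplacian_fundamental:
 fixes x :: "'a::euclidean_space"
 assumes "open S" "0 <= eps" "!!z. z : S ==> 0 < sqdist x z + eps" "z : S"
 defines "n \<equiv> real DIM('a)"
 shows "lap (lap (%z. KK n 0 (sqdist x z + eps))) z
  = 2 * n * (n + 2) * eps^2 * (sqdist x z + eps) powr (- n/2 - 2)"
  and "C_k_on k S (%z. KK n 0 (sqdist x z + eps))"
proof -
 define f where "f z = sqdist x z + eps" for z
 have f: "C_k_on k S f" for k unfolding f_def by (intro C_k_on_add C_k_on_sqdist C_k_on_const assms)
 have fp: "0 < f z" if "z : S" for z using assms(3) that by (simp add: f_def)
 have lf: "lap f z = 2 * n" for z
  unfolding f_def laplacian_def partial_deriv_add_const using laplacian_sqdist[of x] by (simp add: laplacian_def n_def fun_eq_iff)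
 have gf: "grad_inner f f z = 4 * (f z - eps)" for z
  using grad_inner_sqdist[of x z] unfolding f_def grad_inner_def partial_deriv_add_const by simp
 show "C_k_on k S (%z. KK n 0 (sqdist x z + eps))"
  using C_k_on_comp[OF assms(1) f[of k], of "%j. KK n j"] KK_deriv fp continuous_on_subset[OF KK_continuous_on]
  unfolding f_def by (auto simp: image_subset_iff)
 \<comment> \<open>\<open>f\<close> has constant Laplacian, and its squared gradient is a function
   of \<open>f\<close>. So the Laplacian maps functions of \<open>f\<close> to functions of
   \<open>f\<close>, and the computation reduces to ordinary derivatives in
   \<open>s\<close>.\<close>
 define L where "L s = 2 * n * KK n 1 s + 4 * (s - eps) * KK n 2 s" for s
 define L1 where "L1 s = (2 * n + 4) * KK n 2 s + 4 * (s - eps) * KK n 3 s" for s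
 define L2 where "L2 s = (2 * n + 8) * KK n 3 s + 4 * (s - eps) * KK n 4 s" for s
 note D = KK_deriv[of _ n 0] KK_deriv[of _ n 1] KK_deriv[of _ n 2] KK_deriv[of _ n 3]
 have S: "Suc 0 = 1" "Suc 1 = 2" "Suc 2 = 3" "Suc 3 = 4" by auto
 note D = D[unfolded S]
 have 1: "lap (%z. KK n 0 (f z)) z = L (f z)" if "z : S" for z
  using laplacian_comp[OF assms(1) f that, where h = "KK n 0" and ?h1.0 = "KK n 1" and ?h2.0 = "KK n 2 (f z)"] D fp that
  by (simp only: lf gf L_def) (simp add: algebra_simps)
 have dL: "(L has_real_derivative L1 s) (at s)" if "0 < s" for s
 proof -
  have "((%s. 2 * n * KK n 1 s + 4 * (s - eps) * KK n 2 s) has_real_derivative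
    2 * n * KK n 2 s + (4 * (s - eps) * KK n 3 s + 4 * KK n 2 s)) (at s)"
   by (rule derivative_eq_intros D that refl | simp)+
  thus ?thesis unfolding L_def[abs_def] L1_def by (simp add: algebra_simps)
 qed
 have dL1: "(L1 has_real_derivative L2 s) (at s)" if "0 < s" for s
 proof -
  have "((%s. (2 * n + 4) * KK n 2 s + 4 * (s - eps) * KK n 3 s) has_real_derivative
    (2 * n + 4) * KK n 3 s + (4 * (s - eps) * KK n 4 s + 4 * KK n 3 s)) (at s)"
   by (rule derivative_eq_intros D that refl | simp)+
  thus ?thesis unfolding L1_def[abs_def] L2_def by (simp add: algebra_simps)
 qed
 have "lap (lap (%z. KK n 0 (f z))) z = lap (%z. L (f z)) z"
  by (rule laplacian_cong[OF assms(1,4) 1])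
 also have "... = L1 (f z) * (2 * n) + L2 (f z) * (4 * (f z - eps))"
  using laplacian_comp[OF assms(1) f assms(4), where h = L and ?h1.0 = L1 and ?h2.0 = "L2 (f z)"] dL dL1 fp assms(4)
  by (simp add: lf gf)
 also have "... = 2 * n * (n + 2) * eps^2 * f z powr (- n/2 - 2)"
 proof -
  have "((2 * n + 4) * (s^2 * (X / 2)) + 4 * (s - eps) * (- (n / 2) * (s * (X / 2)))) * (2 * n) +
   ((2 * n + 8) * (- (n / 2) * (s * (X / 2))) + 4 * (s - eps) * (n / 2 * (n / 2 + 1) * (X / 2))) * (4 * (s - eps))
   = 2 * n * (n + 2) * eps^2 * X" for s X :: real
   by (simp add: field_simps power2_eq_square)
  thus ?thesis unfolding L1_def L2_def KK_explicit[OF fp[OF assms(4)]] .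
 qed
 finally show "lap (lap (%z. KK n 0 (sqdist x z + eps))) z
  = 2 * n * (n + 2) * eps^2 * (sqdist x z + eps) powr (- n/2 - 2)" unfolding f_def .
qed

text \<open>Substitution \<open>z = x + c * y\<close> with \<open>c ^ 2\<close> the regularisation
  parameter: the powers of \<open>c\<close> cancel exactly against the Jacobian, and
  \<open>W (x + c * y)\<close> converges boundedly to \<open>W x\<close>.\<close>

lemma approximate_identity:
 fixes W :: "'a::euclidean_space => real"
 assumes "continuous_on UNIV W" "!!z. abs (W z) <= M"
 shows "(%k. \<integral>z. W z * ((inverse (real (Suc k)))^2)^2 * (sqdist x z + (inverse (real (Suc k)))^2) powr (- real DIM('a)/2 - 2) \<partial>lborel)
   ----> W x * (\<integral>y. fsol_profile (y::'a) \<partial>lborel)"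
proof -
 let ?p = "- real DIM('a)/2 - 2"
 have Wm [measurable]: "W : borel_measurable borel" using assms(1) by (rule borel_measurable_continuous_onI)
 have eq: "(\<integral>z. W z * (c^2)^2 * (sqdist x z + c^2) powr ?p \<partial>lborel) = (\<integral>y. W (x + c *\<^sub>R y) * fsol_profile y \<partial>lborel)"
  if c: "0 < c" for c
 proof -
  let ?f = "%z. W z * (c^2)^2 * (sqdist x z + c^2) powr ?p"
  have fm [measurable]: "?f : borel_measurable borel" unfolding sqdist_def by measurable
  have tm [measurable]: "(%y. x + c *\<^sub>R y) : borel \<rightarrow>\<^sub>M borel" by measurable
  have "(\<integral>z. ?f z \<partial>lborel) = (\<integral>z. ?f z \<partial>density (distr lborel borel (%y. x + c *\<^sub>R y)) (%_. en (abs c ^ DIM('a))))"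
   using lborel_affine[of c x] c by simp
  also have "... = (\<integral>z. (abs c ^ DIM('a)) *\<^sub>R ?f z \<partial>distr lborel borel (%y. x + c *\<^sub>R y))"
   by (rule integral_density) (use fm in auto)
  also have "... = (\<integral>y. (abs c ^ DIM('a)) *\<^sub>R ?f (x + c *\<^sub>R y) \<partial>lborel)"
   by (rule integral_distr) (use fm in auto)
  also have "... = (\<integral>y. W (x + c *\<^sub>R y) * fsol_profile y \<partial>lborel)"
  proof (rule Bochner_Integration.integral_cong)
   fix y :: 'a
   have a: "sqdist x (x + c *\<^sub>R y) + c^2 = c^2 * (norm y ^ 2 + 1)"
    by (simp add: sqdist_norm power_mult_distrib algebra_simps)
   have "(c^2 * (norm y ^ 2 + 1)) powr ?p = (c^2) powr ?p * fsol_profile y"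
    unfolding fsol_profile_def by (subst powr_mult) auto
   moreover have "(c^2) powr ?p = 1 / (c ^ DIM('a) * (c^2)^2)"
   proof -
    have "(c^2) powr ?p = (c powr 2) powr ?p" using c by (simp only: powr_numeral less_imp_le)
    also have "... = c powr (2 * ?p)" by (rule powr_powr)
    also have "2 * ?p = - real (DIM('a) + 4)" by simp
    also have "c powr - real (DIM('a) + 4) = 1 / c powr real (DIM('a) + 4)" by (rule powr_minus_divide)
    also have "c powr real (DIM('a) + 4) = c ^ (DIM('a) + 4)" using c by (rule powr_realpow)
    finally show ?thesis by (simp add: power_add power_mult[symmetric])
   qed
   ultimately show "(abs c ^ DIM('a)) *\<^sub>R ?f (x + c *\<^sub>R y) = W (x + c *\<^sub>R y) * fsol_profile y"
    using c unfolding a by simp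
  qed simp
  finally show ?thesis .
 qed
 have "(%k. \<integral>y. W (x + inverse (real (Suc k)) *\<^sub>R y) * fsol_profile y \<partial>lborel) ----> (\<integral>y. W x * fsol_profile (y::'a) \<partial>lborel)"
 proof (rule integral_dominated_convergence[where w = "%y. M * fsol_profile y"])
  show "integrable lborel (%y::'a. M * fsol_profile y)" by (intro integrable_mult_right fsol_profile_integrable)
  show "AE y in lborel. (%k. W (x + inverse (real (Suc k)) *\<^sub>R y) * fsol_profile y) ----> W x * fsol_profile y"
  proof (rule AE_I2)
   fix y :: 'a
   have "(%k. x + inverse (real (Suc k)) *\<^sub>R y) ----> x + 0 *\<^sub>R y"
    by (intro tendsto_intros LIMSEQ_inverse_real_of_nat)
   hence "(%k. W (x + inverse (real (Suc k)) *\<^sub>R y)) ----> W x"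
    using assms(1) by (intro isCont_tendsto_compose[of x W]) (auto simp: continuous_on_eq_continuous_at)
   thus "(%k. W (x + inverse (real (Suc k)) *\<^sub>R y) * fsol_profile y) ----> W x * fsol_profile y"
    by (intro tendsto_intros)
  qed
  show "AE y in lborel. norm (W (x + inverse (real (Suc k)) *\<^sub>R y) * fsol_profile y) <= M * fsol_profile y" for k
   using assms(2) by (auto simp: abs_mult fsol_profile_def intro!: mult_right_mono)
 qed measurable
 moreover have "0 < inverse (real (Suc k))" for k by simp
 ultimately show ?thesis by (simp only: eq Bochner_Integration.integral_mult_right_zero)
qed

text \<open>The mass of the approximate identity. It normalises the fundamental solution and later
  \<open>P\<close>; it stays an unevaluated integral, of which only the sign is determined.\<close>

definition fsol_const :: "'a::euclidean_space itself => real" where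
 "fsol_const T = 2 * real DIM('a) * (real DIM('a) + 2) * (\<integral>y. fsol_profile (y::'a) \<partial>lborel)"

lemma fsol_const_pos: "0 < fsol_const TYPE('a::euclidean_space)"
proof -
 have nn: "0 <= (\<integral>y. fsol_profile (y::'a) \<partial>lborel)" by (rule integral_nonneg_AE) (auto simp: fsol_profile_def)
 have "(\<integral>y. fsol_profile (y::'a) \<partial>lborel) ~= 0"
 proof
  assume "(\<integral>y. fsol_profile (y::'a) \<partial>lborel) = 0"
  hence "AE y::'a in lborel. fsol_profile y = 0"
   by (subst (asm) integral_nonneg_eq_0_iff_AE[OF fsol_profile_integrable]) (auto simp: fsol_profile_def)
  moreover have "fsol_profile y ~= 0" for y :: 'a
   unfolding fsol_profile_def using add_nonneg_pos[of "(norm y)^2" 1] by (metis powr_eq_0_iff less_irrefl zero_le_power2 zero_less_one)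
  ultimately have "AE y::'a in lborel. False" by auto
  hence "emeasure lborel (UNIV :: 'a set) = 0"
   using emeasure_eq_0_AE[of "%_. True" "lborel :: 'a measure"] by simp
  thus False by simp
 qed
 with nn have "0 < (\<integral>y. fsol_profile (y::'a) \<partial>lborel)" by simp
 moreover have "0 < 2 * real DIM('a) * (real DIM('a) + 2)" by (intro mult_pos_pos add_pos_pos) simp_all
 ultimately show ?thesis unfolding fsol_const_def by (simp only: mult_pos_pos of_nat_mult of_nat_add of_nat_numeral)
qed

lemma set_integrable_dominated:
 fixes f :: "'a::euclidean_space => real"
 assumes "set_integrable lborel S g" "set_borel_measurable lborel S f" "!!x. x : S ==> abs (f x) <= g x"
 shows "set_integrable lborel S f"
 unfolding set_integrable_def
 by (rule Bochner_Integration.integrable_bound[OF assms(1)[unfolded set_integrable_def]])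
  (use assms(2,3) in "auto simp: indicator_def set_borel_measurable_def intro!: AE_I2 intro: order_trans[OF _ abs_ge_self]")

lemma set_integrable_dist_powr:
 fixes S :: "'a::euclidean_space set" and p :: real
 assumes "bounded S" "S : sets lborel" "0 < p" "p < DIM('a)"
 shows "set_integrable lborel S (%z. dist z x powr (- p))"
proof -
 obtain D where D: "0 < D" "S \<subseteq> ball x D" using assms(1) bounded_subset_ballD[of S x] by blast
 obtain C where C: "!!y::'a. (\<integral>\<^sup>+z\<in>ball y D. en (dist z y powr (- p)) \<partial>lborel) <= en C"
  using nn_integral_dist_powr[OF D(1) assms(3,4)] by blast
 have [measurable]: "ball x D : sets borel" "S : sets borel" using assms(2) by auto
 show ?thesis unfolding set_integrable_def
 proof (rule integrableI_nonneg)
  have "(\<integral>\<^sup>+z. en (ind S z *\<^sub>R dist z x powr (- p)) \<partial>lborel) <= (\<integral>\<^sup>+z\<in>ball x D. en (dist z x powr (- p)) \<partial>lborel)"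
   using D(2) by (intro nn_integral_mono) (auto simp: indicator_def)
  also have "... < \<infinity>" using C[of x] by (rule le_less_trans) simp
  finally show "(\<integral>\<^sup>+z. en (ind S z *\<^sub>R dist z x powr (- p)) \<partial>lborel) < \<infinity>" .
 qed auto
qed

text \<open>The bilaplacian is moved from \<open>w\<close> to the smooth function
  \<open>KK n 0 (sqdist x z + eps)\<close>, where it becomes an approximate identity. On the other
  side the limit is taken by domination: the exponent in \<open>KK_0_bound\<close> is negative, so
  the bound at \<open>sqdist x z\<close> also serves for \<open>sqdist x z + eps\<close>.\<close>

lemma fundamental_solution:
 fixes w :: "'a::euclidean_space => real"
 assumes "open S" "compact C" "C \<subseteq> S" "C_k_on 4 S w" "!!z. z : S - C ==> w z = 0" "x : S"
 shows "set_integrable lborel S (%z. KK DIM('a) 0 (sqdist x z) * lap (lap w) z)"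
  and "(LINT z:S|lborel. KK DIM('a) 0 (sqdist x z) * lap (lap w) z) = fsol_const TYPE('a) * w x"
proof -
 let ?n = "real DIM('a)"
 let ?Lw = "lap (lap w)"
 have opSC: "open (S - C)" using assms by (auto intro: open_Diff compact_imp_closed)
 have Lc: "continuous_on S ?Lw"
  using C_k_on_laplacian[OF assms(1), of 2 w] C_k_on_laplacian[OF assms(1), of 0 "lap w"] assms(4)
  by (simp add: eval_nat_numeral)
 have L0: "?Lw z = 0" if z: "z : S - C" for z
 proof -
  have "lap w y = 0" if "y : S - C" for y by (rule partial_deriv_0_nbhd(2)[OF opSC that assms(5)])
  thus ?thesis by (rule partial_deriv_0_nbhd(2)[OF opSC z])
 qed
 have "compact (?Lw ` C)" using Lc assms by (intro compact_continuous_image) (auto intro: continuous_on_subset)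
 then obtain M where M: "!!z. z : C ==> abs (?Lw z) <= M" "0 < M"
  unfolding compact_eq_bounded_closed bounded_pos real_norm_def by blast
 obtain B where B: "0 < B" "C \<subseteq> ball x B" using compact_imp_bounded[OF assms(2)] bounded_subset_ballD[of C x] by blast
 define D where "D = B^2 + 1"
 have D: "0 < D" using B by (simp add: D_def add_pos_pos)
 obtain K where K: "0 < K" "!!s. 0 < s ==> s <= D ==> abs (KK ?n 0 s) <= K * s powr (- ?n/2 + 1/4)"
  using KK_0_bound[OF D, of ?n] DIM_positive[where 'a='a] by (metis Suc_leI of_nat_1 of_nat_le_iff One_nat_def)
 define eps where "eps k = (inverse (real (Suc k)))^2" for k
 have e: "0 < eps k" "eps k <= 1" for k by (auto simp: eps_def field_simps power_le_one)
 have elim: "eps ----> 0"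
  unfolding eps_def using tendsto_power[OF LIMSEQ_inverse_real_of_nat, of 2] by simp
 define h where "h k z = ind S z * (KK ?n 0 (sqdist x z + eps k) * ?Lw z)" for k z
 define h0 where "h0 z = ind S z * (KK ?n 0 (sqdist x z) * ?Lw z)" for z
 define dom where "dom z = (K * M) * (ind C z * dist z x powr (- ?n + 1/2))" for z
 have Cs [measurable]: "C : sets borel" using assms(2) by (simp add: borel_compact)
 have n1: "1 <= ?n" using DIM_positive[where 'a='a] by (simp add: Suc_le_eq)
 hence p: "0 < ?n - 1/2" "?n - 1/2 < ?n" by linarith+
 have "integrable lborel (%z. ind C z * dist z x powr (- (?n - 1/2)))"
  using set_integrable_dist_powr[OF compact_imp_bounded[OF assms(2)] _ p, of x] Cs by (simp add: set_integrable_def)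
 hence domi: "integrable lborel dom" unfolding dom_def by simp
 have sing: "KK ?n 0 s <= K * d powr (- ?n + 1/2) & - KK ?n 0 s <= K * d powr (- ?n + 1/2)" if "d^2 <= s" "0 < d" "s <= D" for s d
 proof -
  have s: "0 < s" using that by (meson less_le_trans zero_less_power)
  have "s powr (- ?n/2 + 1/4) <= (d^2) powr (- ?n/2 + 1/4)" using that p by (intro powr_mono2') auto
  also have "... = (d powr 2) powr (- ?n/2 + 1/4)" using that by (simp only: powr_numeral less_imp_le)
  also have "... = d powr (2 * (- ?n/2 + 1/4))" by (rule powr_powr)
  also have "2 * (- ?n/2 + 1/4) = - ?n + 1/2" by simp
  finally have "K * s powr (- ?n/2 + 1/4) <= K * d powr (- ?n + 1/2)" using K(1) by simp
  thus ?thesis using K(2)[OF s that(3)] by linarith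
 qed
 \<comment> \<open>A shift \<open>t\<close> between 0 and 1 covers the regularised integrands and,
   with \<open>t = 0\<close>, their limit.\<close>
 have bnd: "abs (ind S z * (KK ?n 0 (sqdist x z + t) * ?Lw z)) <= dom z" if "0 <= t" "t <= 1" "z ~= x" for t z
 proof (cases "z : C")
  case True
  have d: "0 < dist z x" "dist z x < B" using True B(2) that by (auto simp: dist_commute)
  hence "(dist z x)^2 <= B^2" by (intro power_mono) auto
  hence "sqdist x z + t <= D" using that by (simp add: D_def sqdist_norm dist_norm)
  from sing[of "dist z x" "sqdist x z + t", OF _ d(1) this]
  have "abs (KK ?n 0 (sqdist x z + t)) <= K * dist z x powr (- ?n + 1/2)"
   using that by (auto simp: sqdist_norm dist_norm abs_le_iff)
  hence "abs (KK ?n 0 (sqdist x z + t) * ?Lw z) <= (K * dist z x powr (- ?n + 1/2)) * M"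
   unfolding abs_mult using M(1)[OF True] by (intro mult_mono) (auto intro: order_trans[OF abs_ge_zero])
  thus ?thesis using True assms(3) by (auto simp: dom_def mult_ac)
 next
  case False
  thus ?thesis using L0[of z] by (auto simp: dom_def indicator_def)
 qed
 have nx: "AE z in lborel. z ~= x" by (rule AE_lborel_singleton)
 have lim0: "(%k. h k z) ----> h0 z" if "z ~= x" for z
 proof -
  have "(%k. sqdist x z + eps k) ----> sqdist x z + 0" by (intro tendsto_intros elim)
  hence "(%k. KK ?n 0 (sqdist x z + eps k)) ----> KK ?n 0 (sqdist x z)"
   using isCont_tendsto_compose[OF DERIV_isCont[OF KK_deriv[OF sqdist_pos[OF that]]]] by simp
  thus ?thesis unfolding h_def h0_def by (intro tendsto_intros)
 qed
 have Ck: "C_k_on 4 S (%z. KK ?n 0 (sqdist x z + eps k))" for k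
  using bilaplacian_fundamental(2)[OF assms(1), of "eps k" x x 4] e[of k] assms(6) by (simp add: add_nonneg_pos less_imp_le)
 have hm: "h k : borel_measurable lborel" for k
 proof -
  have "continuous_on S (%z. KK ?n 0 (sqdist x z + eps k) * ?Lw z)"
   using C_k_on_imp_continuous[OF Ck] Lc by (intro continuous_intros)
  from borel_measurable_continuous_on_indicator[OF _ this] show ?thesis
   using assms(1) by (simp add: h_def[abs_def])
 qed
 \<comment> \<open>At \<open>z = x\<close> the integrand has whatever value \<open>KK\<close> takes
   at 0; this single point is split off for measurability.\<close>
 have h0m: "h0 : borel_measurable lborel"
 proof -
  have "continuous_on (S - {x}) (%z. KK ?n 0 (sqdist x z + 0) * ?Lw z)"
  proof (intro continuous_on_mult)
   show "continuous_on (S - {x}) (%z. KK ?n 0 (sqdist x z + 0))"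
   proof (cases "S - {x} = {}")
    case True
    thus ?thesis by (simp only: continuous_on_empty)
   next
    case False
    then obtain z where "z : S - {x}" by blast
    thus ?thesis using sqdist_pos assms(1)
     by (intro C_k_on_imp_continuous[OF bilaplacian_fundamental(2)[where z = z and k = 0]]) auto
   qed
  qed (use Lc in "auto intro: continuous_on_subset")
  hence "(%z. ind (S - {x}) z *\<^sub>R (KK ?n 0 (sqdist x z) * ?Lw z)) : borel_measurable borel"
   using assms(1) by (intro borel_measurable_continuous_on_indicator) auto
  hence "(%z. ind (S - {x}) z *\<^sub>R (KK ?n 0 (sqdist x z) * ?Lw z) + ind {x} z * h0 x) : borel_measurable borel"
   by measurable
  moreover have "h0 = (%z. ind (S - {x}) z *\<^sub>R (KK ?n 0 (sqdist x z) * ?Lw z) + ind {x} z * h0 x)"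
   by (auto simp: h0_def indicator_def)
  ultimately show ?thesis by simp
 qed
 have bAE: "AE z in lborel. norm (h k z) <= dom z" for k
  using nx by eventually_elim (use bnd[of "eps k"] e[of k] in "auto simp: h_def less_imp_le")
 have b0AE: "AE z in lborel. norm (h0 z) <= dom z"
  using nx by eventually_elim (use bnd[of 0] in "auto simp: h0_def")
 have "integrable lborel h0"
  by (rule Bochner_Integration.integrable_bound[OF domi h0m]) (use b0AE in "auto elim!: eventually_mono intro: order_trans[OF _ abs_ge_self]")
 thus "set_integrable lborel S (%z. KK ?n 0 (sqdist x z) * ?Lw z)"
  unfolding set_integrable_def h0_def by simp
 have limAE: "AE z in lborel. (%k. h k z) ----> h0 z"
  using nx by eventually_elim (rule lim0)
 have L1: "(%k. integral\<^sup>L lborel (h k)) ----> integral\<^sup>L lborel h0"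
  by (rule integral_dominated_convergence[OF h0m hm domi limAE bAE])
 define W where "W z = (if z : S then w z else 0)" for z
 have Wc: "continuous_on UNIV W"
 proof -
  have "continuous_on S W" using C_k_on_imp_continuous[OF assms(4)] by (simp add: W_def cong: continuous_on_cong)
  moreover have "continuous_on (- C) W"
   by (rule continuous_on_cong[THEN iffD1, OF refl _ continuous_on_const[of _ 0]]) (use assms(5) in "auto simp: W_def")
  moreover have "S \<union> - C = UNIV" using assms(3) by auto
  ultimately show ?thesis
   using continuous_on_open_Un[OF assms(1), of "- C" W] compact_imp_closed[OF assms(2)] by (simp add: open_Compl)
 qed
 obtain M' where M': "!!z. abs (W z) <= M'"
 proof -
  have "compact (W ` C)" using Wc assms by (intro compact_continuous_image) (auto intro: continuous_on_subset)
  then obtain a where a: "!!z. z : C ==> abs (W z) <= a" "0 < a"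
   unfolding compact_eq_bounded_closed bounded_pos real_norm_def by blast
  have "abs (W z) <= a" for z using a(1)[of z] a(2) assms(5)[of z] by (cases "z : C") (auto simp: W_def)
  thus thesis by (rule that)
 qed
 let ?c = "2 * ?n * (?n + 2)"
 have "integral\<^sup>L lborel (h k) = ?c * (\<integral>z. W z * (eps k)^2 * (sqdist x z + eps k) powr (- ?n/2 - 2) \<partial>lborel)" for k
 proof -
  have ge: "0 < sqdist x z + eps k" for z using e[of k] by (simp add: add_nonneg_pos)
  have "integral\<^sup>L lborel (h k) = (LINT z:S|lborel. KK ?n 0 (sqdist x z + eps k) * ?Lw z)"
   by (simp add: set_lebesgue_integral_def h_def[abs_def])
  also have "... = (LINT z:S|lborel. lap (lap (%z. KK ?n 0 (sqdist x z + eps k))) z * w z)"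
   by (rule Green_fourth[OF assms(1-3) Ck assms(4)]) (use opSC assms(5) in blast)
  also have "... = (LINT z:S|lborel. ?c * (w z * (eps k)^2 * (sqdist x z + eps k) powr (- ?n/2 - 2)))"
   using assms(1) bilaplacian_fundamental(1)[OF assms(1), of "eps k" x] ge e[of k]
   by (intro set_lebesgue_integral_cong) (auto simp: less_imp_le)
  also have "... = (\<integral>z. ?c * (W z * (eps k)^2 * (sqdist x z + eps k) powr (- ?n/2 - 2)) \<partial>lborel)"
   unfolding set_lebesgue_integral_def by (intro Bochner_Integration.integral_cong) (auto simp: W_def indicator_def)
  finally show ?thesis by simp
 qed
 hence "(%k. integral\<^sup>L lborel (h k)) ----> ?c * (W x * (\<integral>y. fsol_profile (y::'a) \<partial>lborel))"
  using approximate_identity[OF Wc M', of x] by (simp only: eps_def[symmetric]) (intro tendsto_intros)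
 hence "integral\<^sup>L lborel h0 = ?c * (W x * (\<integral>y. fsol_profile (y::'a) \<partial>lborel))"
  using L1 LIMSEQ_unique by blast
 thus "(LINT z:S|lborel. KK DIM('a) 0 (sqdist x z) * lap (lap w) z) = fsol_const TYPE('a) * w x"
  using assms(6) by (simp add: set_lebesgue_integral_def h0_def[abs_def] fsol_const_def W_def)
qed

section \<open>Step functions and bumps of class C^4\<close>

lemma DERIV_glue:
 fixes g1 g2 :: "real => real"
 assumes "!!s. (g1 has_real_derivative g1' s) (at s)" "!!s. (g2 has_real_derivative g2' s) (at s)"
  and "g1 a = g2 a" "g1' a = g2' a"
 shows "((%s. if s <= a then g1 s else g2 s) has_real_derivative (if s <= a then g1' s else g2' s)) (at s)"
proof -
 have "((%s. if s : {..a} then g1 s else g2 s) has_vector_derivative (if s : {..a} then g1' s else g2' s)) (at s within UNIV)"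
  by (rule has_vector_derivative_If_within_closures[where T = "{a<..}"])
   (use assms in "auto simp: has_real_derivative_iff_has_vector_derivative[symmetric] closure_greaterThan intro: has_field_derivative_at_within")
 thus ?thesis by (simp add: has_real_derivative_iff_has_vector_derivative)
qed

text \<open>\<open>smooth_poly 0\<close> is the polynomial with derivative
  \<open>630 * x^4 * (1 - x)^4\<close> that is 0 at 0; 630 is the reciprocal of the beta integral,
  so it is 1 at 1. Its derivatives of order 1 to 4 vanish at both ends, and the glued step is of
  class \<open>C^4\<close>, as the bilaplacian demands.\<close>

definition smooth_poly :: "nat => real => real" where
 "smooth_poly j x = (if j = 0 then 126*x^5 - 420*x^6 + 540*x^7 - 315*x^8 + 70*x^9
  else if j = 1 then 630*x^4 - 2520*x^5 + 3780*x^6 - 2520*x^7 + 630*x^8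
  else if j = 2 then 2520*x^3 - 12600*x^4 + 22680*x^5 - 17640*x^6 + 5040*x^7
  else if j = 3 then 7560*x^2 - 50400*x^3 + 113400*x^4 - 105840*x^5 + 35280*x^6
  else 15120*x - 151200*x^2 + 453600*x^3 - 529200*x^4 + 211680*x^5)"

text \<open>\<open>smooth_step 0\<close> rises from \<open>0\<close> at \<open>1\<close> to \<open>1\<close> at \<open>2\<close>; \<open>smooth_step j\<close> is its \<open>j\<close>-th derivative
 for \<open>j \<le> 4\<close>.\<close>

definition smooth_step :: "nat => real => real" where
 "smooth_step j s = (if s <= 1 then 0 else if s <= 2 then smooth_poly j (s - 1) else if j = 0 then 1 else 0)"

lemma smooth_poly_deriv:
 assumes "j < 4" shows "(smooth_poly j has_real_derivative smooth_poly (Suc j) x) (at x)"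
proof -
 consider "j = 0" | "j = 1" | "j = 2" | "j = 3" using assms by linarith
 thus ?thesis
  unfolding smooth_poly_def[abs_def]
  by cases (auto intro!: derivative_eq_intros simp: algebra_simps)
qed

lemma smooth_poly_0: "smooth_poly j 0 = 0" and smooth_poly_1: "smooth_poly j 1 = (if j = 0 then 1 else 0)"
 by (simp_all add: smooth_poly_def)

lemma smooth_step_deriv:
 assumes "j < 4" shows "(smooth_step j has_real_derivative smooth_step (Suc j) s) (at s)"
proof -
 have 1: "((%s. smooth_poly j (s - 1)) has_real_derivative smooth_poly (Suc j) (s - 1)) (at s)" for s
  using DERIV_shift[of "smooth_poly j" "smooth_poly (Suc j) (s - 1)" s "-1"] smooth_poly_deriv[OF assms, of "s - 1"] by simp
 have 2: "((%s. if s <= 2 then smooth_poly j (s - 1) else if j = 0 then 1 else 0) has_real_derivative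
   (if s <= 2 then smooth_poly (Suc j) (s - 1) else 0)) (at s)" for s
  by (rule DERIV_glue[OF 1]) (simp_all add: smooth_poly_1)
 have "((%s. if s <= 1 then 0 else if s <= 2 then smooth_poly j (s - 1) else if j = 0 then 1 else 0) has_real_derivative
   (if s <= 1 then 0 else if s <= 2 then smooth_poly (Suc j) (s - 1) else 0)) (at s)"
  by (rule DERIV_glue[OF _ 2]) (simp_all add: smooth_poly_0)
 moreover have "(if s <= 1 then 0 else if s <= 2 then smooth_poly (Suc j) (s - 1) else 0) = smooth_step (Suc j) s"
  by (simp add: smooth_step_def)
 ultimately show ?thesis unfolding smooth_step_def[of j, abs_def] by (simp only:)
qed

lemma smooth_step_continuous: "j <= 4 ==> continuous_on S (smooth_step j)"
proof -
 assume "j <= 4"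
 then consider "j < 4" | "j = 4" by linarith
 thus ?thesis
 proof cases
  case 1
  thus ?thesis by (intro continuous_at_imp_continuous_on) (auto intro: DERIV_isCont[OF smooth_step_deriv])
 next
  case 2
  have p: "continuous_on UNIV (%s. smooth_poly 4 (s - 1))" unfolding smooth_poly_def by (auto intro!: continuous_intros)
  have a: "continuous_on UNIV (%s. if s <= 2 then smooth_poly 4 (s - 1) else 0)"
   by (rule continuous_on_cases_le) (auto simp: smooth_poly_1 intro: continuous_on_subset[OF p])
  have "continuous_on UNIV (%s. if s <= 1 then 0 else if s <= 2 then smooth_poly 4 (s - 1) else 0)"
   by (rule continuous_on_cases_le) (auto simp: smooth_poly_0 intro: continuous_on_subset[OF a])
  thus ?thesis using 2 by (auto simp: smooth_step_def[abs_def] intro: continuous_on_subset)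
 qed
qed

lemma smooth_step_0: "s <= 1 ==> smooth_step j s = 0" and smooth_step_1: "2 <= s ==> smooth_step 0 s = 1"
 by (auto simp: smooth_step_def) (metis antisym_conv2 diff_numeral_special(9) not_le one_add_one smooth_poly_1 add_diff_cancel_right')

lemma smooth_step_bound: "EX C>=1. ALL j<=4. ALL s. abs (smooth_step j s) <= C"
proof -
 have "EX C. ALL s. abs (smooth_step j s) <= C" if "j <= 4" for j
 proof -
  have "compact (smooth_step j ` {1..2})" by (intro compact_continuous_image smooth_step_continuous that) simp
  then obtain a where a: "!!s. s : {1..2} ==> abs (smooth_step j s) <= a"
   unfolding compact_eq_bounded_closed bounded_real by blast
  have "abs (smooth_step j s) <= max a 1" for s
   using a[of s] by (cases "s < 1"; cases "s > 2") (auto simp: smooth_step_def)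
  thus ?thesis by blast
 qed
 then obtain C where C: "!!j s. j <= 4 ==> abs (smooth_step j s) <= C j" by metis
 let ?C = "1 + (SUM j<=4. abs (C j))"
 have "abs (smooth_step j s) <= ?C" if "j <= 4" for j s
  using C[OF that, of s] member_le_sum[of j "{..4}" "%j. abs (C j)"] that by force
 moreover have "1 <= ?C" by (simp add: sum_nonneg)
 ultimately show ?thesis by blast
qed

lemma C_k_on_smooth_step:
 assumes "open S" "C_k_on 4 S f" shows "C_k_on 4 S (%x. smooth_step 0 (f x))"
 using C_k_on_comp[OF assms, of smooth_step] smooth_step_deriv smooth_step_continuous by auto

text \<open>A function of the squared distance, hence smooth at \<open>p\<close>. The factor 2 makes
  it vanish from distance \<open>r\<close> on; it is 1 up to \<open>r / sqrt 2\<close>, in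
  particular up to \<open>r / 2\<close>.\<close>

definition bump :: "'a::euclidean_space => real => 'a => real" where
 "bump p r z = 1 - smooth_step 0 (2 * sqdist p z / r^2)"

lemma C_k_on_bump: "open S ==> C_k_on 4 S (bump p r)"
proof -
 assume S: "open S"
 have "C_k_on 4 S (%z. (2 / r^2) * sqdist p z)" by (intro C_k_on_cmult C_k_on_sqdist S)
 from C_k_on_diff[OF S C_k_on_const C_k_on_smooth_step[OF S this], of 1]
 show ?thesis by (simp add: bump_def[abs_def])
qed

lemma sqdist_dist: "sqdist x z = (dist x z)^2"
 by (simp add: sqdist_norm dist_norm norm_minus_commute)

lemma bump_eq_1: "0 < r ==> dist p z <= r / 2 ==> bump p r z = 1"
proof -
 assume r: "0 < r" "dist p z <= r / 2"
 have "(dist p z)^2 <= (r/2)^2" using r by (intro power_mono) auto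
 hence "4 * (dist p z)^2 <= r^2" by (simp add: power_divide)
 hence "2 * (dist p z)^2 <= r^2" using zero_le_power2[of "dist p z"] by linarith
 hence "2 * sqdist p z / r^2 <= 1" using r(1) by (simp add: sqdist_dist)
 thus ?thesis by (simp add: bump_def smooth_step_0)
qed

lemma bump_eq_0: "0 < r ==> r <= dist p z ==> bump p r z = 0"
proof -
 assume r: "0 < r" "r <= dist p z"
 have "r^2 <= (dist p z)^2" using r by (intro power_mono) auto
 hence "2 <= 2 * sqdist p z / r^2" using r(1) by (simp add: sqdist_dist field_simps)
 thus ?thesis by (simp add: bump_def smooth_step_1)
qed

lemma C_k_holder_imp_C_k_on:
 assumes "0 < gamma" "C_k_holder_on k gamma S g" shows "C_k_on k S g"
 using assms(2)
proof (induction k arbitrary: g)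
 case 0
 then obtain C where C: "!!x y. x : S ==> y : S ==> abs (g x - g y) <= C * dist x y powr gamma" by auto
 have "continuous_on S g"
  unfolding continuous_on_def
 proof
  fix x assume x: "x : S"
  have "((%y. dist y x) ---> dist x x) (at x within S)" by (intro tendsto_intros)
  hence "((%y. dist y x powr gamma) ---> dist x x powr gamma) (at x within S)"
   using assms(1) by (intro tendsto_powr' tendsto_const) auto
  hence "((%y. dist y x powr gamma) ---> 0) (at x within S)" by simp
  hence "((%y. C * dist y x powr gamma) ---> 0) (at x within S)" by (auto intro: tendsto_mult_right_zero)
  moreover have "\<forall>\<^sub>F y in at x within S. norm (g y - g x) <= norm (C * dist y x powr gamma)"
   unfolding eventually_at_filter
   by (rule always_eventually) (auto intro: order_trans[OF C[OF _ x] abs_ge_self])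
  ultimately have "((%y. g y - g x) ---> 0) (at x within S)" by (rule Lim_transform_bound[rotated])
  thus "(g ---> g x) (at x within S)" by (rule LIM_zero_cancel)
 qed
 thus ?case by simp
qed auto

subsection \<open>A defining function of the domain\<close>

lemma C_k_on_grad_inner:
 "open S ==> C_k_on (Suc k) S f ==> C_k_on (Suc k) S g ==> C_k_on k S (grad_inner f g)"
 unfolding grad_inner_def[abs_def] by (intro C_k_on_sum C_k_on_mult) auto

lemma Lipschitz_from_partials:
 fixes f :: "'a::euclidean_space => real" and C :: real
 assumes "convex S" "!!x. x : S ==> f differentiable (at x)"
  and "!!x b. x : S ==> b : Basis ==> abs (pd b f x) <= C" "x : S" "y : S"
 shows "abs (f x - f y) <= real DIM('a) * C * norm (x - y)"
proof -
 have "norm (f x - f y) <= (real DIM('a) * C) * norm (x - y)"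
 proof (rule differentiable_bound[OF assms(1) _ _ assms(4,5)])
  fix z assume z: "z : S"
  show "(f has_derivative (%v. SUM b:Basis. (v \<bullet> b) * pd b f z)) (at z within S)"
   by (rule has_derivative_at_withinI[OF has_derivative_partial[OF assms(2)[OF z]]])
  show "onorm (%v. SUM b:Basis. (v \<bullet> b) * pd b f z) <= real DIM('a) * C"
  proof (rule onorm_le)
   fix v :: 'a
   have "norm (SUM b:Basis. (v \<bullet> b) * pd b f z) <= (SUM b:(Basis::'a set). norm v * C)"
   proof (rule sum_norm_le)
    fix b :: 'a assume b: "b : Basis"
    show "norm ((v \<bullet> b) * pd b f z) <= norm v * C"
     unfolding real_norm_def abs_mult using assms(3)[OF z b] Basis_le_norm[OF b, of v] by (intro mult_mono) auto
   qed
   thus "norm (SUM b:Basis. (v \<bullet> b) * pd b f z) <= real DIM('a) * C * norm v" by (simp add: mult_ac)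
  qed
 qed
 thus ?thesis by simp
qed

text \<open>A finite subcover; monotonicity of \<open>P\<close> in the constant lets the minimum
  over the cover serve everywhere.\<close>

lemma compact_uniform:
 fixes P :: "real => 'a::metric_space => bool"
 assumes "compact K" "!!q. q : K ==> EX e>0. EX m>0. ALL x:ball q e. P m x"
  and "!!m m' x. P m x ==> 0 < m' ==> m' <= m ==> P m' x"
 shows "EX m>0. ALL x:K. P m x"
proof -
 obtain e m where em: "!!q. q : K ==> 0 < e q & 0 < m q & (ALL x:ball q (e q). P (m q) x)"
  using assms(2) by metis
 have "K \<subseteq> (\<Union>q\<in>K. ball q (e q))" using em by force
 then obtain J where J: "J \<subseteq> K" "finite J" "K \<subseteq> (\<Union>q\<in>J. ball q (e q))"
  using compactE_image[OF assms(1), of K "%q. ball q (e q)"] by auto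
 define m0 where "m0 = Min (insert 1 (m ` J))"
 have m0: "0 < m0" "!!q. q : J ==> m0 <= m q" using J em by (auto simp: m0_def)
 have "P m0 x" if x: "x : K" for x
 proof -
  obtain q where "q : J" "x : ball q (e q)" using J(3) x by blast
  thus ?thesis using em[of q] J(1) m0 assms(3) by blast
 qed
 with m0 show ?thesis by blast
qed

lemma isCont_real_eps:
 fixes f :: "'a::metric_space => real"
 assumes "isCont f q" "0 < eps" obtains d where "0 < d" "!!x. dist x q < d ==> abs (f x - f q) < eps"
 using assms unfolding continuous_at_eps_delta dist_real_def by metis

lemma bdist_le_dist:
 assumes "x : Omega" "y \<notin> Omega" shows "bdist Omega x <= dist x y"
proof -
 have "closed_segment x y \<inter> frontier Omega ~= {}"
  by (rule connected_Int_frontier) (use assms in auto)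
 then obtain p where p: "p : closed_segment x y" "p : frontier Omega" by blast
 have "bdist Omega x <= dist x p" unfolding bdist_def by (rule infdist_le[OF p(2)])
 also have "... <= dist x y" using segment_bound(1)[OF p(1)] by (simp add: dist_norm norm_minus_commute)
 finally show ?thesis .
qed

definition boundary_chart :: "'a::euclidean_space set => 'a => real => ('a => real) => bool" where
 "boundary_chart Omega p r h \<longleftrightarrow> 0 < r & C_k_on 4 (ball p r) h &
  (ALL x:ball p r. x : Omega --> 0 < h x) & (ALL x:ball p r. x : frontier Omega --> h x = 0) &
  (ball p r \<subseteq> Omega | (EX e. norm e = 1 & (ALL x s. h (x + s *\<^sub>R e) = h x + s) & (ALL x:ball p r. x : Omega \<longleftrightarrow> 0 < h x)))"

lemma defining_function_local:
 fixes Omega :: "'a::euclidean_space set"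
 assumes "0 < gamma" "C_k_holder_domain 4 gamma Omega" "p : closure Omega"
 shows "EX r h. boundary_chart Omega p r h"
proof -
 have op: "open Omega" using assms(2) by (simp add: C_k_holder_domain_def)
 show ?thesis
 proof (cases "p : Omega")
  case True
  then obtain r where r: "0 < r" "ball p r \<subseteq> Omega" using op open_contains_ball by blast
  hence "x \<notin> frontier Omega" if "x : ball p r" for x using that op frontier_disjoint_eq by fastforce
  thus ?thesis using r unfolding boundary_chart_def
   by (intro exI[of _ r] conjI exI[of _ "%x. 1"] C_k_on_const) auto
 next
  case False
  hence "p : frontier Omega" using assms(3) op by (simp add: frontier_def interior_open)
  then obtain r e g where r: "0 < r" "norm e = 1" "!!x t. g (x + t *\<^sub>R e) = g x"
    "C_k_holder_on 4 gamma (ball p r) g" "!!x. x : ball p r ==> x : Omega \<longleftrightarrow> g x < x \<bullet> e"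
   using assms(2) unfolding C_k_holder_domain_def by metis
  define h where "h x = x \<bullet> e - g x" for x
  have hC: "C_k_on 4 (ball p r) h" unfolding h_def
   using C_k_holder_imp_C_k_on[OF assms(1) r(4)] by (intro C_k_on_diff C_k_on_inner) auto
  have pos: "x : Omega \<longleftrightarrow> 0 < h x" if "x : ball p r" for x using r(5)[OF that] by (simp add: h_def)
  \<comment> \<open>\<open>h\<close> is not positive outside the domain, and by continuity it is not
    negative at limits of points inside.\<close>
  have "h x = 0" if x: "x : ball p r" "x : frontier Omega" for x
  proof (rule antisym)
   have "x \<notin> Omega" using x(2) op by (simp add: frontier_def interior_open)
   thus "h x <= 0" using pos[OF x(1)] by simp
   have "continuous (at x) h"
    using C_k_on_imp_continuous[OF hC] x(1) by (simp add: continuous_on_eq_continuous_at)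
   hence "(h ---> h x) (at x)" by (simp add: isCont_def)
   hence "(h ---> h x) (at x within Omega)" by (rule tendsto_mono[rotated]) (simp add: at_le)
   moreover have "\<forall>\<^sub>F y in at x within Omega. 0 <= h y"
    unfolding eventually_at_topological using x(1) pos by (intro exI[of _ "ball p r"]) (auto intro: less_imp_le)
   moreover have "at x within Omega ~= bot"
    using x \<open>x \<notin> Omega\<close> by (auto simp: trivial_limit_within frontier_def closure_def)
   ultimately show "0 <= h x" by (intro tendsto_lowerbound)
  qed
  moreover have "h (x + s *\<^sub>R e) = h x + s" for x s
   using r(2) by (simp add: h_def r(3) inner_add_left) (metis power2_norm_eq_inner power_one mult.right_neutral)
  ultimately show ?thesis using r(1,2) hC pos unfolding boundary_chart_def
   by (intro exI[of _ r] conjI exI[of _ h] disjI2 exI[of _ e]) auto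
 qed
qed

text \<open>The chart functions are glued by bumps that are not normalised to a partition of unity.
  All summands are nonnegative in the domain, so the sum dominates each chart function where its
  bump is 1; the lower bound and the slope are inherited in this way.\<close>

lemma defining_function:
 fixes Omega :: "'a::euclidean_space set"
 assumes "0 < gamma" "C_k_holder_domain 4 gamma Omega" "bounded Omega"
 shows "EX ph c C m. C_k_on 4 UNIV ph & 0 < c & 0 < C & 0 < m &
   (ALL x:Omega. 0 < ph x & c * bdist Omega x <= ph x & ph x <= C * bdist Omega x) & (ALL x:frontier Omega. ph x = 0) &
   (ALL x:Omega. ph x < m --> m <= grad_inner ph ph x)"
proof -
 have op: "open Omega" and ne: "Omega ~= {}" using assms(2) by (simp_all add: C_k_holder_domain_def)
 have comp: "compact (closure Omega)" using assms(3) by (simp add: compact_closure)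
 have fr: "frontier Omega ~= {}" using ne assms(3) by (metis frontier_eq_empty not_bounded_UNIV)
 have cl: "closure Omega = Omega \<union> frontier Omega" by (simp add: closure_Un_frontier)
 have "ALL p:closure Omega. EX r h. boundary_chart Omega p r h"
  using defining_function_local[OF assms(1,2)] by (rule ballI)
 then obtain r h where "!!p. p : closure Omega ==> boundary_chart Omega p (r p) (h p)" by metis
 note rh = this[unfolded boundary_chart_def]
 have rp0: "0 < r p" if "p : closure Omega" for p using rh[OF that] by (rule conjunct1)
 have "closure Omega \<subseteq> (\<Union>p\<in>closure Omega. ball p (r p / 4))" using rp0 by force
 then obtain J where J: "J \<subseteq> closure Omega" "finite J" "closure Omega \<subseteq> (\<Union>p\<in>J. ball p (r p / 4))"
  using compactE_image[OF comp, of "closure Omega" "%p. ball p (r p / 4)"] by auto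
 have rp: "0 < r p" if "p : J" for p using rp0 J(1) that by blast
 \<comment> \<open>Squaring the bump makes the summand nonnegative without a closer look at
   \<open>smooth_step\<close>. The bump has radius \<open>r p / 2\<close>: it is 1 on the ball of
   radius \<open>r p / 4\<close>, and the extension by zero is smooth.\<close>
 define F where "F p z = (if z : ball p (r p) then (bump p (r p / 2) z)^2 * h p z else 0)" for p z
 have FC: "C_k_on 4 UNIV (F p)" if p: "p : J" for p
 proof -
  have "C_k_on 4 (ball p (r p)) (%z. (bump p (r p / 2) z)^2 * h p z)"
   using rh[of p] J(1) p by (intro C_k_on_mult C_k_on_power C_k_on_bump) auto
  hence 1: "C_k_on 4 (ball p (r p)) (F p)" by (rule C_k_on_cong[rotated]) (simp_all add: F_def)
  have "C_k_on 4 (- cball p (r p / 2)) (%z. 0)" by (rule C_k_on_const)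
  hence 2: "C_k_on 4 (- cball p (r p / 2)) (F p)"
   by (rule C_k_on_cong[rotated]) (use bump_eq_0[of "r p / 2" p] rp[OF p] in "auto simp: F_def")
  have "ball p (r p) \<union> - cball p (r p / 2) = UNIV" using rp[OF p] by auto
  thus ?thesis using C_k_on_Un[OF _ _ 1 2] by auto
 qed
 define ph where "ph z = (SUM p:J. F p z)" for z
 have phC: "C_k_on 4 UNIV ph" unfolding ph_def using J(2) FC by (intro C_k_on_sum) auto
 have Fnn: "0 <= F p z" if "p : J" "z : Omega" for p z
  using rh[of p] J(1) that by (auto simp: F_def less_imp_le)
 have Fh: "F p z = h p z" if "p : J" "z : ball p (r p / 4)" for p z
  using bump_eq_1[of "r p / 2" p z] rp[OF that(1)] that by (auto simp: F_def)
 have Fle: "h p z <= ph z" if "p : J" "z : ball p (r p / 4)" "z : Omega" for p z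
  unfolding ph_def Fh[OF that(1,2), symmetric] using J(2) that Fnn by (intro member_le_sum) auto
 have phpos: "0 < ph z" if z: "z : Omega" for z
 proof -
  obtain p where p: "p : J" "z : ball p (r p / 4)" using J(3) z cl by blast
  have "z : ball p (r p)" using p rp[OF p(1)] by auto
  hence "0 < h p z" using rh[of p] J(1) p z by blast
  thus ?thesis using Fle[OF p z] by linarith
 qed
 have ph0: "ph z = 0" if "z : frontier Omega" for z
  unfolding ph_def using rh J(1) that by (intro sum.neutral) (auto simp: F_def)
 have phd: "ph differentiable (at x)" for x using phC by (auto simp: eval_nat_numeral)
 have phc: "isCont ph x" for x using C_k_on_imp_continuous[OF phC] by (simp add: continuous_on_eq_continuous_at)
 text \<open>A frontier point lies in a chart of boundary type.\<close>
 have chart: "EX p e. p : J & q : ball p (r p / 4) & norm e = 1 & (ALL x s. h p (x + s *\<^sub>R e) = h p x + s)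
   & (ALL x:ball p (r p). x : Omega \<longleftrightarrow> 0 < h p x) & h p q = 0 & continuous_on (ball p (r p)) (h p)"
  if q: "q : frontier Omega" for q
 proof -
  obtain p where p: "p : J" "q : ball p (r p / 4)" using J(3) q cl by blast
  have qb: "q : ball p (r p)" using p rp[OF p(1)] by auto
  have "q \<notin> Omega" using q op by (simp add: frontier_def interior_open)
  thus ?thesis using rh[of p] J(1) p qb q C_k_on_imp_continuous by blast
 qed
 obtain B where B: "0 < B" "closure Omega \<subseteq> cball 0 B"
  using compact_imp_bounded[OF comp] by (metis bounded_pos mem_cball_0 subsetI)
 obtain C1 where C1: "0 < C1" "symb 4 (cball 0 B) (%_. 1) (%_. C1) ph"
  using C_k_on_bounded_compact[OF compact_cball C_k_on_subset[OF phC]] by blast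
 have up: "ph x <= (real DIM('a) * C1) * bdist Omega x" if x: "x : Omega" for x
 proof -
  obtain p where p: "p : frontier Omega" "bdist Omega x = dist x p"
   using infdist_attains_inf[of "frontier Omega" x] fr unfolding bdist_def by auto
  have "abs (ph x - ph p) <= real DIM('a) * C1 * norm (x - p)"
  proof (rule Lipschitz_from_partials[of "cball 0 B"])
   show "abs (pd b ph z) <= C1" if "z : cball 0 B" "b : Basis" for z b
    using C1(2) that by (auto simp: eval_nat_numeral)
  qed (use phd B x p cl in auto)
  thus ?thesis using p ph0[OF p(1)] by (simp add: dist_norm)
 qed
 have "EX c>0. ALL x:closure Omega. x : Omega --> c * bdist Omega x <= ph x"
 proof (rule compact_uniform[OF comp])
  fix q assume q: "q : closure Omega"
  show "EX e>0. EX m>0. ALL x:ball q e. x : Omega --> m * bdist Omega x <= ph x"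
  proof (cases "q : Omega")
   case True
   obtain e where e: "0 < e" "!!x. dist x q < e ==> abs (ph x - ph q) < ph q / 2"
    using isCont_real_eps[OF phc[of q], of "ph q / 2"] phpos[OF True] by auto
   define D where "D = bdist Omega q + e"
   have D: "0 < D" using e by (simp add: D_def bdist_def infdist_nonneg add_nonneg_pos)
   show ?thesis
   proof (rule exI[of _ e], rule conjI[OF e(1)], rule exI[of _ "ph q / 2 / D"], intro conjI ballI impI)
    show "0 < ph q / 2 / D" using phpos[OF True] D by simp
    fix x assume x: "x : ball q e" "x : Omega"
    have "bdist Omega x <= bdist Omega q + dist x q" unfolding bdist_def by (rule infdist_triangle)
    hence "bdist Omega x <= D" using x by (simp add: D_def dist_commute)
    hence "ph q / 2 / D * bdist Omega x <= ph q / 2 / D * D"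
     using phpos[OF True] D by (intro mult_left_mono) auto
    also have "... <= ph x" using e(2)[of x] x D by (simp add: dist_commute abs_if split: if_splits)
    finally show "ph q / 2 / D * bdist Omega x <= ph x" .
   qed
  next
   case False
   hence "q : frontier Omega" using q cl by blast
   from chart[OF this] obtain p e where p: "p : J" "q : ball p (r p / 4)" "norm e = 1"
    "!!x s. h p (x + s *\<^sub>R e) = h p x + s" "!!x. x : ball p (r p) ==> x : Omega \<longleftrightarrow> 0 < h p x" "h p q = 0"
    "continuous_on (ball p (r p)) (h p)" by blast
   obtain t where t: "0 < t" "ball q t \<subseteq> ball p (r p / 4)" using p(2) open_ball open_contains_ball by blast
   have sub: "ball p (r p / 4) \<subseteq> ball p (r p)" using rp[OF p(1)] by auto
   have "isCont (h p) q" using p(2,7) sub by (auto simp: continuous_on_eq_continuous_at)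
   then obtain d where d: "0 < d" "!!x. dist x q < d ==> abs (h p x - h p q) < t / 2"
    using isCont_real_eps[of q "h p" "t / 2"] t(1) by auto
   show ?thesis
   proof (rule exI[of _ "min d (t/2)"], rule conjI, use d t in simp, rule exI[of _ 1], intro conjI ballI impI)
    show "(0::real) < 1" by simp
    fix x assume x: "x : ball q (min d (t / 2))" "x : Omega"
    have "x : ball q t" using x(1) t(1) by auto
    hence xb: "x : ball p (r p / 4)" using t(2) by blast
    hence hx: "0 < h p x" using p(5) sub x(2) by blast
    have hx2: "h p x < t/2" using d(2)[of x] x(1) p(6) by (auto simp: dist_commute)
    \<comment> \<open>Going down along \<open>e\<close> by \<open>h p x\<close> ends at a zero of
      \<open>h p\<close>, hence outside the domain; the length of the way bounds the distance to the
      boundary.\<close>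
    define y where "y = x + (- h p x) *\<^sub>R e"
    have dxy: "dist x y = h p x" using p(3) hx by (simp add: y_def dist_norm)
    have "dist q y < t" using dist_triangle[of q y x] dxy hx2 x(1) by (auto simp: dist_commute)
    hence "y : ball q t" by simp
    hence "y : ball p (r p)" using t(2) sub by blast
    moreover have "h p y = 0" by (simp only: y_def p(4))
    ultimately have "y \<notin> Omega" using p(5) by auto
    from bdist_le_dist[OF x(2) this] have "bdist Omega x <= h p x" using dxy by simp
    also have "... <= ph x" by (rule Fle[OF p(1) xb x(2)])
    finally show "1 * bdist Omega x <= ph x" by simp
   qed
  qed
 next
  fix m m' :: real and x
  assume a: "x : Omega --> m * bdist Omega x <= ph x" "0 < m'" "m' <= m"
  have "m' * bdist Omega x <= m * bdist Omega x" using a by (intro mult_right_mono) (auto simp: bdist_def infdist_nonneg)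
  thus "x : Omega --> m' * bdist Omega x <= ph x" using a by linarith
 qed
 then obtain c where c: "0 < c" "!!x. x : Omega ==> c * bdist Omega x <= ph x" using cl by blast
 have gc: "isCont (grad_inner ph ph) x" for x
 proof -
  have "C_k_on (Suc 0) UNIV ph" using phC by (rule C_k_on_le) simp
  hence "C_k_on 0 UNIV (grad_inner ph ph)" by (intro C_k_on_grad_inner) auto
  hence "continuous_on UNIV (grad_inner ph ph)" by simp
  thus ?thesis by (simp add: continuous_on_eq_continuous_at)
 qed
 have gpos: "0 < grad_inner ph ph q" if q: "q : frontier Omega" for q
 proof -
  from chart[OF q] obtain p e where p: "p : J" "q : ball p (r p / 4)" "norm e = 1"
    "!!x s. h p (x + s *\<^sub>R e) = h p x + s" "!!x. x : ball p (r p) ==> x : Omega \<longleftrightarrow> 0 < h p x" "h p q = 0"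
    "continuous_on (ball p (r p)) (h p)" by blast
  obtain t where t: "0 < t" "ball q t \<subseteq> ball p (r p / 4)" using p(2) open_ball open_contains_ball by blast
  have sub: "ball p (r p / 4) \<subseteq> ball p (r p)" using rp[OF p(1)] by auto
  \<comment> \<open>The derivative of \<open>ph\<close> at \<open>q\<close> along \<open>e\<close>.
    It is at least 1, because \<open>ph\<close> dominates \<open>h p\<close>, which grows from 0
    with unit speed; so the gradient is not zero.\<close>
  define D where "D = (SUM b:Basis. (e \<bullet> b) * pd b ph q)"
  have 1: "((%s. q + s *\<^sub>R e) has_derivative (%s. s *\<^sub>R e)) (at 0)" by (auto intro!: derivative_eq_intros)
  have "(ph has_derivative (%v. SUM b:Basis. (v \<bullet> b) * pd b ph q)) (at (q + 0 *\<^sub>R e))"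
   using has_derivative_partial[OF phd] by simp
  from has_derivative_compose[OF 1 this]
  have "((%s. ph (q + s *\<^sub>R e)) has_derivative (%s. D * s)) (at 0)"
   by (simp add: D_def sum_distrib_left mult_ac)
  hence "((%s. ph (q + s *\<^sub>R e)) has_real_derivative D) (at 0)" by (simp add: has_field_derivative_def)
  hence "((%s. (ph (q + s *\<^sub>R e) - ph (q + 0 *\<^sub>R e)) / (s - 0)) ---> D) (at 0)"
   by (simp add: has_field_derivative_iff)
  hence lim: "((%s. ph (q + s *\<^sub>R e) / s) ---> D) (at_right 0)"
   using ph0[OF q] by (simp add: filterlim_at_split)
  have "\<forall>\<^sub>F s in at_right 0. 1 <= ph (q + s *\<^sub>R e) / s"
  proof (rule eventually_at_rightI[of 0 t])
   fix s assume s: "s : {0<..<t}"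
   have "q + s *\<^sub>R e : ball q t" using s p(3) by (simp add: dist_norm)
   hence b: "q + s *\<^sub>R e : ball p (r p / 4)" using t(2) by blast
   have "h p (q + s *\<^sub>R e) = s" using p(4,6) by simp
   moreover from this have "q + s *\<^sub>R e : Omega" using p(5)[of "q + s *\<^sub>R e"] b sub s by auto
   ultimately show "1 <= ph (q + s *\<^sub>R e) / s" using Fle[OF p(1) b] s by (simp add: field_simps)
  qed (use t in auto)
  hence "1 <= D" by (intro tendsto_lowerbound[OF lim]) auto
  have "EX b:Basis. pd b ph q ~= 0"
  proof (rule ccontr)
   assume "\<not> ?thesis"
   hence "D = 0" by (simp add: D_def)
   thus False using \<open>1 <= D\<close> by simp
  qed
  then obtain b where b: "b : Basis" "pd b ph q ~= 0" by blast
  have "0 < pd b ph q * pd b ph q" using b(2) by (simp add: zero_less_mult_iff) linarith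
  also have "... <= grad_inner ph ph q" unfolding grad_inner_def using b(1)
   by (intro member_le_sum[of b Basis "%b. pd b ph q * pd b ph q"]) auto
  finally show ?thesis .
 qed
 have "EX m>0. ALL x:closure Omega. m <= ph x | m <= grad_inner ph ph x"
 proof (rule compact_uniform[OF comp])
  fix q assume q: "q : closure Omega"
  have aux: "EX e>0. EX m>0. ALL x:ball q e. m <= f x" if fq: "isCont f q" "0 < f q" for f :: "'a => real"
  proof -
   obtain e where e: "0 < e" "!!x. dist x q < e ==> abs (f x - f q) < f q / 2"
    using isCont_real_eps[OF fq(1), of "f q / 2"] fq(2) by auto
   have "f q / 2 <= f x" if "x : ball q e" for x
    using e(2)[of x] that by (simp add: dist_commute abs_if split: if_splits)
   thus ?thesis using e(1) fq(2) half_gt_zero by blast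
  qed
  show "EX e>0. EX m>0. ALL x:ball q e. m <= ph x | m <= grad_inner ph ph x"
  proof (cases "q : Omega")
   case True
   thus ?thesis using aux[OF phc phpos] by blast
  next
   case False
   hence "q : frontier Omega" using q cl by blast
   thus ?thesis using aux[OF gc gpos] by blast
  qed
 qed auto
 then obtain m where m: "0 < m" "!!x. x : Omega ==> m <= ph x | m <= grad_inner ph ph x" using cl by blast
 have C: "0 < real DIM('a) * C1" using C1 by simp
 have grad: "m <= grad_inner ph ph x" if "x : Omega" "ph x < m" for x using m(2)[OF that(1)] that(2) by auto
 show ?thesis
  by (rule exI[of _ ph], rule exI[of _ c], rule exI[of _ "real DIM('a) * C1"], rule exI[of _ m])
   (use phC c C m phpos up ph0 grad in auto)
qed

subsection \<open>The parametrix\<close>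

text \<open>Bounded derivatives at unit scale are more than is asked where \<open>w <= 1\<close>;
  where \<open>w\<close> is larger, each derivative costs at most a factor \<open>D\<close>.\<close>

lemma symb_rescale:
 assumes "symb k S (%_. 1) (%_. C) f" "!!z. z : S ==> 0 < w z & w z <= D" "1 <= D" "0 <= C"
 shows "symb k S w (%_. C * D ^ k) f"
 using assms(1)
proof (induction k arbitrary: f)
 case (Suc k)
 have "symb k S w (%z. C * D ^ Suc k / w z) (pd b f)" if "b : Basis" for b
 proof (rule symb_mono)
  show "symb k S w (%_. C * D ^ k) (pd b f)" using Suc that by simp
  fix z assume z: "z : S"
  show "0 < w z" using assms(2)[OF z] ..
  have "C * D ^ k * w z <= C * D ^ k * D" using assms z by (intro mult_left_mono) auto
  thus "C * D ^ k <= C * D ^ Suc k / w z" using assms(2)[OF z] by (simp add: pos_le_divide_eq mult_ac)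
 qed
 moreover have "C <= C * D ^ Suc k" using mult_left_mono[OF one_le_power[OF assms(3)] assms(4), of "Suc k"] by simp
 ultimately show ?case using Suc.prems by (auto intro: order_trans)
qed simp

text \<open>The dimension enters as the real number \<open>n\<close> because it occurs in exponents
  of \<open>powr\<close>. The gradient of \<open>ph\<close> is bounded below only where
  \<open>ph < m0\<close>; further in, \<open>R\<close> is bounded below and cruder estimates
  do.\<close>

locale smooth_bounded_domain =
 fixes Om :: "'a::euclidean_space set" and ph :: "'a => real" and c0 C0 m0 n :: real
 assumes n_eq: "n = real DIM('a)" and open_dom: "open Om" and bounded_dom: "bounded Om" and nonempty_dom: "Om ~= {}"
  and phi_C4: "C_k_on 4 UNIV ph" and consts_pos: "0 < c0" "0 < C0" "0 < m0"
  and phi_pos: "!!x. x : Om ==> 0 < ph x"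
  and phi_lower: "!!x. x : Om ==> c0 * bdist Om x <= ph x"
  and phi_upper: "!!x. x : Om ==> ph x <= C0 * bdist Om x"
  and phi_frontier: "!!x. x : frontier Om ==> ph x = 0"
  and phi_grad: "!!x. x : Om ==> ph x < m0 ==> m0 <= grad_inner ph ph x"
begin

abbreviation "sols \<equiv> solves_biharmonic_dirichlet Om"
abbreviation "integ f \<equiv> set_integrable lborel Om f"
abbreviation LOm (binder "LO " 10) where "LOm f \<equiv> set_lebesgue_integral lborel Om f"
abbreviation NOm (binder "NO " 10) where "NOm f \<equiv> \<integral>\<^sup>+z\<in>Om. f z \<partial>lborel"
abbreviation NIm (binder "NI " 10) where "NIm f \<equiv> nn_integral lborel f"
abbreviation "bd f F \<equiv> ALL z:Om. abs (f z :: real) <= F"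

abbreviation d :: "'a => real" where "d \<equiv> bdist Om"

text \<open>Comparable to the distance from \<open>x\<close> to the mirror image of
  \<open>z\<close>, up to curvature. It is bounded below by \<open>d x\<close>, so it is positive on
  the diagonal too.\<close>

definition R :: "'a => 'a => real" where "R x z = dist x z + d x + d z"

lemma n_ge_1: "1 <= n" using DIM_positive[where 'a='a] by (simp add: Suc_le_eq n_eq)

lemma d_nonneg [simp]: "0 <= d x" by (simp add: bdist_def infdist_nonneg)

lemma d_pos: "x : Om ==> 0 < d x"
 using phi_pos[of x] phi_upper[of x] d_nonneg[of x] by (cases "d x = 0") (auto simp: less_le)

lemma frontier_ne: "frontier Om ~= {}"
 using nonempty_dom bounded_dom by (metis frontier_eq_empty not_bounded_UNIV)

lemma d_lipschitz: "d x <= d y + dist x y"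
 unfolding bdist_def by (rule infdist_triangle)

lemma R_pos: "x : Om ==> 0 < R x z"
 using d_pos[of x] d_nonneg[of z] by (simp add: R_def add_nonneg_pos add_pos_nonneg)

lemma R_neq_0 [simp]: "x : Om ==> R x z ~= 0"
 using R_pos[of x z] by simp

lemma R_ge: "dist x z <= R x z" "d x <= R x z" "d z <= R x z"
 by (simp_all add: R_def add_nonneg_nonneg)

lemma R_triangle: "R x y <= R x z + R z y"
 using dist_triangle[of x y z] d_nonneg[of z] unfolding R_def by linarith

text \<open>The second leg is measured by the distance alone, \<open>d y\<close> being moved to
  \<open>z\<close> by Lipschitz continuity. This is the form for kernels whose singularity is one of
  the distance and not of \<open>R\<close>.\<close>

lemma R_triangle': "R x y <= R x z + 2 * dist z y"
 using dist_triangle[of x y z] d_lipschitz[of y z] by (simp add: R_def dist_commute)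

lemma ex_big_radius: "EX B>=1. closure Om \<subseteq> cball 0 B"
proof -
 have "bounded (closure Om)" using bounded_dom by (rule bounded_closure)
 then obtain b where b: "0 < b" "!!x. x : closure Om ==> norm x <= b" unfolding bounded_pos by blast
 hence "closure Om \<subseteq> cball 0 (max b 1)" by (auto simp: le_max_iff_disj)
 thus ?thesis by (intro exI[of _ "max b 1"]) simp
qed

definition B :: real where "B = (SOME B. 1 <= B & closure Om \<subseteq> cball 0 B)"

lemma B: "1 <= B" "closure Om \<subseteq> cball 0 B"
 using someI_ex[OF ex_big_radius] unfolding B_def by auto

lemma dom_subset_cball: "Om \<subseteq> cball 0 B" using B(2) closure_subset by blast

text \<open>Bounds \<open>R\<close> in the domain: each of its three summands is at most
  \<open>2 * B\<close>.\<close>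

definition Dm :: real where "Dm = 6 * B"

lemma Dm_ge_1: "1 <= Dm" using B by (simp add: Dm_def)

lemma dist_le_2B: assumes "x : closure Om" "z : closure Om" shows "dist x z <= 2 * B"
proof -
 have "norm x <= B" "norm z <= B" using assms B(2) by auto
 thus ?thesis using norm_triangle_ineq4[of x z] by (simp add: dist_norm)
qed

lemma d_le_2B: assumes "x : closure Om" shows "d x <= 2 * B"
proof -
 obtain p where p: "p : frontier Om" using frontier_ne by blast
 hence "d x <= dist x p" unfolding bdist_def by (rule infdist_le)
 also have "... <= 2 * B" using assms p by (intro dist_le_2B) (auto simp: frontier_def)
 finally show ?thesis .
qed

lemma R_le_Dm: assumes "x : Om" "z : Om" shows "R x z <= Dm"
proof -
 have "x : closure Om" "z : closure Om" using assms closure_subset[of Om] by auto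
 thus ?thesis
  using dist_le_2B[of x z] d_le_2B[of x] d_le_2B[of z] unfolding R_def Dm_def by linarith
qed

text \<open>\<open>ord k s f\<close>: the family \<open>f x\<close> is a symbol of order \<open>s\<close> with respect to the scale \<open>R x\<close>, that
 is, derivatives of order \<open>j \<le> k\<close> are \<open>O(R\<^bsup>s-j\<^esup>)\<close>, uniformly in \<open>x\<close>.\<close>

definition ord :: "nat => real => ('a => 'a => real) => bool" where
 "ord k s f \<longleftrightarrow> (EX C>0. ALL x:Om. symb k Om (R x) (%z. C * R x z powr s) (f x))"

lemma ordD: "ord k s f ==> EX C>0. ALL x:Om. ALL z:Om. abs (f x z) <= C * R x z powr s"
 unfolding ord_def using symb_bound by fast

lemma ord_C_k_on: "ord k s f ==> x : Om ==> C_k_on k Om (f x)"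
 unfolding ord_def using symb_imp_C_k_on by blast

lemma ord_le: "ord k s f ==> j <= k ==> ord j s f"
 unfolding ord_def using symb_le by blast

lemma ord_cong: "ord k s f ==> (!!x z. x : Om ==> z : Om ==> f x z = g x z) ==> ord k s g"
 unfolding ord_def using symb_cong[OF open_dom] by metis

lemma ord_add: assumes "ord k s f" "ord k s g" shows "ord k s (%x z. f x z + g x z)"
proof -
 obtain C C' where C: "0 < C" "!!x. x : Om ==> symb k Om (R x) (%z. C * R x z powr s) (f x)"
   "0 < C'" "!!x. x : Om ==> symb k Om (R x) (%z. C' * R x z powr s) (g x)"
  using assms unfolding ord_def by blast
 have "symb k Om (R x) (%z. (C + C') * R x z powr s) (%z. f x z + g x z)" if x: "x : Om" for x
  using symb_add[OF open_dom C(2)[OF x] C(4)[OF x]] by (simp add: distrib_right)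
 thus ?thesis unfolding ord_def using C by (intro exI[of _ "C + C'"]) auto
qed

lemma ord_mult: assumes "ord k s f" "ord k s' g" shows "ord k (s + s') (%x z. f x z * g x z)"
proof -
 obtain C C' where C: "0 < C" "!!x. x : Om ==> symb k Om (R x) (%z. C * R x z powr s) (f x)"
   "0 < C'" "!!x. x : Om ==> symb k Om (R x) (%z. C' * R x z powr s') (g x)"
  using assms unfolding ord_def by blast
 have "symb k Om (R x) (%z. (2 ^ k * C * C') * R x z powr (s + s')) (%z. f x z * g x z)" if x: "x : Om" for x
  using symb_mult[OF open_dom R_pos[OF x] C(2)[OF x] C(4)[OF x]] by (simp add: powr_add mult_ac)
 moreover have "0 < 2 ^ k * C * C'" using C by simp
 ultimately show ?thesis unfolding ord_def by blast
qed

lemma ord_const_family: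
 assumes "!!x z. x : Om ==> z : Om ==> abs (a x) <= C * R x z powr s"
 shows "ord k s (%x z. a x)"
proof -
 have "symb k Om (R x) (%z. max C 1 * R x z powr s) (%z. a x)" if x: "x : Om" for x
 proof (rule symb_const[OF R_pos[OF x]])
  fix z assume "z : Om"
  have "C * R x z powr s <= max C 1 * R x z powr s" by (intro mult_right_mono) auto
  thus "abs (a x) <= max C 1 * R x z powr s" using assms[OF x \<open>z : Om\<close>] by linarith
 qed
 thus ?thesis unfolding ord_def by (intro exI[of _ "max C 1"]) auto
qed

lemma ord_const: "ord k 0 (%x z. a)"
 by (rule ord_const_family[where C = "abs a"]) simp

lemma ord_cmult: "ord k s f ==> ord k s (%x z. a * f x z)"
 using ord_mult[OF ord_const, of k s f a] by simp

lemma ord_sum: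
 assumes "finite I" "!!i. i : I ==> ord k s (f i)" shows "ord k s (%x z. SUM i:I. f i x z)"
 using assms
proof (induction I rule: finite_induct)
 case empty
 have "ord k s (%x z. 0)" by (rule ord_const_family[where C = 0]) simp
 thus ?case by simp
qed (simp add: ord_add)

lemma ord_of_bounded:
 assumes "!!x. x : Om ==> symb k Om (%_. 1) (%_. C) (f x)" shows "ord k 0 f"
proof -
 have "symb k Om (R x) (%z. (max C 1 * Dm ^ k) * R x z powr 0) (f x)" if x: "x : Om" for x
 proof (rule symb_mono)
  have "symb k Om (%_. 1) (%_. max C 1) (f x)" by (rule symb_mono[OF assms[OF x]]) auto
  thus "symb k Om (R x) (%_. max C 1 * Dm ^ k) (f x)"
   using R_pos[OF x] R_le_Dm[OF x] Dm_ge_1 by (intro symb_rescale) auto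
 qed (use x R_pos in simp_all)
 moreover have "0 < max C 1 * Dm ^ k" using Dm_ge_1 by auto
 ultimately show ?thesis unfolding ord_def by blast
qed

text \<open>The bound on \<open>f\<close> itself is a separate hypothesis: this is where vanishing
  on the diagonal or at the boundary enters, while the derivatives are left to the calculus.\<close>

lemma ord_Suc:
 assumes "!!x z. x : Om ==> z : Om ==> abs (f x z) <= C * R x z powr s"
  and "!!x z. x : Om ==> z : Om ==> f x differentiable (at z)"
  and "!!b. b : Basis ==> ord k (s - 1) (%x. pd b (f x))"
 shows "ord (Suc k) s f"
proof -
 have "ALL b:Basis. EX C>0. ALL x:Om. symb k Om (R x) (%z. C * R x z powr (s - 1)) (pd b (f x))"
  using assms(3) unfolding ord_def by blast
 then obtain K where K: "!!b. b : Basis ==> 0 < K b & (ALL x:Om. symb k Om (R x) (%z. K b * R x z powr (s - 1)) (pd b (f x)))"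
  by metis
 define C' where "C' = max C 1 + (SUM b:Basis. K b)"
 have s0: "0 <= (SUM b:Basis. K b)" by (rule sum_nonneg) (use K less_imp_le in blast)
 have C'0: "0 < C'" and CC: "C <= C'" using s0 by (simp_all add: C'_def)
 have KC: "K b <= C'" if "b : Basis" for b
  using member_le_sum[of b Basis K] K that by (auto simp: C'_def less_imp_le add_increasing)
 have "symb (Suc k) Om (R x) (%z. C' * R x z powr s) (f x)" if x: "x : Om" for x
 proof -
  have "symb k Om (R x) (%z. C' * R x z powr s / R x z) (pd b (f x))" if b: "b : Basis" for b
  proof (rule symb_mono)
   show "symb k Om (R x) (%z. K b * R x z powr (s - 1)) (pd b (f x))" using K b x by blast
   fix z assume "z : Om"
   show "K b * R x z powr (s - 1) <= C' * R x z powr s / R x z"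
    using KC[OF b] R_pos[OF x, of z] by (simp add: powr_diff mult_right_mono divide_right_mono)
  qed (use R_pos[OF x] in auto)
  moreover have "abs (f x z) <= C' * R x z powr s" if "z : Om" for z
   by (rule order_trans[OF assms(1)[OF x that] mult_right_mono[OF CC]]) simp
  ultimately show ?thesis using assms(2)[OF x] by simp
 qed
 thus ?thesis unfolding ord_def using C'0 by blast
qed

lemma ord_partial:
 assumes "ord (Suc k) s f" "b : Basis" shows "ord k (s - 1) (%x. pd b (f x))"
proof -
 obtain C where C: "0 < C" "!!x. x : Om ==> symb (Suc k) Om (R x) (%z. C * R x z powr s) (f x)"
  using assms(1) unfolding ord_def by blast
 have "symb k Om (R x) (%z. C * R x z powr (s - 1)) (pd b (f x))" if x: "x : Om" for x
 proof -
  have "symb k Om (R x) (%z. C * R x z powr s / R x z) (pd b (f x))"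
   using C(2)[OF x] assms(2) by simp
  moreover have "C * R x z powr s / R x z = C * R x z powr (s - 1)" for z
   using R_pos[OF x, of z] by (simp add: powr_diff abs_of_pos)
  ultimately show ?thesis by (simp only:)
 qed
 thus ?thesis unfolding ord_def using C(1) by blast
qed

lemma ord_laplacian:
 assumes "ord (Suc (Suc k)) s f" shows "ord k (s - 2) (%x. lap (f x))"
proof -
 have "ord k (s - 1 - 1) (%x. pd b (pd b (f x)))" if "b : Basis" for b
  by (intro ord_partial assms that)
 hence "ord k (s - 2) (%x z. SUM b:Basis. pd b (pd b (f x)) z)"
  by (intro ord_sum) auto
 thus ?thesis by (simp add: laplacian_def[abs_def])
qed

text \<open>The outer function is singular at 0 like \<open>s powr sg\<close>. Each of its
  derivatives costs a factor \<open>1 / f\<close>, which the lower bound of \<open>f\<close> turns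
  into a multiple of \<open>R^(-2)\<close>, just compensating the weight of
  \<open>f\<close>.\<close>

lemma ord_comp:
 assumes "ord k 2 f" "0 < c" "!!x z. x : Om ==> z : Om ==> c * (R x z)^2 <= f x z"
  and "!!j s. 0 < s ==> (h j has_real_derivative h (Suc j) s) (at s)"
  and "!!j s. 0 < s ==> abs (h j s) <= K j * s powr (sg - real j)"
  and "sg <= 0"
 shows "ord k (2 * sg) (%x z. h 0 (f x z))"
proof -
 obtain C where C: "0 < C" "!!x. x : Om ==> symb k Om (R x) (%z. C * R x z powr 2) (f x)"
  using assms(1) unfolding ord_def by auto
 have fp: "0 < f x z" if "x : Om" "z : Om" for x z
  using mult_pos_pos[OF assms(2) zero_less_power[OF R_pos[OF that(1), of z], of 2]] assms(3)[OF that] by linarith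
 define N where "N = 1 + (SUM j<=k. abs (K j) * c powr (sg - real j) * C ^ j)"
 have N0: "0 < N" using assms(2) C by (auto simp: N_def intro!: add_pos_nonneg sum_nonneg)
 have "symb k Om (R x) (%z. 2 ^ (k * k) * (N * R x z powr (2 * sg))) (%z. h 0 (f x z))" if x: "x : Om" for x
 proof (rule symb_comp[OF open_dom R_pos[OF x] _ C(2)[OF x]])
  show "0 < C * R x z powr 2" for z using C(1) R_pos[OF x, of z] by simp
  show "(h j has_real_derivative h (Suc j) (f x z)) (at (f x z))" if "z : Om" for j z
   by (rule assms(4)[OF fp[OF x that]])
  show "continuous_on (f x ` Om) (h k)"
   by (intro continuous_at_imp_continuous_on ballI DERIV_isCont[OF assms(4)]) (use fp[OF x] in auto)
  fix j z assume j: "j <= k" and z: "z : Om"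
  define r where "r = R x z"
  have r: "0 < r" using R_pos[OF x] by (simp add: r_def)
  have cr: "c * r powr 2 <= f x z" using assms(3)[OF x z] r by (simp add: r_def)
  have ej: "(C * r powr 2) ^ j = C ^ j * r powr (2 * real j)"
  proof -
   have "(r powr 2) ^ j = (r powr 2) powr real j" using r by (intro powr_realpow[symmetric]) simp
   thus ?thesis by (simp only: power_mult_distrib powr_powr)
  qed
  have "abs (h j (f x z)) <= K j * f x z powr (sg - real j)" by (rule assms(5)[OF fp[OF x z]])
  also have "... <= abs (K j) * f x z powr (sg - real j)" by (intro mult_right_mono) auto
  also have "... <= abs (K j) * (c * r powr 2) powr (sg - real j)"
   using cr assms(2,6) r by (intro mult_left_mono powr_mono2') auto
  also have "(c * r powr 2) powr (sg - real j) = c powr (sg - real j) * r powr (2 * (sg - real j))"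
   using assms(2) by (simp add: powr_mult powr_powr)
  finally have "abs (h j (f x z)) * (C * r powr 2) ^ j
    <= abs (K j) * (c powr (sg - real j) * r powr (2 * (sg - real j))) * (C * r powr 2) ^ j"
   using C(1) by (intro mult_right_mono) auto
  also note ej
  also have "abs (K j) * (c powr (sg - real j) * r powr (2 * (sg - real j))) * (C ^ j * r powr (2 * real j))
    = (abs (K j) * c powr (sg - real j) * C ^ j) * (r powr (2 * (sg - real j)) * r powr (2 * real j))" by simp
  also have "r powr (2 * (sg - real j)) * r powr (2 * real j) = r powr (2 * sg)"
   by (simp add: powr_add[symmetric] algebra_simps)
  also have "(abs (K j) * c powr (sg - real j) * C ^ j) * r powr (2 * sg) <= N * r powr (2 * sg)"
  proof (rule mult_right_mono)
   have "abs (K j) * c powr (sg - real j) * C ^ j <= (SUM j<=k. abs (K j) * c powr (sg - real j) * C ^ j)"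
    using j C assms(2) by (intro member_le_sum[of j "{..k}"]) auto
   thus "abs (K j) * c powr (sg - real j) * C ^ j <= N" by (simp add: N_def)
  qed simp
  finally show "abs (h j (f x z)) * (C * R x z powr 2) ^ j <= N * R x z powr (2 * sg)"
   unfolding r_def[symmetric] ej .
 qed
 hence "symb k Om (R x) (%z. (2 ^ (k * k) * N) * R x z powr (2 * sg)) (%z. h 0 (f x z))" if "x : Om" for x
  using that by (simp add: mult.assoc)
 moreover have "0 < 2 ^ (k * k) * N" using N0 by simp
 ultimately show ?thesis unfolding ord_def by blast
qed

end

lemma symb_cmult:
 assumes "open S" "symb k S w M f" shows "symb k S w (%x. abs a * M x) (%x. a * f x)"
 using assms(2)
proof (induction k arbitrary: M f)
 case 0 thus ?case by (auto simp: abs_mult intro!: continuous_intros mult_left_mono)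
next
 case (Suc k)
 have "symb k S w (%x. abs a * M x / w x) (pd b (%x. a * f x))" if b: "b : Basis" for b
 proof -
  have "symb k S w (%x. abs a * (M x / w x)) (%x. a * pd b f x)"
   using Suc.IH[of "%x. M x / w x" "pd b f"] Suc.prems b by simp
  from symb_cong[OF assms(1) this, of "pd b (%x. a * f x)"] show ?thesis
   using Suc.prems by (simp add: partial_deriv_cmult)
 qed
 thus ?case using Suc.prems by (auto simp: abs_mult intro: mult_left_mono)
qed

lemma partial_deriv_inner_diff: "pd b (%z. (z - x) \<bullet> c) = (%z. b \<bullet> c)"
 by (rule ext, rule partial_derivI) (auto intro!: derivative_eq_intros)

lemma partial_deriv_diff:
 assumes "f differentiable (at x)" "g differentiable (at x)"
 shows "pd b (%x. f x - g x) x = pd b f x - pd b g x"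
proof -
 have "((%x. f x - g x) has_derivative
   (%h. frechet_derivative f (at x) h - frechet_derivative g (at x) h)) (at x)"
  using assms by (intro has_derivative_diff) (auto simp: frechet_derivative_works)
 from partial_derivI[OF this, of b] show ?thesis by (simp add: partial_deriv_def)
qed

section \<open>The ingredients of the parametrix and their orders\<close>

context smooth_bounded_domain
begin

text \<open>The length of the gradient is frozen at \<open>x\<close>: dividing by its value at
  \<open>z\<close> would cost one of the four derivatives of \<open>ph\<close>. The maximum with
  \<open>m0\<close> keeps it away from zero; inside the domain it takes effect only where
  \<open>ph x >= m0\<close>, far from the boundary.\<close>

definition slope :: "'a => real" where "slope x = sqrt (max m0 (grad_inner ph ph x))"
definition t :: "'a => real" where "t x = inverse (slope x) * ph x"
definition rho :: "'a => 'a => real" where "rho x z = inverse (slope x) * ph z"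

text \<open>In a half-space, with \<open>rho\<close> the distance to the boundary, \<open>b x z\<close> is the squared distance from
 \<open>z\<close> to the mirror image of \<open>x\<close>, and \<open>e3\<close> and \<open>e4\<close> vanish.\<close>

definition b :: "'a => 'a => real" where "b x z = sqdist x z + 4 * t x * rho x z"
definition e3 :: "'a => 'a => real" where
 "e3 x z = (SUM c:Basis. ((z - x) \<bullet> c) * pd c (rho x) z) - rho x z + t x"
definition e4 :: "'a => 'a => real" where "e4 x z = grad_inner (rho x) (rho x) z - 1"

text \<open>The part of Boggio's kernel that is regular in the domain: minus the first-order Taylor
  polynomial of \<open>KK n 0\<close> at \<open>b x z\<close>, evaluated at
  \<open>sqdist x z\<close>, which is \<open>b x z - 4 * t x * rho x z\<close>.\<close>

definition V :: "'a => 'a => real" where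
 "V x z = - KK n 0 (b x z) + 4 * t x * (rho x z * KK n 1 (b x z))"
definition E :: "'a => 'a => real" where "E x z = lap (lap (V x)) z"

lemma phi_diff: "ph differentiable (at z)" "c : Basis ==> pd c ph differentiable (at z)"
 using phi_C4 by (auto simp: eval_nat_numeral)

lemma phi_bounded_derivs: "EX C>0. symb 4 (cball 0 B) (%_. 1) (%_. C) ph"
 by (rule C_k_on_bounded_compact[OF compact_cball C_k_on_subset[OF phi_C4]]) simp

lemma slope_lower: "sqrt m0 <= slope x" by (simp add: slope_def)

lemma slope_pos: "0 < slope x"
 using consts_pos by (simp add: slope_def less_max_iff_disj)

lemma slope_upper: "EX C>0. ALL x:Om. slope x <= C"
proof -
 have "C_k_on (Suc 0) UNIV ph" using phi_C4 by (rule C_k_on_le) simp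
 hence "continuous_on UNIV (grad_inner ph ph)"
  using C_k_on_grad_inner[of UNIV 0 ph ph] by simp
 hence "compact (grad_inner ph ph ` cball 0 B)" by (intro compact_continuous_image) (auto intro: continuous_on_subset)
 then obtain a where a: "!!x. x : cball 0 B ==> abs (grad_inner ph ph x) <= a"
  unfolding compact_eq_bounded_closed bounded_real by blast
 have "slope x <= sqrt (max m0 a)" if "x : Om" for x
  using a[of x] dom_subset_cball that unfolding slope_def by (intro real_sqrt_le_mono) auto
 moreover have "0 < sqrt (max m0 a)" using consts_pos by auto
 ultimately show ?thesis by blast
qed

lemma t_rho: "t x = rho x x" by (simp add: t_def rho_def)

lemma rho_bounds:
 "EX c>0. EX C>0. ALL x:Om. ALL z:Om. c * d z <= rho x z & rho x z <= C * d z"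
proof -
 obtain C1 where C1: "0 < C1" "!!x. x : Om ==> slope x <= C1" using slope_upper by blast
 have m: "0 < sqrt m0" using consts_pos by simp
 have "c0 / C1 * d z <= rho x z & rho x z <= C0 / sqrt m0 * d z" if x: "x : Om" and z: "z : Om" for x z
 proof
  have "c0 / C1 * d z <= ph z / C1" using phi_lower[OF z] C1(1) by (simp add: divide_right_mono)
  also have "... <= ph z / slope x" using phi_pos[OF z] C1(2)[OF x] slope_pos by (intro divide_left_mono) (auto simp: C1(1))
  finally show "c0 / C1 * d z <= rho x z" by (simp add: rho_def field_simps)
  have "ph z / slope x <= ph z / sqrt m0" using phi_pos[OF z] slope_lower slope_pos m by (intro divide_left_mono) auto
  also have "... <= C0 / sqrt m0 * d z" using phi_upper[OF z] m by (simp add: divide_right_mono)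
  finally show "rho x z <= C0 / sqrt m0 * d z" by (simp add: rho_def field_simps)
 qed
 moreover have "0 < c0 / C1" "0 < C0 / sqrt m0" using consts_pos C1 m by auto
 ultimately show ?thesis by blast
qed

lemma rho_pos: "z : Om ==> 0 < rho x z" using phi_pos slope_pos by (simp add: rho_def)

lemma t_pos: "x : Om ==> 0 < t x" using rho_pos by (simp add: t_rho)

text \<open>\<open>d\<close> is Lipschitz, so \<open>(d x - d z)^2\<close> is at most the squared
  distance; hence \<open>(d x + d z)^2\<close> exceeds \<open>4 * d x * d z\<close> by no more than
  that.\<close>

lemma b_bounds: "EX c>0. EX C>0. ALL x:Om. ALL z:Om. c * (R x z)^2 <= b x z & b x z <= C * (R x z)^2"
proof -
 obtain c C where c: "0 < c" "0 < C" "!!x z. x : Om ==> z : Om ==> c * d z <= rho x z"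
   "!!x z. x : Om ==> z : Om ==> rho x z <= C * d z"
  using rho_bounds by blast
 have "min 1 (c^2) / 4 * (R x z)^2 <= b x z & b x z <= (1 + 4 * C^2) * (R x z)^2" if x: "x : Om" and z: "z : Om" for x z
 proof
  let ?r = "dist x z"
  have "(c * d x) * (c * d z) <= t x * rho x z" unfolding t_rho using c x z by (intro mult_mono) (auto simp: less_imp_le rho_pos)
  hence 1: "c^2 * (d x * d z) <= t x * rho x z" by (simp add: power2_eq_square mult_ac)
  have "(t x) * rho x z <= (C * d x) * (C * d z)" unfolding t_rho using c x z by (intro mult_mono) (auto simp: less_imp_le rho_pos)
  hence 2: "t x * rho x z <= C^2 * (d x * d z)" by (simp add: power2_eq_square mult_ac)
  have rr: "?r^2 <= (R x z)^2" using R_ge(1)[of x z] by (intro power_mono) auto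
  have dd: "d x * d z <= (R x z)^2" unfolding power2_eq_square using R_ge(2)[of x z] R_ge(3)[of z x] by (intro mult_mono) (auto intro: order_trans[OF d_nonneg])
  have "C^2 * (d x * d z) <= C^2 * (R x z)^2" using dd by (intro mult_left_mono) auto
  thus "b x z <= (1 + 4 * C^2) * (R x z)^2"
   unfolding b_def sqdist_dist using 2 rr by (simp add: algebra_simps)
  have "abs (d x - d z) <= ?r" using d_lipschitz[of x z] d_lipschitz[of z x] by (simp add: dist_commute abs_le_iff)
  hence "(d x - d z)^2 <= ?r^2" by (metis abs_ge_zero power2_abs power_mono)
  hence "(d x + d z)^2 <= ?r^2 + 4 * (d x * d z)" by (simp add: power2_eq_square algebra_simps)
  moreover have "(R x z)^2 <= 2 * ?r^2 + 2 * (d x + d z)^2"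
   using sum_squares_bound[of ?r "d x + d z"] by (simp add: R_def power2_eq_square algebra_simps)
  moreover have "0 <= d x * d z" by simp
  ultimately have 3: "(R x z)^2 <= 4 * ?r^2 + 16 * (d x * d z)" by linarith
  have m: "0 <= min 1 (c^2)" by simp
  have "min 1 (c^2) / 4 * (R x z)^2 <= min 1 (c^2) / 4 * (4 * ?r^2 + 16 * (d x * d z))"
   using 3 m by (intro mult_left_mono) auto
  also have "... = min 1 (c^2) * ?r^2 + 4 * (min 1 (c^2) * (d x * d z))" by (simp add: algebra_simps)
  also have "... <= 1 * ?r^2 + 4 * (c^2 * (d x * d z))"
   by (intro add_mono mult_right_mono mult_left_mono) auto
  also have "... <= b x z" unfolding b_def sqdist_dist using 1 by simp
  finally show "min 1 (c^2) / 4 * (R x z)^2 <= b x z" .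
 qed
 moreover have "0 < min 1 (c^2) / 4" "0 < 1 + 4 * C^2" using c by (auto simp: add_pos_nonneg)
 ultimately show ?thesis by blast
qed

lemma b_pos: "x : Om ==> z : Om ==> 0 < b x z"
 unfolding b_def using t_pos[of x] rho_pos[of z x] by (simp add: add_nonneg_pos)

lemma ord_coord: "ord k 1 (%x z. (z - x) \<bullet> c)" if c: "c : Basis"
proof -
 have bd: "abs ((z - x) \<bullet> c) <= 1 * R x z powr 1" if "x : Om" "z : Om" for x z
  using Basis_le_norm[OF c, of "z - x"] R_ge(1)[of x z] R_pos[OF that(1), of z] by (simp add: dist_norm norm_minus_commute)
 have "ord (Suc k) 1 (%x z. (z - x) \<bullet> c)"
 proof (rule ord_Suc[OF bd])
  show "(%z. (z - x) \<bullet> c) differentiable (at z)" for x z by (auto intro!: derivative_intros)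
  show "ord k (1 - 1) (%x. pd c' (%z. (z - x) \<bullet> c))" for c'
   using ord_const[of k "c' \<bullet> c"] by (simp add: partial_deriv_inner_diff)
 qed
 thus ?thesis by (rule ord_le) simp
qed

lemma ord_sqdist: "ord k 2 sqdist"
proof -
 have "ord k (1 + 1) (%x z. ((z - x) \<bullet> c) * ((z - x) \<bullet> c))" if "c : Basis" for c
  by (intro ord_mult ord_coord that)
 hence "ord k 2 (%x z. SUM c:Basis. ((z - x) \<bullet> c) * ((z - x) \<bullet> c))" by (intro ord_sum) auto
 thus ?thesis by (rule ord_cong) (simp add: sqdist_def euclidean_inner[of "_ - _" "_ - _"])
qed

lemma partial_rho: "pd c (rho x) = (%z. inverse (slope x) * pd c ph z)"
 unfolding rho_def[abs_def] by (rule ext) (intro partial_deriv_cmult phi_diff)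

lemma rho_C4: "C_k_on 4 UNIV (rho x)"
 unfolding rho_def[abs_def] by (intro C_k_on_cmult phi_C4) simp

lemma rho_bounded_derivs: "EX C>0. ALL x. symb 4 Om (%_. 1) (%_. C) (rho x)"
proof -
 obtain C where C: "0 < C" "symb 4 (cball 0 B) (%_. 1) (%_. C) ph" using phi_bounded_derivs by blast
 have m: "0 < sqrt m0" using consts_pos by simp
 have "symb 4 Om (%_. 1) (%_. inverse (sqrt m0) * C) (rho x)" for x
 proof (rule symb_mono)
  show "symb 4 Om (%_. 1) (%_. abs (inverse (slope x)) * C) (rho x)"
   unfolding rho_def[abs_def] by (rule symb_cmult[OF open_dom symb_subset[OF C(2) dom_subset_cball]])
  show "abs (inverse (slope x)) * C <= inverse (sqrt m0) * C"
   using slope_lower[of x] slope_pos[of x] m C(1) by (intro mult_right_mono) (auto intro: le_imp_inverse_le)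
 qed auto
 moreover have "0 < inverse (sqrt m0) * C" using m C by simp
 ultimately show ?thesis by blast
qed

lemma ord_partial_rho: "c : Basis ==> ord 3 0 (%x. pd c (rho x))"
proof -
 assume c: "c : Basis"
 obtain C where "0 < C" "!!x. symb 4 Om (%_. 1) (%_. C) (rho x)" using rho_bounded_derivs by blast
 hence "symb 3 Om (%_. 1) (%_. C) (pd c (rho x))" for x
  using c by (simp add: eval_nat_numeral)
 thus ?thesis by (rule ord_of_bounded)
qed

lemma ord_partial2_rho: "c : Basis ==> c' : Basis ==> ord 2 0 (%x. pd c' (pd c (rho x)))"
proof -
 assume c: "c : Basis" "c' : Basis"
 obtain C where "0 < C" "!!x. symb 4 Om (%_. 1) (%_. C) (rho x)" using rho_bounded_derivs by blast
 hence "symb 2 Om (%_. 1) (%_. C) (pd c' (pd c (rho x)))" for x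
  using c by (simp add: eval_nat_numeral)
 thus ?thesis by (rule ord_of_bounded)
qed

lemma ord_laplacian_rho: "ord 2 0 (%x. lap (rho x))"
 using ord_sum[of Basis 2 0 "%c x z. pd c (pd c (rho x)) z"] ord_partial2_rho
 by (simp add: laplacian_def[abs_def])

lemma ord_rho: "ord 4 1 rho"
proof -
 obtain C where C: "0 < C" "!!x z. x : Om ==> z : Om ==> rho x z <= C * d z" using rho_bounds by blast
 have "ord (Suc 3) 1 rho"
 proof (rule ord_Suc)
  fix x z assume xz: "x : Om" "z : Om"
  have "C * d z <= C * R x z" using R_ge(3) C(1) by simp
  thus "abs (rho x z) <= C * R x z powr 1"
   using C(2)[OF xz] rho_pos[OF xz(2), of x] R_pos[OF xz(1), of z] by simp
  show "rho x differentiable (at z)" using rho_C4 by (auto simp: eval_nat_numeral)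
 qed (simp add: ord_partial_rho)
 thus ?thesis by simp
qed

lemma ord_t: "ord k 1 (%x z. t x)"
proof -
 obtain C where C: "0 < C" "!!x z. x : Om ==> z : Om ==> rho x z <= C * d z" using rho_bounds by blast
 show ?thesis
 proof (rule ord_const_family)
  fix x z assume xz: "x : Om" "z : Om"
  have "C * d x <= C * R x z" using R_ge(2) C(1) by simp
  thus "abs (t x) <= C * R x z powr 1"
   using C(2)[OF xz(1,1)] rho_pos[OF xz(1), of x] R_pos[OF xz(1), of z] by (simp add: t_rho)
 qed
qed

lemma ord_b: "ord 4 2 b"
proof -
 have "ord 4 (1 + 1) (%x z. t x * rho x z)" by (intro ord_mult ord_t ord_rho)
 hence "ord 4 2 (%x z. sqdist x z + 4 * (t x * rho x z))" by (intro ord_add ord_sqdist ord_cmult) simp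
 thus ?thesis by (rule ord_cong) (simp add: b_def)
qed

lemma ord_KK: assumes "k <= 4" shows "ord k (- n - 2 * real j) (%x z. KK n (Suc (Suc j)) (b x z))"
proof -
 obtain c where c: "0 < c" "!!x z. x : Om ==> z : Om ==> c * (R x z)^2 <= b x z" using b_bounds by blast
 have "ord k (2 * (- n/2 - real j)) (%x z. KK n (Suc (Suc (j + 0))) (b x z))"
 proof (rule ord_comp[OF ord_le[OF ord_b assms] c])
  show "(KK n (Suc (Suc (j + i))) has_real_derivative KK n (Suc (Suc (j + Suc i))) s) (at s)" if "0 < s" for i s
   using KK_deriv[OF that] by simp
  show "abs (KK n (Suc (Suc (j + i))) s) <= (abs (\<Prod>l<j + i. - n/2 - real l) / 2) * s powr (- n/2 - real j - real i)" for i s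
   unfolding KK_bound by (simp add: algebra_simps)
  show "- n/2 - real j <= 0" using n_ge_1 by simp
 qed auto
 thus ?thesis by (simp add: algebra_simps)
qed

end

lemma C_k_on_UNIV: "C_k_on k UNIV f ==> j <= k ==> C_k_on j S f"
 by (rule C_k_on_le[OF C_k_on_subset]) auto

context smooth_bounded_domain
begin

text \<open>\<open>e3\<close> is a Taylor remainder of \<open>rho\<close> between \<open>z\<close>
  and \<open>x\<close>: it vanishes at \<open>z = x\<close>, and its gradient is
  \<open>z - x\<close> contracted with the second derivatives of \<open>rho\<close>, since the
  first-order terms cancel. Hence the order is 2 and not 1.\<close>

lemma ord_e3: "ord 2 2 e3"
proof -
 obtain C1 where C1: "0 < C1" "symb 4 (cball 0 B) (%_. 1) (%_. C1) ph" using phi_bounded_derivs by blast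
 define C where "C = inverse (sqrt m0) * C1"
 have C: "0 < C" using C1 consts_pos by (simp add: C_def)
 have Cr: "abs (pd c (pd c' (rho x)) y) <= C" if "y : cball 0 B" "c : Basis" "c' : Basis" for x y c c'
 proof -
  have "abs (pd c (pd c' (rho x)) y) = inverse (slope x) * abs (pd c (pd c' ph) y)"
   unfolding partial_rho partial_deriv_cmult[OF phi_diff(2)[OF that(3)]] using slope_pos[of x] by (simp add: abs_mult)
  also have "... <= inverse (sqrt m0) * C1"
   using C1 that slope_lower[of x] slope_pos[of x] consts_pos by (intro mult_mono le_imp_inverse_le) (auto simp: eval_nat_numeral)
  finally show ?thesis by (simp add: C_def)
 qed
 have rd: "rho x differentiable (at z)" "c : Basis ==> pd c (rho x) differentiable (at z)" for x z c
  using rho_C4[of x] by (auto simp: eval_nat_numeral)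
 have cd: "(%z. (z - x) \<bullet> c) differentiable (at z)" for x z c by (auto intro!: derivative_intros)
 have cmd: "(%z. ((z - x) \<bullet> c) * pd c (rho x) z) differentiable (at z)" if "c : Basis" for x z c
  by (intro differentiable_mult cd rd that)
 have ed: "e3 x differentiable (at z)" for x z
  unfolding e3_def[abs_def] using rd by (intro differentiable_add differentiable_diff differentiable_sum cmd differentiable_const) auto
 have pe: "pd c (e3 x) z = (SUM c':Basis. ((z - x) \<bullet> c') * pd c (pd c' (rho x)) z)" if c: "c : Basis" for x z c
 proof -
  have sd: "(%z. SUM c:Basis. ((z - x) \<bullet> c) * pd c (rho x) z) differentiable (at z)"
   by (intro differentiable_sum ballI cmd) auto
  have "pd c (e3 x) z = pd c (%z. SUM c:Basis. ((z - x) \<bullet> c) * pd c (rho x) z) z - pd c (rho x) z"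
   unfolding e3_def[abs_def] partial_deriv_add_const using sd rd by (intro partial_deriv_diff) auto
  also have "pd c (%z. SUM c:Basis. ((z - x) \<bullet> c) * pd c (rho x) z) z
    = (SUM c':Basis. pd c (%z. ((z - x) \<bullet> c') * pd c' (rho x) z) z)"
   by (rule partial_deriv_sum[OF cmd])
  also have "... = (SUM c':Basis. ((z - x) \<bullet> c') * pd c (pd c' (rho x)) z + (c \<bullet> c') * pd c' (rho x) z)"
   by (intro sum.cong refl) (simp add: partial_deriv_mult[OF cd rd(2)] partial_deriv_inner_diff)
  also have "... = (SUM c':Basis. ((z - x) \<bullet> c') * pd c (pd c' (rho x)) z)
     + (SUM c':Basis. if c' = c then pd c' (rho x) z else 0)"
   unfolding sum.distrib using c by (intro arg_cong2[where f = "(+)"] sum.cong refl) (auto simp: inner_Basis)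
  finally show ?thesis using c by simp
 qed
 have "ord (Suc 1) 2 e3"
 proof (rule ord_Suc)
  fix x z assume xz: "x : Om" "z : Om"
  let ?r = "dist x z"
  \<comment> \<open>Applied on a convex set that contains \<open>x\<close> and \<open>z\<close> and
    on which the distance to \<open>x\<close> is at most \<open>dist x z\<close>: the gradient
    contributes one factor of the distance and the increment the other.\<close>
  have "abs (e3 x z - e3 x x) <= real DIM('a) * (n * (?r * C)) * norm (z - x)"
  proof (rule Lipschitz_from_partials[of "cball 0 B \<inter> cball x ?r"])
   fix y c :: 'a assume y: "y : cball 0 B \<inter> cball x ?r" and c: "c : Basis"
   have "abs (pd c (e3 x) y) <= (SUM c':(Basis::'a set). ?r * C)"
    unfolding pe[OF c]
   proof (rule order_trans[OF sum_abs sum_mono])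
    fix c' :: 'a assume c': "c' : Basis"
    have "abs ((y - x) \<bullet> c') <= ?r" using Basis_le_norm[OF c', of "y - x"] y by (simp add: dist_norm norm_minus_commute)
    moreover have "abs (pd c (pd c' (rho x)) y) <= C" using Cr[of y c c' x] y c c' by simp
    ultimately show "abs (((y - x) \<bullet> c') * pd c (pd c' (rho x)) y) <= ?r * C"
     unfolding abs_mult by (intro mult_mono) auto
   qed
   thus "abs (pd c (e3 x) y) <= n * (?r * C)" by (simp add: n_eq)
  qed (use xz dom_subset_cball ed in "auto intro: convex_Int")
  hence "abs (e3 x z) <= (n * n * C) * ?r^2"
   by (simp add: e3_def[of x x] rho_def t_def n_eq dist_norm norm_minus_commute power2_eq_square mult_ac)
  also have "... <= (n * n * C) * (R x z)^2" using C R_ge(1) n_ge_1 by (intro mult_left_mono power_mono) auto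
  finally show "abs (e3 x z) <= (n * n * C) * R x z powr 2" using R_pos[OF xz(1), of z] by simp
  show "e3 x differentiable (at z)" by (rule ed)
 next
  fix c :: 'a assume c: "c : Basis"
  have "ord 1 (1 + 0) (%x z. ((z - x) \<bullet> c') * pd c (pd c' (rho x)) z)" if "c' : Basis" for c'
   by (intro ord_mult ord_coord that ord_le[OF ord_partial2_rho[OF that c]]) simp
  hence "ord 1 1 (%x z. SUM c':Basis. ((z - x) \<bullet> c') * pd c (pd c' (rho x)) z)"
   by (intro ord_sum) auto
  hence "ord 1 1 (%x. pd c (e3 x))" by (rule ord_cong) (simp add: pe[OF c])
  thus "ord 1 (2 - 1) (%x. pd c (e3 x))" by simp
 qed
 thus ?thesis by (simp add: numeral_2_eq_2)
qed

text \<open>At \<open>z = x\<close> the squared gradient of \<open>rho\<close> is 1, unless the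
  maximum in \<open>slope\<close> is attained by \<open>m0\<close> alone. In that case
  \<open>ph x >= m0\<close>, so \<open>R\<close> is bounded below and a plain bound is as good as
  one by \<open>R\<close>.\<close>

lemma ord_e4: "ord 2 1 e4"
proof -
 let ?g = "grad_inner ph ph"
 have gC: "C_k_on (Suc (Suc (Suc 0))) UNIV ?g" using phi_C4 by (intro C_k_on_grad_inner) (simp_all add: eval_nat_numeral)
 obtain C where C: "0 < C" "symb (Suc (Suc (Suc 0))) (cball 0 B) (%_. 1) (%_. C) ?g"
  using C_k_on_bounded_compact[OF compact_cball C_k_on_subset[OF gC]] by blast
 have gd: "?g differentiable (at z)" for z using gC by simp
 have g4: "e4 x z = inverse ((slope x)^2) * ?g z + (-1)" for x z
  unfolding e4_def grad_inner_def partial_rho by (simp add: sum_distrib_left power2_eq_square mult_ac)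
 have sl2: "(slope x)^2 = max m0 (?g x)" for x using consts_pos by (simp add: slope_def max_def)
 define L where "L = n * C + (C + m0) * (C0 / m0)"
 have L: "n * C <= L" "(C + m0) * (C0 / m0) <= L" "0 < L" using C(1) n_ge_1 consts_pos by (auto simp: L_def add_pos_nonneg)
 have "ord (Suc 1) 1 e4"
 proof (rule ord_Suc)
  fix x z assume xz: "x : Om" "z : Om"
  have R0: "0 < R x z" using R_pos[OF xz(1)] .
  have "abs (?g z - (slope x)^2) <= L * R x z"
  proof (cases "m0 <= ?g x")
   case True
   have "abs (?g z - ?g x) <= real DIM('a) * C * norm (z - x)"
    by (rule Lipschitz_from_partials[OF convex_cball[of 0 B]]) (use gd C(2) xz dom_subset_cball in auto)
   hence "abs (?g z - (slope x)^2) <= n * C * dist x z" using True by (simp add: sl2 max_def n_eq dist_norm norm_minus_commute)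
   also have "... <= L * R x z" using L R_ge(1) by (intro mult_mono) auto
   finally show ?thesis .
  next
   case False
   hence "m0 <= ph x" using phi_grad[OF xz(1)] by linarith
   also have "... <= C0 * d x" by (rule phi_upper[OF xz(1)])
   also have "... <= C0 * R x z" using R_ge(2) consts_pos by simp
   finally have 1: "1 <= C0 / m0 * R x z" using consts_pos by (simp add: field_simps)
   have "abs (?g z) <= C" using symb_bound[OF C(2)] xz(2) dom_subset_cball by blast
   hence "abs (?g z - (slope x)^2) <= C + m0" using False consts_pos by (simp add: sl2 max_def abs_le_iff)
   also have "... <= (C + m0) * (C0 / m0 * R x z)" using mult_left_mono[OF 1, of "C + m0"] C consts_pos by simp
   also have "... <= L * R x z" using mult_right_mono[OF L(2), of "R x z"] R0 by (simp add: mult.assoc)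
   finally show ?thesis .
  qed
  moreover have "e4 x z = (?g z - (slope x)^2) / (slope x)^2" using slope_pos[of x] by (simp add: g4 field_simps)
  ultimately have "abs (e4 x z) <= L * R x z / (slope x)^2" by (simp add: abs_divide divide_right_mono)
  also have "... <= L * R x z / m0" using R0 consts_pos L by (intro divide_left_mono) (auto simp: sl2)
  finally show "abs (e4 x z) <= (L / m0) * R x z powr 1" using R0 by simp
  show "e4 x differentiable (at z)" unfolding g4[abs_def] by (intro differentiable_add differentiable_mult gd differentiable_const)
 next
  fix c :: 'a assume c: "c : Basis"
  have "ord 1 0 (%x. pd c (e4 x))"
  proof (rule ord_of_bounded)
   fix x
   have pc: "symb (Suc 0) Om (%_. 1) (%_. C) (pd c ?g)"
    using symb_subset[OF C(2) dom_subset_cball] c symb_Suc_D[of "Suc 0" Om "%_. 1" "%_. C" "pd c ?g"] by simp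
   have e: "inverse ((slope x)^2) * pd c ?g z = pd c (e4 x) z" for z
    unfolding g4[abs_def] partial_deriv_add_const by (rule partial_deriv_cmult[OF gd, symmetric])
   have "symb (Suc 0) Om (%_. 1) (%_. C / m0) (%z. inverse ((slope x)^2) * pd c ?g z)"
   proof (rule symb_mono[OF symb_cmult[OF open_dom pc]])
    have "inverse ((slope x)^2) <= inverse m0" using consts_pos by (intro le_imp_inverse_le) (auto simp: sl2)
    thus "abs (inverse ((slope x)^2)) * C <= C / m0" using C(1) by (simp add: divide_inverse mult.commute mult_left_mono)
   qed simp
   thus "symb 1 Om (%_. 1) (%_. C / m0) (pd c (e4 x))" unfolding e by simp
  qed
  thus "ord 1 (1 - 1) (%x. pd c (e4 x))" by simp
 qed
 thus ?thesis by (simp add: numeral_2_eq_2)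
qed

lemma grad_inner_rho_sqdist:
 "grad_inner (rho x) (sqdist x) z = 2 * (e3 x z + rho x z - t x)"
proof -
 have "grad_inner (rho x) (sqdist x) z = (SUM c:Basis. 2 * (((z - x) \<bullet> c) * pd c (rho x) z))"
  unfolding grad_inner_def partial_deriv_sqdist by (intro sum.cong refl) (simp add: inner_commute)
 thus ?thesis by (simp add: e3_def sum_distrib_left)
qed

lemma partial_b: "pd c (b x) z = pd c (sqdist x) z + 4 * t x * pd c (rho x) z"
proof -
 have 1: "sqdist x differentiable (at z)" using C_k_on_sqdist[of UNIV 1 x] by simp
 have 2: "rho x differentiable (at z)" using rho_C4[of x] by (auto simp: eval_nat_numeral)
 have 3: "(%z. (4 * t x) * rho x z) differentiable (at z)" using 2 by (intro differentiable_mult differentiable_const)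
 show ?thesis unfolding b_def[abs_def]
  using partial_deriv_add[OF 1 3, of c] partial_deriv_cmult[OF 2, of c "4 * t x"] by simp
qed

lemma b_C4: "C_k_on 4 UNIV (b x)"
 unfolding b_def[abs_def] using C_k_on_add[OF _ C_k_on_sqdist[of UNIV 4 x] C_k_on_cmult[OF _ rho_C4[of x], of "4 * t x"]]
 by simp

lemma grad_inner_rho_rho: "grad_inner (rho x) (rho x) z = 1 + e4 x z"
 by (simp add: e4_def)

lemma grad_inner_rho_b: "grad_inner (rho x) (b x) z = 2 * (rho x z + t x) + 2 * e3 x z + 4 * t x * e4 x z"
proof -
 have "grad_inner (rho x) (b x) z = grad_inner (rho x) (sqdist x) z + 4 * t x * grad_inner (rho x) (rho x) z"
  by (simp add: grad_inner_def partial_b distrib_left sum.distrib sum_distrib_left mult_ac)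
 thus ?thesis unfolding grad_inner_rho_sqdist grad_inner_rho_rho by (simp add: algebra_simps)
qed

lemma grad_inner_b_b: "grad_inner (b x) (b x) z = 4 * b x z + 16 * t x * (e3 x z + t x * e4 x z)"
proof -
 have "grad_inner (b x) (b x) z = (SUM c:Basis. pd c (sqdist x) z * pd c (sqdist x) z
   + 8 * t x * (pd c (rho x) z * pd c (sqdist x) z) + 16 * (t x)^2 * (pd c (rho x) z * pd c (rho x) z))"
  unfolding grad_inner_def partial_b by (intro sum.cong refl) (simp add: power2_eq_square algebra_simps)
 also have "... = grad_inner (sqdist x) (sqdist x) z + 8 * t x * grad_inner (rho x) (sqdist x) z + 16 * (t x)^2 * grad_inner (rho x) (rho x) z"
  by (simp add: sum.distrib sum_distrib_left grad_inner_def)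
 also have "... = 4 * b x z + 16 * t x * (e3 x z + t x * e4 x z)"
  unfolding grad_inner_rho_sqdist grad_inner_rho_rho grad_inner_sqdist b_def by (simp add: power2_eq_square algebra_simps)
 finally show ?thesis .
qed

lemma laplacian_b: "lap (b x) z = 2 * n + 4 * t x * lap (rho x) z"
proof -
 have 1: "C_k_on 2 UNIV (rho x)" using rho_C4[of x] by (rule C_k_on_le) simp
 have 2: "C_k_on 2 UNIV (%z. (4 * t x) * rho x z)" by (intro C_k_on_cmult 1) simp
 show ?thesis unfolding b_def[abs_def]
  using laplacian_add[OF _ C_k_on_sqdist[of UNIV 2 x] 2, of z] laplacian_cmult[OF _ 1, of z "4 * t x"]
  by (simp add: laplacian_sqdist n_eq)
qed

lemma laplacian_comp_b:
 assumes "x : Om" "z : Om"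
  and "!!s. 0 < s ==> (h has_real_derivative h1 s) (at s)" "(h1 has_real_derivative h2) (at (b x z))"
 shows "lap (%z. h (b x z)) z = h1 (b x z) * (2 * n + 4 * t x * lap (rho x) z)
  + h2 * (4 * b x z + 16 * t x * (e3 x z + t x * e4 x z))"
proof -
 have "C_k_on 2 Om (b x)" by (rule C_k_on_UNIV[OF b_C4]) simp
 from laplacian_comp[OF open_dom this assms(2) _ assms(4)] show ?thesis
  using assms(3) b_pos[OF assms(1)] by (simp add: laplacian_b grad_inner_b_b)
qed

lemma laplacian_mult_comp_b:
 assumes "x : Om" "z : Om" "C_k_on 2 Om f" "C_k_on 2 Om (%z. h (b x z))"
  and "!!s. 0 < s ==> (h has_real_derivative h1 s) (at s)" "(h1 has_real_derivative h2) (at (b x z))"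
 shows "lap (%z. f z * h (b x z)) z = f z * (h1 (b x z) * (2 * n + 4 * t x * lap (rho x) z)
  + h2 * (4 * b x z + 16 * t x * (e3 x z + t x * e4 x z))) + 2 * h1 (b x z) * grad_inner f (b x) z + h (b x z) * lap f z"
proof -
 have bd: "b x differentiable (at z)" using b_C4[of x] by (auto simp: eval_nat_numeral)
 have "pd c (%z. h (b x z)) z = h1 (b x z) * pd c (b x) z" for c
  by (rule partial_deriv_comp[OF bd assms(5)[OF b_pos[OF assms(1,2)]]])
 hence "grad_inner f (%z. h (b x z)) z = h1 (b x z) * grad_inner f (b x) z"
  by (simp add: grad_inner_def sum_distrib_left mult_ac)
 thus ?thesis
  using laplacian_mult[OF open_dom assms(3,4,2)] laplacian_comp_b[OF assms(1,2,5,6)] by simp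
qed

lemma C4_KK_b: "x : Om ==> C_k_on 4 Om (%z. KK n j (b x z))"
proof -
 assume x: "x : Om"
 have "C_k_on 4 Om (%z. KK n (j + 0) (b x z))"
 proof (rule C_k_on_comp[OF open_dom, where h = "%i. KK n (j + i)"])
  show "C_k_on 4 Om (b x)" using b_C4 by (rule C_k_on_subset) simp
  show "(KK n (j + i) has_real_derivative KK n (j + Suc i) (b x z)) (at (b x z))" if "z : Om" for i z
   using KK_deriv[OF b_pos[OF x that]] by simp
  show "continuous_on (b x ` Om) (KK n (j + 4))"
   by (rule continuous_on_subset[OF KK_continuous_on]) (use b_pos[OF x] in auto)
 qed
 thus ?thesis by simp
qed

lemma V_C4: assumes "x : Om" shows "C_k_on 4 Om (V x)"
proof -
 have "C_k_on 4 Om (rho x)" using rho_C4 by (rule C_k_on_subset) simp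
 thus ?thesis unfolding V_def[abs_def]
  by (intro C_k_on_add C_k_on_minus C_k_on_cmult C_k_on_mult C4_KK_b open_dom assms)
qed

text \<open>\<open>S1\<close> and \<open>S2\<close> vanish in the half-space. They collect what
  \<open>e3\<close>, \<open>e4\<close> and the Laplacian of \<open>rho\<close> contribute, after a
  factor \<open>(t x)^2\<close> has been taken out.\<close>

definition S1 :: "'a => 'a => real" where
 "S1 x z = 16 * (e4 x z * KK n 2 (b x z)) + 16 * (rho x z * lap (rho x) z * KK n 2 (b x z))
  + 64 * (rho x z * (e3 x z + t x * e4 x z) * KK n 3 (b x z))"

definition S2 :: "'a => 'a => real" where
 "S2 x z = 64 * (e4 x z * KK n 3 (b x z)) + 64 * ((rho x z + t x) * lap (rho x) z * KK n 3 (b x z))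
  + 256 * ((rho x z + t x) * (e3 x z + t x * e4 x z) * KK n 4 (b x z))"

lemma KK_recurrence:
 assumes "0 < s"
 shows "s * KK n 3 s = - (n/2) * KK n 2 s" "s * KK n 4 s = - (n/2 + 1) * KK n 3 s"
 unfolding KK_explicit[OF assms] by (simp_all add: power2_eq_square field_simps)

lemma KK_derivs:
 assumes "0 < s"
 shows "(KK n 0 has_real_derivative KK n 1 s) (at s)" "(KK n 1 has_real_derivative KK n 2 s) (at s)"
  "(KK n 2 has_real_derivative KK n 3 s) (at s)" "(KK n 3 has_real_derivative KK n 4 s) (at s)"
 using KK_deriv[OF assms, of n 0] KK_deriv[OF assms, of n 1] KK_deriv[OF assms, of n 2] KK_deriv[OF assms, of n 3]
 by (simp_all add: eval_nat_numeral)

text \<open>The point is the factor \<open>(t x)^2\<close> of the error: the contributions of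
  \<open>e3\<close> and of the Laplacian of \<open>rho\<close> that are linear in \<open>t x\<close>
  cancel between the two terms of \<open>V\<close>. This factor becomes the \<open>(d x)^2\<close>
  of the error kernel.\<close>

lemma laplacian_V:
 assumes x: "x : Om" and z: "z : Om"
 shows "lap (V x) z = (- 2 * n * KK n 1 (b x z) - 4 * b x z * KK n 2 (b x z))
  + 16 * t x * ((rho x z + t x) * KK n 2 (b x z)) + (t x)^2 * S1 x z"
proof -
 have C2: "C_k_on 2 Om (%z. KK n j (b x z))" for j using C4_KK_b[OF x] by (rule C_k_on_le) simp
 have r2: "C_k_on 2 Om (rho x)" by (rule C_k_on_UNIV[OF rho_C4]) simp
 have c1: "C_k_on 2 Om (%z. rho x z * KK n 1 (b x z))" by (intro C_k_on_mult open_dom r2 C2)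
 have c2: "C_k_on 2 Om (%z. (-1) * KK n 0 (b x z))" "C_k_on 2 Om (%z. (4 * t x) * (rho x z * KK n 1 (b x z)))"
  by (intro C_k_on_cmult open_dom C2 c1)+
 have "lap (V x) z = (-1) * lap (%z. KK n 0 (b x z)) z + (4 * t x) * lap (%z. rho x z * KK n 1 (b x z)) z"
  using laplacian_add[OF open_dom c2 z] laplacian_cmult[OF open_dom C2 z, of "-1" 0] laplacian_cmult[OF open_dom c1 z, of "4 * t x"]
  by (simp add: V_def[abs_def])
 also note laplacian_comp_b[OF x z KK_derivs(1) KK_derivs(2)[OF b_pos[OF x z]]]
 also note laplacian_mult_comp_b[OF x z r2 C2 KK_derivs(2) KK_derivs(3)[OF b_pos[OF x z]]]
 finally have 1: "lap (V x) z = - 1 * (KK n 1 (b x z) * (2 * n + 4 * t x * lap (rho x) z) + KK n 2 (b x z) * (4 * b x z + 16 * t x * (e3 x z + t x * e4 x z))) +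
  4 * t x * (rho x z * (KK n 2 (b x z) * (2 * n + 4 * t x * lap (rho x) z) + KK n 3 (b x z) * (4 * b x z + 16 * t x * (e3 x z + t x * e4 x z))) +
   2 * KK n 2 (b x z) * grad_inner (rho x) (b x) z + KK n 1 (b x z) * lap (rho x) z)" .
 have alg: "- 1 * (k1 * (2 * n + 4 * T * L) + k2 * (4 * B + 16 * T * (a3 + T * a4))) +
  4 * T * (r * (k2 * (2 * n + 4 * T * L) + k3 * (4 * B + 16 * T * (a3 + T * a4))) +
   2 * k2 * (2 * (r + T) + 2 * a3 + 4 * T * a4) + k1 * L)
  = (- 2 * n * k1 - 4 * B * k2) + 16 * T * ((r + T) * k2) +
   T^2 * (16 * (a4 * k2) + 16 * (r * L * k2) + 64 * (r * (a3 + T * a4) * k3))"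
  if "B * k3 = - (n/2) * k2" for k1 k2 k3 T L B a3 a4 r
 proof -
  have "16 * T * r * (B * k3) = 16 * T * r * (- (n/2) * k2)" using that by simp
  thus ?thesis by (simp add: power2_eq_square algebra_simps)
 qed
 show ?thesis unfolding 1 grad_inner_rho_b S1_def
  by (rule alg[OF KK_recurrence(1)[OF b_pos[OF x z]]])
qed

lemma ord_S1: "ord 2 (1 - n) S1" and ord_S2: "ord 0 (- 1 - n) S2"
proof -
 have K2: "ord 2 (- n) (%x z. KK n 2 (b x z))" using ord_KK[of 2 0] by (simp add: numeral_2_eq_2)
 have K3: "ord 2 (- n - 2) (%x z. KK n 3 (b x z))" using ord_KK[of 2 1] by (simp add: numeral_3_eq_3)
 have K4: "ord 2 (- n - 4) (%x z. KK n 4 (b x z))" using ord_KK[of 2 2] by (simp add: eval_nat_numeral)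
 have r: "ord 2 1 rho" using ord_rho by (rule ord_le) simp
 have rt: "ord 2 1 (%x z. rho x z + t x)" by (intro ord_add r ord_t)
 have e: "ord 2 2 (%x z. e3 x z + t x * e4 x z)"
  using ord_mult[OF ord_t ord_e4] by (intro ord_add ord_e3) simp
 have "ord 2 (1 - n) (%x z. e4 x z * KK n 2 (b x z))" using ord_mult[OF ord_e4 K2] by simp
 moreover have "ord 2 (1 - n) (%x z. rho x z * lap (rho x) z * KK n 2 (b x z))"
  using ord_mult[OF ord_mult[OF r ord_laplacian_rho] K2] by simp
 moreover have "ord 2 (1 - n) (%x z. rho x z * (e3 x z + t x * e4 x z) * KK n 3 (b x z))"
  using ord_mult[OF ord_mult[OF r e] K3] by (simp add: algebra_simps)
 ultimately show "ord 2 (1 - n) S1" unfolding S1_def[abs_def] by (intro ord_add ord_cmult)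
 have "ord 2 (- 1 - n) (%x z. e4 x z * KK n 3 (b x z))" using ord_mult[OF ord_e4 K3] by (simp add: algebra_simps)
 moreover have "ord 2 (- 1 - n) (%x z. (rho x z + t x) * lap (rho x) z * KK n 3 (b x z))"
  using ord_mult[OF ord_mult[OF rt ord_laplacian_rho] K3] by (simp add: algebra_simps)
 moreover have "ord 2 (- 1 - n) (%x z. (rho x z + t x) * (e3 x z + t x * e4 x z) * KK n 4 (b x z))"
  using ord_mult[OF ord_mult[OF rt e] K4] by (simp add: algebra_simps)
 ultimately have "ord 2 (- 1 - n) S2" unfolding S2_def[abs_def] by (intro ord_add ord_cmult)
 thus "ord 0 (- 1 - n) S2" by (rule ord_le) simp
qed

text \<open>The leading part of the Laplacian of \<open>V\<close> is treated like \<open>V\<close>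
  itself: in the half-space it is harmonic, and again the error terms linear in \<open>t x\<close>
  cancel.\<close>

lemma E_eq:
 assumes x: "x : Om" and z: "z : Om"
 shows "E x z = (t x)^2 * (lap (S1 x) z + S2 x z)"
proof -
 have C2: "C_k_on 2 Om (%z. KK n j (b x z))" for j using C4_KK_b[OF x] by (rule C_k_on_le) simp
 have r2: "C_k_on 2 Om (rho x)" by (rule C_k_on_UNIV[OF rho_C4]) simp
 have rt2: "C_k_on 2 Om (%z. rho x z + t x)" by (intro C_k_on_add open_dom r2 C_k_on_const)
 have S2': "C_k_on 2 Om (S1 x)" by (rule ord_C_k_on[OF ord_S1 x])
 \<comment> \<open>The part that depends on \<open>b\<close> alone; the recurrence for
   \<open>KK\<close> reduces its derivative to a single term.\<close>
 define J where "J s = - 2 * n * KK n 1 s - 4 * s * KK n 2 s" for s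
 have dJ: "(J has_real_derivative - 4 * KK n 2 s) (at s)" if s: "0 < s" for s
 proof -
  have "((%s. 4 * s) has_real_derivative 4) (at s)" using DERIV_cmult_Id by blast
  from DERIV_diff[OF DERIV_cmult[OF KK_derivs(2)[OF s], of "- 2 * n"] DERIV_mult[OF this KK_derivs(3)[OF s]]]
  have "(J has_real_derivative (- 2 * n) * KK n 2 s - (4 * KK n 2 s + KK n 3 s * (4 * s))) (at s)"
   by (simp add: J_def[abs_def])
  moreover have "(- 2 * n) * KK n 2 s - (4 * KK n 2 s + KK n 3 s * (4 * s)) = - 4 * KK n 2 s"
  proof -
   have alg: "(- 2 * n) * X - (4 * X + Y * (4 * s)) = (- 2 * n) * X - 4 * X - 4 * (s * Y)"
    "(- 2 * n) * X - 4 * X - 4 * (- (n/2) * X) = - 4 * X" for X Y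
    by (simp_all add: algebra_simps)
   show ?thesis unfolding alg(1) KK_recurrence(1)[OF s] by (rule alg(2))
  qed
  ultimately show ?thesis by (rule DERIV_cong)
 qed
 have dJ2: "((%s. - 4 * KK n 2 s) has_real_derivative - 4 * KK n 3 s) (at s)" if s: "0 < s" for s
  by (intro DERIV_cmult KK_derivs s)
 have JC: "C_k_on 2 Om (%z. J (b x z))"
 proof -
  have "C_k_on 2 Om (b x)" by (rule C_k_on_UNIV[OF b_C4]) simp
  hence "C_k_on 2 Om (%z. (- 2 * n) * KK n 1 (b x z) - 4 * (b x z * KK n 2 (b x z)))"
   by (intro C_k_on_diff C_k_on_cmult C_k_on_mult open_dom C2)
  thus ?thesis by (simp add: J_def mult.assoc)
 qed
 have c1: "C_k_on 2 Om (%z. (rho x z + t x) * KK n 2 (b x z))" by (intro C_k_on_mult open_dom rt2 C2)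
 have c2: "C_k_on 2 Om (%z. (16 * t x) * ((rho x z + t x) * KK n 2 (b x z)))" by (intro C_k_on_cmult open_dom c1)
 have c3: "C_k_on 2 Om (%z. J (b x z) + (16 * t x) * ((rho x z + t x) * KK n 2 (b x z)))" by (intro C_k_on_add open_dom JC c2)
 have c4: "C_k_on 2 Om (%z. (t x)^2 * S1 x z)" by (intro C_k_on_cmult open_dom S2')
 have "E x z = lap (%z. (J (b x z) + (16 * t x) * ((rho x z + t x) * KK n 2 (b x z))) + (t x)^2 * S1 x z) z"
  unfolding E_def by (rule laplacian_cong[OF open_dom z]) (simp add: laplacian_V[OF x] J_def)
 also have "... = lap (%z. J (b x z)) z + (16 * t x) * lap (%z. (rho x z + t x) * KK n 2 (b x z)) z + (t x)^2 * lap (S1 x) z"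
  using laplacian_add[OF open_dom c3 c4 z] laplacian_add[OF open_dom JC c2 z] laplacian_cmult[OF open_dom c1 z, of "16 * t x"]
   laplacian_cmult[OF open_dom S2' z, of "(t x)^2"] by simp
 also note laplacian_comp_b[OF x z dJ dJ2[OF b_pos[OF x z]]]
 also note laplacian_mult_comp_b[OF x z rt2 C2 KK_derivs(3) KK_derivs(4)[OF b_pos[OF x z]]]
 also have "lap (%z. rho x z + t x) z = lap (rho x) z"
  unfolding laplacian_def partial_deriv_add_const ..
 also have "grad_inner (%z. rho x z + t x) (b x) z = grad_inner (rho x) (b x) z"
  unfolding grad_inner_def partial_deriv_add_const ..
 also note grad_inner_rho_b
 finally have 1: "E x z = - 4 * KK n 2 (b x z) * (2 * n + 4 * t x * lap (rho x) z) + - 4 * KK n 3 (b x z) * (4 * b x z + 16 * t x * (e3 x z + t x * e4 x z)) +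
  16 * t x * ((rho x z + t x) * (KK n 3 (b x z) * (2 * n + 4 * t x * lap (rho x) z) + KK n 4 (b x z) * (4 * b x z + 16 * t x * (e3 x z + t x * e4 x z))) +
   2 * KK n 3 (b x z) * (2 * (rho x z + t x) + 2 * e3 x z + 4 * t x * e4 x z) + KK n 2 (b x z) * lap (rho x) z) + (t x)^2 * lap (S1 x) z" .
 have alg: "- 4 * k2 * (2 * n + 4 * T * L) + - 4 * k3 * (4 * B + 16 * T * (a3 + T * a4)) +
  16 * T * (q * (k3 * (2 * n + 4 * T * L) + k4 * (4 * B + 16 * T * (a3 + T * a4))) +
   2 * k3 * (2 * q + 2 * a3 + 4 * T * a4) + k2 * L) + T^2 * LS
  = T^2 * (LS + (64 * (a4 * k3) + 64 * (q * L * k3) + 256 * (q * (a3 + T * a4) * k4)))"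
  if "B * k3 = - (n/2) * k2" "B * k4 = - (n/2 + 1) * k3" for k2 k3 k4 T L B a3 a4 q LS
 proof -
  have "16 * (B * k3) = 16 * (- (n/2) * k2)" "64 * T * q * (B * k4) = 64 * T * q * (- (n/2 + 1) * k3)" using that by simp_all
  thus ?thesis by (simp add: power2_eq_square algebra_simps)
 qed
 show ?thesis unfolding 1 S2_def
  by (rule alg[OF KK_recurrence[OF b_pos[OF x z]]])
qed

text \<open>Each of \<open>e3\<close>, \<open>e4\<close> and the Laplacian of \<open>rho\<close> is
  one order better than its homogeneity suggests. Without this gain the exponent would be
  \<open>- n - 2\<close>, and applying the error kernel would improve nothing.\<close>

lemma E_bound: "EX C>0. ALL x:Om. ALL z:Om. abs (E x z) <= C * (d x)^2 * R x z powr (- n - 1)"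
proof -
 have "ord 0 (1 - n - 2) (%x. lap (S1 x))" using ord_S1 by (intro ord_laplacian) (simp add: numeral_2_eq_2)
 hence "ord 0 (- 1 - n) (%x z. lap (S1 x) z + S2 x z)" by (intro ord_add ord_S2) simp
 from ordD[OF this] obtain C where C: "0 < C" "!!x z. x : Om ==> z : Om ==> abs (lap (S1 x) z + S2 x z) <= C * R x z powr (- 1 - n)"
  by blast
 obtain C' where C': "0 < C'" "!!x z. x : Om ==> z : Om ==> rho x z <= C' * d z" using rho_bounds by blast
 have "abs (E x z) <= (C'^2 * C) * (d x)^2 * R x z powr (- n - 1)" if x: "x : Om" and z: "z : Om" for x z
 proof -
  have "(t x)^2 <= (C' * d x)^2" using C'(2)[OF x x] t_pos[OF x] by (intro power_mono) (auto simp: t_rho)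
  hence "(t x)^2 * abs (lap (S1 x) z + S2 x z) <= (C' * d x)^2 * (C * R x z powr (- 1 - n))"
   using C(2)[OF x z] by (intro mult_mono) auto
  moreover have "- 1 - n = - n - 1" by simp
  ultimately show ?thesis unfolding E_eq[OF x z] by (simp add: abs_mult power_mult_distrib mult_ac)
 qed
 moreover have "0 < C'^2 * C" using C C' by simp
 ultimately show ?thesis by blast
qed

lemma E_continuous: "x : Om ==> continuous_on Om (E x)"
proof -
 assume "x : Om"
 hence "C_k_on (Suc (Suc (Suc (Suc 0)))) Om (V x)" using V_C4 by (simp add: eval_nat_numeral)
 hence "C_k_on 0 Om (lap (lap (V x)))" by (intro C_k_on_laplacian open_dom)
 thus ?thesis by (simp add: E_def[abs_def])
qed

end

text \<open>The remainder of the first-order Taylor expansion of \<open>KK nu 0\<close> at \<open>a + c\<close>, evaluated at \<open>a\<close>;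
 up to a factor this is Boggio's formula in the half-space.\<close>

definition PK :: "real => real => real => real" where
 "PK nu a c = KK nu 0 a - KK nu 0 (a + c) + c * KK nu 1 (a + c)"

text \<open>The integral form of the Taylor remainder. \<open>KK nu 2\<close> is a positive power,
  decreasing for \<open>nu > 0\<close>, so the sign and the bounds of \<open>PK\<close> can be read
  off from the integrand.\<close>

lemma PK_has_integral:
 assumes "0 < a" "0 <= c"
 shows "((%theta. c^2 * theta * KK nu 2 (a + theta * c)) has_integral PK nu a c) {0..1}"
proof -
 define G where "G theta = (c * theta) * KK nu 1 (a + theta * c) - KK nu 0 (a + theta * c)" for theta
 have "(G has_real_derivative c^2 * theta * KK nu 2 (a + theta * c)) (at theta)" if "0 <= theta" for theta
 proof -
  have p: "0 < a + theta * c" using assms that by (simp add: add_pos_nonneg)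
  have l: "((%theta. a + theta * c) has_real_derivative c) (at theta)" "((%theta. c * theta) has_real_derivative c) (at theta)"
   by (auto intro!: derivative_eq_intros)
  have k: "((%theta. KK nu j (a + theta * c)) has_real_derivative KK nu (Suc j) (a + theta * c) * c) (at theta)" for j
   by (rule DERIV_chain2[OF KK_deriv[OF p] l(1)])
  have "(G has_real_derivative (c * KK nu 1 (a + theta * c) + KK nu (Suc 1) (a + theta * c) * c * (c * theta)) - KK nu (Suc 0) (a + theta * c) * c) (at theta)"
   unfolding G_def[abs_def] by (intro DERIV_diff DERIV_mult l(2) k)
  moreover have "(c * KK nu 1 (a + theta * c) + KK nu (Suc 1) (a + theta * c) * c * (c * theta)) - KK nu (Suc 0) (a + theta * c) * c
   = c^2 * theta * KK nu 2 (a + theta * c)"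
   by (simp add: power2_eq_square numeral_2_eq_2 mult_ac)
  ultimately show ?thesis by (rule DERIV_cong)
 qed
 hence "((%theta. c^2 * theta * KK nu 2 (a + theta * c)) has_integral (G 1 - G 0)) {0..1}"
  by (intro fundamental_theorem_of_calculus)
   (auto simp: has_real_derivative_iff_has_vector_derivative[symmetric] intro: has_field_derivative_at_within)
 moreover have "G 1 - G 0 = PK nu a c" by (simp add: G_def PK_def)
 ultimately show ?thesis by simp
qed

lemma KK2: "KK nu 2 s = s powr (- nu/2) / 2"
 by (simp add: KK.simps numeral_2_eq_2)

lemma PK_nonneg: "0 < a ==> 0 <= c ==> 0 <= PK nu a c"
 by (rule has_integral_nonneg[OF PK_has_integral]) (auto simp: KK2)

lemma theta_has_integral: "((%theta. A * theta) has_integral A / 2) {0..1::real}"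
proof -
 have "((%theta. A * theta) has_integral (A * 1^2 / 2 - A * 0^2 / 2)) {0..1::real}"
  by (rule fundamental_theorem_of_calculus)
   (auto simp: has_real_derivative_iff_has_vector_derivative[symmetric] intro!: derivative_eq_intros)
 thus ?thesis by simp
qed

lemma PK_le_1:
 assumes "0 < a" "0 <= c" "0 <= nu" shows "PK nu a c <= c^2 * a powr (- nu/2) / 4"
proof -
 have "PK nu a c <= (c^2 * a powr (- nu/2) / 2) / 2"
 proof (rule has_integral_le[OF PK_has_integral[OF assms(1,2)] theta_has_integral])
  fix theta :: real assume "theta : {0..1}"
  hence "(a + theta * c) powr (- nu/2) <= a powr (- nu/2)" using assms by (intro powr_mono2') auto
  hence "c^2 * theta * ((a + theta * c) powr (- nu/2) / 2) <= c^2 * theta * (a powr (- nu/2) / 2)"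
   using \<open>theta : {0..1}\<close> by (intro mult_left_mono divide_right_mono) auto
  thus "c^2 * theta * KK nu 2 (a + theta * c) <= c^2 * a powr (- nu/2) / 2 * theta" by (simp add: KK2 mult_ac)
 qed
 thus ?thesis by simp
qed

lemma PK_ge_1:
 assumes "0 < a" "0 <= c" "0 <= nu" shows "c^2 * (a + c) powr (- nu/2) / 4 <= PK nu a c"
proof -
 have "(c^2 * (a + c) powr (- nu/2) / 2) / 2 <= PK nu a c"
 proof (rule has_integral_le[OF theta_has_integral PK_has_integral[OF assms(1,2)]])
  fix theta :: real assume t: "theta : {0..1}"
  hence "theta * c <= 1 * c" using assms by (intro mult_right_mono) auto
  moreover have "0 <= theta * c" using t assms by simp
  ultimately have "(a + c) powr (- nu/2) <= (a + theta * c) powr (- nu/2)" using assms by (intro powr_mono2') auto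
  hence "c^2 * theta * ((a + c) powr (- nu/2) / 2) <= c^2 * theta * ((a + theta * c) powr (- nu/2) / 2)"
   using t by (intro mult_left_mono divide_right_mono) auto
  thus "c^2 * (a + c) powr (- nu/2) / 2 * theta <= c^2 * theta * KK nu 2 (a + theta * c)" by (simp add: KK2 mult_ac)
 qed
 thus ?thesis by simp
qed

text \<open>The bound \<open>PK_le_1\<close> has the singularity \<open>a powr (- nu/2)\<close>,
  which is not integrable when \<open>a\<close> is a squared distance in dimension
  \<open>nu\<close>. A quarter power is taken from it and given to \<open>a + c\<close>, at the
  price of \<open>theta powr (-1/4)\<close>, which the factor \<open>theta\<close> pays for.\<close>

lemma PK_le_2:
 assumes "0 < a" "0 <= c" "1 <= nu" shows "PK nu a c <= c^2 * (a powr (- nu/2 + 1/4) * (a + c) powr (-1/4))"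
proof -
 have "PK nu a c <= integral {0..1::real} (%theta. c^2 * (a powr (- nu/2 + 1/4) * (a + c) powr (-1/4)))"
 proof (rule has_integral_le[OF PK_has_integral[OF assms(1,2)] integrable_integral])
  fix theta :: real assume t: "theta : {0..1}"
  show "c^2 * theta * KK nu 2 (a + theta * c) <= c^2 * (a powr (- nu/2 + 1/4) * (a + c) powr (-1/4))"
  proof (cases "theta = 0")
   case False
   hence t0: "0 < theta" "theta <= 1" using t by auto
   have p: "0 < a + theta * c" using assms t0 by (simp add: add_pos_nonneg)
   have m: "theta * (a + c) <= a + theta * c" using t0 assms by (simp add: distrib_left mult_le_cancel_right2)
   have "(a + theta * c) powr (- nu/2) = (a + theta * c) powr (- nu/2 + 1/4) * (a + theta * c) powr (-1/4)"
    by (simp add: powr_add[symmetric])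
   also have "... <= a powr (- nu/2 + 1/4) * (theta * (a + c)) powr (-1/4)"
    using assms t0 m by (intro mult_mono powr_mono2') auto
   also have "(theta * (a + c)) powr (-1/4) = theta powr (-1/4) * (a + c) powr (-1/4)"
    using assms t0 by (intro powr_mult)
   finally have "theta * (a + theta * c) powr (- nu/2) <= theta * (a powr (- nu/2 + 1/4) * (theta powr (-1/4) * (a + c) powr (-1/4)))"
    using t0 by (intro mult_left_mono) auto
   also have "... = (theta powr 1 * theta powr (-1/4)) * (a powr (- nu/2 + 1/4) * (a + c) powr (-1/4))" using t0 by simp
   also have "theta powr 1 * theta powr (-1/4) = theta powr (3/4)"
    by (simp only: powr_add[symmetric]) simp
   also have "theta powr (3/4) * (a powr (- nu/2 + 1/4) * (a + c) powr (-1/4)) <= 1 * (a powr (- nu/2 + 1/4) * (a + c) powr (-1/4))"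
    using t0 by (intro mult_right_mono) (auto intro: powr_le1)
   finally have 1: "theta * (a + theta * c) powr (- nu/2) <= a powr (- nu/2 + 1/4) * (a + c) powr (-1/4)" by simp
   have "theta * KK nu 2 (a + theta * c) <= theta * (a + theta * c) powr (- nu/2)" using t0 by (simp add: KK2)
   hence "theta * KK nu 2 (a + theta * c) <= a powr (- nu/2 + 1/4) * (a + c) powr (-1/4)" using 1 by linarith
   hence "c^2 * (theta * KK nu 2 (a + theta * c)) <= c^2 * (a powr (- nu/2 + 1/4) * (a + c) powr (-1/4))"
    by (intro mult_left_mono) auto
   thus ?thesis by (simp add: mult.assoc)
  qed auto
 qed (rule integrable_const_ivl)
 thus ?thesis by simp
qed

section \<open>The parametrix in the domain\<close>

context smooth_bounded_domain
begin

definition P :: "'a => 'a => real" where "P x z = KK n 0 (sqdist x z) + V x z"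

lemma P_eq_PK: "P x z = PK n (sqdist x z) (4 * t x * rho x z)"
 by (simp add: P_def V_def PK_def b_def mult.assoc)

lemma P_nonneg: assumes "x : Om" "z : Om" "z ~= x" shows "0 <= P x z"
 unfolding P_eq_PK using assms by (intro PK_nonneg sqdist_pos) (auto simp: less_imp_le t_pos rho_pos)

lemma trho_bounds:
 "EX c>0. EX C>0. ALL x:Om. ALL z:Om. c * (d x * d z) <= 4 * t x * rho x z & 4 * t x * rho x z <= C * (d x * d z)"
proof -
 obtain c C where c: "0 < c" "0 < C" "!!x z. x : Om ==> z : Om ==> c * d z <= rho x z"
   "!!x z. x : Om ==> z : Om ==> rho x z <= C * d z"
  using rho_bounds by blast
 have "4 * c^2 * (d x * d z) <= 4 * t x * rho x z & 4 * t x * rho x z <= 4 * C^2 * (d x * d z)" if x: "x : Om" and z: "z : Om" for x z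
 proof -
  have "(c * d x) * (c * d z) <= t x * rho x z" unfolding t_rho using c x z by (intro mult_mono) (auto simp: less_imp_le rho_pos)
  moreover have "(t x) * rho x z <= (C * d x) * (C * d z)" unfolding t_rho using c x z by (intro mult_mono) (auto simp: less_imp_le rho_pos)
  ultimately show ?thesis by (simp add: power2_eq_square mult_ac)
 qed
 moreover have "0 < 4 * c^2" "0 < 4 * C^2" using c by auto
 ultimately show ?thesis by blast
qed

lemma sqdist_powr: "sqdist x z powr p = dist x z powr (2 * p)"
proof -
 have "sqdist x z = dist x z powr 2" by (simp add: sqdist_dist)
 thus ?thesis by (simp only: powr_powr)
qed

lemma P_upper:
 "EX C>0. ALL x:Om. ALL z:Om. z ~= x --> P x z <= C * (d x)^2 * (d z)^2 * (dist x z powr (- n + 1/2) * R x z powr (-1/2))"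
proof -
 obtain C where C: "0 < C" "!!x z. x : Om ==> z : Om ==> 4 * t x * rho x z <= C * (d x * d z)" using trho_bounds by blast
 obtain c where c: "0 < c" "!!x z. x : Om ==> z : Om ==> c * (R x z)^2 <= b x z" using b_bounds by blast
 have "P x z <= (C^2 * c powr (-1/4)) * (d x)^2 * (d z)^2 * (dist x z powr (- n + 1/2) * R x z powr (-1/2))"
  if x: "x : Om" and z: "z : Om" and ne: "z ~= x" for x z
 proof -
  have T0: "0 <= 4 * t x * rho x z" using t_pos[OF x] rho_pos[OF z, of x] by simp
  have R0: "0 < R x z" using R_pos[OF x] .
  have "P x z <= (4 * t x * rho x z)^2 * (sqdist x z powr (- n/2 + 1/4) * (sqdist x z + 4 * t x * rho x z) powr (-1/4))"
   unfolding P_eq_PK using T0 n_ge_1 by (intro PK_le_2 sqdist_pos ne)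
  also have "... <= (C * (d x * d z))^2 * (sqdist x z powr (- n/2 + 1/4) * (c * (R x z)^2) powr (-1/4))"
  proof (intro mult_mono)
   show "(4 * t x * rho x z)^2 <= (C * (d x * d z))^2" using C(2)[OF x z] T0 by (intro power_mono)
   show "(sqdist x z + 4 * t x * rho x z) powr (-1/4) <= (c * (R x z)^2) powr (-1/4)"
    using c(2)[OF x z] c(1) R0 unfolding b_def by (intro powr_mono2') simp_all
  qed simp_all
  also have "sqdist x z powr (- n/2 + 1/4) = dist x z powr (- n + 1/2)"
   unfolding sqdist_powr by (rule arg_cong[of _ _ "%p. dist x z powr p"]) simp
  also have "(c * (R x z)^2) powr (-1/4) = c powr (-1/4) * R x z powr (-1/2)"
  proof -
   have "(R x z)^2 = R x z powr 2" using R0 by simp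
   hence "((R x z)^2) powr (-1/4) = R x z powr (2 * (-1/4))" by (simp only: powr_powr)
   thus ?thesis using c(1) by (simp add: powr_mult)
  qed
  finally show ?thesis by (simp add: power_mult_distrib mult_ac)
 qed
 moreover have "0 < C^2 * c powr (-1/4)" using C c by simp
 ultimately show ?thesis by blast
qed

lemma P_lower: "EX c>0. ALL x:Om. ALL z:Om. z ~= x --> c * (d x)^2 * (d z)^2 * R x z powr (- n) <= P x z"
proof -
 obtain c where c: "0 < c" "!!x z. x : Om ==> z : Om ==> c * (d x * d z) <= 4 * t x * rho x z" using trho_bounds by blast
 obtain C where C: "0 < C" "!!x z. x : Om ==> z : Om ==> b x z <= C * (R x z)^2" using b_bounds by blast
 have "(c^2 * C powr (- n/2) / 4) * (d x)^2 * (d z)^2 * R x z powr (- n) <= P x z"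
  if x: "x : Om" and z: "z : Om" and ne: "z ~= x" for x z
 proof -
  have T0: "0 <= 4 * t x * rho x z" using t_pos[OF x] rho_pos[OF z, of x] by simp
  have R0: "0 < R x z" using R_pos[OF x] .
  have "(C * (R x z)^2) powr (- n/2) = C powr (- n/2) * R x z powr (- n)"
  proof -
   have "(R x z)^2 = R x z powr 2" using R0 by simp
   hence "((R x z)^2) powr (- n/2) = R x z powr (2 * (- n/2))" by (simp only: powr_powr)
   thus ?thesis using C(1) by (simp add: powr_mult)
  qed
  hence "(c^2 * C powr (- n/2) / 4) * (d x)^2 * (d z)^2 * R x z powr (- n) = (c * (d x * d z))^2 * (C * (R x z)^2) powr (- n/2) / 4"
   by (simp add: power_mult_distrib mult_ac)
  also have "... <= (4 * t x * rho x z)^2 * (b x z) powr (- n/2) / 4"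
  proof (intro divide_right_mono mult_mono)
   show "(c * (d x * d z))^2 <= (4 * t x * rho x z)^2" using c(2)[OF x z] c(1) by (intro power_mono) simp_all
   show "(C * (R x z)^2) powr (- n/2) <= b x z powr (- n/2)"
    using C(2)[OF x z] b_pos[OF x z] n_ge_1 by (intro powr_mono2') simp_all
  qed simp_all
  also have "... <= P x z" unfolding P_eq_PK b_def using T0 n_ge_1 by (intro PK_ge_1 sqdist_pos ne) auto
  finally show ?thesis .
 qed
 moreover have "0 < c^2 * C powr (- n/2) / 4" using C c by simp
 ultimately show ?thesis by blast
qed

lemma set_integrable_dist_dom:
 assumes "p < n" "0 < p" shows "integ (%z. dist z x powr (- p))"
 using assms open_dom bounded_dom n_eq by (intro set_integrable_dist_powr) auto

text \<open>The set reaches up to the boundary and across it as long as \<open>b\<close> is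
  positive. So the derivatives of \<open>P x\<close> can be bounded on compact sets that meet the
  boundary.\<close>

lemma P_C4: assumes "x : Om" shows "C_k_on 4 {z. z ~= x & 0 < b x z} (P x)"
proof -
 let ?W = "{z. z ~= x & 0 < b x z}"
 have bc: "continuous_on UNIV (b x)" using b_C4 by (rule C_k_on_imp_continuous)
 have "?W = - {x} \<inter> b x -` {0<..}" by auto
 hence W: "open ?W" using continuous_open_preimage[OF bc, of "{0<..}"] by (auto intro!: open_Int)
 have "C_k_on 4 ?W (%z. KK n j (b x z))" for j
 proof -
  have "C_k_on 4 ?W (%z. KK n (j + 0) (b x z))"
  proof (rule C_k_on_comp[OF W, where h = "%i. KK n (j + i)"])
   show "C_k_on 4 ?W (b x)" using b_C4 by (rule C_k_on_subset) simp
   show "(KK n (j + i) has_real_derivative KK n (j + Suc i) (b x z)) (at (b x z))" if "z : ?W" for i z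
    using KK_deriv[of "b x z" n "j + i"] that by simp
   show "continuous_on (b x ` ?W) (KK n (j + 4))"
    by (rule continuous_on_subset[OF KK_continuous_on]) auto
  qed
  thus ?thesis by simp
 qed
 moreover have "C_k_on 4 ?W (rho x)" by (rule C_k_on_UNIV[OF rho_C4]) simp
 moreover have "C_k_on 4 ?W (%z. KK n 0 (sqdist x z))"
 proof (cases "?W = {}")
  case False
  then obtain z where "z : ?W" by blast
  thus ?thesis using bilaplacian_fundamental(2)[OF W, of 0 x z 4] sqdist_pos by (auto simp: n_eq)
 next
  case True
  thus ?thesis by (rule ssubst) (rule C_k_on_cong[OF open_empty C_k_on_const], simp)
 qed
 ultimately show ?thesis unfolding P_def[abs_def] V_def[abs_def]
  by (intro C_k_on_add C_k_on_minus C_k_on_cmult C_k_on_mult W)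
qed

lemma dom_subset_W: "x : Om ==> Om - {x} \<subseteq> {z. z ~= x & 0 < b x z}"
 using b_pos by auto

lemma P_continuous: "x : Om ==> continuous_on (Om - {x}) (P x)"
 using C_k_on_imp_continuous[OF P_C4] dom_subset_W continuous_on_subset by blast

lemma bilaplacian_P:
 assumes x: "x : Om" and z: "z : Om" "z ~= x" shows "lap (lap (P x)) z = E x z"
proof -
 let ?S = "Om - {x}"
 have op: "open ?S" using open_dom by auto
 have zS: "z : ?S" using z by simp
 have K4: "C_k_on 4 ?S (%z. KK n 0 (sqdist x z))"
  using bilaplacian_fundamental(2)[OF op, of 0 x z 4] sqdist_pos zS by (auto simp: n_eq)
 have V4: "C_k_on 4 ?S (V x)" using V_C4[OF x] by (rule C_k_on_subset) auto
 have K2: "C_k_on 2 ?S (%z. KK n 0 (sqdist x z))" "C_k_on 2 ?S (V x)" using K4 V4 by (auto intro: C_k_on_le)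
 have L2: "C_k_on 2 ?S (lap (%z. KK n 0 (sqdist x z)))" "C_k_on 2 ?S (lap (V x))"
  using C_k_on_laplacian[OF op, of 2] K4 V4 by (auto simp: eval_nat_numeral)
 have "lap (lap (P x)) z = lap (%z. lap (%z. KK n 0 (sqdist x z)) z + lap (V x) z) z"
  by (rule laplacian_cong[OF op zS]) (simp add: P_def[abs_def] laplacian_add[OF op K2])
 also have "... = lap (lap (%z. KK n 0 (sqdist x z))) z + E x z"
  unfolding E_def by (rule laplacian_add[OF op L2 zS])
 also have "lap (lap (%z. KK n 0 (sqdist x z))) z = 0"
  using bilaplacian_fundamental(1)[OF op, of 0 x z] sqdist_pos zS by (auto simp: n_eq)
 finally show ?thesis by simp
qed

end

subsection \<open>Cut-off functions and boundary strips\<close>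

context smooth_bounded_domain
begin

lemma phi_continuous: "continuous_on S ph"
 using C_k_on_imp_continuous[OF phi_C4] by (rule continuous_on_subset) simp

lemma compact_superlevel: "0 < dl ==> compact {z : Om. dl <= ph z}"
proof -
 assume d: "0 < dl"
 have "{z : Om. dl <= ph z} = closure Om \<inter> ph -` {dl..}"
  using phi_frontier d closure_subset[of Om] by (force simp: closure_Un_frontier)
 moreover have "closed (ph -` {dl..})" using phi_continuous[of UNIV] by (intro closed_vimage) auto
 ultimately show ?thesis using bounded_dom by (simp add: compact_Int_closed compact_closure)
qed

lemma open_sublevel: "open {z : Om. ph z < dl}"
proof -
 have "{z : Om. ph z < dl} = Om \<inter> ph -` {..<dl}" by auto
 moreover have "open (ph -` {..<dl})" using phi_continuous[of UNIV] by (intro open_vimage) auto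
 ultimately show ?thesis using open_dom by auto
qed

definition cut :: "real => 'a => real" where "cut dl z = smooth_step 0 (ph z / dl)"

lemma cut_C4: "open S ==> C_k_on 4 S (cut dl)"
proof -
 assume S: "open S"
 have "C_k_on 4 S (%z. inverse dl * ph z)" by (intro C_k_on_cmult S C_k_on_UNIV[OF phi_C4]) simp
 from C_k_on_smooth_step[OF S this] show ?thesis by (simp add: cut_def[abs_def] field_simps)
qed

lemma cut_0: "0 < dl ==> ph z <= dl ==> cut dl z = 0" and cut_1: "0 < dl ==> 2 * dl <= ph z ==> cut dl z = 1"
 by (simp_all add: cut_def smooth_step_0 smooth_step_1 field_simps)

text \<open>On \<open>ph < 16 * dl\<close> the quotient \<open>ph / dl\<close> is bounded and varies
  on the scale \<open>dl\<close>. The number 16 leaves room to use the cuts at \<open>dl / 2\<close>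
  and \<open>2 * dl\<close> together up to \<open>ph = 4 * dl\<close>.\<close>

lemma cut_symb:
 "EX C>0. ALL dl. 0 < dl & dl <= 1 --> symb 4 {z : Om. ph z < 16 * dl} (%_. dl) (%_. C) (cut dl)"
proof -
 obtain C1 where C1: "0 < C1" "symb 4 (cball 0 B) (%_. 1) (%_. C1) ph" using phi_bounded_derivs by blast
 obtain Cs where Cs: "1 <= Cs" "!!j s. j <= 4 ==> abs (smooth_step j s) <= Cs" using smooth_step_bound by blast
 define M where "M = 16 + C1"
 have M: "1 <= M" using C1 by (simp add: M_def)
 have "symb 4 {z : Om. ph z < 16 * dl} (%_. dl) (%_. 2 ^ (4 * 4) * (Cs * M ^ 4)) (cut dl)" if d: "0 < dl" "dl <= 1" for dl
 proof -
  let ?S = "{z : Om. ph z < 16 * dl}"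
  have S: "open ?S" by (rule open_sublevel)
  have sub: "?S \<subseteq> cball 0 B" using dom_subset_cball by auto
  have "symb (Suc 3) ?S (%_. dl) (%_. M) (%z. (1/dl) * ph z)"
   unfolding symb.simps
  proof (intro conjI ballI)
   show "(%z. (1/dl) * ph z) differentiable (at x)" for x by (intro differentiable_mult differentiable_const phi_diff)
   show "abs ((1/dl) * ph x) <= M" if "x : ?S" for x
   proof -
    have "0 < ph x" "ph x < 16 * dl" using that phi_pos by auto
    hence "abs ((1/dl) * ph x) <= 16" using d by (simp add: field_simps abs_mult)
    thus ?thesis using C1(1) by (simp add: M_def)
   qed
   fix c :: 'a assume c: "c : Basis"
   have "symb 3 ?S (%_. 1) (%_. C1) (pd c ph)"
    using symb_subset[OF C1(2) sub] c by (simp add: eval_nat_numeral)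
   hence "symb 3 ?S (%_. dl) (%_. C1 * 1 ^ 3) (pd c ph)" using d C1(1) by (intro symb_rescale) auto
   from symb_cmult[OF S this, of "1/dl"]
   have "symb 3 ?S (%_. dl) (%_. M / dl) (%z. (1/dl) * pd c ph z)"
    by (rule symb_mono) (use d C1(1) in "auto simp: M_def divide_right_mono")
   thus "symb 3 ?S (%_. dl) (%_. M / dl) (pd c (%z. (1/dl) * ph z))"
    by (rule symb_cong[OF S]) (simp only: partial_deriv_cmult[OF phi_diff(1)])
  qed
  hence "symb 4 ?S (%_. dl) (%_. M) (%z. (1/dl) * ph z)" by simp
  from symb_comp[OF S _ _ this, of smooth_step "%_. Cs * M ^ 4"]
  have "symb 4 ?S (%_. dl) (%_. 2 ^ (4 * 4) * (Cs * M ^ 4)) (%z. smooth_step 0 ((1/dl) * ph z))"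
  proof -
   have "abs (smooth_step j s) * M ^ j <= Cs * M ^ 4" if "j <= 4" for j s
    using Cs M that by (intro mult_mono power_increasing) auto
   thus ?thesis
    using symb_comp[OF S _ _ \<open>symb 4 ?S (%_. dl) (%_. M) (%z. (1/dl) * ph z)\<close>, of smooth_step "%_. Cs * M ^ 4"]
     d M smooth_step_deriv smooth_step_continuous by auto
  qed
  thus ?thesis by (simp add: cut_def[abs_def])
 qed
 moreover have "0 < 2 ^ (4 * 4) * (Cs * M ^ 4)" using Cs M by simp
 ultimately show ?thesis by blast
qed

section \<open>Volume of boundary strips\<close>

lemma lap_phi_bounded: "EX C>0. ALL z:Om. abs (lap ph z) <= C"
proof -
 obtain C1 where C1: "0 < C1" "symb 4 (cball 0 B) (%_. 1) (%_. C1) ph" using phi_bounded_derivs by blast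
 have "symb (Suc (Suc 2)) Om (%_. 1) (%_. C1) ph" using symb_subset[OF C1(2) dom_subset_cball] by (simp add: eval_nat_numeral)
 from symb_laplacian[OF open_dom _ this] have "symb 2 Om (%_. 1) (%x. real DIM('a) * (C1 / 1^2)) (lap ph)" by simp
 hence "abs (lap ph z) <= real DIM('a) * C1" if "z : Om" for z using symb_bound that by fastforce
 thus ?thesis using C1 by (intro exI[of _ "real DIM('a) * C1"]) simp
qed

lemma sets_dom [measurable, simp]: "Om : sets borel" using open_dom by auto

lemma emeasure_dom_finite: "emeasure lborel Om < \<infinity>"
 using bounded_dom by (rule emeasure_bounded_finite)

lemma set_integrable_const_dom: "integ (%_. c :: real)"
 using emeasure_dom_finite unfolding set_integrable_def by (intro integrable_scaleR_left) (simp add: integrable_real_indicator)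

lemma set_borel_measurable_cont:
 fixes f :: "'a => real"
 assumes "continuous_on Om f" shows "set_borel_measurable lborel Om f"
 unfolding set_borel_measurable_def using borel_measurable_continuous_on_indicator[OF _ assms] by simp

lemma set_integrable_bounded_cont:
 fixes f :: "'a => real"
 assumes "continuous_on Om f" "!!z. z : Om ==> abs (f z) <= C" shows "integ f"
 by (rule set_integrable_dominated[OF set_integrable_const_dom set_borel_measurable_cont[OF assms(1)] assms(2)])

definition strip :: "real => real => 'a set" where "strip u v = {z : Om. u <= ph z & ph z <= v}"

lemma strip_subset: "strip u v \<subseteq> Om" by (auto simp: strip_def)

lemma sets_strip [measurable, simp]: "strip u v : sets borel"
proof -
 have "strip u v = Om \<inter> ph -` {u..v}" by (auto simp: strip_def)
 moreover have "ph -` {u..v} : sets borel" using phi_continuous[of UNIV] by (intro borel_closed closed_vimage) auto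
 ultimately show ?thesis by simp
qed

lemma emeasure_strip_finite: "emeasure lborel (strip u v) < \<infinity>"
 using emeasure_mono[OF strip_subset, of lborel] emeasure_dom_finite by (auto intro: le_less_trans)

lemma strip_indicator_integral: "(LO z. c * ind (strip u v) z) = c * measure lborel (strip u v)"
  "integ (%z. c * ind (strip u v) z)"
proof -
 have e: "ind Om z *\<^sub>R (c * ind (strip u v) z) = c * ind (strip u v) z" for z
  using strip_subset[of u v] by (auto simp: indicator_def)
 show "(LO z. c * ind (strip u v) z) = c * measure lborel (strip u v)" unfolding set_lebesgue_integral_def e by simp
 show "integ (%z. c * ind (strip u v) z)"
  unfolding set_integrable_def e using emeasure_strip_finite by (intro integrable_mult_right integrable_real_indicator) auto
qed

text \<open>A substitute for the coarea formula. A function \<open>g = h 0 (ph)\<close> that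
  vanishes near the boundary has a Laplacian of integral zero. With \<open>h 0\<close> increasing
  and convex on the scale \<open>dl\<close>, this Laplacian is at least a constant over
  \<open>dl^2\<close> in the strip, by the gradient bound, up to an error \<open>O(1 / dl)\<close>
  everywhere; so the volume is \<open>O(dl)\<close>.\<close>

lemma strip_volume:
 "EX C>0. ALL dl. 0 < dl & dl < m0 / 8 --> measure lborel (strip (dl / 2) (4 * dl)) <= C * dl"
proof -
 obtain L where L: "0 < L" "!!z. z : Om ==> abs (lap ph z) <= L" using lap_phi_bounded by blast
 let ?v = "measure lborel Om"
 have "measure lborel (strip (dl / 2) (4 * dl)) <= (L * ?v * 226^2 / (8 * m0) + 1) * dl" if d: "0 < dl" "dl < m0 / 8" for dl
 proof -
  define a where "a = dl / 4"
  have a: "0 < a" using d by (simp add: a_def)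
  define u where "u s = (s - a) / a" for s
  have u: "(u has_real_derivative 1 / a) (at s)" for s unfolding u_def[abs_def] using a by (auto intro!: derivative_eq_intros)
  have ne: "1 + (u s)^2 ~= 0" for s using zero_le_power2[of "u s"] by linarith
  \<comment> \<open>\<open>s - arctan s\<close> is convex with bounded derivative and vanishes to second order at \<open>0\<close>.\<close>
  define h where "h j s = (if s <= a then 0 else if j = 0 then u s - arctan (u s) else if j = 1 then 1 / a - 1 / a / (1 + (u s)^2)
   else 2 / a^2 * u s / (1 + (u s)^2)^2)" for j :: nat and s
  have ua: "u a = 0" by (simp add: u_def)
  have h: "h 0 = (%s. if s <= a then 0 else u s - arctan (u s))" "h 1 = (%s. if s <= a then 0 else 1 / a - 1 / a / (1 + (u s)^2))"
   "h 2 = (%s. if s <= a then 0 else 2 / a^2 * u s / (1 + (u s)^2)^2)" by (auto simp: h_def)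
  have d0: "((%s. u s - arctan (u s)) has_real_derivative 1 / a - 1 / a / (1 + (u s)^2)) (at s)" for s
   by (rule DERIV_cong[OF DERIV_diff[OF u DERIV_chain2[OF DERIV_arctan u]]]) (simp add: divide_inverse mult.commute)
  have d1: "((%s. 1 / a - 1 / a / (1 + (u s)^2)) has_real_derivative 2 / a^2 * u s / (1 + (u s)^2)^2) (at s)" for s
   using ne[of s] a by (auto intro!: derivative_eq_intros u simp: power2_eq_square)
  have "(h 0 has_real_derivative h 1 s) (at s)" "(h 1 has_real_derivative h 2 s) (at s)" for s
   unfolding h using DERIV_glue[OF DERIV_const d0, of 0 a s] DERIV_glue[OF DERIV_const d1, of 0 a s] by (simp_all only: ua) simp_all
  hence hd: "(h j has_real_derivative h (Suc j) s) (at s)" if "j < 2" for j s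
   using that less_2_cases[of j] by (auto simp only: numeral_2_eq_2 One_nat_def)
  have hc: "continuous_on S (h 2)" for S
  proof -
   have "h 2 = (%s. 2 / a^2 * max 0 (u s) / (1 + (u s)^2)^2)"
    using a by (intro ext) (auto simp: h u_def max_def divide_le_0_iff zero_le_divide_iff)
   moreover have "continuous_on S u" unfolding u_def[abs_def] using a by (intro continuous_intros) auto
   ultimately show ?thesis using ne a by (auto intro!: continuous_intros)
  qed
  have p2: "C_k_on 2 Om ph" by (rule C_k_on_UNIV[OF phi_C4]) simp
  define g where "g z = h 0 (ph z)" for z
  have gC: "C_k_on 2 Om g" unfolding g_def[abs_def] by (rule C_k_on_comp[OF open_dom p2 hd hc])
  have lap: "lap g z = h 1 (ph z) * lap ph z + h 2 (ph z) * grad_inner ph ph z" if "z : Om" for z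
   unfolding g_def[abs_def] using laplacian_comp[OF open_dom p2 that, of "h 0" "h 1" "h 2 (ph z)"] hd[of 0] hd[of 1 "ph z"] by (simp add: numeral_2_eq_2)
  have loc: "EX U. open U & x : U & ((ALL y:U. (1::real) = 0) | (ALL y:U. g y = 0))" if "x : Om - {z : Om. a <= ph z}" for x
   by (rule exI[of _ "{z : Om. ph z < a}"]) (use that open_sublevel[of a] in "auto simp: g_def h_def")
  note G = Green_second[OF open_dom compact_superlevel[OF a] _ C_k_on_const gC loc]
  have G1: "integ (lap g)" "(LO z. lap g z) = 0"
   using G(1) G(3) by (auto simp: set_lebesgue_integral_def)
  define q where "q = 2 / (226^2 * a^2) * m0"
  have q: "0 < q" using a consts_pos by (simp add: q_def)
  have pt: "q * ind (strip (dl/2) (4 * dl)) z + (- L / a) <= lap g z" if z: "z : Om" for z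
  proof -
   have un: "0 <= u s" if "a <= s" for s using that a by (simp add: u_def)
   have g0: "0 <= grad_inner ph ph z" unfolding grad_inner_def by (intro sum_nonneg) auto
   have "0 <= h 1 (ph z)" "h 1 (ph z) <= 1 / a"
    using a by (auto simp: h_def field_simps add_pos_nonneg)
   hence "abs (h 1 (ph z) * lap ph z) <= (1 / a) * L" unfolding abs_mult using L(2)[OF z] L(1) a by (intro mult_mono) auto
   hence 1: "- L / a <= h 1 (ph z) * lap ph z" by (simp add: abs_le_iff)
   have 2: "0 <= h 2 (ph z)" using un[of "ph z"] by (auto simp: h_def)
   have "q <= h 2 (ph z) * grad_inner ph ph z" if "z : strip (dl/2) (4 * dl)"
   proof -
    have p: "2 * a <= ph z" "ph z <= 16 * a" "ph z < m0" using that d by (auto simp: strip_def a_def)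
    have uz: "1 <= u (ph z)" "u (ph z) <= 15" using p a by (simp_all add: u_def field_simps)
    have "1 + (u (ph z))^2 <= 226" using power_mono[OF uz(2), of 2] uz(1) by simp
    hence "(1 + (u (ph z))^2)^2 <= 226^2" by (intro power_mono) auto
    hence "(2 / a^2 * 1) / 226^2 <= (2 / a^2 * u (ph z)) / (1 + (u (ph z))^2)^2"
     using uz a ne[of "ph z"] by (intro frac_le mult_left_mono) auto
    hence "2 / (226^2 * a^2) <= h 2 (ph z)" using p a by (simp add: h_def mult.commute)
    thus ?thesis unfolding q_def using phi_grad[OF z p(3)] consts_pos 2 by (intro mult_mono) auto
   qed
   moreover have "0 <= h 2 (ph z) * grad_inner ph ph z" using 2 g0 by simp
   ultimately show ?thesis unfolding lap[OF z] using 1 by (auto simp: indicator_def)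
  qed
  have "(LO z. q * ind (strip (dl/2) (4 * dl)) z + (- L / a)) <= (LO z. lap g z)"
   by (rule set_integral_mono[OF set_integral_add(1)[OF strip_indicator_integral(2) set_integrable_const_dom] G1(1)]) (rule pt)
  hence "q * measure lborel (strip (dl/2) (4 * dl)) <= L / a * ?v"
   unfolding set_integral_add(2)[OF strip_indicator_integral(2) set_integrable_const_dom] strip_indicator_integral(1) G1(2)
   by (simp add: set_lebesgue_integral_def mult.commute)
  hence "measure lborel (strip (dl/2) (4 * dl)) <= L / a * ?v / q" by (subst pos_le_divide_eq[OF q], subst mult.commute)
  also have "... = (L * ?v * 226^2 / (8 * m0)) * dl" using a consts_pos d by (simp add: q_def a_def field_simps power2_eq_square)
  also have "... <= (L * ?v * 226^2 / (8 * m0) + 1) * dl" using d by (simp add: distrib_right)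
  finally show ?thesis .
 qed
 moreover have "0 < L * ?v * 226^2 / (8 * m0) + 1" using L consts_pos by (simp add: add_nonneg_pos)
 ultimately show ?thesis by blast
qed

section \<open>Boundary behaviour of solutions\<close>

lemma compact_closure_dom: "compact (closure Om)"
 using bounded_dom by (simp add: compact_closure)

lemma closure_dom: "closure Om = Om \<union> frontier Om"
 by (simp add: closure_Un_frontier)

lemma not_in_dom_frontier: "p : frontier Om ==> p \<notin> Om"
 using open_dom by (simp add: frontier_def interior_open)

lemma ball_d_subset: "x : Om ==> ball x (d x) \<subseteq> Om"
 using bdist_le_dist[of x Om] by force

lemma boundary_limit_uniform:
 fixes w :: "'a => real"
 assumes "!!p. p : frontier Om ==> (w ---> 0) (at p within Om)" "0 < eps"
 shows "EX dl>0. ALL z:Om. d z < dl --> abs (w z) <= eps"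
proof -
 have "EX m>0. ALL z:closure Om. z : Om --> d z < m --> abs (w z) <= eps"
 proof (rule compact_uniform[OF compact_closure_dom])
  fix q assume q: "q : closure Om"
  show "EX e>0. EX m>0. ALL z:ball q e. z : Om --> d z < m --> abs (w z) <= eps"
  proof (cases "q : Om")
   case True
   have "\<not> d z < d q / 2" if "z : ball q (d q / 2)" for z using that d_lipschitz[of q z] by auto
   thus ?thesis using d_pos[OF True] half_gt_zero by blast
  next
   case False
   hence "q : frontier Om" using q closure_dom by blast
   from assms(1)[OF this] assms(2) obtain e where "0 < e" "!!z. z : Om ==> z ~= q ==> dist z q < e ==> abs (w z) < eps"
    unfolding Lim_within by auto
   hence "ALL z:ball q e. z : Om --> d z < 1 --> abs (w z) <= eps"
    using False by (metis dist_commute less_imp_le mem_ball)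
   thus ?thesis using \<open>0 < e\<close> zero_less_one by blast
  qed
 qed auto
 thus ?thesis using closure_subset by blast
qed

lemma compact_inner: "compact {z : Om. dl <= d z}" if "0 < dl"
proof -
 have "{z : Om. dl <= d z} = closure Om \<inter> d -` {dl..}"
 proof -
  have "d p = 0" if "p : frontier Om" for p using that by (simp add: bdist_def)
  thus ?thesis using \<open>0 < dl\<close> closure_dom by force
 qed
 moreover have "closed (d -` {dl..})"
  by (intro closed_vimage) (auto simp: bdist_def[abs_def] intro!: continuous_intros)
 ultimately show ?thesis using compact_closure_dom by (simp add: compact_Int_closed)
qed

lemma bounded_of_boundary_limits:
 fixes w :: "'a => real"
 assumes "continuous_on Om w" "!!p. p : frontier Om ==> (w ---> 0) (at p within Om)"
 shows "EX C>0. ALL z:Om. abs (w z) <= C"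
proof -
 obtain dl where d: "0 < dl" "!!z. z : Om ==> d z < dl ==> abs (w z) <= 1" using boundary_limit_uniform[OF assms(2), of 1] by auto
 have "compact (w ` {z : Om. dl <= d z})"
  by (intro compact_continuous_image compact_inner d(1) continuous_on_subset[OF assms(1)]) auto
 then obtain a where a: "!!z. z : Om ==> dl <= d z ==> abs (w z) <= a"
  unfolding compact_eq_bounded_closed bounded_real by blast
 have "abs (w z) <= max a 1" if "z : Om" for z using a[OF that] d(2)[OF that] by (cases "d z < dl") auto
 thus ?thesis by (intro exI[of _ "max a 1"]) auto
qed

lemma sol_C4: "sols f u ==> C_k_on 4 Om u"
 and sol_eq: "sols f u ==> z : Om ==> lap (lap u) z = f z"
 and sol_lim: "sols f u ==> p : frontier Om ==> (u ---> 0) (at p within Om)"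
 and sol_lim_partial: "sols f u ==> p : frontier Om ==> c : Basis ==>
   (pd c u ---> 0) (at p within Om)"
 by (simp_all add: solves_biharmonic_dirichlet_def)

lemma sol_continuous: "sols f u ==> continuous_on Om u"
 using sol_C4 C_k_on_imp_continuous by blast

lemma sol_diff: "sols f u ==> z : Om ==> u differentiable (at z)"
 using sol_C4 by (auto simp: eval_nat_numeral)

lemma sol_bounded: "sols f u ==> EX C>0. ALL z:Om. abs (u z) <= C"
 by (rule bounded_of_boundary_limits[OF sol_continuous sol_lim])

text \<open>A mean value estimate towards the nearest boundary point, inside the ball of radius
  \<open>d z\<close>. The boundary value exists only as a limit, so points \<open>y k\<close> of the
  ball approach it.\<close>

lemma sol_bdry_Lipschitz:
 assumes "sols f u" "z : Om"
  and "!!y c. y : ball z (d z) ==> c : Basis ==> abs (pd c u y) <= K"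
 shows "abs (u z) <= n * K * d z"
proof -
 obtain p where p: "p : frontier Om" "d z = dist z p"
  using infdist_attains_inf[of "frontier Om" z] frontier_ne unfolding bdist_def by auto
 define y where "y k = z + (1 - inverse (real (Suc k))) *\<^sub>R (p - z)" for k
 have dz: "0 < d z" using d_pos[OF assms(2)] .
 have yz: "dist z (y k) = (1 - inverse (real (Suc k))) * d z" for k
 proof -
  have "inverse (real (Suc k)) <= 1" by (simp add: field_simps)
  thus ?thesis using p(2) by (simp add: y_def dist_norm norm_minus_commute)
 qed
 have yb: "y k : ball z (d z)" for k
 proof -
  have "0 < inverse (real (Suc k)) * d z" using dz by simp
  hence "dist z (y k) < d z" unfolding yz[of k] left_diff_distrib by linarith
  thus ?thesis by simp
 qed
 have yl: "y ----> p"
 proof -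
  have "y ----> z + (1 - 0) *\<^sub>R (p - z)" unfolding y_def by (intro tendsto_intros LIMSEQ_inverse_real_of_nat)
  thus ?thesis by simp
 qed
 have "(%k. u (y k)) ----> 0"
 proof -
  have "filterlim y (at p within Om) sequentially"
  proof -
   have yO: "y k : Om" for k using yb ball_d_subset[OF assms(2)] by blast
   hence "y k ~= p" for k using not_in_dom_frontier[OF p(1)] by metis
   thus ?thesis unfolding filterlim_at using yl yO by simp
  qed
  thus ?thesis by (rule filterlim_compose[OF sol_lim[OF assms(1) p(1)]])
 qed
 hence "(%k. abs (u z - u (y k))) ----> abs (u z - 0)" by (intro tendsto_intros)
 moreover have "abs (u z - u (y k)) <= n * K * d z" for k
 proof -
  have "abs (u z - u (y k)) <= real DIM('a) * K * norm (z - y k)"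
  proof (rule Lipschitz_from_partials[OF convex_ball _ assms(3)])
   show "u differentiable (at x)" if "x : ball z (d z)" for x
    using sol_diff[OF assms(1)] ball_d_subset[OF assms(2)] that by blast
  qed (use yb dz in auto)
  also have "... <= real DIM('a) * K * d z"
  proof (rule mult_left_mono)
   show "norm (z - y k) <= d z" using yb[of k] by (simp add: dist_norm)
   obtain c :: 'a where "c : Basis" using nonempty_Basis by blast
   hence "abs (pd c u z) <= K" using assms(3)[of z c] dz by simp
   thus "0 <= real DIM('a) * K" by (auto intro: order_trans[OF abs_ge_zero])
  qed
  finally show ?thesis by (simp add: n_eq)
 qed
 ultimately have "abs (u z - 0) <= n * K * d z" by (intro LIMSEQ_le_const2) auto
 thus ?thesis by simp
qed

text \<open>The gradient tends to zero uniformly at the boundary. The resulting \<open>o(d)\<close>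
  is all that the boundary conditions give directly, and just enough for the representation
  formula.\<close>

lemma sol_little_o:
 assumes "sols f u" "0 < eps"
 shows "EX dl>0. ALL z:Om. d z < dl --> abs (u z) <= eps * d z"
proof -
 have e: "0 < eps / n" using assms(2) n_ge_1 by simp
 have "ALL c:Basis. EX dl>0. ALL z:Om. d z < dl --> abs (pd c u z) <= eps / n"
  using boundary_limit_uniform[OF sol_lim_partial[OF assms(1)] e] by blast
 then obtain dl where D: "!!c. c : Basis ==> 0 < dl c" "!!c z. c : Basis ==> z : Om ==> d z < dl c ==> abs (pd c u z) <= eps / n"
  by metis
 define m where "m = Min (dl ` Basis)"
 have m: "0 < m" "!!c. c : Basis ==> m <= dl c" using D(1) by (auto simp: m_def)
 have "abs (u z) <= eps * d z" if z: "z : Om" "d z < m / 2" for z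
 proof -
  have "abs (u z) <= n * (eps / n) * d z"
  proof (rule sol_bdry_Lipschitz[OF assms(1) z(1)])
   fix y c :: 'a assume y: "y : ball z (d z)" and c: "c : Basis"
   have "d y < m" using d_lipschitz[of y z] y z(2) by (simp add: dist_commute)
   thus "abs (pd c u y) <= eps / n"
    using D(2)[OF c _ less_le_trans[OF _ m(2)[OF c]]] ball_d_subset[OF z(1)] y by blast
  qed
  thus ?thesis using n_ge_1 by simp
 qed
 thus ?thesis using m(1) half_gt_zero by blast
qed

text \<open>\<open>P x\<close> vanishes to second order at the boundary. At the scale
  \<open>dl\<close> it is therefore a symbol of weight \<open>dl^2\<close>, and so is its product
  with the cut-off; four derivatives cost \<open>dl^(-4)\<close>.\<close>

lemma cut_P_bound:
 assumes x: "x : Om"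
 shows "EX C>0. EX dl0>0. ALL dl z. 0 < dl & dl < dl0 & z : strip dl (2 * dl) -->
   abs (lap (lap (%z. cut dl z * P x z)) z) <= C / dl^2"
proof -
 \<comment> \<open>The bound \<open>ph x / 16\<close> keeps the region \<open>ph < 8 * dl\<close>
   away from \<open>x\<close>; the last one keeps the balls of radius \<open>d z / 2\<close>, on
   which the gradient is interpolated, inside \<open>N\<close>.\<close>
 define dl0 where "dl0 = min 1 (min (ph x / 16) (c0 * ph x / (24 * C0)))"
 have d0: "0 < dl0" using phi_pos[OF x] consts_pos by (simp add: dl0_def)
 let ?W = "{z. z ~= x & 0 < b x z}"
 define N where "N = closure Om \<inter> ph -` {..ph x / 2}"
 have Nc: "compact N"
  unfolding N_def using phi_continuous[of UNIV] compact_closure_dom by (intro compact_Int_closed closed_vimage) auto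
 have phi0: "0 <= ph z" if "z : closure Om" for z
  using that closure_dom phi_pos phi_frontier by (force simp: less_imp_le)
 have xN: "x \<notin> N" using phi_pos[OF x] by (simp add: N_def)
 have NW: "N \<subseteq> ?W"
 proof
  fix z assume z: "z : N"
  hence ne: "z ~= x" using xN by blast
  have "0 <= rho x z" using phi0[of z] z slope_pos[of x] by (simp add: rho_def N_def)
  thus "z : ?W" using sqdist_pos[OF ne] ne t_pos[OF x] by (simp add: b_def add_pos_nonneg)
 qed
 have W: "open ?W"
 proof -
  have "?W = - {x} \<inter> b x -` {0<..}" by auto
  moreover have "continuous_on UNIV (b x)" using b_C4 by (rule C_k_on_imp_continuous)
  ultimately show ?thesis using continuous_open_preimage[of UNIV "b x" "{0<..}"] by (auto intro!: open_Int)
 qed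
 obtain C1 where C1: "0 < C1" "symb 4 N (%_. 1) (%_. C1) (P x)"
  using C_k_on_bounded_compact[OF Nc C_k_on_subset[OF P_C4[OF x] NW]] by blast
 obtain a0 where a0: "0 < a0" "!!z. z : N ==> a0 <= sqdist x z"
 proof (cases "N = {}")
  case True thus thesis using that[of 1] by simp
 next
  case False
  have "continuous_on N (sqdist x)" using C_k_on_imp_continuous[OF C_k_on_sqdist[of UNIV 0 x]] by (rule continuous_on_subset) auto
  from continuous_attains_inf[OF Nc False this] obtain q where "q : N" "!!z. z : N ==> sqdist x q <= sqdist x z" by blast
  thus thesis using that[of "sqdist x q"] sqdist_pos[of q x] xN by blast
 qed
 obtain C2 where C2: "0 < C2" "!!dl. 0 < dl ==> dl <= 1 ==> symb 4 {z : Om. ph z < 16 * dl} (%_. dl) (%_. C2) (cut dl)"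
  using cut_symb by blast
 define T where "T = 4 * t x * inverse (slope x)"
 have T: "0 < T" using t_pos[OF x] slope_pos[of x] by (simp add: T_def)
 have Tr: "4 * t x * rho x z = T * ph z" for z by (simp add: T_def rho_def)
 define K1 where "K1 = T^2 * a0 powr (- n/2) / 4"
 define K2 where "K2 = (9 * K1 * C0^2 + n * C1) * (8 / c0)"
 have K0: "0 <= K1" "0 <= K2" using T a0 C1 consts_pos n_ge_1 by (auto simp: K1_def K2_def intro!: mult_nonneg_nonneg add_nonneg_nonneg)
 have P0: "abs (P x z) <= K1 * s^2" if z: "z : N" "z : Om" "ph z <= s" for z s
 proof -
  have zx: "z ~= x" using z(1) xN by blast
  have "P x z <= (T * ph z)^2 * sqdist x z powr (- n/2) / 4"
   unfolding P_eq_PK Tr using T phi_pos[OF z(2)] n_ge_1 by (intro PK_le_1 sqdist_pos zx) auto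
  also have "... <= (T * s)^2 * a0 powr (- n/2) / 4"
   using T phi_pos[OF z(2)] z(3) a0 z(1) n_ge_1
   by (intro divide_right_mono mult_mono power_mono mult_left_mono powr_mono2') auto
  also have "... = K1 * s^2" by (simp add: K1_def power_mult_distrib)
  finally show ?thesis using P_nonneg[OF x z(2) zx] by simp
 qed
 have PN: "P x differentiable (at y)" "c : Basis ==> pd c (P x) differentiable (at y)"
  "c : Basis ==> c' : Basis ==> abs (pd c' (pd c (P x)) y) <= C1" if "y : N" for y c c'
  using C1(2) that by (auto simp: eval_nat_numeral)
 text \<open>Interpolation: \<open>P x\<close> is at most quadratic in \<open>ph\<close> and has bounded second derivatives, so its gradient is at most linear.\<close>
 have P1: "abs (pd c (P x) z) <= K2 * dl" if z: "z : Om" "ph z < 8 * dl" "dl < dl0" and c: "c : Basis" for z dl c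
 proof -
  define h where "h = d z / 2"
  have h: "0 < h" "c0 * (2 * h) < 8 * dl" using d_pos[OF z(1)] phi_lower[OF z(1)] z(2) by (auto simp: h_def)
  have y: "y : N" "y : Om" "ph y <= C0 * (3 * h)" if "y : cball z h" for y
  proof -
   show yO: "y : Om" using that ball_d_subset[OF z(1)] h(1) by (force simp: h_def)
   have "d y <= 3 * h" using d_lipschitz[of y z] that by (simp add: h_def dist_commute)
   thus *: "ph y <= C0 * (3 * h)" using phi_upper[OF yO] consts_pos by (meson mult_left_mono less_imp_le order_trans)
   have "dl < c0 * ph x / (24 * C0)" using z(3) by (simp add: dl0_def)
   hence "24 * C0 * dl < c0 * ph x" using consts_pos by (simp add: pos_less_divide_eq mult.commute)
   moreover have "C0 * (c0 * (2 * h)) < C0 * (8 * dl)" using h(2) consts_pos by simp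
   ultimately have "c0 * (C0 * (3 * h)) < c0 * (ph x / 2)" by (simp add: algebra_simps)
   hence "C0 * (3 * h) < ph x / 2" using consts_pos by simp
   thus "y : N" using * yO closure_subset by (auto simp: N_def)
  qed
  have yc: "z + s *\<^sub>R c : cball z h" if "0 <= s" "s <= h" for s using that c by (simp add: dist_norm)
  have "EX s. 0 < s & s < h & P x (z + h *\<^sub>R c) - P x (z + 0 *\<^sub>R c) = (h - 0) * pd c (P x) (z + s *\<^sub>R c)"
   by (rule MVT2[OF h(1)], rule partial_deriv_line, rule PN(1)) (use y(1) yc in auto)
  then obtain s where s: "0 < s" "s < h" "P x (z + h *\<^sub>R c) - P x z = h * pd c (P x) (z + s *\<^sub>R c)" by auto
  let ?y = "z + s *\<^sub>R c"
  have "abs (P x (z + h *\<^sub>R c)) <= K1 * (C0 * (3 * h))^2" "abs (P x z) <= K1 * (C0 * (3 * h))^2"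
   using P0 y yc[of h] yc[of 0] h(1) by auto
  moreover have "h * abs (pd c (P x) ?y) = abs (P x (z + h *\<^sub>R c) - P x z)" using s(3) h(1) by (simp add: abs_mult)
  ultimately have "h * abs (pd c (P x) ?y) <= 2 * (K1 * (C0 * (3 * h))^2)" by linarith
  also have "... = h * (18 * K1 * C0^2 * h)" by (simp add: power2_eq_square)
  finally have "h * abs (pd c (P x) ?y) <= h * (18 * K1 * C0^2 * h)" .
  hence 1: "abs (pd c (P x) ?y) <= 18 * K1 * C0^2 * h" using h(1) by simp
  have "abs (pd c (P x) z - pd c (P x) ?y) <= real DIM('a) * C1 * norm (z - ?y)"
   by (rule Lipschitz_from_partials[OF convex_cball[of z h]]) (use PN y(1) yc[of 0] yc[of s] s h(1) c in "simp_all")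
  also have "... <= n * C1 * (2 * h)" unfolding n_eq[symmetric] using n_ge_1 C1(1) s c by (intro mult_left_mono) auto
  finally have "abs (pd c (P x) z) <= (9 * K1 * C0^2 + n * C1) * (2 * h)" using 1 by (simp add: algebra_simps)
  also have "... <= (9 * K1 * C0^2 + n * C1) * (8 / c0 * dl)"
   using h(2) K0 C1 n_ge_1 consts_pos by (intro mult_left_mono) (auto simp: pos_le_divide_eq mult.commute)
  finally show ?thesis by (simp only: K2_def mult.assoc)
 qed
 define K where "K = 64 * K1 + K2 + C1"
 have main: "abs (lap (lap (%z. cut dl z * P x z)) z) <= (real DIM('a) * (real DIM('a) * (2 ^ 4 * (C2 * K)))) / dl^2"
  if d: "0 < dl" "dl < dl0" and z: "z : strip dl (2 * dl)" for dl z
 proof -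
  let ?S = "{z : Om. ph z < 8 * dl}"
  have S: "open ?S" by (rule open_sublevel)
  have d1: "dl <= 1" using d by (simp add: dl0_def)
  have SN: "?S \<subseteq> N" using d closure_subset by (auto simp: N_def dl0_def)
  have "symb (Suc (Suc 2)) ?S (%_. dl) (%_. K * dl^2) (P x)"
   unfolding symb.simps(2)
  proof (intro conjI ballI)
   fix y assume y: "y : ?S"
   show "P x differentiable (at y)" using PN(1) y SN by blast
   have "K1 * (8 * dl)^2 <= K * dl^2" using K0 C1 by (auto simp: K_def power_mult_distrib algebra_simps)
   thus "abs (P x y) <= K * dl^2" using P0[of y "8 * dl"] y SN by force
   fix c :: 'a assume c: "c : Basis"
   show "pd c (P x) differentiable (at y)" using PN(2) y SN c by blast
   have "K2 * dl <= K * dl" using K0 C1 d by (intro mult_right_mono) (auto simp: K_def)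
   moreover have "abs (pd c (P x) y) <= K2 * dl" using P1[of y dl c] y c d by auto
   moreover have "K * dl^2 / dl = K * dl" using d by (simp add: power2_eq_square)
   ultimately show "abs (pd c (P x) y) <= K * dl^2 / dl" by linarith
  next
   fix c c' :: 'a assume c: "c : Basis" "c' : Basis"
   have "symb 2 ?S (%_. 1) (%_. C1) (pd c' (pd c (P x)))"
    using symb_subset[OF C1(2) SN] c by (simp add: eval_nat_numeral)
   hence "symb 2 ?S (%_. dl) (%_. C1 * 1 ^ 2) (pd c' (pd c (P x)))"
    using d d1 C1(1) by (intro symb_rescale) auto
   thus "symb 2 ?S (%_. dl) (%_. K * dl^2 / dl / dl) (pd c' (pd c (P x)))"
    by (rule symb_mono) (use d K0 in "auto simp: K_def power2_eq_square")
  qed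
  hence "symb 4 ?S (%_. dl) (%_. K * dl^2) (P x)" by (simp add: eval_nat_numeral)
  note PS = this
  have CS: "symb 4 ?S (%_. dl) (%_. C2) (cut dl)" by (rule symb_subset[OF C2(2)[OF d(1) d1]]) (use d in auto)
  have "symb 4 ?S (%_. dl) (%_. 2 ^ 4 * (C2 * (K * dl^2))) (%z. cut dl z * P x z)"
   by (rule symb_mult[OF S _ CS PS]) (use d in auto)
  hence "symb (Suc (Suc (Suc (Suc 0)))) ?S (%_. dl) (%_. 2 ^ 4 * (C2 * (K * dl^2))) (%z. cut dl z * P x z)"
   using d by (simp add: eval_nat_numeral)
  from symb_laplacian[OF S _ symb_laplacian[OF S _ this]]
  have "symb 0 ?S (%_. dl) (%_. real DIM('a) * (real DIM('a) * (2 ^ 4 * (C2 * (K * dl^2)) / dl^2) / dl^2)) (lap (lap (%z. cut dl z * P x z)))"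
   using d by simp
  moreover have "z : ?S" using z d by (auto simp: strip_def)
  ultimately have "abs (lap (lap (%z. cut dl z * P x z)) z) <= real DIM('a) * (real DIM('a) * (2 ^ 4 * (C2 * (K * dl^2)) / dl^2) / dl^2)"
   by auto
  also have "... = (real DIM('a) * (real DIM('a) * (2 ^ 4 * (C2 * K)))) / dl^2" using d by simp
  finally show ?thesis .
 qed
 have "0 < real DIM('a) * (real DIM('a) * (2 ^ 4 * (C2 * K)))" using C1 C2 K0 by (simp add: K_def add_nonneg_pos)
 thus ?thesis using main d0 by blast
qed

end

subsection \<open>The representation formula\<close>

context smooth_bounded_domain
begin

lemma set_borel_measurable_off_point:
 fixes g :: "'a => real"
 assumes "continuous_on (Om - {x}) g" shows "set_borel_measurable lborel Om g"
proof -
 have "(%z. ind (Om - {x}) z *\<^sub>R g z) : borel_measurable borel"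
  using open_dom by (intro borel_measurable_continuous_on_indicator assms) auto
 hence "(%z. ind (Om - {x}) z *\<^sub>R g z + ind {x} z * (ind Om x * g x)) : borel_measurable borel"
  by measurable
 moreover have "(%z. ind (Om - {x}) z *\<^sub>R g z + ind {x} z * (ind Om x * g x)) = (%z. ind Om z *\<^sub>R g z)"
  by (auto simp: indicator_def)
 ultimately show ?thesis by (simp add: set_borel_measurable_def)
qed

lemma E_bounded: assumes "x : Om" shows "EX C>0. ALL z:Om. abs (E x z) <= C"
proof -
 obtain C where C: "0 < C" "!!z. z : Om ==> abs (E x z) <= C * (d x)^2 * R x z powr (- n - 1)" using E_bound assms by blast
 have "abs (E x z) <= C * (d x)^2 * d x powr (- n - 1)" if z: "z : Om" for z
 proof -
  have "R x z powr (- n - 1) <= d x powr (- n - 1)" using R_ge(2)[of x z] d_pos[OF assms] n_ge_1 by (intro powr_mono2') auto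
  hence "C * (d x)^2 * R x z powr (- n - 1) <= C * (d x)^2 * d x powr (- n - 1)" using C by (intro mult_left_mono) auto
  thus ?thesis using C(2)[OF z] by linarith
 qed
 moreover have "0 < C * (d x)^2 * d x powr (- n - 1)" using C d_pos[OF assms] by simp
 ultimately show ?thesis by blast
qed

lemma E_u_integrable:
 assumes "x : Om" "continuous_on Om u" "!!z. z : Om ==> abs (u z) <= M"
 shows "integ (%z. E x z * u z)"
proof -
 obtain C where C: "0 < C" "!!z. z : Om ==> abs (E x z) <= C" using E_bounded[OF assms(1)] by blast
 show ?thesis
 proof (rule set_integrable_bounded_cont)
  show "continuous_on Om (%z. E x z * u z)" using E_continuous assms by (intro continuous_intros)
  show "abs (E x z * u z) <= C * M" if "z : Om" for z unfolding abs_mult using C assms(3)[OF that] that by (intro mult_mono) auto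
 qed
qed

lemma P_le_dist:
 assumes "x : Om" shows "EX C>0. ALL z:Om. z ~= x --> P x z <= C * dist z x powr (- (n - 1/2))"
proof -
 obtain C where C: "0 < C" "!!z. z : Om ==> z ~= x ==>
   P x z <= C * (d x)^2 * (d z)^2 * (dist x z powr (- n + 1/2) * R x z powr (-1/2))" using P_upper assms by blast
 have "P x z <= (C * (d x)^2 * Dm^2 * d x powr (-1/2)) * dist z x powr (- (n - 1/2))" if z: "z : Om" "z ~= x" for z
 proof -
  have dD: "d z <= Dm" using R_ge(3)[of z x] R_le_Dm[OF assms z(1)] by linarith
  have "C * (d x)^2 * (d z)^2 * (dist x z powr (- n + 1/2) * R x z powr (-1/2))
    <= C * (d x)^2 * Dm^2 * (dist x z powr (- n + 1/2) * d x powr (-1/2))"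
   using C(1) dD R_ge(2)[of x z] d_pos[OF assms] by (intro mult_mono mult_left_mono power_mono powr_mono2') auto
  moreover have "- n + 1/2 = - (n - 1/2)" by simp
  ultimately show ?thesis using C(2)[OF z] by (simp add: dist_commute mult_ac)
 qed
 moreover have "0 < C * (d x)^2 * Dm^2 * d x powr (-1/2)" using C d_pos[OF assms] Dm_ge_1 by simp
 ultimately show ?thesis by blast
qed

lemma P_f_integrable:
 assumes x: "x : Om" and f: "continuous_on Om f" "!!z. z : Om ==> abs (f z) <= F"
 shows "integ (%z. P x z * f z)"
proof -
 obtain C where C: "0 < C" "!!z. z : Om ==> z ~= x ==> P x z <= C * dist z x powr (- (n - 1/2))" using P_le_dist[OF x] by blast
 have F0: "0 <= F" using f(2)[OF x] by linarith
 have p: "0 < n - 1/2" "n - 1/2 < n" using n_ge_1 by linarith+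
 have i: "integ (%z. (C * F) * dist z x powr (- (n - 1/2)) + ind {x} z * abs (P x x * f x))"
 proof (rule set_integral_add(1))
  show "integ (%z. (C * F) * dist z x powr (- (n - 1/2)))"
   using set_integrable_dist_dom[OF p(2,1), of x] by simp
  show "integ (%z. ind {x} z * abs (P x x * f x))"
  proof -
   have "integrable lborel (ind {x})" by (intro integrable_real_indicator) auto
   hence "integrable lborel (%z. ind {x} z * (ind Om x * abs (P x x * f x)))" by (rule integrable_mult_left)
   moreover have "ind {x} z * (ind Om x * abs (P x x * f x)) = ind Om z *\<^sub>R (ind {x} z * abs (P x x * f x))" for z
    by (auto simp: indicator_def)
   ultimately show ?thesis unfolding set_integrable_def by simp
  qed
 qed
 show ?thesis
 proof (rule set_integrable_dominated[OF i])
  show "set_borel_measurable lborel Om (%z. P x z * f z)"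
   by (rule set_borel_measurable_off_point[of x])
    (intro continuous_on_mult P_continuous x continuous_on_subset[OF f(1)]; blast)
  fix z assume z: "z : Om"
  show "abs (P x z * f z) <= (C * F) * dist z x powr (- (n - 1/2)) + ind {x} z * abs (P x x * f x)"
  proof (cases "z = x")
   case True thus ?thesis using C(1) F0 by (simp add: mult_nonneg_nonneg)
  next
   case False
   have "abs (P x z * f z) = P x z * abs (f z)" using P_nonneg[OF x z False] by (simp add: abs_mult)
   also have "... <= (C * dist z x powr (- (n - 1/2))) * F"
    using C(1) C(2)[OF z False] f(2)[OF z] F0 by (intro mult_mono) auto
   finally show ?thesis using False by (simp add: mult_ac)
  qed
 qed
qed

lemma sol_f_continuous: assumes "sols f u" shows "continuous_on Om f"
proof -
 have "C_k_on (Suc (Suc (Suc (Suc 0)))) Om u" using sol_C4[OF assms] by (simp add: eval_nat_numeral)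
 hence "C_k_on 0 Om (lap (lap u))" by (intro C_k_on_laplacian open_dom)
 hence "continuous_on Om (lap (lap u))" by simp
 thus ?thesis by (rule continuous_on_eq) (rule sol_eq[OF assms])
qed

text \<open>Green's representation with the parametrix in place of the Green function, on \<open>{ph > dl}\<close>.\<close>

lemma representation_cut:
 assumes sol: "sols f u" and F: "!!z. z : Om ==> abs (f z) <= F" and x: "x : Om"
 obtains dl1 w1 w2 where "0 < dl1" "continuous_on Om w1" "continuous_on Om w2" "!!z. z : Om ==> u z = w1 z + w2 z"
  and "!!dl. 0 < dl ==> dl < dl1 ==>
   integ (%z. ind (strip dl (2 * dl)) z * (lap (lap (%z. cut dl z * P x z)) z * u z)) &
   (LO z. cut dl z * P x z * f z) = fsol_const TYPE('a) * u x + (LO z. E x z * w1 z)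
    + (LO z. ind {z. 2 * dl < ph z} z * (E x z * w2 z))
    + (LO z. ind (strip dl (2 * dl)) z * (lap (lap (%z. cut dl z * P x z)) z * u z))"
  and "EX M. ALL z:Om. abs (w1 z) <= M & abs (w2 z) <= M"
proof -
 have px: "0 < ph x" by (rule phi_pos[OF x])
 have "open (Om \<inter> ph -` {ph x / 2<..})" using phi_continuous[of UNIV] open_dom by (intro open_Int open_vimage) auto
 moreover have "x : Om \<inter> ph -` {ph x / 2<..}" using x px by simp
 ultimately obtain r where r: "0 < r" "cball x r \<subseteq> Om \<inter> ph -` {ph x / 2<..}"
  unfolding open_contains_cball by blast
 have rO: "cball x r \<subseteq> Om" using r(2) by blast
 \<comment> \<open>\<open>u\<close> is split by a bump at \<open>x\<close>: \<open>w1\<close> has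
   compact support and meets the singularity, so the fundamental solution applies to it;
   \<open>w2\<close> vanishes near \<open>x\<close>, so Green's identity applies to it and the
   cut-off kernel.\<close>
 define eta where "eta = bump x r"
 have eC: "C_k_on 4 Om eta" unfolding eta_def by (rule C_k_on_bump[OF open_dom])
 have e1: "eta z = 1" if "dist x z <= r / 2" for z unfolding eta_def by (rule bump_eq_1[OF r(1) that])
 have e0: "eta z = 0" if "r <= dist x z" for z unfolding eta_def by (rule bump_eq_0[OF r(1) that])
 define w1 where "w1 z = eta z * u z" for z
 define w2 where "w2 z = (1 - eta z) * u z" for z
 have uC: "C_k_on 4 Om u" by (rule sol_C4[OF sol])
 have w1C: "C_k_on 4 Om w1" unfolding w1_def by (intro C_k_on_mult open_dom eC uC)
 have w2C: "C_k_on 4 Om w2" unfolding w2_def by (intro C_k_on_mult C_k_on_diff C_k_on_const open_dom eC uC)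
 have Lc: "continuous_on Om (lap (lap w))" if "C_k_on 4 Om w" for w
 proof -
  have "C_k_on (Suc (Suc (Suc (Suc 0)))) Om w" using that by (simp add: eval_nat_numeral)
  hence "C_k_on 0 Om (lap (lap w))" by (intro C_k_on_laplacian open_dom)
  thus ?thesis by simp
 qed
 have L0: "lap (lap w) z = 0" if "open U" "z : U" "!!y. y : U ==> w y = 0" for w :: "'a => real" and z U
  by (rule partial_deriv_0_nbhd(2)[OF that(1,2)], rule partial_deriv_0_nbhd(2)[OF that(1)]) (use that in auto)
 have w10: "w1 z = 0" if "z : Om - cball x r" for z using that e0[of z] by (simp add: w1_def)
 have Lw10: "lap (lap w1) z = 0" if "z : Om - cball x r" for z
  by (rule L0[of "Om - cball x r"]) (use that w10 open_dom in auto)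
 have sumf: "lap (lap w1) z + lap (lap w2) z = f z" if z: "z : Om" for z
 proof -
  have "lap u y = lap w1 y + lap w2 y" if y: "y : Om" for y
  proof -
   have "lap u y = lap (%z. w1 z + w2 z) y"
    by (rule laplacian_cong[OF open_dom y]) (simp add: w1_def w2_def algebra_simps)
   also have "... = lap w1 y + lap w2 y"
    by (rule laplacian_add[OF open_dom _ _ y]) (rule C_k_on_le[OF w1C] C_k_on_le[OF w2C]; simp)+
   finally show ?thesis .
  qed
  hence "lap (lap u) z = lap (%y. lap w1 y + lap w2 y) z"
   by (rule laplacian_cong[OF open_dom z])
  also have "... = lap (lap w1) z + lap (lap w2) z"
  proof (rule laplacian_add[OF open_dom _ _ z])
   show "C_k_on 2 Om (lap w1)" "C_k_on 2 Om (lap w2)"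
    using C_k_on_laplacian[OF open_dom, of 2] w1C w2C by (auto simp: eval_nat_numeral)
  qed
  finally show ?thesis using sol_eq[OF sol z] by simp
 qed
 note FS = fundamental_solution[OF open_dom compact_cball rO w1C w10 x]
 have iK: "integ (%z. KK n 0 (sqdist x z) * lap (lap w1) z)"
  and eK: "(LO z. KK n 0 (sqdist x z) * lap (lap w1) z) = fsol_const TYPE('a) * u x"
 proof -
  have "w1 x = u x" using e1[of x] r(1) by (simp add: w1_def)
  thus "integ (%z. KK n 0 (sqdist x z) * lap (lap w1) z)"
   "(LO z. KK n 0 (sqdist x z) * lap (lap w1) z) = fsol_const TYPE('a) * u x"
   using FS by (simp_all add: n_eq)
 qed
 have iV: "integ (%z. V x z * lap (lap w1) z)"
  by (rule compact_support_integrable[OF open_dom compact_cball rO])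
   (use Lw10 in "auto intro!: continuous_intros Lc w1C C_k_on_imp_continuous[OF V_C4[OF x]]")
 have eV: "(LO z. V x z * lap (lap w1) z) = (LO z. E x z * w1 z)"
 proof -
  have "(LO z. V x z * lap (lap w1) z) = (LO z. lap (lap (V x)) z * w1 z)"
  proof (rule Green_fourth[OF open_dom compact_cball rO V_C4[OF x] w1C])
   fix z assume "z : Om - cball x r"
   thus "EX U. open U & z : U & ((ALL y:U. V x y = 0) | (ALL y:U. w1 y = 0))"
    using w10 open_dom by (intro exI[of _ "Om - cball x r"]) auto
  qed
  thus ?thesis by (simp add: E_def)
 qed
 have iP1: "integ (%z. P x z * lap (lap w1) z)"
  and eP1: "(LO z. P x z * lap (lap w1) z) = fsol_const TYPE('a) * u x + (LO z. E x z * w1 z)"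
  using set_integral_add[OF iK iV] eK eV by (simp_all add: P_def distrib_right)
 obtain M where M: "0 < M" "!!z. z : Om ==> abs (u z) <= M" using sol_bounded[OF sol] by blast
 obtain Cs where Cs: "1 <= Cs" "!!j s. j <= 4 ==> abs (smooth_step j s) <= Cs" using smooth_step_bound by blast
 have eb: "abs (eta z) <= 1 + Cs" "abs (1 - eta z) <= 1 + Cs" for z
  using Cs(2)[of 0 "2 * sqdist x z / r^2"] Cs(1) unfolding eta_def bump_def by (simp_all add: abs_le_iff)
 have wM: "abs (w1 z) <= (1 + Cs) * M" "abs (w2 z) <= (1 + Cs) * M" if "z : Om" for z
  unfolding w1_def w2_def abs_mult using eb M that Cs(1) by (intro mult_mono; auto)+
 have wc: "continuous_on Om w1" "continuous_on Om w2" using w1C w2C by (auto intro: C_k_on_imp_continuous)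
 have iw2: "integ (%z. E x z * w2 z)" by (rule E_u_integrable[OF x wc(2) wM(2)])
 have ball0: "w2 y = 0" if "y : ball x (r / 2)" for y using e1[of y] that by (simp add: w2_def)
 show thesis
 proof (rule that[of "ph x / 4" w1 w2])
  show "u z = w1 z + w2 z" for z by (simp add: w1_def w2_def algebra_simps)
  show "EX M. ALL z:Om. abs (w1 z) <= M & abs (w2 z) <= M" using wM by blast
  fix dl assume d: "0 < dl" "dl < ph x / 4"
  let ?G = "%z. cut dl z * P x z"
  let ?A = "%z. ind (strip dl (2 * dl)) z * (lap (lap ?G) z * u z)"
  let ?S = "Om - {x}"
  \<comment> \<open>Off this compact set either the cut-off or \<open>w2\<close> vanishes
    locally.\<close>
  let ?C = "{z : Om. dl <= ph z} - ball x (r / 2)"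
  have S: "open ?S" using open_dom by auto
  have Cc: "compact ?C" using compact_superlevel[OF d(1)] by (rule compact_diff) simp
  have CS: "?C \<subseteq> ?S" using r(1) by auto
  have far: "2 * dl < ph z & z : Om" if "dist x z <= r" for z
  proof -
   have "z : cball x r" using that by simp
   hence "ph x / 2 < ph z" "z : Om" using r(2) by auto
   thus ?thesis using d by simp
  qed
  have G4: "C_k_on 4 ?S ?G"
   by (intro C_k_on_mult S cut_C4 C_k_on_subset[OF P_C4[OF x] dom_subset_W[OF x]])
  have w2S: "C_k_on 4 ?S w2" using w2C by (rule C_k_on_subset) auto
  have loc: "EX U. open U & z : U & ((ALL y:U. ?G y = 0) | (ALL y:U. w2 y = 0))" if z: "z : ?S - ?C" for z
  proof (cases "z : ball x (r / 2)")
   case True thus ?thesis using ball0 by (intro exI[of _ "ball x (r/2)"]) auto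
  next
   case False
   hence "ph z < dl" using z by auto
   thus ?thesis using open_sublevel[of dl] z cut_0[OF d(1)] by (intro exI[of _ "{z : Om. ph z < dl}"]) auto
  qed
  have G0: "lap (lap ?G) z = 0" if "z : Om" "ph z < dl" for z
   by (rule L0[OF open_sublevel[of dl]]) (use that cut_0[OF d(1)] in auto)
  have GE: "lap (lap ?G) z = E x z" if z: "z : Om" "2 * dl < ph z" "z ~= x" for z
  proof -
   let ?U = "Om \<inter> ph -` {2 * dl<..}"
   have U: "open ?U" using phi_continuous[of UNIV] open_dom by (intro open_Int open_vimage) auto
   have "lap ?G y = lap (P x) y" if "y : ?U" for y
    by (rule laplacian_cong[OF U that]) (use cut_1[OF d(1)] in auto)
   hence "lap (lap ?G) z = lap (lap (P x)) z"
    by (rule laplacian_cong[OF U, rotated]) (use z in auto)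
   thus ?thesis using bilaplacian_P[OF x z(1,3)] by simp
  qed
  have w2x: "w2 x = 0" "lap (lap w2) x = 0"
   using ball0[of x] L0[of "ball x (r/2)" x w2] ball0 r(1) by auto
  have conv: "ind ?S z *\<^sub>R g z = ind Om z *\<^sub>R g z" if "g x = 0" for g :: "'a => real" and z
   using that by (auto simp: indicator_def)
  have C4S: "continuous_on ?S (lap (lap ?G))" "continuous_on ?S ?G" "continuous_on ?S w2" "continuous_on ?S (lap (lap w2))"
  proof -
   have "C_k_on (Suc (Suc (Suc (Suc 0)))) ?S ?G" using G4 by (simp add: eval_nat_numeral)
   hence "C_k_on 0 ?S (lap (lap ?G))" by (intro C_k_on_laplacian S)
   thus "continuous_on ?S (lap (lap ?G))" by simp
   show "continuous_on ?S ?G" using G4 by (rule C_k_on_imp_continuous)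
   show "continuous_on ?S w2" using wc(2) by (rule continuous_on_subset) auto
   show "continuous_on ?S (lap (lap w2))" using Lc[OF w2C] by (rule continuous_on_subset) auto
  qed
  have zero: "?G z * lap (lap w2) z = 0" "lap (lap ?G) z * w2 z = 0" if z: "z : ?S - ?C" for z
  proof -
   obtain U where U: "open U" "z : U" "(ALL y:U. ?G y = 0) | (ALL y:U. w2 y = 0)" using loc[OF z] by blast
   show "?G z * lap (lap w2) z = 0"
   proof (cases "ALL y:U. ?G y = 0")
    case True thus ?thesis using U(2) by simp
   next
    case False
    hence "!!y. y : U ==> w2 y = 0" using U(3) by blast
    from L0[OF U(1,2) this] show ?thesis by simp
   qed
   show "lap (lap ?G) z * w2 z = 0"
   proof (cases "ALL y:U. ?G y = 0")
    case True thus ?thesis using L0[OF U(1,2), of ?G] by simp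
   next
    case False
    hence "w2 z = 0" using U(2,3) by blast
    thus ?thesis by simp
   qed
  qed
  note i2 = compact_support_integrable(1)[OF S Cc CS continuous_on_mult[OF C4S(2) C4S(4)] zero(1)]
    compact_support_integrable(1)[OF S Cc CS continuous_on_mult[OF C4S(1) C4S(3)] zero(2)]
  have conv1: "ind ?S z *\<^sub>R (?G z * lap (lap w2) z) = ind Om z *\<^sub>R (?G z * lap (lap w2) z)" for z
   by (rule conv) (simp add: w2x)
  have conv2: "ind ?S z *\<^sub>R (lap (lap ?G) z * w2 z) = ind Om z *\<^sub>R (lap (lap ?G) z * w2 z)" for z
   by (rule conv) (simp add: w2x)
  have i2': "integ (%z. ?G z * lap (lap w2) z)" "integ (%z. lap (lap ?G) z * w2 z)"
   using i2 unfolding set_integrable_def conv1 conv2 by simp_all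
  have e2: "(LO z. ?G z * lap (lap w2) z) = (LO z. lap (lap ?G) z * w2 z)"
   using Green_fourth[OF S Cc CS G4 w2S loc] unfolding set_lebesgue_integral_def conv1 conv2 .
  have c1: "?G z * lap (lap w1) z = P x z * lap (lap w1) z" if z: "z : Om" for z
  proof (cases "dist x z <= r")
   case True thus ?thesis using far[OF True] cut_1[OF d(1), of z] by simp
  next
   case False thus ?thesis using Lw10[of z] z by simp
  qed
  have i1: "integ (%z. ?G z * lap (lap w1) z)"
   by (rule set_integrable_cong[THEN iffD2, OF refl refl c1 iP1])
  have "(LO z. ?G z * f z) = (LO z. ?G z * lap (lap w1) z + ?G z * lap (lap w2) z)"
   using sumf by (intro set_lebesgue_integral_cong) (auto simp: distrib_left[symmetric])
  also have "... = (LO z. ?G z * lap (lap w1) z) + (LO z. ?G z * lap (lap w2) z)"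
   by (rule set_integral_add(2)[OF i1 i2'(1)])
  also have "(LO z. ?G z * lap (lap w1) z) = (LO z. P x z * lap (lap w1) z)"
   by (rule set_lebesgue_integral_cong) (use c1 in auto)
  finally have 1: "(LO z. ?G z * f z) = fsol_const TYPE('a) * u x + (LO z. E x z * w1 z)
    + (LO z. lap (lap ?G) z * w2 z)" unfolding eP1 e2 .
  \<comment> \<open>Below the strip the cut-off is 0; above it the cut-off is 1 and the bilaplacian
    of the kernel is \<open>E\<close>. What is left lives in the strip, where
    \<open>w2 = u\<close>.\<close>
  have split: "lap (lap ?G) z * w2 z - ind {z. 2 * dl < ph z} z * (E x z * w2 z) = ?A z" if z: "z : Om" for z
  proof -
   consider "ph z < dl" | "z : strip dl (2 * dl)" | "2 * dl < ph z" using z by (force simp: strip_def)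
   thus ?thesis
   proof cases
    case 1 thus ?thesis using G0[OF z 1] d by (simp add: strip_def)
   next
    case 2
    hence "\<not> dist x z <= r" using far[of z] by (auto simp: strip_def)
    hence "eta z = 0" using e0[of z] by simp
    thus ?thesis using 2 by (simp add: w2_def strip_def)
   next
    case 3
    thus ?thesis using GE[OF z 3] w2x(1) by (cases "z = x") (auto simp: strip_def)
   qed
  qed
  have iE: "integ (%z. ind {z. 2 * dl < ph z} z * (E x z * w2 z))"
  proof -
   have "{z. 2 * dl < ph z} = ph -` {2 * dl<..}" by auto
   hence [measurable]: "{z. 2 * dl < ph z} : sets borel" using phi_continuous[of UNIV] by (auto intro!: borel_open open_vimage)
   have m: "(%z. ind Om z *\<^sub>R (E x z * w2 z)) : borel_measurable lborel" using iw2 unfolding set_integrable_def by auto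
   have "(%z. ind {z. 2 * dl < ph z} z * (ind Om z *\<^sub>R (E x z * w2 z))) : borel_measurable lborel"
    using m by measurable
   hence m2: "set_borel_measurable lborel Om (%z. ind {z. 2 * dl < ph z} z * (E x z * w2 z))"
    unfolding set_borel_measurable_def by (simp add: mult_ac)
   have "integ (%z. abs (E x z * w2 z))" using iw2 by (rule set_integrable_abs)
   thus ?thesis by (rule set_integrable_dominated[OF _ m2]) (auto simp: indicator_def)
  qed
  have iA: "integ ?A"
   using set_integral_diff(1)[OF i2'(2) iE] by (rule set_integrable_cong[THEN iffD1, rotated 3]) (use split in auto)
  have "(LO z. lap (lap ?G) z * w2 z) - (LO z. ind {z. 2 * dl < ph z} z * (E x z * w2 z))
    = (LO z. ?A z)"
   unfolding set_integral_diff(2)[OF i2'(2) iE, symmetric] by (rule set_lebesgue_integral_cong) (use split in auto)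
  thus "integ ?A & (LO z. cut dl z * P x z * f z) = fsol_const TYPE('a) * u x + (LO z. E x z * w1 z)
    + (LO z. ind {z. 2 * dl < ph z} z * (E x z * w2 z)) + (LO z. ?A z)"
   using 1 iA by simp
 qed (use px wc in auto)
qed

lemma strip_mono: "u <= u' ==> v' <= v ==> strip u' v' \<subseteq> strip u v"
 by (auto simp: strip_def)

lemma strip_term_bound:
 assumes "integ (%z. ind (strip u v) z * g z)" "!!z. z : strip u v ==> abs (g z) <= K" "0 <= K"
 shows "abs (LO z. ind (strip u v) z * g z) <= K * measure lborel (strip u v)"
proof -
 have e: "ind Om z *\<^sub>R (ind (strip u v) z * g z) = ind (strip u v) z * g z" for z
  using strip_subset[of u v] by (auto simp: indicator_def)
 have "abs (LO z. ind (strip u v) z * g z) <= (LINT z|lborel. K * ind (strip u v) z)"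
  unfolding set_lebesgue_integral_def
 proof (rule Bochner_Integration.integral_abs_bound_integral)
  show "integrable lborel (%z. ind Om z *\<^sub>R (ind (strip u v) z * g z))"
   using assms(1) unfolding set_integrable_def .
  show "integrable lborel (%z. K * ind (strip u v) z)"
   using emeasure_strip_finite by (intro integrable_mult_right integrable_real_indicator) auto
  show "abs (ind Om z *\<^sub>R (ind (strip u v) z * g z)) <= K * ind (strip u v) z" for z
   unfolding e using assms(2,3) by (auto simp: indicator_def)
 qed
 thus ?thesis by simp
qed

lemma cut_measurable [measurable]: "cut dl : borel_measurable borel"
 using C_k_on_imp_continuous[OF cut_C4[of UNIV dl]] by (simp add: borel_measurable_continuous_onI)

lemma phi_measurable [measurable]: "ph : borel_measurable borel"
 using phi_continuous by (rule borel_measurable_continuous_onI)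

lemma cut_integral_limit:
 assumes h: "integ h" and e: "!!k. 0 < e k" "e ----> 0"
 shows "(%k. LO z. cut (e k) z * h z) ----> (LO z. h z)"
proof -
 obtain Cs where Cs: "1 <= Cs" "!!j s. j <= 4 ==> abs (smooth_step j s) <= Cs" using smooth_step_bound by blast
 show ?thesis
  unfolding set_lebesgue_integral_def
 proof (rule integral_dominated_convergence[where w = "%z. Cs * abs (ind Om z *\<^sub>R h z)"])
  show m [measurable]: "(%z. ind Om z *\<^sub>R h z) : borel_measurable lborel" using h unfolding set_integrable_def by auto
  have "(%z. cut (e k) z * (ind Om z *\<^sub>R h z)) : borel_measurable lborel" for k by measurable
  thus "(%z. ind Om z *\<^sub>R (cut (e k) z * h z)) : borel_measurable lborel" for k by (simp add: mult_ac)
  show "integrable lborel (%z. Cs * abs (ind Om z *\<^sub>R h z))"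
   using h unfolding set_integrable_def by (intro integrable_mult_right integrable_abs)
  show "AE z in lborel. norm (ind Om z *\<^sub>R (cut (e k) z * h z)) <= Cs * abs (ind Om z *\<^sub>R h z)" for k
  proof (rule AE_I2)
   fix z
   have "abs (cut (e k) z) * abs (ind Om z *\<^sub>R h z) <= Cs * abs (ind Om z *\<^sub>R h z)"
    using Cs(2)[of 0] by (intro mult_right_mono) (auto simp: cut_def)
   thus "norm (ind Om z *\<^sub>R (cut (e k) z * h z)) <= Cs * abs (ind Om z *\<^sub>R h z)"
    by (simp add: abs_mult mult_ac)
  qed
  show "AE z in lborel. (%k. ind Om z *\<^sub>R (cut (e k) z * h z)) ----> ind Om z *\<^sub>R h z"
  proof (rule AE_I2)
   fix z
   show "(%k. ind Om z *\<^sub>R (cut (e k) z * h z)) ----> ind Om z *\<^sub>R h z"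
   proof (cases "z : Om")
    case True
    have "\<forall>\<^sub>F k in sequentially. e k < ph z / 2" by (rule order_tendstoD(2)[OF e(2)]) (use phi_pos[OF True] in simp)
    hence "\<forall>\<^sub>F k in sequentially. ind Om z *\<^sub>R h z = ind Om z *\<^sub>R (cut (e k) z * h z)"
     by eventually_elim (use cut_1 e(1) in simp)
    thus ?thesis by (rule tendsto_eventually[THEN tendsto_cong[THEN iffD1, rotated], rotated]) simp
   qed simp
  qed
 qed
qed

text \<open>In the strip the bilaplacian of the cut-off kernel is \<open>O(dl^(-2))\<close>,
  \<open>u\<close> is \<open>o(dl)\<close> and the volume is \<open>O(dl)\<close>; so the strip term
  vanishes in the limit.\<close>

theorem representation:
 assumes sol: "sols f u" and F: "!!z. z : Om ==> abs (f z) <= F" and x: "x : Om"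
 shows "fsol_const TYPE('a) * u x + (LO z. E x z * u z) = (LO z. P x z * f z)"
proof -
 let ?A = "%dl z. lap (lap (%z. cut dl z * P x z)) z * u z"
 obtain dl1 w1 w2 where d1: "0 < dl1" and wc: "continuous_on Om w1" "continuous_on Om w2" and uw: "!!z. z : Om ==> u z = w1 z + w2 z"
  and iAeA: "!!dl. 0 < dl ==> dl < dl1 ==> integ (%z. ind (strip dl (2 * dl)) z * ?A dl z) &
   (LO z. cut dl z * P x z * f z) = fsol_const TYPE('a) * u x + (LO z. E x z * w1 z)
    + (LO z. ind {z. 2 * dl < ph z} z * (E x z * w2 z))
    + (LO z. ind (strip dl (2 * dl)) z * ?A dl z)"
  and wM: "EX M. ALL z:Om. abs (w1 z) <= M & abs (w2 z) <= M"
  by (rule representation_cut[OF sol F x], assumption) (rule that, assumption+)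
 note iA = iAeA[THEN conjunct1] and eA = iAeA[THEN conjunct2]
 obtain M where M: "!!z. z : Om ==> abs (w1 z) <= M" "!!z. z : Om ==> abs (w2 z) <= M" using wM by blast
 obtain C dl0 where C: "0 < C" "0 < dl0" "!!dl z. 0 < dl ==> dl < dl0 ==> z : strip dl (2 * dl) ==>
   abs (lap (lap (%z. cut dl z * P x z)) z) <= C / dl^2" using cut_P_bound[OF x] by blast
 obtain Cv where Cv: "0 < Cv" "!!dl. 0 < dl ==> dl < m0 / 8 ==> measure lborel (strip (dl / 2) (4 * dl)) <= Cv * dl"
  using strip_volume by blast
 define D where "D = min (min dl1 dl0) (m0 / 8)"
 have D: "0 < D" using d1 C consts_pos by (simp add: D_def)
 define e where "e k = D * inverse (real (Suc (Suc k)))" for k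
 have e0: "0 < e k" "e k < D" for k
 proof -
  show "0 < e k" using D by (simp add: e_def)
  have "inverse (real (Suc (Suc k))) < 1" by (simp add: field_simps)
  thus "e k < D" using D by (simp add: e_def)
 qed
 have eD: "e k < dl1" "e k < dl0" "e k < m0 / 8" for k using e0(2)[of k] by (auto simp: D_def)
 have elim: "e ----> 0"
 proof -
  have "(%k. inverse (real (Suc (Suc k)))) ----> 0" using LIMSEQ_Suc[OF LIMSEQ_inverse_real_of_nat] .
  from tendsto_mult_left[OF this, of D] show ?thesis by (simp add: e_def[abs_def])
 qed
 have small: "\<forall>\<^sub>F k in sequentially. e k < s" if "0 < s" for s using elim that by (rule order_tendstoD(2))
 have iPf: "integ (%z. P x z * f z)" by (rule P_f_integrable[OF x sol_f_continuous[OF sol] F])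
 have iE1: "integ (%z. E x z * w1 z)" by (rule E_u_integrable[OF x wc(1) M(1)])
 have iE2: "integ (%z. E x z * w2 z)" by (rule E_u_integrable[OF x wc(2) M(2)])
 have L1: "(%k. LO z. cut (e k) z * P x z * f z) ----> (LO z. P x z * f z)"
  using cut_integral_limit[OF iPf e0(1) elim] by (simp add: mult.assoc)
 have L2: "(%k. LO z. ind {z. 2 * e k < ph z} z * (E x z * w2 z)) ----> (LO z. E x z * w2 z)"
  unfolding set_lebesgue_integral_def
 proof (rule integral_dominated_convergence[where w = "%z. abs (ind Om z *\<^sub>R (E x z * w2 z))"])
  have m [measurable]: "(%z. ind Om z *\<^sub>R (E x z * w2 z)) : borel_measurable lborel" using iE2 unfolding set_integrable_def by auto
  show "(%z. ind Om z *\<^sub>R (E x z * w2 z)) : borel_measurable lborel" by (rule m)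
  have "(%z. ind {z. 2 * e k < ph z} z * (ind Om z *\<^sub>R (E x z * w2 z))) : borel_measurable lborel" for k by measurable
  thus "(%z. ind Om z *\<^sub>R (ind {z. 2 * e k < ph z} z * (E x z * w2 z))) : borel_measurable lborel" for k by (simp add: mult_ac)
  show "integrable lborel (%z. abs (ind Om z *\<^sub>R (E x z * w2 z)))"
   using iE2 unfolding set_integrable_def by (intro integrable_abs)
  show "AE z in lborel. norm (ind Om z *\<^sub>R (ind {z. 2 * e k < ph z} z * (E x z * w2 z))) <= abs (ind Om z *\<^sub>R (E x z * w2 z))" for k
   by (rule AE_I2) (auto simp: indicator_def)
  show "AE z in lborel. (%k. ind Om z *\<^sub>R (ind {z. 2 * e k < ph z} z * (E x z * w2 z))) ----> ind Om z *\<^sub>R (E x z * w2 z)"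
  proof (rule AE_I2)
   fix z
   show "(%k. ind Om z *\<^sub>R (ind {z. 2 * e k < ph z} z * (E x z * w2 z))) ----> ind Om z *\<^sub>R (E x z * w2 z)"
   proof (cases "z : Om")
    case True
    have "\<forall>\<^sub>F k in sequentially. e k < ph z / 2" by (rule small) (use phi_pos[OF True] in simp)
    hence "\<forall>\<^sub>F k in sequentially. ind Om z *\<^sub>R (E x z * w2 z) = ind Om z *\<^sub>R (ind {z. 2 * e k < ph z} z * (E x z * w2 z))"
     by eventually_elim simp
    thus ?thesis by (rule tendsto_eventually[THEN tendsto_cong[THEN iffD1, rotated], rotated]) simp
   qed simp
  qed
 qed
 have L3: "(%k. LO z. ind (strip (e k) (2 * e k)) z * ?A (e k) z) ----> 0"
 proof (rule LIMSEQ_I)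
  fix s :: real assume s: "0 < s"
  \<comment> \<open>The product of these three bounds, apart from the factor \<open>eps\<close>; the
    powers of \<open>e k\<close> cancel.\<close>
  define Q where "Q = 2 * C * Cv / c0"
  have Q: "0 < Q" using C Cv consts_pos by (simp add: Q_def)
  define eps where "eps = s / 2 / Q"
  have ep: "0 < eps" using s Q by (simp add: eps_def)
  obtain dl' where d': "0 < dl'" "!!z. z : Om ==> d z < dl' ==> abs (u z) <= eps * d z" using sol_little_o[OF sol ep] by blast
  have "\<forall>\<^sub>F k in sequentially. e k < c0 * dl' / 2" by (rule small) (use d' consts_pos in simp)
  then obtain N where N: "!!k. N <= k ==> e k < c0 * dl' / 2" unfolding eventually_sequentially by blast
  have "norm ((LO z. ind (strip (e k) (2 * e k)) z * ?A (e k) z) - 0) < s" if k: "N <= k" for k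
  proof -
   let ?K = "C / (e k)^2 * (eps * (2 * e k / c0))"
   have K0: "0 <= ?K" using C ep e0(1)[of k] consts_pos by simp
   have "abs (LO z. ind (strip (e k) (2 * e k)) z * ?A (e k) z) <= ?K * measure lborel (strip (e k) (2 * e k))"
   proof (rule strip_term_bound[OF iA[OF e0(1) eD(1)] _ K0])
    fix z assume z: "z : strip (e k) (2 * e k)"
    hence zO: "z : Om" "ph z <= 2 * e k" by (auto simp: strip_def)
    have "c0 * d z <= 2 * e k" using phi_lower[OF zO(1)] zO(2) by linarith
    hence dz: "d z <= 2 * e k / c0" using consts_pos by (simp add: field_simps)
    also have "... < dl'" using N[OF k] consts_pos by (simp add: field_simps)
    finally have "abs (u z) <= eps * d z" by (rule d'(2)[OF zO(1)])
    also have "... <= eps * (2 * e k / c0)" using dz ep by (intro mult_left_mono) auto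
    finally have "abs (u z) <= eps * (2 * e k / c0)" .
    moreover have "0 <= C / (e k)^2" using C(1) by simp
    ultimately show "abs (?A (e k) z) <= ?K"
     unfolding abs_mult using C(3)[OF e0(1) eD(2) z] by (intro mult_mono) auto
   qed
   also have "... <= ?K * (Cv * e k)"
   proof (rule mult_left_mono[OF _ K0])
    have "measure lborel (strip (e k) (2 * e k)) <= measure lborel (strip (e k / 2) (4 * e k))"
     using e0(1)[of k] emeasure_strip_finite by (intro measure_mono_fmeasurable strip_mono) (auto simp: fmeasurable_def)
    thus "measure lborel (strip (e k) (2 * e k)) <= Cv * e k" using Cv(2)[OF e0(1) eD(3), of k] by linarith
   qed
   also have "... = Q * eps" using e0(1)[of k] by (simp add: Q_def power2_eq_square)
   also have "... < s" using Q s by (simp add: eps_def)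
   finally show ?thesis by simp
  qed
  thus "EX N. ALL k>=N. norm ((LO z. ind (strip (e k) (2 * e k)) z * ?A (e k) z) - 0) < s" by blast
 qed
 have "(%k. LO z. cut (e k) z * P x z * f z) ----> fsol_const TYPE('a) * u x + (LO z. E x z * w1 z) + (LO z. E x z * w2 z) + 0"
  unfolding eA[OF e0(1) eD(1)] by (intro tendsto_add tendsto_const L2 L3)
 hence "(LO z. P x z * f z) = fsol_const TYPE('a) * u x + (LO z. E x z * w1 z) + (LO z. E x z * w2 z)"
  using L1 LIMSEQ_unique by fastforce
 moreover have "(LO z. E x z * u z) = (LO z. E x z * w1 z) + (LO z. E x z * w2 z)"
  unfolding set_integral_add(2)[OF iE1 iE2, symmetric]
  by (rule set_lebesgue_integral_cong) (auto simp: uw distrib_left)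
 ultimately show ?thesis by simp
qed

end

subsection \<open>The error operator and a priori bounds\<close>

context smooth_bounded_domain
begin

lemma d_measurable [measurable]: "d : borel_measurable borel"
 unfolding bdist_def by (intro borel_measurable_continuous_onI continuous_intros)

lemma R_measurable [measurable]:
 "f : borel_measurable M ==> g : borel_measurable M ==> (%w. R (f w) (g w)) : borel_measurable M"
 unfolding R_def by (intro borel_measurable_add borel_measurable_dist measurable_compose[OF _ d_measurable])

lemma nn_integral_dist_dom:
 "EX C>0. ALL x:Om. (NO z. en (dist z x powr (- n + 1/2))) <= en C"
proof -
 have *: "0 < 2 * B + 1" "0 < n - 1/2" "n - 1/2 < real DIM('a)" using B(1) n_ge_1 n_eq by linarith+
 obtain C where C: "0 <= C" "!!y::'a. (\<integral>\<^sup>+z\<in>ball y (2 * B + 1). en (dist z y powr (- (n - 1/2))) \<partial>lborel) <= en C"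
  using nn_integral_dist_powr[OF *] by blast
 have "(NO z. en (dist z x powr (- n + 1/2))) <= en (C + 1)" if x: "x : Om" for x
 proof -
  have sub: "Om \<subseteq> ball x (2 * B + 1)"
   using dist_le_2B[of x] x closure_subset[of Om] by (fastforce simp: mem_ball)
  have "(NO z. en (dist z x powr (- n + 1/2))) <= (\<integral>\<^sup>+z\<in>ball x (2 * B + 1). en (dist z x powr (- (n - 1/2))) \<partial>lborel)"
   using sub by (intro nn_integral_mono) (auto simp: indicator_def)
  also have "... <= en C" by (rule C(2))
  also have "... <= en (C + 1)" using C by (intro ennreal_leI) simp
  finally show ?thesis .
 qed
 thus ?thesis using C(1) by (intro exI[of _ "C + 1"]) auto
qed

lemma R_powr_le_dist:
 assumes "z ~= x" "p <= 0" shows "R x z powr p <= dist z x powr p"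
 using assms R_ge(1)[of x z] by (intro powr_mono2') (auto simp: dist_commute)

lemma AE_neq: "AE z in lborel. z ~= (x::'a)"
 using AE_lborel_singleton[of x] by simp

lemma nn_integral_R_dom:
 "EX C>0. ALL x:Om. (NO z. en (R x z powr (- n + 1/2))) <= en C"
proof -
 obtain C where C: "0 < C" "!!x. x : Om ==> (NO z. en (dist z x powr (- n + 1/2))) <= en C"
  using nn_integral_dist_dom by blast
 have "(NO z. en (R x z powr (- n + 1/2))) <= (NO z. en (dist z x powr (- n + 1/2)))" for x
 proof (rule nn_integral_mono_AE)
  show "AE z in lborel. en (R x z powr (- n + 1/2)) * indicator Om z <= en (dist z x powr (- n + 1/2)) * indicator Om z"
   using AE_neq[of x] by eventually_elim (use n_ge_1 R_powr_le_dist in "auto intro!: mult_right_mono ennreal_leI")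
 qed
 thus ?thesis using C order_trans by blast
qed

text \<open>The positive majorant of the error operator from \<open>E_bound\<close>. With values in
  \<open>ennreal\<close> it can be iterated, and Fubini applied, without integrability
  conditions.\<close>

definition Kop :: "('a => ennreal) => 'a => ennreal" where
 "Kop u x = (NO z. en ((d x)^2 * R x z powr (- n - 1)) * u z)"

lemma Kop_mono: "(!!z. z : Om ==> u z <= v z) ==> Kop u x <= Kop v x"
 unfolding Kop_def by (intro nn_integral_mono) (auto simp: indicator_def intro!: mult_left_mono)

lemma Kop_cmult: "u : borel_measurable borel ==> Kop (%z. c * u z) x = c * Kop u x"
 unfolding Kop_def by (subst nn_integral_cmult[symmetric]) (auto simp: mult_ac)

lemma Kop_add:
 "u : borel_measurable borel ==> v : borel_measurable borel ==> Kop (%z. u z + v z) x = Kop u x + Kop v x"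
 unfolding Kop_def by (subst nn_integral_add[symmetric]) (auto simp: distrib_left distrib_right)

text \<open>As \<open>d x\<close> and \<open>d z\<close> are at most \<open>R\<close>, the kernel
  times \<open>d z powr beta\<close> is at most \<open>d x powr (beta + 1/2)\<close> times
  \<open>R x z powr (- n + 1/2)\<close>, whose integral is bounded uniformly. The gain is half a
  power, up to the total power 2.\<close>

lemma Kop_powr_d:
 assumes "0 <= beta" "beta <= 3/2"
 shows "EX C>0. ALL x:Om. Kop (%z. en (d z powr beta)) x <= en C * en (d x powr (beta + 1/2))"
proof -
 obtain C where C: "0 < C" "!!x. x : Om ==> (NO z. en (R x z powr (- n + 1/2))) <= en C"
  using nn_integral_R_dom by blast
 have "Kop (%z. en (d z powr beta)) x <= en C * en (d x powr (beta + 1/2))" if x: "x : Om" for x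
 proof -
  have pt: "(d x)^2 * R x z powr (- n - 1) * d z powr beta <= d x powr (beta + 1/2) * R x z powr (- n + 1/2)" for z
  proof -
   have "d z powr beta <= R x z powr beta" using assms R_ge(3)[of z x] by (intro powr_mono2) auto
   hence "(d x)^2 * R x z powr (- n - 1) * d z powr beta <= (d x)^2 * R x z powr (- n - 1) * R x z powr beta"
    by (intro mult_left_mono) auto
   also have "... = (d x)^2 * (R x z powr (- n + 1/2) * R x z powr (beta - 3/2))" by (simp add: powr_add[symmetric] algebra_simps)
   also have "... <= (d x)^2 * (R x z powr (- n + 1/2) * d x powr (beta - 3/2))"
    using assms d_pos[OF x] R_ge(2)[of x z] by (intro mult_left_mono powr_mono2') auto
   also have "... = (d x powr 2 * d x powr (beta - 3/2)) * R x z powr (- n + 1/2)" using d_pos[OF x] by (simp add: powr_numeral)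
   also have "d x powr 2 * d x powr (beta - 3/2) = d x powr (beta + 1/2)" unfolding powr_add[symmetric] by (simp add: add.commute)
   finally show ?thesis .
  qed
  have "Kop (%z. en (d z powr beta)) x <= (NI z. en (d x powr (beta + 1/2)) * (en (R x z powr (- n + 1/2)) * indicator Om z))"
   unfolding Kop_def mult.assoc[symmetric]
   by (intro nn_integral_mono mult_right_mono) (use pt in "simp_all add: ennreal_mult[symmetric] ennreal_leI mult_ac")
  also have "... = en (d x powr (beta + 1/2)) * (NO z. en (R x z powr (- n + 1/2)))"
   by (rule nn_integral_cmult) measurable
  also have "... <= en (d x powr (beta + 1/2)) * en C" by (intro mult_left_mono C(2) x) simp
  finally show ?thesis by (simp add: mult.commute)
 qed
 thus ?thesis using C(1) by blast
qed

text \<open>One turn of the bootstrap: a bound \<open>A * (g x + h x)\<close> of \<open>u\<close> is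
  inserted into the operator, which reproduces \<open>g\<close> up to a constant and improves
  \<open>h\<close> to \<open>h'\<close>.\<close>

lemma Kop_bootstrap:
 assumes [measurable]: "g : borel_measurable borel" "h : borel_measurable borel"
  and u: "!!x. x : Om ==> u x <= g x + L * Kop u x"
  and g: "!!x. x : Om ==> Kop g x <= L * g x" and h: "!!x. x : Om ==> Kop h x <= L * h' x"
  and uh: "!!x. x : Om ==> u x <= A * (g x + h x)" and x: "x : Om"
 shows "u x <= (1 + L * A * L) * (g x + h' x)" "Kop u x <= A * L * (g x + h' x)"
proof -
 have "Kop u x <= Kop (%z. A * (g z + h z)) x" by (rule Kop_mono[OF uh])
 also have "... = A * (Kop g x + Kop h x)" by (subst Kop_cmult, measurable) (simp add: Kop_add)
 also have "... <= A * (L * g x + L * h' x)" by (intro mult_left_mono add_mono g h x) simp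
 also have "... = A * L * (g x + h' x)" by (simp add: distrib_left mult_ac)
 finally show k: "Kop u x <= A * L * (g x + h' x)" .
 have "u x <= g x + L * (A * L * (g x + h' x))" using u[OF x] k by (meson add_left_mono mult_left_mono order_trans zero_le)
 also have "... <= (g x + h' x) + L * (A * L * (g x + h' x))" by (intro add_right_mono) simp
 also have "... = (1 + L * A * L) * (g x + h' x)" unfolding distrib_right[of 1] by (simp add: mult.assoc)
 finally show "u x <= (1 + L * A * L) * (g x + h' x)" .
qed

text \<open>Four turns of \<open>Kop_bootstrap\<close>, half a power of \<open>d\<close> each, raise
  the constant \<open>M\<close> to \<open>M * (d x)^2\<close>. The resulting constant depends on
  \<open>L\<close> alone.\<close>

lemma Kop_bootstrap_d:
 fixes L :: real assumes "0 <= L"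
 shows "EX A>0. ALL u g M. g : borel_measurable borel --> (ALL x:Om. u x <= g x + en L * Kop u x) -->
  (ALL x:Om. Kop g x <= en L * g x) --> (ALL x:Om. u x <= g x + M) -->
  (ALL x:Om. u x <= en A * (g x + M * en ((d x)^2)))"
proof -
 have ex: "EX C>0. ALL x:Om. Kop (%z. en (d z powr (real k / 2))) x <= en C * en (d x powr (real (Suc k) / 2))" if "k < 4" for k
  using Kop_powr_d[of "real k / 2"] that by (simp add: add_divide_distrib add.commute)
 then obtain C where C: "!!k. k < 4 ==> 0 < C k"
   "!!k x. k < 4 ==> x : Om ==> Kop (%z. en (d z powr (real k / 2))) x <= en (C k) * en (d x powr (real (Suc k) / 2))"
  by metis
 define L' where "L' = L + (\<Sum>k<4. C k)"
 have L': "L <= L'" "!!k. k < 4 ==> C k <= L'"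
 proof -
  have "0 <= (\<Sum>k<4. C k)" using C(1) by (intro sum_nonneg) (auto intro: less_imp_le)
  thus "L <= L'" by (simp add: L'_def)
  fix k :: nat assume "k < 4"
  hence "C k <= (\<Sum>k<4. C k)" using C(1) by (intro member_le_sum) (auto intro: less_imp_le)
  thus "C k <= L'" using assms by (simp add: L'_def)
 qed
 have L'0: "0 <= L'" using L'(1) assms by simp
 \<comment> \<open>The constants of the successive turns: by \<open>Kop_bootstrap\<close> each turn
   replaces \<open>a\<close> by \<open>1 + L' * a * L'\<close>.\<close>
 define A where "A k = ((%a. 1 + L' * a * L') ^^ k) 1" for k
 have A1: "1 <= A k" for k
  unfolding A_def by (induction k) (use L'0 in "auto intro!: mult_nonneg_nonneg")
 have main: "u x <= en (A k) * (g x + M * en (d x powr (real k / 2)))"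
  if [measurable]: "g : borel_measurable borel" and u: "ALL x:Om. u x <= g x + en L * Kop u x"
   and g: "ALL x:Om. Kop g x <= en L * g x" and M: "ALL x:Om. u x <= g x + M" and x: "x : Om" and k: "k <= 4" for u g M x k
  using x k
 proof (induction k arbitrary: x)
  case 0 thus ?case using M d_pos[of x] by (auto simp: A_def)
 next
  case (Suc k)
  have LL: "en L * a <= en L' * a" for a using L' by (intro mult_right_mono ennreal_leI) auto
  have "u x <= (1 + en L' * en (A k) * en L') * (g x + M * en (d x powr (real (Suc k) / 2)))"
  proof (rule Kop_bootstrap(1)[where h = "%x. M * en (d x powr (real k / 2))"])
   show "u x <= g x + en L' * Kop u x" if "x : Om" for x
    using u that LL by (meson add_left_mono order_trans)
   show "Kop g x <= en L' * g x" if "x : Om" for x using g that LL by (meson order_trans)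
   show "Kop (%x. M * en (d x powr (real k / 2))) x <= en L' * (M * en (d x powr (real (Suc k) / 2)))" if "x : Om" for x
   proof -
    have "Kop (%x. M * en (d x powr (real k / 2))) x = M * Kop (%x. en (d x powr (real k / 2))) x" by (rule Kop_cmult) measurable
    also have "... <= M * (en (C k) * en (d x powr (real (Suc k) / 2)))" using Suc that by (intro mult_left_mono C(2)) auto
    also have "... <= M * (en L' * en (d x powr (real (Suc k) / 2)))" using Suc by (intro mult_left_mono mult_right_mono ennreal_leI L'(2)) auto
    finally show ?thesis by (simp add: mult_ac)
   qed
  qed (use Suc in auto)
  also have "1 + en L' * en (A k) * en L' = en (A (Suc k))"
   using L'0 A1[of k] by (simp add: A_def ennreal_mult[symmetric] ennreal_plus[symmetric] mult_nonneg_nonneg flip: ennreal_1 del: ennreal_plus)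
  finally show ?case .
 qed
 have "u x <= en (A 4) * (g x + M * en ((d x)^2))"
  if "g : borel_measurable borel" "ALL x:Om. u x <= g x + en L * Kop u x" "ALL x:Om. Kop g x <= en L * g x" "ALL x:Om. u x <= g x + M" "x : Om" for u g M x
  using main[OF that, of 4] d_pos[of x] that(5) by (simp add: powr_numeral)
 moreover have "0 < A 4" using A1[of 4] by linarith
 ultimately show ?thesis by blast
qed

section \<open>A priori bounds for solutions\<close>

lemma sol_kernel:
 "EX C>0. ALL f u F x. sols f u --> bd f F --> x : Om -->
  en (abs (u x - (LO z. P x z * f z) / fsol_const TYPE('a))) <= en C * Kop (%z. en (abs (u z))) x"
proof -
 let ?kappa = "fsol_const TYPE('a)"
 have kappa: "0 < ?kappa" by (rule fsol_const_pos)
 obtain C where C: "0 < C" "!!x z. x : Om ==> z : Om ==> abs (E x z) <= C * (d x)^2 * R x z powr (- n - 1)" using E_bound by blast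
 have "en (abs (u x - (LO z. P x z * f z) / ?kappa)) <= en (C / ?kappa) * Kop (%z. en (abs (u z))) x"
  if sol: "sols f u" and F: "bd f F" and x: "x : Om" for f u F x
 proof -
  obtain M where M: "!!z. z : Om ==> abs (u z) <= M" using sol_bounded[OF sol] by blast
  have iE: "integ (%z. E x z * u z)" by (rule E_u_integrable[OF x sol_continuous[OF sol] M])
  have [measurable]: "(%z. en (abs (u z)) * indicator Om z) : borel_measurable borel"
  proof -
   have [measurable]: "(%z. ind Om z *\<^sub>R u z) : borel_measurable borel"
    using borel_measurable_continuous_on_indicator[OF _ sol_continuous[OF sol]] by simp
   have "(%z. en (abs (ind Om z *\<^sub>R u z))) : borel_measurable borel" by measurable
   moreover have "(%z. en (abs (ind Om z *\<^sub>R u z))) = (%z. en (abs (u z)) * indicator Om z)" by (auto simp: indicator_def)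
   ultimately show ?thesis by metis
  qed
  have "(LO z. P x z * f z) = ?kappa * u x + (LO z. E x z * u z)"
   by (rule representation[OF sol _ x, symmetric]) (use F in blast)
  hence "u x - (LO z. P x z * f z) / ?kappa = - (LO z. E x z * u z) / ?kappa" using kappa by (simp add: field_simps)
  hence e1: "en (abs (u x - (LO z. P x z * f z) / ?kappa)) = en (1 / ?kappa) * en (norm (LO z. E x z * u z))"
   using kappa by (simp add: ennreal_mult[symmetric])
  have "en (norm (LO z. E x z * u z)) <= (NI z. en (norm (ind Om z *\<^sub>R (E x z * u z))))"
   using integral_norm_bound_ennreal iE unfolding set_lebesgue_integral_def set_integrable_def by blast
  also have "... <= (NI z. en C * (en ((d x)^2 * R x z powr (- n - 1)) * (en (abs (u z)) * indicator Om z)))"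
  proof (rule nn_integral_mono)
   fix z
   show "en (norm (ind Om z *\<^sub>R (E x z * u z))) <= en C * (en ((d x)^2 * R x z powr (- n - 1)) * (en (abs (u z)) * indicator Om z))"
   proof (cases "z : Om")
    case True
    have "abs (E x z) * abs (u z) <= C * (d x)^2 * R x z powr (- n - 1) * abs (u z)" by (intro mult_right_mono C(2) x True) simp
    hence "en (abs (E x z) * abs (u z)) <= en (C * ((d x)^2 * R x z powr (- n - 1) * abs (u z)))" by (intro ennreal_leI) (simp add: mult_ac)
    thus ?thesis using True C(1) by (simp add: abs_mult ennreal_mult mult_nonneg_nonneg mult.assoc)
   qed simp
  qed
  also have "... = en C * Kop (%z. en (abs (u z))) x"
   unfolding Kop_def mult.assoc by (rule nn_integral_cmult) measurable
  finally have "en (1 / ?kappa) * en (norm (LO z. E x z * u z)) <= en (1 / ?kappa) * (en C * Kop (%z. en (abs (u z))) x)"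
   by (rule mult_left_mono) simp
  also have "... = en (C / ?kappa) * Kop (%z. en (abs (u z))) x"
   using kappa C(1) by (simp add: ennreal_mult[symmetric] mult.assoc[symmetric])
  finally show ?thesis unfolding e1 .
 qed
 thus ?thesis using C(1) kappa by (intro exI[of _ "C / ?kappa"]) auto
qed

text \<open>The majorant of \<open>P\<close> from \<open>P_upper\<close>: symmetric, with the
  integrable singularity \<open>dist x y powr (- n + 1/2)\<close>.\<close>

definition pk :: "'a => 'a => real" where
 "pk x y = (d x)^2 * (d y)^2 * (dist x y powr (- n + 1/2) * R x y powr (-1/2))"

lemma pk_nonneg [simp]: "0 <= pk x y" by (simp add: pk_def)

lemma pk_measurable [measurable]:
 "f : borel_measurable M ==> g : borel_measurable M ==> (%w. pk (f w) (g w)) : borel_measurable M"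
 unfolding pk_def by (intro borel_measurable_times borel_measurable_power powr_real_measurable borel_measurable_const
   borel_measurable_dist R_measurable measurable_compose[OF _ d_measurable])

definition pmaj :: "('a => real) => 'a => ennreal" where
 "pmaj f x = (NO y. en (pk x y * abs (f y)))"

lemma P_integral_le:
 "EX C>0. ALL f F x. continuous_on Om f --> bd f F --> x : Om -->
   en (abs (LO z. P x z * f z)) <= en C * pmaj f x"
proof -
 obtain C where C: "0 < C" "!!x z. x : Om ==> z : Om ==> z ~= x ==> P x z <= C * (d x)^2 * (d z)^2 * (dist x z powr (- n + 1/2) * R x z powr (-1/2))"
  using P_upper by blast
 have "en (abs (LO z. P x z * f z)) <= en C * pmaj f x"
  if f: "continuous_on Om f" and F: "bd f F" and x: "x : Om" for f F x
 proof -
  have i: "integ (%z. P x z * f z)" using F by (intro P_f_integrable[OF x f]) auto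
  have [measurable]: "(%z. ind Om z *\<^sub>R f z) : borel_measurable borel"
   using borel_measurable_continuous_on_indicator[OF _ f] by simp
  have m: "(%z. en (pk x z * abs (ind Om z *\<^sub>R f z))) : borel_measurable borel" by measurable
  have e: "en (pk x z * abs (f z)) * indicator Om z = en (pk x z * abs (ind Om z *\<^sub>R f z))" for z by (simp add: indicator_def)
  have "en (norm (LO z. P x z * f z)) <= (NI z. en (norm (ind Om z *\<^sub>R (P x z * f z))))"
   using integral_norm_bound_ennreal i unfolding set_lebesgue_integral_def set_integrable_def by blast
  also have "... <= (NI z. en C * en (pk x z * abs (ind Om z *\<^sub>R f z)))"
  proof (rule nn_integral_mono_AE, use AE_neq[of x] in eventually_elim)
   fix z assume ne: "z ~= x"
   show "en (norm (ind Om z *\<^sub>R (P x z * f z))) <= en C * en (pk x z * abs (ind Om z *\<^sub>R f z))"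
   proof (cases "z : Om")
    case True
    have "P x z * abs (f z) <= C * pk x z * abs (f z)" using C(2)[OF x True ne] by (intro mult_right_mono) (auto simp: pk_def mult.assoc)
    thus ?thesis
     using True C(1) P_nonneg[OF x True ne] by (simp add: abs_mult ennreal_mult[symmetric] mult_nonneg_nonneg ennreal_leI mult.assoc)
   qed simp
  qed
  also have "... = en C * pmaj f x" unfolding pmaj_def e by (rule nn_integral_cmult) (use m in simp)
  finally show ?thesis by simp
 qed
 thus ?thesis using C(1) by blast
qed

lemma pmaj_sup:
 "EX C>0. ALL f F x. bd f F --> x : Om --> pmaj f x <= en (C * F * (d x)^2)"
proof -
 obtain C where C: "0 < C" "!!x. x : Om ==> (NO z. en (dist z x powr (- n + 1/2))) <= en C"
  using nn_integral_dist_dom by blast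
 let ?D = "Dm powr (3/2)"
 have "pmaj f x <= en (C * ?D * F * (d x)^2)" if F: "bd f F" and x: "x : Om" for f F x
 proof -
  have F0: "0 <= F" using F x by fastforce
  have pt: "pk x z * abs (f z) <= (?D * F * (d x)^2) * dist z x powr (- n + 1/2)" if z: "z : Om" for z
  proof -
   have "(d z)^2 * R x z powr (-1/2) <= R x z powr 2 * R x z powr (-1/2)"
    using R_ge(3)[of z x] R_pos[OF x, of z] by (intro mult_right_mono) (auto simp: powr_numeral power_mono)
   also have "... = R x z powr (3/2)" unfolding powr_add[symmetric] by simp
   also have "... <= ?D" using R_le_Dm[OF x z] R_pos[OF x, of z] by (intro powr_mono2) auto
   finally have 1: "(d z)^2 * R x z powr (-1/2) <= ?D" .
   have "pk x z * abs (f z) = ((d z)^2 * R x z powr (-1/2)) * abs (f z) * ((d x)^2 * dist z x powr (- n + 1/2))"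
    by (simp add: pk_def dist_commute mult_ac)
   also have "... <= (?D * F) * ((d x)^2 * dist z x powr (- n + 1/2))"
    using 1 F z F0 by (intro mult_right_mono mult_mono) auto
   finally show ?thesis by (simp add: mult_ac)
  qed
  have "pmaj f x <= (NI z. en (?D * F * (d x)^2) * (en (dist z x powr (- n + 1/2)) * indicator Om z))"
   unfolding pmaj_def mult.assoc[symmetric]
  proof (rule nn_integral_mono)
   fix z
   show "en (pk x z * abs (f z)) * indicator Om z <= en (?D * F * (d x)^2) * en (dist z x powr (- n + 1/2)) * indicator Om z"
    using pt[of z] F0 by (cases "z : Om") (auto simp: ennreal_mult[symmetric] ennreal_leI)
  qed
  also have "... = en (?D * F * (d x)^2) * (NO z. en (dist z x powr (- n + 1/2)))"
   by (rule nn_integral_cmult) measurable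
  also have "... <= en (?D * F * (d x)^2) * en C" by (intro mult_left_mono C(2) x) simp
  finally show ?thesis using C(1) F0 by (simp add: ennreal_mult[symmetric] mult_ac)
 qed
 moreover have "0 < C * ?D" using C(1) Dm_ge_1 by simp
 ultimately show ?thesis by blast
qed

lemma Kop_d2: "EX C>0. ALL x:Om. Kop (%z. en ((d z)^2)) x <= en C * en ((d x)^2)"
proof -
 obtain C where C: "0 < C" "!!x. x : Om ==> Kop (%z. en (d z powr (3/2))) x <= en C * en (d x powr (3/2 + 1/2))"
  using Kop_powr_d[of "3/2"] by auto
 let ?D = "Dm powr (1/2)"
 have "Kop (%z. en ((d z)^2)) x <= en (?D * C) * en ((d x)^2)" if x: "x : Om" for x
 proof -
  have "Kop (%z. en ((d z)^2)) x <= Kop (%z. ennreal ?D * en (d z powr (3/2))) x"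
  proof (rule Kop_mono)
   fix z assume z: "z : Om"
   have "(d z)^2 = d z powr (1/2) * d z powr (3/2)" using d_pos[OF z] by (simp add: powr_add[symmetric] powr_numeral)
   also have "... <= ?D * d z powr (3/2)"
    using R_le_Dm[OF z z] R_ge(2)[of z z] by (intro mult_right_mono powr_mono2) auto
   finally show "en ((d z)^2) <= ennreal ?D * en (d z powr (3/2))" by (simp add: ennreal_mult[symmetric] ennreal_leI)
  qed
  also have "... = ennreal ?D * Kop (%z. en (d z powr (3/2))) x" by (rule Kop_cmult) measurable
  also have "... <= ennreal ?D * (en C * en (d x powr (3/2 + 1/2)))" by (intro mult_left_mono C(2) x) simp
  also have "... = en (?D * C) * en ((d x)^2)" using C(1) d_pos[OF x] by (simp add: ennreal_mult mult.assoc powr_numeral)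
  finally show ?thesis .
 qed
 moreover have "0 < ?D * C" using C(1) Dm_ge_1 by simp
 ultimately show ?thesis by blast
qed

lemma sol_majorant:
 "EX L>0. ALL f u F x. sols f u --> bd f F --> x : Om -->
   en (abs (u x)) <= en L * pmaj f x + en L * Kop (%z. en (abs (u z))) x"
proof -
 let ?kappa = "fsol_const TYPE('a)"
 have kappa: "0 < ?kappa" by (rule fsol_const_pos)
 obtain C where C: "0 < C" "!!f u F x. sols f u ==> bd f F ==> x : Om ==>
  en (abs (u x - (LO z. P x z * f z) / ?kappa)) <= en C * Kop (%z. en (abs (u z))) x" using sol_kernel by blast
 obtain C' where C': "0 < C'" "!!f F x. continuous_on Om f ==> bd f F ==> x : Om ==>
   en (abs (LO z. P x z * f z)) <= en C' * pmaj f x" using P_integral_le by blast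
 define L where "L = C + C' / ?kappa"
 have L: "0 < L" "C <= L" "C' / ?kappa <= L" using C C' kappa by (auto simp: L_def intro: add_pos_pos)
 have "en (abs (u x)) <= en L * pmaj f x + en L * Kop (%z. en (abs (u z))) x"
  if sol: "sols f u" and F: "bd f F" and x: "x : Om" for f u F x
 proof -
  let ?I = "LO z. P x z * f z"
  have "en (abs (u x)) <= en (abs (?I) / ?kappa + abs (u x - ?I / ?kappa))"
  proof (rule ennreal_leI)
   have "abs (?I / ?kappa) = abs (?I) / ?kappa" using kappa by simp
   thus "abs (u x) <= abs (?I) / ?kappa + abs (u x - ?I / ?kappa)" by linarith
  qed
  also have "... = en (1 / ?kappa) * en (abs (?I)) + en (abs (u x - ?I / ?kappa))"
   using kappa by (simp add: ennreal_mult[symmetric])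
  also have "... <= en (1 / ?kappa) * (en C' * pmaj f x) + en C * Kop (%z. en (abs (u z))) x"
   by (intro add_mono mult_left_mono C'(2)[OF sol_f_continuous[OF sol] F x] C(2)[OF sol F x]) simp
  also have "... = en (C' / ?kappa) * pmaj f x + en C * Kop (%z. en (abs (u z))) x"
   using kappa C' by (simp add: ennreal_mult[symmetric] mult.assoc[symmetric])
  also have "... <= en L * pmaj f x + en L * Kop (%z. en (abs (u z))) x"
   using L by (intro add_mono mult_right_mono ennreal_leI) auto
  finally show ?thesis .
 qed
 thus ?thesis using L(1) by blast
qed

text \<open>The bootstrap lifts the bound \<open>M\<close> of \<open>|u|\<close> by a factor
  \<open>(d x)^2\<close>, whereas the boundary conditions alone give \<open>o(d)\<close>. The
  symmetry argument rests on this quadratic decay.\<close>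

theorem a_priori:
 "EX C>0. ALL f u F M. sols f u --> bd f F --> (ALL z:Om. abs (u z) <= M) -->
   (ALL x:Om. abs (u x) <= C * (F + M) * (d x)^2)"
proof -
 obtain L1 where L1: "0 < L1" "!!f u F x. sols f u ==> bd f F ==> x : Om ==>
   en (abs (u x)) <= en L1 * pmaj f x + en L1 * Kop (%z. en (abs (u z))) x" using sol_majorant by blast
 obtain C2 where C2: "0 < C2" "!!x. x : Om ==> Kop (%z. en ((d z)^2)) x <= en C2 * en ((d x)^2)" using Kop_d2 by blast
 obtain C3 where C3: "0 < C3" "!!f F x. bd f F ==> x : Om ==> pmaj f x <= en (C3 * F * (d x)^2)" using pmaj_sup by blast
 define L where "L = L1 + C2"
 have L: "0 <= L" "L1 <= L" "C2 <= L" using L1 C2 by (auto simp: L_def)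
 obtain A where A: "0 < A" "!!u g M x. g : borel_measurable borel ==> (ALL x:Om. u x <= g x + en L * Kop u x) ==>
  (ALL x:Om. Kop g x <= en L * g x) ==> (ALL x:Om. u x <= g x + M) ==> x : Om ==> u x <= en A * (g x + M * en ((d x)^2))"
  using Kop_bootstrap_d[OF L(1)] by blast
 have "abs (u x) <= A * (L1 * C3 + 1) * (F + M) * (d x)^2"
  if sol: "sols f u" and F: "bd f F" and M: "ALL z:Om. abs (u z) <= M" and x: "x : Om" for f u F M x
 proof -
  have F0: "0 <= F" "0 <= M" using F M x by fastforce+
  let ?g = "%x. en (L1 * C3 * F) * en ((d x)^2)"
  have 1: "en L1 * pmaj f x <= ?g x" if "x : Om" for x
  proof -
   have "en L1 * pmaj f x <= en L1 * en (C3 * F * (d x)^2)" by (intro mult_left_mono C3(2) F that) simp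
   thus ?thesis using L1 C3 F0 by (simp add: ennreal_mult[symmetric] mult.assoc)
  qed
  have 2: "en (abs (u x)) <= ?g x + en L * Kop (%z. en (abs (u z))) x" if "x : Om" for x
  proof -
   have "en L1 * Kop (%z. en (abs (u z))) x <= en L * Kop (%z. en (abs (u z))) x" using L by (intro mult_right_mono ennreal_leI) auto
   thus ?thesis using L1(2)[OF sol F that] 1[OF that] by (meson add_mono order_trans)
  qed
  have 3: "Kop ?g x <= en L * ?g x" if "x : Om" for x
  proof -
   have "Kop ?g x = en (L1 * C3 * F) * Kop (%z. en ((d z)^2)) x" by (rule Kop_cmult) measurable
   also have "... <= en (L1 * C3 * F) * (en C2 * en ((d x)^2))" by (intro mult_left_mono C2(2) that) simp
   also have "... <= en (L1 * C3 * F) * (en L * en ((d x)^2))" using L by (intro mult_left_mono mult_right_mono ennreal_leI) auto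
   finally show ?thesis by (simp add: mult_ac)
  qed
  have 4: "en (abs (u x)) <= ?g x + en M" if "x : Om" for x
   using M that by (meson add_increasing ennreal_leI zero_le)
  have "en (abs (u x)) <= en A * (?g x + en M * en ((d x)^2))"
   by (rule A(2)[of ?g "%x. en (abs (u x))"]) (use 2 3 4 x in "auto simp del: ennreal_le_iff")
  also have "... = en (A * (L1 * C3 * F + M) * (d x)^2)"
   using A(1) L1 C3 F0 by (simp add: ennreal_mult[symmetric] ennreal_plus[symmetric] algebra_simps del: ennreal_plus)
  finally have "abs (u x) <= A * (L1 * C3 * F + M) * (d x)^2" using A(1) L1 C3 F0 by (subst (asm) ennreal_le_iff) auto
  also have "... <= A * ((L1 * C3 + 1) * (F + M)) * (d x)^2"
   using A(1) L1 C3 F0 by (intro mult_right_mono mult_left_mono) (auto simp: algebra_simps)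
  finally show ?thesis by (simp add: mult_ac)
 qed
 moreover have "0 < A * (L1 * C3 + 1)" using A(1) L1 C3 by (intro mult_pos_pos add_pos_pos) auto
 ultimately show ?thesis by blast
qed

end

section \<open>Boundedness of the solution operator\<close>

lemma near_supremum:
 fixes w :: "'b => real"
 assumes "x0 : S" "K < w x0" "0 <= K" "!!x. x : S ==> w x <= C"
 shows "EX M x. x : S & (ALL z:S. w z <= M) & 3/4 * M < w x & K < M"
proof -
 define M where "M = (SUP x\<in>S. w x)"
 have bd: "bdd_above (w ` S)" using assms(4) by (auto simp: bdd_above_def)
 have le: "w z <= M" if "z : S" for z unfolding M_def by (rule cSUP_upper[OF that bd])
 have "K < M" using le[OF assms(1)] assms(2) by linarith
 hence "3/4 * M < (SUP x\<in>S. w x)" using assms(3) by (simp add: M_def)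
 then obtain x where "x : S" "3/4 * M < w x" using less_cSUP_iff[OF _ bd, of "3/4 * M"] assms(1) by blast
 thus ?thesis using le \<open>K < M\<close> by blast
qed

context smooth_bounded_domain
begin

abbreviation gint :: "('a => 'a => real) => ('a => real) => 'a => real" where
 "gint G f x \<equiv> LO y. G x y * f y"

abbreviation holder :: "real => ('a => real) => bool" where
 "holder gamma f \<equiv> C_k_holder_on 0 gamma (closure Om) f"

lemma green_integrable:
 "biharmonic_green_function gamma Om G ==> holder gamma f ==> x : Om ==> integ (%y. G x y * f y)"
 and green_solves: "biharmonic_green_function gamma Om G ==> holder gamma f ==> sols f (gint G f)"
 unfolding biharmonic_green_function_def by blast+

lemma holder_const: "holder gamma (%x. c)" by (auto intro!: exI[of _ 0])

lemma Kop_inner_le: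
 assumes "x : Om" "0 < c" "c <= d x" "(%z. u z * indicator Om z) : borel_measurable lborel"
 shows "Kop u x <= en (Dm^2 * c powr (- n - 1)) * (NO z. u z)"
proof -
 have "(d x)^2 * R x z powr (- n - 1) <= Dm^2 * c powr (- n - 1)" for z
  using R_ge(2)[of x x] R_le_Dm[of x x] R_ge(2)[of x z] assms n_ge_1
  by (intro mult_mono power_mono powr_mono2') auto
 hence "Kop u x <= (NI z. en (Dm^2 * c powr (- n - 1)) * (u z * indicator Om z))"
  unfolding Kop_def mult.assoc by (intro nn_integral_mono mult_right_mono ennreal_leI) auto
 also have "... = en (Dm^2 * c powr (- n - 1)) * (NO z. u z)" using assms(4) by (rule nn_integral_cmult)
 finally show ?thesis .
qed

lemma sol_abs_measurable:
 assumes "continuous_on Om u" shows "(%z. en (abs (u z)) * indicator Om z) : borel_measurable borel"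
proof -
 have [measurable]: "(%z. ind Om z *\<^sub>R u z) : borel_measurable borel"
  using borel_measurable_continuous_on_indicator[OF _ assms] by simp
 have "(%z. en (abs (ind Om z *\<^sub>R u z))) : borel_measurable borel" by measurable
 moreover have "(%z. en (abs (ind Om z *\<^sub>R u z))) = (%z. en (abs (u z)) * indicator Om z)" by (auto simp: indicator_def)
 ultimately show ?thesis by metis
qed

text \<open>Blow-up argument. Suppose that data bounded by 1 led to solutions with suprema
  \<open>M k\<close> tending to infinity. The normalised solutions tend to zero pointwise, since
  \<open>u k z\<close> is at most the integral of \<open>|G z|\<close>, and hence in
  \<open>L^1\<close> by domination. But near-maximal points stay away from the boundary by
  \<open>a_priori\<close>, and there \<open>u\<close> is controlled by the data and its
  \<open>L^1\<close> norm.\<close>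

lemma green_sup:
 assumes G: "biharmonic_green_function gamma Om G"
 shows "EX C>0. ALL f. holder gamma f --> (ALL z:Om. abs (f z) <= 1) --> (ALL x:Om. abs (gint G f x) <= C * (d x)^2)"
proof -
 obtain C1 where C1: "0 < C1" "!!f u F M x. sols f u ==> bd f F ==> ALL z:Om. abs (u z) <= M ==>
   x : Om ==> abs (u x) <= C1 * (F + M) * (d x)^2" using a_priori by blast
 obtain L where L: "0 < L" "!!f u F x. sols f u ==> bd f F ==> x : Om ==>
   en (abs (u x)) <= en L * pmaj f x + en L * Kop (%z. en (abs (u z))) x" using sol_majorant by blast
 obtain C3 where C3: "0 < C3" "!!f F x. bd f F ==> x : Om ==> pmaj f x <= en (C3 * F * (d x)^2)" using pmaj_sup by blast
 \<comment> \<open>With this \<open>c\<close>, at points nearer than \<open>c\<close> to the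
   boundary \<open>a_priori\<close> gives \<open>|u| <= (1 + M) / 4\<close>, which excludes
   \<open>|u| > 3/4 * M\<close> once \<open>M > 1\<close>.\<close>
 define c where "c = sqrt (1 / (4 * C1))"
 have c: "0 < c" "C1 * c^2 = 1/4" using C1(1) by (auto simp: c_def)
 define C4 where "C4 = L * (C3 * Dm^2)"
 define C5 where "C5 = L * (Dm^2 * c powr (- n - 1))"
 have C45: "0 < C4" "0 < C5" using L(1) C3(1) Dm_ge_1 c by (auto simp: C4_def C5_def)
 have "EX C>0. ALL f. holder gamma f --> (ALL z:Om. abs (f z) <= 1) --> (ALL x:Om. abs (gint G f x) <= C)"
 proof (rule ccontr)
  assume "\<not> ?thesis"
  hence "EX f x. holder gamma f & (ALL z:Om. abs (f z) <= 1) & x : Om & real (Suc k) < abs (gint G f x)" for k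
   by (metis not_le of_nat_0_less_iff zero_less_Suc)
  then obtain f x0 where f: "!!k. holder gamma (f k)" "!!k z. z : Om ==> abs (f k z) <= 1"
    "!!k. x0 k : Om" "!!k. real (Suc k) < abs (gint G (f k) (x0 k))" by metis
  define u where "u k = gint G (f k)" for k
  have sol: "sols (f k) (u k)" for k unfolding u_def by (rule green_solves[OF G f(1)])
  have "EX M x. x : Om & (ALL z:Om. abs (u k z) <= M) & 3/4 * M < abs (u k x) & real (Suc k) < M" for k
  proof -
   obtain C where C: "!!z. z : Om ==> abs (u k z) <= C" using sol_bounded[OF sol] by blast
   show ?thesis
    by (rule near_supremum[where w = "%x. abs (u k x)", OF f(3) _ _ C]) (use f(4) in "auto simp: u_def")
  qed
  then obtain M x where x: "!!k. x k : Om" "!!k z. z : Om ==> abs (u k z) <= M k" "!!k. 3/4 * M k < abs (u k (x k))" "!!k. real (Suc k) < M k"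
   by metis
  have Mpos: "1 < M k" "0 < M k" for k using x(4)[of k] by auto
  have far: "c <= d (x k)" for k
  proof (rule ccontr)
   assume "\<not> c <= d (x k)"
   hence "C1 * (1 + M k) * (d (x k))^2 <= C1 * (1 + M k) * c^2" using C1 Mpos[of k] by (intro mult_left_mono power_mono) auto
   moreover have "abs (u k (x k)) <= C1 * (1 + M k) * (d (x k))^2" by (rule C1(2)[OF sol]) (use f x in auto)
   moreover have "C1 * (1 + M k) * c^2 = (1 + M k) / 4" using c(2) by (simp add: mult_ac)
   ultimately show False using x(3)[of k] Mpos(1)[of k] by argo
  qed
  have m: "(%z. en (abs (u k z) / M k) * indicator Om z) : borel_measurable borel" for k
  proof -
   have "continuous_on Om (%z. u k z / M k)" using Mpos(2)[of k] by (intro continuous_intros sol_continuous[OF sol]) auto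
   from sol_abs_measurable[OF this] show ?thesis using Mpos(2)[of k] by (simp add: abs_divide)
  qed
  define I where "I k = (NO z. en (abs (u k z) / M k))" for k
  have I: "en (3/4 * M k) <= en C4 + en (C5 * M k) * I k" for k
  proof -
   have e: "en (abs (u k z)) * indicator Om z = en (M k) * (en (abs (u k z) / M k) * indicator Om z)" for z
    using Mpos(2)[of k] by (simp add: mult.assoc[symmetric] ennreal_mult[symmetric])
   have nn: "(NO z. en (abs (u k z))) = en (M k) * I k"
    unfolding I_def e by (rule nn_integral_cmult) (use m[of k] in simp)
   have "en (3/4 * M k) <= en (abs (u k (x k)))" using x(3)[of k] by (intro ennreal_leI) simp
   also have "... <= en L * pmaj (f k) (x k) + en L * Kop (%z. en (abs (u k z))) (x k)" by (rule L(2)[OF sol _ x(1)]) (use f(2) in blast)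
   also have "... <= en L * en (C3 * Dm^2) + en L * (en (Dm^2 * c powr (- n - 1)) * (en (M k) * I k))"
   proof (intro add_mono mult_left_mono)
    have "pmaj (f k) (x k) <= en (C3 * 1 * (d (x k))^2)" by (rule C3(2)) (use f(2) x(1) in auto)
    also have "... <= en (C3 * Dm^2)"
     using C3(1) R_ge(2)[of "x k" "x k"] R_le_Dm[OF x(1) x(1), of k k] by (intro ennreal_leI) (auto intro!: mult_left_mono power_mono)
    finally show "pmaj (f k) (x k) <= en (C3 * Dm^2)" .
    show "Kop (%z. en (abs (u k z))) (x k) <= en (Dm^2 * c powr (- n - 1)) * (en (M k) * I k)"
     unfolding nn[symmetric] by (rule Kop_inner_le[OF x(1) c(1) far]) (use sol_abs_measurable[OF sol_continuous[OF sol]] in simp)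
   qed simp_all
   also have "... = en C4 + en (C5 * M k) * I k"
    using L(1) C3(1) Mpos(2)[of k] by (simp add: C4_def C5_def ennreal_mult[symmetric] mult.assoc[symmetric])
   finally show ?thesis .
  qed
  have "(%k. NI z. en (abs (u k z) / M k) * indicator Om z) ----> (\<integral>\<^sup>+z. 0 \<partial>(lborel :: 'a measure))"
  proof (rule nn_integral_dominated_convergence[where w = "indicator Om"])
   show "(%z. en (abs (u k z) / M k) * indicator Om z) : borel_measurable lborel" for k
    using m[of k] by simp
   show "AE z in lborel. en (abs (u k z) / M k) * indicator Om z <= indicator Om z" for k
   proof (rule AE_I2)
    fix z show "en (abs (u k z) / M k) * indicator Om z <= indicator Om z"
     using x(2)[of z k] Mpos(2)[of k] by (cases "z : Om") (auto simp: ennreal_le_1)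
   qed
   show "(NI z. indicator Om z) < \<infinity>" using emeasure_dom_finite by simp
   show "AE z in lborel. (%k. en (abs (u k z) / M k) * indicator Om z) ----> 0"
   proof (rule AE_I2)
    fix z
    show "(%k. en (abs (u k z) / M k) * indicator Om z) ----> 0"
    proof (cases "z : Om")
     case True
     \<comment> \<open>The constant 1 is an admissible right-hand side, so the definition of
       \<open>G\<close> makes \<open>G z\<close> integrable.\<close>
     have iG: "integ (%y. abs (G z y))"
      using set_integrable_abs[OF green_integrable[OF G holder_const[of gamma 1] True]] by simp
     define N where "N = (LO y. abs (G z y))"
     have uN: "abs (u k z) <= N" for k
     proof -
      have "abs (u k z) <= (LO y. abs (G z y * f k y))"
       unfolding u_def set_lebesgue_integral_def
       using integral_abs_bound[of lborel "%y. ind Om y *\<^sub>R (G z y * f k y)"] by (simp add: abs_mult)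
      also have "... <= N"
       unfolding N_def
      proof (rule set_integral_mono[OF set_integrable_abs[OF green_integrable[OF G f(1) True]] iG])
       fix y assume "y : Om"
       thus "abs (G z y * f k y) <= abs (G z y)" using f(2)[of y k] by (simp add: abs_mult mult_left_le)
      qed
      finally show ?thesis .
     qed
     have N0: "0 <= N" using uN[of 0] by linarith
     have "(%k. abs (u k z) / M k) ----> 0"
     proof (rule tendsto_sandwich)
      show "\<forall>\<^sub>F k in sequentially. 0 <= abs (u k z) / M k" using Mpos(2) by (simp add: less_imp_le)
      have "abs (u k z) / M k <= N * inverse (real (Suc k))" for k
       using uN[of k] x(4)[of k] N0 unfolding divide_inverse by (intro mult_mono le_imp_inverse_le) auto
      thus "\<forall>\<^sub>F k in sequentially. abs (u k z) / M k <= N * inverse (real (Suc k))" by simp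
      show "(%k. N * inverse (real (Suc k))) ----> 0" using tendsto_mult_left[OF LIMSEQ_inverse_real_of_nat, of N] by simp
     qed simp
     hence "(%k. en (abs (u k z) / M k)) ----> en 0" by (rule tendsto_ennrealI)
     thus ?thesis using True by simp
    qed simp
   qed
  qed simp_all
  hence I0: "I ----> 0" by (simp add: I_def[abs_def])
  \<comment> \<open>This makes the mass term at most \<open>M k / 4\<close>, so that
    \<open>M k <= 2 * C4\<close>, against \<open>M k > 4 * C4\<close>.\<close>
  have "\<forall>\<^sub>F k in sequentially. I k < en (1 / (4 * C5))" using I0 C45 by (intro order_tendstoD(2)[OF I0]) simp
  then obtain N where N: "!!k. N <= k ==> I k < en (1 / (4 * C5))" unfolding eventually_sequentially by blast
  obtain N' :: nat where N': "4 * C4 < real N'" using reals_Archimedean2 by blast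
  define k where "k = max N N'"
  have "4 * C4 < M k" using x(4)[of k] N' by (simp add: k_def)
  have "en (C5 * M k) * I k <= en (C5 * M k) * en (1 / (4 * C5))" using N[of k] by (intro mult_left_mono) (auto simp: k_def)
  also have "... = en (M k / 4)" using C45 Mpos(2)[of k] by (simp add: ennreal_mult[symmetric])
  finally have "en (3/4 * M k) <= en C4 + en (M k / 4)" using I[of k] by (meson add_left_mono order_trans)
  also have "... = en (C4 + M k / 4)" using C45 Mpos(2)[of k] by simp
  finally have "3/4 * M k <= C4 + M k / 4" using C45 Mpos(2)[of k] by (subst (asm) ennreal_le_iff) auto
  thus False using \<open>4 * C4 < M k\<close> Mpos(2)[of k] by argo
 qed
 then obtain C where C: "0 < C" "!!f x. holder gamma f ==> ALL z:Om. abs (f z) <= 1 ==> x : Om ==> abs (gint G f x) <= C" by blast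
 have "abs (gint G f x) <= C1 * (1 + C) * (d x)^2" if "holder gamma f" "ALL z:Om. abs (f z) <= 1" "x : Om" for f x
  by (rule C1(2)[OF green_solves[OF G that(1)] that(2) _ that(3)]) (use C(2) that in blast)
 moreover have "0 < C1 * (1 + C)" using C1 C by (auto intro: mult_pos_pos)
 ultimately show ?thesis by blast
qed

end

subsection \<open>Symmetry of the solution operator\<close>

text \<open>In the application \<open>L\<close> is the Laplacian of \<open>u\<close> and
  \<open>f\<close> its bilaplacian, \<open>p\<close> and \<open>D\<close> are the gradients of
  \<open>u\<close> and of the cut-off \<open>zeta\<close>, \<open>W\<close> and \<open>Y\<close> the
  Laplacians of \<open>zeta^4\<close> and \<open>zeta^2\<close>, and \<open>s\<close> is the inverse
  width. The right-hand side is the integrand of two Green identities; the second, weighted by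
  \<open>A\<close>, yields the squared gradient and absorbs the gradient terms of the first. Young's
  inequality spends 1/4, 1/8 and 1/8 of \<open>X^2\<close>, which leaves one half.\<close>

lemma caccioppoli_pointwise:
 fixes p D :: "'b => real" and s :: real
 assumes D: "!!i. i : I ==> abs (D i) <= k * s" and N: "N = real (card I)" "1 <= N"
  and W: "abs W <= w * zeta^2 * s^2" and Y: "abs Y <= w * s^2" and w: "0 <= w" and A: "A = 32 * N * k^2 + 1"
 shows "(zeta^2 * L)^2 / 2 + s^2 * zeta^2 * (SUM i:I. (p i)^2) - (2 * w^2 + 8 * A^2 + A * w) * (s^2 * u)^2 - zeta ^ 4 * abs (u * f)
  <= (zeta ^ 4 * L + 2 * (SUM i:I. 4 * zeta ^ 3 * D i * p i) + u * W) * L - zeta ^ 4 * u * f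
   + A * s^2 * (zeta^2 * (2 * u * L + 2 * (SUM i:I. (p i)^2)) - u^2 * Y)"
proof -
 define X where "X = zeta^2 * L"
 define S where "S = (SUM i:I. (p i)^2)"
 have A0: "0 <= A" using N A by (simp add: mult_nonneg_nonneg)
 have "- (X^2 / (4 * N) + 64 * N * k^2 * s^2 * zeta^2 * (p i)^2) <= 8 * zeta ^ 3 * D i * p i * L" if "i : I" for i
 proof -
  define Z where "Z = zeta * p i * D i"
  have "0 <= (X + 16 * N * Z)^2 / (4 * N)" using N by simp
  also have "... = X^2 / (4 * N) + 8 * X * Z + 64 * N * Z^2" using N(2) by (simp add: field_simps power2_eq_square)
  finally have 1: "0 <= X^2 / (4 * N) + 8 * X * Z + 64 * N * Z^2" .
  have "(D i)^2 <= (k * s)^2" using D[OF that] by (rule abs_le_square_iff[THEN iffD1, OF order_trans[OF _ abs_ge_self]])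
  hence "Z^2 <= (zeta * p i)^2 * (k * s)^2" unfolding Z_def power_mult_distrib by (intro mult_left_mono) auto
  hence "64 * N * Z^2 <= 64 * N * ((zeta * p i)^2 * (k * s)^2)" using N by (intro mult_left_mono) auto
  moreover have "8 * X * Z = 8 * zeta ^ 3 * D i * p i * L" by (simp add: X_def Z_def power2_eq_square power3_eq_cube)
  ultimately show ?thesis using 1 by (simp add: power_mult_distrib mult_ac)
 qed
 hence "(SUM i:I. - (X^2 / (4 * N) + 64 * N * k^2 * s^2 * zeta^2 * (p i)^2)) <= (SUM i:I. 8 * zeta ^ 3 * D i * p i * L)" by (rule sum_mono)
 moreover have "(SUM i:I. - (X^2 / (4 * N) + 64 * N * k^2 * s^2 * zeta^2 * (p i)^2)) = - (X^2 / 4 + 64 * N * k^2 * s^2 * zeta^2 * S)"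
  using N by (simp add: S_def sum_negf sum_subtractf sum.distrib sum_distrib_left)
 moreover have "(SUM i:I. 8 * zeta ^ 3 * D i * p i * L) = 2 * (SUM i:I. 4 * zeta ^ 3 * D i * p i) * L"
  by (simp add: sum_distrib_left sum_distrib_right mult_ac)
 ultimately have t1: "- (X^2 / 4 + 64 * N * k^2 * s^2 * zeta^2 * S) <= 2 * (SUM i:I. 4 * zeta ^ 3 * D i * p i) * L" by simp
 have t2: "- (X^2 / 8 + 2 * w^2 * (s^2 * u)^2) <= u * W * L"
 proof -
  define Z where "Z = w * abs (s^2 * u)"
  have "abs (u * W * L) <= abs u * (w * zeta^2 * s^2) * abs L" unfolding abs_mult using W by (intro mult_right_mono mult_left_mono) auto
  also have "... = abs X * Z" by (simp add: X_def Z_def abs_mult)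
  also have "... <= X^2 / 8 + 2 * Z^2"
  proof -
   have "0 <= (abs X - 4 * Z)^2 / 8" by simp
   also have "... = X^2 / 8 - abs X * Z + 2 * Z^2" by (simp add: power2_diff power_mult_distrib field_simps)
   finally show ?thesis by simp
  qed
  finally show ?thesis by (simp add: Z_def power_mult_distrib)
 qed
 have t3: "- (X^2 / 8 + 8 * A^2 * (s^2 * u)^2) <= A * s^2 * (zeta^2 * (2 * u * L))"
 proof -
  have "0 <= (X + 8 * (A * (s^2 * u)))^2 / 8" by simp
  also have "... = X^2 / 8 + 2 * X * (A * (s^2 * u)) + 8 * A^2 * (s^2 * u)^2" by (simp add: power2_sum power_mult_distrib field_simps)
  finally show ?thesis by (simp add: X_def mult_ac)
 qed
 have t4: "A * s^2 * (u^2 * Y) <= A * w * (s^2 * u)^2"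
 proof -
  have "A * s^2 * (u^2 * Y) <= A * s^2 * (u^2 * (w * s^2))" using Y A0 by (intro mult_left_mono) auto
  thus ?thesis by (simp add: power_mult_distrib power2_eq_square mult_ac)
 qed
 have t5: "zeta ^ 4 * (u * f) <= zeta ^ 4 * abs (u * f)" by (intro mult_left_mono) auto
 \<comment> \<open>The origin of \<open>A\<close>: \<open>2 * A\<close> exceeds the coefficient
   \<open>64 * N * k^2\<close> of the gradient terms to be absorbed by 2.\<close>
 have t6: "64 * N * k^2 * s^2 * zeta^2 * S + 2 * (s^2 * zeta^2 * S) = A * s^2 * (zeta^2 * (2 * S))" unfolding A by (simp add: algebra_simps)
 have t7: "0 <= s^2 * zeta^2 * S" by (simp add: S_def sum_nonneg)
 have t8: "zeta ^ 4 * L * L = X^2" by (simp add: X_def power2_eq_square power4_eq_xxxx)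
 have e: "(zeta ^ 4 * L + 2 * (SUM i:I. 4 * zeta ^ 3 * D i * p i) + u * W) * L - zeta ^ 4 * u * f
   + A * s^2 * (zeta^2 * (2 * u * L + 2 * S) - u^2 * Y)
  = zeta ^ 4 * L * L + 2 * (SUM i:I. 4 * zeta ^ 3 * D i * p i) * L + u * W * L - zeta ^ 4 * (u * f)
   + A * s^2 * (zeta^2 * (2 * u * L)) + A * s^2 * (zeta^2 * (2 * S)) - A * s^2 * (u^2 * Y)"
  by (simp only: distrib_left distrib_right right_diff_distrib left_diff_distrib mult.assoc diff_conv_add_uminus add.assoc)
 have e2: "(2 * w^2 + 8 * A^2 + A * w) * (s^2 * u)^2 = 2 * w^2 * (s^2 * u)^2 + 8 * A^2 * (s^2 * u)^2 + A * w * (s^2 * u)^2"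
  by (simp only: distrib_right)
 show ?thesis unfolding S_def[symmetric] e e2 X_def[symmetric] using t1 t2 t3 t4 t5 t6 t7 t8 by linarith
qed

section \<open>Energy in boundary strips\<close>

context smooth_bounded_domain
begin

lemma cut_derivs:
 "EX C>0. ALL dl z. 0 < dl --> dl <= 1 --> z : Om --> ph z < 16 * dl -->
   abs (cut dl z) <= C & (ALL b:Basis. abs (pd b (cut dl) z) <= C / dl) & abs (lap (cut dl) z) <= C / dl^2"
proof -
 obtain C where C: "0 < C" "!!dl. 0 < dl ==> dl <= 1 ==> symb 4 {z : Om. ph z < 16 * dl} (%_. dl) (%_. C) (cut dl)"
  using cut_symb by blast
 have nC: "C <= n * C" using C(1) n_ge_1 by simp
 have "abs (cut dl z) <= n * C & (ALL b:Basis. abs (pd b (cut dl) z) <= n * C / dl) & abs (lap (cut dl) z) <= n * C / dl^2"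
  if d: "0 < dl" "dl <= 1" and z: "z : Om" "ph z < 16 * dl" for dl z
 proof -
  let ?S = "{z : Om. ph z < 16 * dl}"
  have zS: "z : ?S" using z by simp
  have s: "symb (Suc (Suc 2)) ?S (%_. dl) (%_. C) (cut dl)" using C(2)[OF d] by (simp add: eval_nat_numeral)
  have 1: "abs (cut dl z) <= C" using symb_bound[OF s zS] .
  have 2: "abs (pd b (cut dl) z) <= C / dl" if "b : Basis" for b
   using s zS that unfolding symb.simps by blast
  have 3: "symb 2 ?S (%_. dl) (%x. real DIM('a) * (C / dl^2)) (lap (cut dl))"
   using symb_laplacian[OF open_sublevel _ s] d by simp
  have "abs (lap (cut dl) z) <= n * C / dl^2" using symb_bound[OF 3 zS] by (simp add: n_eq)
  moreover have "C / dl <= n * C / dl" using nC d by (intro divide_right_mono) auto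
  ultimately show ?thesis using 1 2 nC by fastforce
 qed
 moreover have "0 < n * C" using C(1) n_ge_1 by simp
 ultimately show ?thesis by blast
qed

lemma strip_cont_integrable:
 fixes q :: "'a => real"
 assumes "0 < alpha" "continuous_on Om q" shows "integ (%z. ind (strip alpha beta) z * q z)"
proof -
 have "strip alpha beta = {z : Om. alpha <= ph z} \<inter> ph -` {..beta}" by (auto simp: strip_def)
 moreover have "closed (ph -` {..beta})" using phi_continuous[of UNIV] by (intro closed_vimage) auto
 ultimately have "compact (strip alpha beta)" using compact_superlevel[OF assms(1)] by (simp add: compact_Int_closed)
 from borel_integrable_compact[OF this continuous_on_subset[OF assms(2) strip_subset]]
 have "integrable lborel (%z. ind (strip alpha beta) z *\<^sub>R q z)" by simp
 moreover have "(%z. ind Om z *\<^sub>R (ind (strip alpha beta) z * q z)) = (%z. ind (strip alpha beta) z *\<^sub>R q z)"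
  using strip_subset[of alpha beta] by (intro ext) (auto simp: indicator_def)
 ultimately show ?thesis unfolding set_integrable_def by (simp only:)
qed

text \<open>The weight \<open>1 / dl^2\<close> makes both terms scale alike in a strip of width
  \<open>dl\<close>.\<close>

definition energy :: "real => ('a => real) => 'a => real" where
 "energy dl u z = (lap u z)^2 + (SUM b:Basis. (pd b u z)^2) / dl^2"

lemma energy_continuous: "C_k_on 4 Om u ==> continuous_on Om (energy dl u)"
proof -
 assume "C_k_on 4 Om u"
 hence C: "C_k_on (Suc (Suc 2)) Om u" by (simp add: eval_nat_numeral)
 have "continuous_on Om (lap u)" using C_k_on_imp_continuous[OF C_k_on_laplacian[OF open_dom C]] .
 moreover have "continuous_on Om (pd b u)" if "b : Basis" for b
  using C_k_on_imp_continuous[OF C_k_on_partial[OF C that]] .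
 ultimately show ?thesis unfolding energy_def[abs_def] divide_inverse by (intro continuous_intros) auto
qed

lemma locally_zero_laplacian:
 assumes "open U" "x : U" "!!y. y : U ==> g y = c" shows "lap g x = 0" "pd v g x = 0"
 using laplacian_cong[OF assms(1,2), of g "%_. c"] partial_deriv_cong[OF assms(1,2), of g "%_. c" v] assms(3) by auto

lemma superlevel_open: "open {z : Om. dl < ph z}"
proof -
 have "{z : Om. dl < ph z} = Om \<inter> ph -` {dl<..}" by auto
 moreover have "open (ph -` {dl<..})" using phi_continuous[of UNIV] by (intro open_vimage) auto
 ultimately show ?thesis using open_dom by auto
qed

text \<open>A substitute for boundary values of the second derivatives. If
  \<open>u = O(d^2)\<close>, then \<open>u / dl^2\<close> is bounded in the strip, so the integrated
  Caccioppoli inequality bounds the energy by a multiple of the volume of the surrounding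
  strip.\<close>

theorem strip_energy:
 "EX C>0. ALL f u F K dl. sols f u --> bd f F --> (ALL z:Om. abs (u z) <= K * (d z)^2) -->
  0 < dl --> dl <= 1/2 --> dl < m0 / 8 -->
  (LO z. ind (strip dl (2 * dl)) z * energy dl u z) <= C * (K^2 + K * F) * dl"
proof -
 obtain Cv where Cv: "0 < Cv" "!!dl. 0 < dl ==> dl < m0 / 8 ==> measure lborel (strip (dl / 2) (4 * dl)) <= Cv * dl"
  using strip_volume by blast
 obtain C where C: "0 < C" "!!dl z b. 0 < dl ==> dl <= 1 ==> z : Om ==> ph z < 16 * dl ==>
   abs (cut dl z) <= C & (ALL b:Basis. abs (pd b (cut dl) z) <= C / dl) & abs (lap (cut dl) z) <= C / dl^2"
  using cut_derivs by blast
 \<comment> \<open>\<open>zeta\<close> below is the difference of the cuts at \<open>dl / 2\<close>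
   and \<open>2 * dl\<close>. At the scale \<open>dl\<close> its bounds are \<open>2 * C\<close>,
   \<open>5/2 * C\<close> and \<open>17/4 * C\<close> for the function, its gradient and its
   Laplacian; \<open>w\<close> then controls the Laplacian of \<open>zeta^4\<close>.\<close>
 define k where "k = 5 * C"
 have k0: "0 < k" using C by (simp add: k_def)
 define w where "w = 4 * k^2 + 12 * n * k^2"
 define A where "A = 32 * n * k^2 + 1"
 have w0: "0 <= w" using n_ge_1 by (simp add: w_def)
 define Q where "Q = 2 * w^2 + 8 * A^2 + A * w"
 have A0: "0 < A" using n_ge_1 by (simp add: A_def add_nonneg_pos)
 have Q0: "0 <= Q" using w0 A0 by (simp add: Q_def)
 define Q' where "Q' = Q * (256 / c0 ^ 4) + k ^ 4 * (16 / c0^2)"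
 have Q'0: "0 < Q'" using Q0 k0 consts_pos by (simp add: Q'_def add_nonneg_pos)
 have main: "(LO z. ind (strip dl (2 * dl)) z * energy dl u z) <= (2 * Q' * Cv) * (K^2 + K * F) * dl"
  if sol: "sols f u" and F: "bd f F" and K: "ALL z:Om. abs (u z) <= K * (d z)^2"
   and d: "0 < dl" "dl <= 1/2" "dl < m0 / 8" for f u F K dl
 proof -
  have F0: "0 <= F" "0 <= K"
  proof -
   obtain x where x: "x : Om" using nonempty_dom by blast
   thus "0 <= F" using F by fastforce
   have "0 <= K * (d x)^2" using K x by fastforce
   thus "0 <= K" using d_pos[OF x] by (simp add: zero_le_mult_iff)
  qed
  define s where "s = 1 / dl"
  have s0: "0 < s" using d by (simp add: s_def)
  \<comment> \<open>It is 1 for \<open>ph\<close> between \<open>dl\<close> and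
    \<open>2 * dl\<close>, and 0 for \<open>ph\<close> outside the range from \<open>dl / 2\<close>
    to \<open>4 * dl\<close>.\<close>
  define zeta where "zeta z = cut (dl/2) z + (-1) * cut (2 * dl) z" for z
  define h2 where "h2 z = zeta z * zeta z" for z
  define h4 where "h4 z = h2 z * h2 z" for z
  have zC: "C_k_on 4 Om zeta" unfolding zeta_def[abs_def] by (intro C_k_on_add C_k_on_cmult cut_C4 open_dom)
  have h2C: "C_k_on 4 Om h2" unfolding h2_def[abs_def] by (intro C_k_on_mult zC open_dom)
  have h4C: "C_k_on 4 Om h4" unfolding h4_def[abs_def] by (intro C_k_on_mult h2C open_dom)
  have uC: "C_k_on 4 Om u" by (rule sol_C4[OF sol])
  have le2: "C_k_on 2 Om g" if "C_k_on 4 Om g" for g by (rule C_k_on_le[OF that]) simp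
  have df: "g differentiable (at z)" if "C_k_on 4 Om g" "z : Om" for g z using that by (auto simp: eval_nat_numeral)
  have LuC: "C_k_on 2 Om (lap u)" using uC by (intro C_k_on_laplacian open_dom) (simp add: eval_nat_numeral)
  have z0: "zeta z = 0" if "ph z <= dl/2 | 4 * dl <= ph z" for z
   using that d cut_0[of "dl/2" z] cut_0[of "2*dl" z] cut_1[of "dl/2" z] cut_1[of "2*dl" z] by (auto simp: zeta_def)
  have z1: "zeta z = 1" if "z : strip dl (2 * dl)" for z
   using that d cut_0[of "2*dl" z] cut_1[of "dl/2" z] by (auto simp: zeta_def strip_def)
  \<comment> \<open>The two Green integrands of \<open>caccioppoli_pointwise\<close>; both integrate
    to zero because \<open>zeta\<close> vanishes near the boundary.\<close>
  define Theta where "Theta z = (lap (%z. h4 z * u z) z * lap u z - (h4 z * u z) * lap (lap u) z)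
    + A * s^2 * (h2 z * lap (%z. u z * u z) z - lap h2 z * (u z * u z))" for z
  let ?N = "{z : Om. dl/2 <= ph z}"
  have N: "compact ?N" "?N \<subseteq> Om" using compact_superlevel[of "dl/2"] d by auto
  have loc: "EX U. open U & x : U & (ALL y:U. zeta y = 0)" if "x : Om - ?N" for x
   by (rule exI[of _ "{z : Om. ph z < dl/2}"]) (use that z0 open_sublevel[of "dl/2"] in "simp add: not_le")
  have loc1: "EX U. open U & x : U & ((ALL y:U. h4 y * u y = 0) | (ALL y:U. lap u y = 0))" if "x : Om - ?N" for x
   using loc[OF that] unfolding h4_def h2_def by (metis mult_zero_left)
  have loc2: "EX U. open U & x : U & ((ALL y:U. h2 y = 0) | (ALL y:U. u y * u y = 0))" if "x : Om - ?N" for x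
   using loc[OF that] unfolding h2_def by (metis mult_zero_left)
  note G1 = Green_second[OF open_dom N le2[OF C_k_on_mult[OF open_dom h4C uC]] LuC loc1]
  note G2 = Green_second[OF open_dom N le2[OF h2C] le2[OF C_k_on_mult[OF open_dom uC uC]] loc2]
  have i1: "integ (%z. lap (%z. h4 z * u z) z * lap u z - (h4 z * u z) * lap (lap u) z)"
   using G1(1,2) by (intro set_integral_diff(1))
  have i2: "integ (%z. A * s^2 * (h2 z * lap (%z. u z * u z) z - lap h2 z * (u z * u z)))"
   using G2(1,2) by (intro set_integrable_mult_right set_integral_diff(1))
  have iT: "integ Theta" unfolding Theta_def[abs_def] by (rule set_integral_add(1)[OF i1 i2])
  have "(LO z. lap (%z. h4 z * u z) z * lap u z - (h4 z * u z) * lap (lap u) z) = 0"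
   using set_integral_diff(2)[OF G1(2) G1(1)] G1(3) by simp
  moreover have "(LO z. h2 z * lap (%z. u z * u z) z - lap h2 z * (u z * u z)) = 0"
   using set_integral_diff(2)[OF G2(1) G2(2)] G2(3) by simp
  ultimately have T0: "(LO z. Theta z) = 0"
   unfolding Theta_def set_integral_add(2)[OF i1 i2] set_integral_mult_right by simp
  let ?I' = "ind (strip (dl/2) (4 * dl))"
  have pt: "ind (strip dl (2 * dl)) z * energy dl u z <= 2 * Theta z + 2 * (Q' * (K^2 + K * F)) * ?I' z" if z: "z : Om" for z
  proof (cases "z : strip (dl/2) (4 * dl)")
   case False
   then consider "ph z < dl/2" | "4 * dl < ph z" using z by (force simp: strip_def)
   then obtain U where U: "open U" "z : U" "!!y. y : U ==> zeta y = 0"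
   proof cases
    case 1 show thesis by (rule that[OF open_sublevel[of "dl/2"]]) (use z 1 z0 in auto)
   next
    case 2 show thesis by (rule that[OF superlevel_open[of "4 * dl"]]) (use z 2 z0 in auto)
   qed
   have "lap (%z. h4 z * u z) z = 0" "lap h2 z = 0"
    by (rule locally_zero_laplacian(1)[OF U(1,2), of _ 0], simp add: h4_def h2_def U(3))+
   moreover have "h4 z = 0" "h2 z = 0" using U(2,3) by (simp_all add: h4_def h2_def)
   ultimately have "Theta z = 0" by (simp add: Theta_def)
   moreover have "z \<notin> strip dl (2 * dl)" using False strip_mono[of "dl/2" dl "2*dl" "4*dl"] d by auto
   ultimately show ?thesis using False by simp
  next
   case True
   hence zp: "dl/2 <= ph z" "ph z <= 4 * dl" by (auto simp: strip_def)
   have c1: "abs (cut (dl/2) z) <= C" "!!b. b : Basis ==> abs (pd b (cut (dl/2)) z) <= C / (dl/2)" "abs (lap (cut (dl/2)) z) <= C / (dl/2)^2"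
    using C(2)[of "dl/2" z] d z zp by auto
   have c2: "abs (cut (2*dl) z) <= C" "!!b. b : Basis ==> abs (pd b (cut (2*dl)) z) <= C / (2*dl)" "abs (lap (cut (2*dl)) z) <= C / (2*dl)^2"
    using C(2)[of "2*dl" z] d z zp by auto
   have dc: "cut e differentiable (at z)" for e by (rule df[OF cut_C4[OF open_dom] z])
   have dm: "(%z. (-1) * cut e z) differentiable (at z)" for e by (intro differentiable_mult differentiable_const dc)
   have pz: "pd b zeta z = pd b (cut (dl/2)) z + (-1) * pd b (cut (2*dl)) z" for b
    unfolding zeta_def[abs_def] by (subst partial_deriv_add[OF dc dm], subst partial_deriv_cmult[OF dc]) simp
   have lz: "lap zeta z = lap (cut (dl/2)) z + (-1) * lap (cut (2*dl)) z"
    unfolding zeta_def[abs_def] laplacian_add[OF open_dom le2[OF cut_C4[OF open_dom]] le2[OF C_k_on_cmult[OF open_dom cut_C4[OF open_dom]]] z]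
     laplacian_cmult[OF open_dom le2[OF cut_C4[OF open_dom]] z] ..
   have b0: "abs (zeta z) <= k" using c1(1) c2(1) C(1) unfolding zeta_def k_def by linarith
   have b1: "abs (pd b zeta z) <= k * s" if "b : Basis" for b
   proof -
    have "abs (pd b zeta z) <= C / (dl/2) + C / (2*dl)" unfolding pz by (rule order_trans[OF abs_triangle_ineq add_mono]) (use c1(2)[OF that] c2(2)[OF that] in simp_all)
    also have "... = (5/2 * C) * s" using d by (simp add: s_def field_simps)
    also have "... <= k * s" using s0 C(1) by (intro mult_right_mono) (auto simp: k_def)
    finally show ?thesis .
   qed
   have b2: "abs (lap zeta z) <= k * s^2"
   proof -
    have "abs (lap zeta z) <= C / (dl/2)^2 + C / (2*dl)^2" unfolding lz by (rule order_trans[OF abs_triangle_ineq add_mono]) (use c1(3) c2(3) in simp_all)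
    also have "... = (17/4 * C) * s^2" using d by (simp add: s_def field_simps power2_eq_square)
    also have "... <= k * s^2" using C(1) by (intro mult_right_mono) (auto simp: k_def)
    finally show ?thesis .
   qed
   have gz: "abs (grad_inner zeta zeta z) <= n * (k^2 * s^2)"
   proof -
    have "abs (grad_inner zeta zeta z) <= (SUM b:(Basis :: 'a set). k^2 * s^2)"
     unfolding grad_inner_def
    proof (rule order_trans[OF sum_abs sum_mono])
     fix b :: 'a assume "b : Basis"
     hence "abs (pd b zeta z) * abs (pd b zeta z) <= (k * s) * (k * s)" using b1 k0 s0 by (intro mult_mono) auto
     thus "abs (pd b zeta z * pd b zeta z) <= k^2 * s^2" by (simp add: abs_mult power2_eq_square mult_ac)
    qed
    thus ?thesis by (simp add: n_eq)
   qed
   have h2z: "h2 z = (zeta z)^2" and h4z: "h4 z = (zeta z) ^ 4" by (simp_all add: h4_def h2_def power2_eq_square power4_eq_xxxx)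
   have p2: "pd b h2 z = 2 * zeta z * pd b zeta z" for b
    unfolding h2_def[abs_def] by (subst partial_deriv_mult[OF df[OF zC z] df[OF zC z]]) simp
   have p4: "pd b h4 z = 4 * zeta z ^ 3 * pd b zeta z" for b
    unfolding h4_def[abs_def] by (subst partial_deriv_mult[OF df[OF h2C z] df[OF h2C z]]) (simp add: p2 h2z power2_eq_square power3_eq_cube)
   have L2: "lap h2 z = 2 * (zeta z * lap zeta z) + 2 * grad_inner zeta zeta z"
    unfolding h2_def[abs_def] by (subst laplacian_mult[OF open_dom le2[OF zC] le2[OF zC] z]) simp
   have L4: "lap h4 z = 2 * ((zeta z)^2 * lap h2 z) + 8 * ((zeta z)^2 * grad_inner zeta zeta z)"
   proof -
    have "grad_inner h2 h2 z = 4 * ((zeta z)^2 * grad_inner zeta zeta z)"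
     unfolding grad_inner_def p2 by (simp add: sum_distrib_left power2_eq_square mult_ac)
    thus ?thesis
     unfolding h4_def[abs_def] by (subst laplacian_mult[OF open_dom le2[OF h2C] le2[OF h2C] z]) (simp add: h2z)
   qed
   have Y0: "abs (lap h2 z) <= (2 * k^2 + 2 * n * k^2) * s^2"
   proof -
    have "abs (zeta z * lap zeta z) <= k * (k * s^2)" unfolding abs_mult using b0 b2 k0 by (intro mult_mono) auto
    hence "abs (lap h2 z) <= 2 * (k * (k * s^2)) + 2 * (n * (k^2 * s^2))" using gz unfolding L2 by linarith
    thus ?thesis by (simp add: algebra_simps power2_eq_square)
   qed
   have Y: "abs (lap h2 z) <= w * s^2"
    by (rule order_trans[OF Y0 mult_right_mono]) (use n_ge_1 in "auto simp: w_def")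
   have W: "abs (lap h4 z) <= w * (zeta z)^2 * s^2"
   proof -
    have "abs (lap h4 z) <= 2 * ((zeta z)^2 * abs (lap h2 z)) + 8 * ((zeta z)^2 * abs (grad_inner zeta zeta z))"
     unfolding L4 by (rule order_trans[OF abs_triangle_ineq]) (simp add: abs_mult)
    also have "... <= 2 * ((zeta z)^2 * ((2 * k^2 + 2 * n * k^2) * s^2)) + 8 * ((zeta z)^2 * (n * (k^2 * s^2)))"
     using Y0 gz by (intro add_mono mult_left_mono) auto
    also have "... = w * (zeta z)^2 * s^2" by (simp add: w_def algebra_simps)
    finally show ?thesis .
   qed
   have Th: "Theta z = ((zeta z) ^ 4 * lap u z + 2 * (SUM b:Basis. 4 * zeta z ^ 3 * pd b zeta z * pd b u z) + u z * lap h4 z) * lap u z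
     - (zeta z) ^ 4 * u z * f z + A * s^2 * ((zeta z)^2 * (2 * u z * lap u z + 2 * (SUM b:Basis. (pd b u z)^2)) - (u z)^2 * lap h2 z)"
   proof -
    have "lap (%z. h4 z * u z) z = h4 z * lap u z + 2 * grad_inner h4 u z + u z * lap h4 z"
     by (rule laplacian_mult[OF open_dom le2[OF h4C] le2[OF uC] z])
    moreover have "lap (%z. u z * u z) z = u z * lap u z + 2 * grad_inner u u z + u z * lap u z"
     by (rule laplacian_mult[OF open_dom le2[OF uC] le2[OF uC] z])
    ultimately show ?thesis
     unfolding Theta_def sol_eq[OF sol z] h2z h4z grad_inner_def p4 by (simp add: power2_eq_square mult_ac)
   qed
   have key: "((zeta z)^2 * lap u z)^2 / 2 + s^2 * (zeta z)^2 * (SUM b:Basis. (pd b u z)^2) - Q * (s^2 * u z)^2 - (zeta z) ^ 4 * abs (u z * f z) <= Theta z"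
    unfolding Th Q_def by (rule caccioppoli_pointwise[OF b1 n_eq n_ge_1 W Y w0 A_def])
   have dz: "d z <= 4 * dl / c0" using phi_lower[OF z] zp(2) consts_pos by (simp add: field_simps)
   have uz: "abs (u z) <= K * (16 * dl^2 / c0^2)"
   proof -
    have "(d z)^2 <= (4 * dl / c0)^2" using dz by (intro power_mono) auto
    also have "... = 16 * dl^2 / c0^2" by (simp add: power_divide power_mult_distrib)
    finally have "K * (d z)^2 <= K * (16 * dl^2 / c0^2)" using F0 by (intro mult_left_mono) auto
    thus ?thesis using K z by fastforce
   qed
   have "(s^2 * u z)^2 <= (K * (16 / c0^2))^2"
   proof -
    have "abs (s^2 * u z) <= s^2 * (K * (16 * dl^2 / c0^2))" using mult_left_mono[OF uz, of "s^2"] by (simp add: abs_mult)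
    also have "... = K * (16 / c0^2)" using d by (simp add: s_def power_divide)
    finally show ?thesis using F0 by (intro abs_le_square_iff[THEN iffD1]) auto
   qed
   hence q1: "Q * (s^2 * u z)^2 <= Q * (256 / c0 ^ 4) * K^2"
    using mult_left_mono[OF _ Q0] by (fastforce simp: power_mult_distrib power_divide mult_ac)
   have q2: "(zeta z) ^ 4 * abs (u z * f z) <= k ^ 4 * (16 / c0^2) * (K * F)"
   proof -
    have "dl^2 <= 1" using d by (simp add: power_le_one)
    hence "K * (16 * dl^2 / c0^2) <= K * (16 / c0^2)" using F0 by (intro mult_left_mono divide_right_mono) auto
    hence "abs (u z) * abs (f z) <= (K * (16 / c0^2)) * F" using uz F z F0 by (intro mult_mono) auto
    moreover have "(zeta z) ^ 4 <= k ^ 4" using power_mono[OF b0, of 4] by simp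
    ultimately have "(zeta z) ^ 4 * (abs (u z) * abs (f z)) <= k ^ 4 * ((K * (16 / c0^2)) * F)" using k0 by (intro mult_mono[of "zeta z ^ 4" "k ^ 4"]) auto
    thus ?thesis by (simp add: abs_mult mult_ac)
   qed
   have tot: "Q * (s^2 * u z)^2 + (zeta z) ^ 4 * abs (u z * f z) <= Q' * (K^2 + K * F)"
   proof -
    have "0 <= Q * (256 / c0 ^ 4) * (K * F)" "0 <= k ^ 4 * (16 / c0^2) * K^2" using Q0 F0 by auto
    hence "Q * (256 / c0 ^ 4) * K^2 + k ^ 4 * (16 / c0^2) * (K * F) <= Q' * (K^2 + K * F)"
     unfolding Q'_def distrib_left distrib_right by linarith
    thus ?thesis using q1 q2 by linarith
   qed
   show ?thesis
   proof (cases "z : strip dl (2 * dl)")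
    case T: True
    have e: "s^2 * (SUM b:Basis. (pd b u z)^2) = (SUM b:Basis. (pd b u z)^2) / dl^2" by (simp add: s_def power_divide)
    have "0 <= (SUM b:Basis. (pd b u z)^2) / dl^2" by (simp add: sum_nonneg)
    thus ?thesis using key tot z1[OF T] True T e by (simp add: energy_def)
   next
    case F: False
    have "0 <= s^2 * (zeta z)^2 * (SUM b:Basis. (pd b u z)^2)" by (simp add: sum_nonneg)
    hence "0 <= Theta z + Q' * (K^2 + K * F)" using key tot zero_le_power2[of "(zeta z)^2 * lap u z"] by linarith
    thus ?thesis using True F by simp
   qed
  qed
  have iR: "integ (%z. 2 * Theta z)" by (rule set_integrable_mult_right) (rule iT)
  have "(LO z. ind (strip dl (2 * dl)) z * energy dl u z) <= (LO z. 2 * Theta z + 2 * (Q' * (K^2 + K * F)) * ?I' z)"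
   by (rule set_integral_mono[OF strip_cont_integrable[OF d(1) energy_continuous[OF uC]] set_integral_add(1)[OF iR strip_indicator_integral(2)]]) (rule pt)
  also have "... = 2 * (Q' * (K^2 + K * F)) * measure lborel (strip (dl/2) (4 * dl))"
   unfolding set_integral_add(2)[OF iR strip_indicator_integral(2)] strip_indicator_integral(1) by (simp add: T0)
  also have "... <= 2 * (Q' * (K^2 + K * F)) * (Cv * dl)"
   using Cv(2)[OF d(1,3)] Q'0 F0 by (intro mult_left_mono mult_nonneg_nonneg add_nonneg_nonneg) auto
  finally show ?thesis by (simp add: mult_ac)
 qed
 have "0 < 2 * Q' * Cv" using Q'0 Cv by simp
 with main show ?thesis by blast
qed

end

text \<open>Young's inequality for a gradient and a Laplacian of different functions:
  \<open>q\<close> and \<open>v\<close> belong to one, \<open>L\<close> to the other. The result has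
  the scaling of \<open>energy\<close>.\<close>

lemma commutator_pointwise:
 fixes q D :: "'b => real"
 assumes D: "!!i. i : I ==> abs (D i) <= C * s" and N: "N = real (card I)" and Lambda: "abs Lambda <= C * s^2" and C: "0 <= C"
 shows "abs ((2 * (SUM i:I. D i * q i) + v * Lambda) * L) <= C * (N + 1) * (L^2 + s^2 * (SUM i:I. (q i)^2)) + C * (s^2 * v)^2"
proof -
 have amgm: "2 * (abs x * abs y) <= x^2 + y^2" for x y :: real
  using zero_le_power2[of "abs x - abs y"] by (simp add: power2_diff)
 define S where "S = (SUM i:I. (q i)^2)"
 have S0: "0 <= S" by (simp add: S_def sum_nonneg)
 have "abs (2 * (SUM i:I. D i * q i) * L) = abs (SUM i:I. 2 * (D i * q i) * L)" by (simp add: sum_distrib_left sum_distrib_right mult_ac)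
 also have "... <= (SUM i:I. C * (L^2 + s^2 * (q i)^2))"
 proof (rule order_trans[OF sum_abs sum_mono])
  fix i assume i: "i : I"
  have "abs (2 * (D i * q i) * L) = abs (D i) * (2 * (abs (q i) * abs L))" by (simp add: abs_mult)
  also have "... <= (C * abs s) * (2 * (abs (q i) * abs L))" using D[OF i] C by (intro mult_right_mono order_trans[OF D[OF i] mult_left_mono]) auto
  also have "... = C * (2 * (abs (s * q i) * abs L))" by (simp add: abs_mult)
  also have "... <= C * ((s * q i)^2 + L^2)" using amgm C by (rule mult_left_mono)
  finally show "abs (2 * (D i * q i) * L) <= C * (L^2 + s^2 * (q i)^2)" by (simp add: power_mult_distrib add.commute)
 qed
 also have "... = C * (N * L^2 + s^2 * S)" by (simp add: N S_def sum.distrib sum_distrib_left distrib_left)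
 finally have 1: "abs (2 * (SUM i:I. D i * q i) * L) <= C * (N * L^2 + s^2 * S)" .
 have "abs (v * Lambda * L) <= abs v * (C * s^2) * abs L" unfolding abs_mult using Lambda by (intro mult_right_mono mult_left_mono) auto
 also have "... = C * (abs (s^2 * v) * abs L)" by (simp add: abs_mult)
 also have "... <= C * ((s^2 * v)^2 + L^2)"
 proof (rule mult_left_mono[OF _ C])
  have "0 <= abs (s^2 * v) * abs L" by simp
  thus "abs (s^2 * v) * abs L <= (s^2 * v)^2 + L^2" using amgm[of "s^2 * v" L] by linarith
 qed
 finally have 2: "abs (v * Lambda * L) <= C * ((s^2 * v)^2 + L^2)" .
 have 3: "0 <= C * (N * (s^2 * S))" using C S0 by (simp add: N)
 have "abs ((2 * (SUM i:I. D i * q i) + v * Lambda) * L) <= abs (2 * (SUM i:I. D i * q i) * L) + abs (v * Lambda * L)"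
  unfolding distrib_right by (rule abs_triangle_ineq)
 also have "... <= C * (N * L^2 + s^2 * S) + C * ((s^2 * v)^2 + L^2) + C * (N * (s^2 * S))" using 1 2 3 by linarith
 also have "... = C * (N + 1) * (L^2 + s^2 * S) + C * (s^2 * v)^2" by (simp add: algebra_simps)
 finally show ?thesis by (simp add: S_def)
qed

context smooth_bounded_domain
begin

text \<open>Green's identity with a cut-off. What remains is supported in the strip and bilinear in
  the derivatives of \<open>u\<close> and \<open>v\<close> up to order two; the strip energies,
  which are \<open>O(dl)\<close>, bound it.\<close>

theorem sol_symmetry:
 assumes su: "sols f u" and sv: "sols g v"
  and F: "bd f F" "ALL z:Om. abs (g z) <= F"
  and K: "ALL z:Om. abs (u z) <= K * (d z)^2" "ALL z:Om. abs (v z) <= K * (d z)^2"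
 shows "(LO z. f z * v z) = (LO z. u z * g z)"
proof -
 obtain Cv where Cv: "0 < Cv" "!!dl. 0 < dl ==> dl < m0 / 8 ==> measure lborel (strip (dl / 2) (4 * dl)) <= Cv * dl"
  using strip_volume by blast
 obtain C where C: "0 < C" "!!dl z. 0 < dl ==> dl <= 1 ==> z : Om ==> ph z < 16 * dl ==>
   abs (cut dl z) <= C & (ALL b:Basis. abs (pd b (cut dl) z) <= C / dl) & abs (lap (cut dl) z) <= C / dl^2"
  using cut_derivs by blast
 obtain Ce where Ce: "0 < Ce" "!!f u F K dl. sols f u ==> bd f F ==> ALL z:Om. abs (u z) <= K * (d z)^2 ==>
  0 < dl ==> dl <= 1/2 ==> dl < m0 / 8 ==>
  (LO z. ind (strip dl (2 * dl)) z * energy dl u z) <= Ce * (K^2 + K * F) * dl"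
  using strip_energy by blast
 have K0: "0 <= K"
 proof -
  obtain x where x: "x : Om" using nonempty_dom by blast
  have "0 <= K * (d x)^2" using K x by fastforce
  thus "0 <= K" using d_pos[OF x] by (simp add: zero_le_mult_iff)
 qed
 have uC: "C_k_on 4 Om u" and vC: "C_k_on 4 Om v" using sol_C4 su sv by auto
 have le2: "C_k_on 2 Om g" if "C_k_on 4 Om g" for g by (rule C_k_on_le[OF that]) simp
 have LC: "C_k_on 2 Om (lap g)" if "C_k_on 4 Om g" for g
  using that by (intro C_k_on_laplacian open_dom) (simp add: eval_nat_numeral)
 have cC: "C_k_on 4 Om (cut dl)" for dl by (rule cut_C4[OF open_dom])
 define H where "H = 2 * (C * (n + 1) * (Ce * (K^2 + K * F))) + 2 * C * (K * (4 / c0^2))^2 * Cv"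
 have bound: "abs (LO z. cut dl z * (f z * v z - u z * g z)) <= H * dl"
  if d: "0 < dl" "dl <= 1/2" "dl < m0 / 8" for dl
 proof -
  let ?N = "{z : Om. dl <= ph z}"
  let ?I = "ind (strip dl (2 * dl))"
  have N: "compact ?N" "?N \<subseteq> Om" using compact_superlevel[of "dl"] d by auto
  have loc: "EX U. open U & x : U & (ALL y:U. cut dl y = 0)" if "x : Om - ?N" for x
   by (rule exI[of _ "{z : Om. ph z < dl}"]) (use that cut_0[OF d(1)] open_sublevel[of dl] in "simp add: not_le")
  have loc': "EX U. open U & x : U & ((ALL y:U. cut dl y * w y = 0) | (ALL y:U. w' y = 0))" if "x : Om - ?N" for x and w w' :: "'a => real"
   using loc[OF that] by (metis mult_zero_left)
  note G = Green_second[OF open_dom N le2[OF C_k_on_mult[OF open_dom cC]] LC loc']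
  note G1 = G[OF vC uC] and G2 = G[OF uC vC]
  \<comment> \<open>The products of the two Laplacians cancel in the difference, and only terms with
    a derivative of the cut-off are left.\<close>
  define Xi where "Xi z = lap (%z. cut dl z * v z) z * lap u z - lap (%z. cut dl z * u z) z * lap v z" for z
  have "(LO z. cut dl z * (f z * v z - u z * g z))
    = (LO z. cut dl z * v z * lap (lap u) z - cut dl z * u z * lap (lap v) z)"
   by (rule set_lebesgue_integral_cong) (simp_all add: sol_eq[OF su] sol_eq[OF sv] algebra_simps)
  also have "... = (LO z. Xi z)"
   unfolding Xi_def using set_integral_diff(2)[OF G1(1) G2(1)] set_integral_diff(2)[OF G1(2) G2(2)] G1(3) G2(3) by simp
  finally have e: "(LO z. cut dl z * (f z * v z - u z * g z)) = (LO z. Xi z)" .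
  have iX: "integ Xi" unfolding Xi_def[abs_def] by (rule set_integral_diff(1)[OF G1(2) G2(2)])
  let ?c = "2 * C * (K * (4 / c0^2))^2"
  have pt: "abs (Xi z) <= C * (n + 1) * (?I z * energy dl u z + ?I z * energy dl v z) + ?c * ?I z" if z: "z : Om" for z
  proof -
   have ex: "lap (%z. cut dl z * w z) z = cut dl z * lap w z + (2 * (SUM b:Basis. pd b (cut dl) z * pd b w z) + w z * lap (cut dl) z)"
    if "C_k_on 4 Om w" for w
    using laplacian_mult[OF open_dom le2[OF cC] le2[OF that] z] by (simp add: grad_inner_def)
   have alg: "(c * l + x) * m - (c * m + y) * l = x * m - y * l" for c l m x y :: real by (simp add: algebra_simps)
   have X: "Xi z = (2 * (SUM b:Basis. pd b (cut dl) z * pd b v z) + v z * lap (cut dl) z) * lap u z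
     - (2 * (SUM b:Basis. pd b (cut dl) z * pd b u z) + u z * lap (cut dl) z) * lap v z"
    unfolding Xi_def ex[OF uC] ex[OF vC] by (rule alg)
   show ?thesis
   proof (cases "z : strip dl (2 * dl)")
    case False
    then consider "ph z < dl" | "2 * dl < ph z" using z by (force simp: strip_def)
    hence "lap (cut dl) z = 0 & (ALL b. pd b (cut dl) z = 0)"
    proof cases
     case 1 thus ?thesis using locally_zero_laplacian[OF open_sublevel[of dl], of z "cut dl" 0] cut_0[OF d(1)] z by simp
    next
     case 2 thus ?thesis using locally_zero_laplacian[OF superlevel_open[of "2 * dl"], of z "cut dl" 1] cut_1[OF d(1)] z by simp
    qed
    thus ?thesis using False by (simp add: X)
   next
    case True
    hence zp: "ph z <= 2 * dl" by (auto simp: strip_def)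
    have c: "!!b. b : Basis ==> abs (pd b (cut dl) z) <= C * (1 / dl)" "abs (lap (cut dl) z) <= C * (1 / dl)^2"
     using C(2)[OF d(1) _ z] d zp by (auto simp: power_divide)
    have en: "(lap w z)^2 + (1/dl)^2 * (SUM b:Basis. (pd b w z)^2) = energy dl w z" for w
     by (simp add: energy_def power_divide)
    have small: "C * ((1/dl)^2 * w z)^2 <= C * (K * (4 / c0^2))^2" if "ALL z:Om. abs (w z) <= K * (d z)^2" for w
    proof -
     have "d z <= 2 * dl / c0" using phi_lower[OF z] zp consts_pos by (simp add: field_simps)
     hence "(d z)^2 <= (2 * dl / c0)^2" by (intro power_mono) auto
     hence "K * (d z)^2 <= K * (2 * dl / c0)^2" using K0 by (rule mult_left_mono)
     hence "abs (w z) <= K * (2 * dl / c0)^2" using that z by fastforce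
     from mult_left_mono[OF this, of "(1/dl)^2"] have "abs ((1/dl)^2 * w z) <= K * (4 / c0^2)"
      using d(1) by (simp add: abs_mult power_divide power_mult_distrib)
     hence "((1/dl)^2 * w z)^2 <= (K * (4 / c0^2))^2" using K0 by (intro abs_le_square_iff[THEN iffD1]) auto
     thus ?thesis using C(1) by simp
    qed
    have "abs (Xi z) <= (C * (n + 1) * ((lap u z)^2 + (1/dl)^2 * (SUM b:Basis. (pd b v z)^2)) + C * ((1/dl)^2 * v z)^2)
      + (C * (n + 1) * ((lap v z)^2 + (1/dl)^2 * (SUM b:Basis. (pd b u z)^2)) + C * ((1/dl)^2 * u z)^2)"
     unfolding X using C(1) by (intro order_trans[OF abs_triangle_ineq4 add_mono] commutator_pointwise c n_eq) auto
    also have "... = C * (n + 1) * (energy dl u z + energy dl v z) + C * ((1/dl)^2 * v z)^2 + C * ((1/dl)^2 * u z)^2"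
     unfolding en[symmetric] by (simp add: distrib_left)
    also have "... <= C * (n + 1) * (energy dl u z + energy dl v z) + ?c" using small[OF K(1)] small[OF K(2)] by linarith
    finally show ?thesis using True by simp
   qed
  qed
  have iu: "integ (%z. ?I z * energy dl u z)" and iv: "integ (%z. ?I z * energy dl v z)"
   by (intro strip_cont_integrable d energy_continuous uC vC)+
  have isum: "integ (%z. C * (n + 1) * (?I z * energy dl u z + ?I z * energy dl v z))"
   by (intro set_integrable_mult_right set_integral_add(1)[OF iu iv])
  have "abs (LO z. Xi z) <= (LO z. abs (Xi z))"
   unfolding set_lebesgue_integral_def using integral_abs_bound[of lborel "%z. ind Om z *\<^sub>R Xi z"] by (simp add: abs_mult)
  also have "... <= (LO z. C * (n + 1) * (?I z * energy dl u z + ?I z * energy dl v z) + ?c * ?I z)"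
   by (rule set_integral_mono[OF set_integrable_abs[OF iX] set_integral_add(1)[OF isum strip_indicator_integral(2)]]) (rule pt)
  also have "... = C * (n + 1) * ((LO z. ?I z * energy dl u z) + (LO z. ?I z * energy dl v z)) + ?c * measure lborel (strip dl (2 * dl))"
   unfolding set_integral_add(2)[OF isum strip_indicator_integral(2)] strip_indicator_integral(1) set_integral_mult_right set_integral_add(2)[OF iu iv]
   using strip_indicator_integral(1)[of 1 dl "2 * dl"] by simp
  also have "... <= C * (n + 1) * (Ce * (K^2 + K * F) * dl + Ce * (K^2 + K * F) * dl) + ?c * (Cv * dl)"
  proof (intro add_mono mult_left_mono)
   show "(LO z. ?I z * energy dl u z) <= Ce * (K^2 + K * F) * dl" by (rule Ce(2)[OF su F(1) K(1) d])
   show "(LO z. ?I z * energy dl v z) <= Ce * (K^2 + K * F) * dl" by (rule Ce(2)[OF sv F(2) K(2) d])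
   have "measure lborel (strip dl (2 * dl)) <= measure lborel (strip (dl / 2) (4 * dl))"
    using d emeasure_strip_finite by (intro measure_mono_fmeasurable strip_mono) (auto simp: fmeasurable_def)
   thus "measure lborel (strip dl (2 * dl)) <= Cv * dl" using Cv(2)[OF d(1,3)] by linarith
  qed (use C(1) n_ge_1 in auto)
  also have "... = H * dl" by (simp add: H_def algebra_simps)
  finally show ?thesis unfolding e .
 qed
 define D where "D = min (1/2) (m0 / 8)"
 have D: "0 < D" "D <= 1/2" "D <= m0 / 8" using consts_pos by (auto simp: D_def)
 define e where "e k = D * inverse (real (Suc (Suc k)))" for k
 have e0: "0 < e k" "e k < D" for k
 proof -
  have "inverse (real (Suc (Suc k))) < 1" by (simp add: field_simps)
  thus "0 < e k" "e k < D" using D by (simp_all add: e_def)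
 qed
 have elim: "e ----> 0"
  using tendsto_mult_left[OF LIMSEQ_Suc[OF LIMSEQ_inverse_real_of_nat], of D] by (simp add: e_def[abs_def])
 have bf: "continuous_on Om f" "continuous_on Om g" "continuous_on Om u" "continuous_on Om v"
  using sol_f_continuous sol_continuous su sv by auto
 obtain Mu Mv where M: "!!z. z : Om ==> abs (u z) <= Mu" "!!z. z : Om ==> abs (v z) <= Mv" using sol_bounded[OF su] sol_bounded[OF sv] by blast
 have i1: "integ (%z. f z * v z)"
 proof (rule set_integrable_bounded_cont[where C = "F * Mv"])
  show "abs (f z * v z) <= F * Mv" if "z : Om" for z
   unfolding abs_mult using F(1) M(2) that by (intro mult_mono') auto
 qed (intro continuous_intros bf)
 have i2: "integ (%z. u z * g z)"
 proof (rule set_integrable_bounded_cont[where C = "Mu * F"])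
  show "abs (u z * g z) <= Mu * F" if "z : Om" for z
   unfolding abs_mult using F(2) M(1) that by (intro mult_mono') auto
 qed (intro continuous_intros bf)
 have "(%k. LO z. cut (e k) z * (f z * v z - u z * g z)) ----> (LO z. f z * v z - u z * g z)"
  by (rule cut_integral_limit[OF set_integral_diff(1)[OF i1 i2] e0(1) elim])
 moreover have "(%k. LO z. cut (e k) z * (f z * v z - u z * g z)) ----> 0"
 proof (rule Lim_null_comparison)
  have "norm (LO z. cut (e k) z * (f z * v z - u z * g z)) <= H * e k" for k
  proof -
   have "e k <= 1/2" "e k < m0 / 8" using e0(2)[of k] D by linarith+
   thus ?thesis using bound[OF e0(1)] by simp
  qed
  thus "\<forall>\<^sub>F k in sequentially. norm (LO z. cut (e k) z * (f z * v z - u z * g z)) <= H * e k" by simp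
  show "(%k. H * e k) ----> 0" using tendsto_mult_left[OF elim, of H] by simp
 qed
 ultimately have "(LO z. f z * v z - u z * g z) = 0" using LIMSEQ_unique by blast
 thus ?thesis unfolding set_integral_diff(2)[OF i1 i2] by simp
qed

end

subsection \<open>Green functions\<close>

context smooth_bounded_domain
begin

lemma lipschitz_holder:
 assumes "gamma < 1" "!!x y. x : closure Om ==> y : closure Om ==> abs (f x - f y) <= L * dist x y"
 shows "holder gamma f"
proof -
 have "abs (f x - f y) <= (abs L * (2 * B) powr (1 - gamma)) * dist x y powr gamma" if "x : closure Om" "y : closure Om" for x y
 proof -
  have "abs (f x - f y) <= abs L * dist x y" using assms(2)[OF that] by (rule order_trans) (simp add: mult_right_mono)
  also have "dist x y = dist x y powr (1 - gamma) * dist x y powr gamma" by (simp add: powr_add[symmetric])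
  also have "... <= (2 * B) powr (1 - gamma) * dist x y powr gamma" using dist_le_2B[OF that] assms(1) by (intro mult_right_mono powr_mono2) auto
  finally show ?thesis by (simp add: mult_left_mono mult.assoc)
 qed
 thus ?thesis by auto
qed

lemma C1_holder:
 assumes "gamma < 1" "C_k_on (Suc 0) UNIV f" shows "holder gamma f"
proof -
 obtain C where C: "symb (Suc 0) (cball 0 B) (%_. 1) (%_. C) f"
  using C_k_on_bounded_compact[OF compact_cball C_k_on_subset[OF assms(2)]] by blast
 have "abs (f x - f y) <= (real DIM('a) * C) * dist x y" if "x : closure Om" "y : closure Om" for x y
  unfolding dist_norm by (rule Lipschitz_from_partials[of "cball 0 B"]) (use C that B(2) in auto)
 thus ?thesis by (rule lipschitz_holder[OF assms(1)])
qed

text \<open>An admissible approximation of the sign of \<open>w\<close>: \<open>arctan\<close>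
  smooths the sign, and the cut-off makes the extension by zero continuously differentiable,
  whatever \<open>w\<close> does at the boundary.\<close>

lemma test_function_holder:
 assumes "gamma < 1" "C_k_on 4 Om w" "0 < dl"
 shows "holder gamma (%z. if z : Om then cut dl z * (c * arctan (k * w z)) else 0)" (is "holder gamma ?g")
proof (rule C1_holder[OF assms(1)])
 have w: "C_k_on (Suc 0) Om w" by (rule C_k_on_le[OF assms(2)]) simp
 define h where "h j s = (if j = 0 then arctan (k * s) else k / (1 + (k * s)^2))" for j :: nat and s
 have "C_k_on (Suc 0) Om (%z. h 0 (w z))"
 proof (rule C_k_on_comp[OF open_dom w])
  show "(h j has_real_derivative h (Suc j) (w x)) (at (w x))" if "j < Suc 0" for j x
  proof -
   have "((%s. arctan (k * s)) has_real_derivative inverse (1 + (k * w x)^2) * k) (at (w x))"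
    by (auto intro!: derivative_eq_intros)
   thus ?thesis using that by (simp add: h_def[abs_def] divide_inverse mult.commute)
  qed
  have "1 + (k * s)^2 ~= 0" for s using zero_le_power2[of "k * s"] by linarith
  thus "continuous_on (w ` Om) (h (Suc 0))" by (auto simp: h_def[abs_def] intro!: continuous_intros)
 qed
 hence 1: "C_k_on (Suc 0) Om (%z. cut dl z * (c * arctan (k * w z)))"
  using C_k_on_le[OF cut_C4[OF open_dom], of "Suc 0"] by (intro C_k_on_mult C_k_on_const open_dom) (simp_all add: h_def)
 have A: "C_k_on (Suc 0) Om ?g" by (rule C_k_on_cong[OF open_dom 1]) simp
 let ?K = "{z : Om. dl <= ph z}"
 have K: "open (- ?K)" using compact_superlevel[OF assms(3)] by (simp add: compact_imp_closed open_Compl)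
 have B: "C_k_on (Suc 0) (- ?K) ?g"
  by (rule C_k_on_cong[OF K C_k_on_const[of _ _ 0]]) (use cut_0[OF assms(3)] in auto)
 have "C_k_on (Suc 0) (Om \<union> - ?K) ?g" by (rule C_k_on_Un[OF open_dom K A B])
 moreover have "Om \<union> - ?K = UNIV" by auto
 ultimately show "C_k_on (Suc 0) UNIV ?g" by simp
qed

text \<open>Duality: \<open>u\<close> is tested against approximations \<open>g k\<close> of its own
  sign. By symmetry the integral of \<open>u * g k\<close> equals that of \<open>f * v\<close>,
  where \<open>v\<close> is the solution for \<open>g k\<close>, and \<open>green_sup\<close> bounds
  \<open>v\<close> by a multiple of \<open>d^2\<close>.\<close>

lemma green_L1:
 assumes G: "biharmonic_green_function gamma Om G" and gamma: "gamma < 1"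
 shows "EX C>0. ALL f u F. sols f u --> bd f F -->
  (LO z. abs (u z)) <= C * (LO z. abs (f z) * (d z)^2)"
proof -
 obtain Cs where Cs: "1 <= Cs" "!!j s. j <= 4 ==> abs (smooth_step j s) <= Cs" using smooth_step_bound by blast
 obtain Cg where Cg: "0 < Cg" "!!f x. holder gamma f ==> ALL z:Om. abs (f z) <= 1 ==> x : Om ==> abs (gint G f x) <= Cg * (d x)^2"
  using green_sup[OF G] by blast
 obtain Ca where Ca: "0 < Ca" "!!f u F M. sols f u ==> bd f F ==> ALL z:Om. abs (u z) <= M ==>
   (ALL x:Om. abs (u x) <= Ca * (F + M) * (d x)^2)" using a_priori by blast
 \<comment> \<open>Normalises the test functions to sup norm at most 1: \<open>arctan\<close> is
   bounded by \<open>pi / 2\<close> and the cut-off by \<open>Cs\<close>. The limit of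
   \<open>u * g k\<close> is then \<open>|u| / Cs\<close>.\<close>
 define c where "c = 2 / (Cs * pi)"
 have c: "0 < c" "c * (pi / 2) = 1 / Cs" using Cs by (auto simp: c_def)
 have "(LO z. abs (u z)) <= (Cs * Cg) * (LO z. abs (f z) * (d z)^2)"
  if sol: "sols f u" and F: "bd f F" for f u F
 proof -
  obtain M where M: "ALL z:Om. abs (u z) <= M" using sol_bounded[OF sol] by blast
  define K where "K = max (Ca * (F + M)) Cg"
  have uK: "ALL z:Om. abs (u z) <= K * (d z)^2"
  proof
   fix z assume "z : Om"
   hence "abs (u z) <= Ca * (F + M) * (d z)^2" using Ca(2)[OF sol F M] by blast
   also have "... <= K * (d z)^2" by (intro mult_right_mono) (simp_all add: K_def)
   finally show "abs (u z) <= K * (d z)^2" .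
  qed
  define e where "e k = inverse (real (Suc k))" for k
  have e: "0 < e k" "e ----> 0" for k using LIMSEQ_inverse_real_of_nat by (simp_all add: e_def[abs_def])
  define g where "g k z = (if z : Om then cut (e k) z * (c * arctan (real k * u z)) else 0)" for k z
  define h where "h k z = cut (e k) z * (c * (arctan (real k * u z) * u z))" for k z
  have hol: "holder gamma (g k)" for k unfolding g_def by (rule test_function_holder[OF gamma sol_C4[OF sol] e(1)])
  have ac: "abs (cut (e k) z) * abs (c * arctan (real k * u z)) <= 1" for k z
  proof -
   have "abs (arctan (real k * u z)) <= pi / 2" using arctan_bounded[of "real k * u z"] by linarith
   hence "abs (c * arctan (real k * u z)) <= 1 / Cs" using c mult_left_mono[of "abs (arctan (real k * u z))" "pi/2" c] by (simp add: abs_mult)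
   moreover have "abs (cut (e k) z) <= Cs" using Cs(2)[of 0] by (simp add: cut_def)
   ultimately have "abs (cut (e k) z) * abs (c * arctan (real k * u z)) <= Cs * (1 / Cs)" using Cs(1) by (intro mult_mono) auto
   thus ?thesis using Cs(1) by simp
  qed
  have g1: "abs (g k z) <= 1" for k z using ac[of k z] by (simp add: g_def abs_mult)
  have fc: "continuous_on Om f" by (rule sol_f_continuous[OF sol])
  have dc: "continuous_on Om d" unfolding bdist_def by (intro continuous_intros)
  have ifd: "integ (%z. abs (f z) * (d z)^2)"
  proof (rule set_integrable_bounded_cont[where C = "F * (2 * B)^2"])
   show "abs (abs (f z) * (d z)^2) <= F * (2 * B)^2" if "z : Om" for z
    using F that power_mono[OF d_le_2B[OF subsetD[OF closure_subset that]] d_nonneg, of 2] unfolding abs_mult by (intro mult_mono') auto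
  qed (intro continuous_intros fc dc)
  have le: "(LO z. h k z) <= Cg * (LO z. abs (f z) * (d z)^2)" for k
  proof -
   let ?v = "gint G (g k)"
   have sv: "sols (g k) ?v" by (rule green_solves[OF G hol])
   have vC: "ALL z:Om. abs (?v z) <= Cg * (d z)^2" using Cg(2)[OF hol] g1 by blast
   hence vK: "ALL z:Om. abs (?v z) <= K * (d z)^2"
   proof -
    have "Cg * (d z)^2 <= K * (d z)^2" for z by (intro mult_right_mono) (simp_all add: K_def)
    thus ?thesis using vC order_trans by blast
   qed
   have "(LO z. h k z) = (LO z. u z * g k z)"
    by (rule set_lebesgue_integral_cong) (auto simp: h_def g_def)
   also have "... = (LO z. f z * ?v z)"
    by (rule sol_symmetry[OF sol sv _ _ uK vK, symmetric, where F = "max F 1"]) (use F g1 in "auto simp: le_max_iff_disj")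
   also have "... <= (LO z. Cg * (abs (f z) * (d z)^2))"
   proof (rule set_integral_mono)
    obtain Mv where Mv: "ALL z:Om. abs (?v z) <= Mv" using sol_bounded[OF sv] by blast
    show "integ (%z. f z * ?v z)"
    proof (rule set_integrable_bounded_cont[where C = "F * Mv"])
     show "abs (f z * ?v z) <= F * Mv" if "z : Om" for z
      unfolding abs_mult using F Mv that by (intro mult_mono') auto
    qed (intro continuous_intros fc sol_continuous[OF sv])
    show "integ (%z. Cg * (abs (f z) * (d z)^2))" by (rule set_integrable_mult_right) (rule ifd)
    fix z assume z: "z : Om"
    have "abs (f z) * abs (?v z) <= abs (f z) * (Cg * (d z)^2)" using vC z by (intro mult_left_mono) auto
    thus "f z * ?v z <= Cg * (abs (f z) * (d z)^2)" using abs_ge_self[of "f z * ?v z"] by (simp add: abs_mult mult_ac)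
   qed
   also have "... = Cg * (LO z. abs (f z) * (d z)^2)" by simp
   finally show ?thesis .
  qed
  have iu: "integ (%z. abs (u z))"
   by (rule set_integrable_bounded_cont[where C = M]) (use M in "auto intro: continuous_intros sol_continuous[OF sol]")
  have lim: "(%k. LO z. h k z) ----> (LO z. (1 / Cs) * abs (u z))"
   unfolding set_lebesgue_integral_def
  proof (rule integral_dominated_convergence[where w = "%z. ind Om z *\<^sub>R (abs (u z))"])
   have "continuous_on Om (h k)" for k
    unfolding h_def[abs_def] by (intro continuous_intros sol_continuous[OF sol] C_k_on_imp_continuous[OF cut_C4[OF open_dom]])
   thus "(%z. ind Om z *\<^sub>R h k z) : borel_measurable lborel" for k
    using borel_measurable_continuous_on_indicator[OF _ \<open>continuous_on Om (h k)\<close>] by simp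
   show "(%z. ind Om z *\<^sub>R ((1 / Cs) * abs (u z))) : borel_measurable lborel"
    using borel_measurable_continuous_on_indicator[OF _ continuous_on_mult[OF continuous_on_const continuous_on_rabs[OF sol_continuous[OF sol]]], of "1 / Cs"] by simp
   show "integrable lborel (%z. ind Om z *\<^sub>R (abs (u z)))" using iu unfolding set_integrable_def .
   show "AE z in lborel. norm (ind Om z *\<^sub>R h k z) <= ind Om z *\<^sub>R (abs (u z))" for k
   proof (rule AE_I2)
    fix z
    have "abs (cut (e k) z) * abs (c * arctan (real k * u z)) * abs (u z) <= 1 * abs (u z)" by (intro mult_right_mono ac) simp
    thus "norm (ind Om z *\<^sub>R h k z) <= ind Om z *\<^sub>R (abs (u z))" by (simp add: h_def abs_mult indicator_def mult.assoc)
   qed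
   show "AE z in lborel. (%k. ind Om z *\<^sub>R h k z) ----> ind Om z *\<^sub>R ((1 / Cs) * abs (u z))"
   proof (rule AE_I2)
    fix z
    show "(%k. ind Om z *\<^sub>R h k z) ----> ind Om z *\<^sub>R ((1 / Cs) * abs (u z))"
    proof (cases "z : Om")
     case True
     have "\<forall>\<^sub>F k in sequentially. e k < ph z / 2" by (rule order_tendstoD(2)[OF e(2)]) (use phi_pos[OF True] in simp)
     hence ev: "\<forall>\<^sub>F k in sequentially. c * (arctan (real k * u z) * u z) = h k z"
      by eventually_elim (use cut_1 e(1) in "simp add: h_def")
     have "(%k. arctan (real k * u z) * u z) ----> pi / 2 * abs (u z)"
     proof (cases "u z = 0")
      case nz: False
      have eq: "arctan (real k * u z) * u z = arctan (abs (u z) * real k) * abs (u z)" for k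
       by (cases "0 <= u z") (auto simp: mult.commute arctan_minus)
      have "filterlim (%k. abs (u z) * real k) at_top sequentially"
       using nz by (intro filterlim_tendsto_pos_mult_at_top[OF tendsto_const _ filterlim_real_sequentially]) simp
      from filterlim_compose[OF tendsto_arctan_at_top this] show ?thesis unfolding eq by (intro tendsto_intros)
     qed simp
     hence "(%k. c * (arctan (real k * u z) * u z)) ----> c * (pi / 2 * abs (u z))" by (rule tendsto_mult_left)
     hence "(%k. h k z) ----> c * (pi / 2 * abs (u z))" using ev by (rule Lim_transform_eventually)
     thus ?thesis using True c(2) by (simp add: mult.assoc[symmetric])
    qed simp
   qed
  qed
  have "(LO z. (1 / Cs) * abs (u z)) <= Cg * (LO z. abs (f z) * (d z)^2)"
   by (rule LIMSEQ_le_const2[OF lim]) (use le in blast)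
  thus ?thesis using Cs(1) by (simp add: field_simps)
 qed
 moreover have "0 < Cs * Cg" using Cs Cg by simp
 ultimately show ?thesis by blast
qed

lemma integral_pos:
 fixes q :: "'a => real"
 assumes "continuous_on Om q" "!!z. z : Om ==> 0 <= q z" "integ q" "x : Om" "0 < q x"
 shows "0 < (LO z. q z)"
proof -
 have "isCont q x" using assms(1,4) open_dom by (simp add: continuous_on_eq_continuous_at)
 then obtain r where r: "0 < r" "!!z. dist z x < r ==> abs (q z - q x) < q x / 2"
  by (rule isCont_real_eps[where f = q and q = x and eps = "q x / 2"]) (use assms(5) in auto)
 obtain r' where r': "0 < r'" "ball x r' \<subseteq> Om" using open_dom assms(4) open_contains_ball by blast
 let ?A = "ball x (min r r')"
 have "measure lborel ?A * (q x / 2) = (LINT z|lborel. (q x / 2) * ind ?A z)" by (simp add: mult.commute)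
 also have "... <= (LINT z|lborel. ind Om z *\<^sub>R q z)"
 proof (rule integral_mono)
  show "integrable lborel (%z. (q x / 2) * ind ?A z)"
   using emeasure_bounded_finite[OF bounded_ball, of x "min r r'"] by (intro integrable_mult_right integrable_real_indicator) simp_all
  show "integrable lborel (%z. ind Om z *\<^sub>R q z)" using assms(3) unfolding set_integrable_def .
  fix z
  show "(q x / 2) * ind ?A z <= ind Om z *\<^sub>R q z"
  proof (cases "z : ?A")
   case True
   hence "abs (q z - q x) < q x / 2" "z : Om" using r r' by (auto simp: dist_commute)
   moreover from this(1) have "q x / 2 <= q z" by linarith
   ultimately show ?thesis using True by simp
  next
   case False
   hence "ind ?A z = 0" by (simp add: indicator_def)
   moreover have "0 <= ind Om z *\<^sub>R q z" using assms(2)[of z] by (simp add: indicator_def)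
   ultimately show ?thesis by (simp only: mult_zero_right)
  qed
 qed
 finally have "measure lborel ?A * (q x / 2) <= (LO z. q z)" unfolding set_lebesgue_integral_def .
 moreover have "0 < measure lborel ?A" using r r' content_ball_pos[of "min r r'" x] by simp
 ultimately show ?thesis using assms(5) by (meson half_gt_zero less_le_trans mult_pos_pos)
qed

text \<open>A Lipschitz, hence Hoelder continuous, approximation of the unit mass at
  \<open>y\<close>. It is normalised over \<open>Om\<close>, so the integral is 1 for every
  \<open>k\<close>, also while the support of the tent leaves the domain.\<close>

definition tent :: "'a => nat => 'a => real" where
 "tent y k z = max 0 (1 - real (Suc k) * dist z y) / (LO z. max 0 (1 - real (Suc k) * dist z y))"

lemma tent_holder: "gamma < 1 ==> holder gamma (tent y k)"
proof (rule lipschitz_holder[where L = "real (Suc k) * abs (inverse (LO z. max 0 (1 - real (Suc k) * dist z y)))"])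
 fix x z
 let ?m = "%z. max 0 (1 - real (Suc k) * dist z y)" and ?c = "inverse (LO z. max 0 (1 - real (Suc k) * dist z y))"
 have "abs (dist x y - dist z y) <= dist x z" using dist_triangle[of x y z] dist_triangle[of z y x] dist_commute[of x z] by linarith
 hence "real (Suc k) * abs (dist x y - dist z y) <= real (Suc k) * dist x z" by (rule mult_left_mono) simp
 hence "abs (real (Suc k) * dist x y - real (Suc k) * dist z y) <= real (Suc k) * dist x z" by (simp add: right_diff_distrib[symmetric] abs_mult del: of_nat_Suc)
 hence "abs (?m x - ?m z) <= real (Suc k) * dist x z" by linarith
 hence "abs (?m x - ?m z) * abs (?c) <= real (Suc k) * dist x z * abs (?c)" by (rule mult_right_mono) simp
 thus "abs (tent y k x - tent y k z) <= real (Suc k) * abs (?c) * dist x z"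
  by (simp only: tent_def divide_inverse left_diff_distrib[symmetric] abs_mult mult_ac)
qed

lemma tent_nonneg: "0 <= tent y k z"
 unfolding tent_def set_lebesgue_integral_def by (intro divide_nonneg_nonneg integral_nonneg) auto

lemma tent_continuous: "continuous_on S (tent y k)"
 unfolding tent_def[abs_def] divide_inverse by (intro continuous_intros)

lemma tent_bounded: "EX C. ALL z:Om. abs (tent y k z) <= C"
proof -
 have "compact (tent y k ` closure Om)" by (intro compact_continuous_image tent_continuous compact_closure_dom)
 then obtain C where "ALL z:closure Om. abs (tent y k z) <= C" unfolding compact_eq_bounded_closed bounded_pos by auto
 thus ?thesis using closure_subset by blast
qed

lemma tent_integral: assumes "y : Om" shows "(LO z. tent y k z) = 1" "integ (tent y k)"
proof -
 let ?m = "%z. max 0 (1 - real (Suc k) * dist z y)"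
 have c: "continuous_on Om ?m" by (intro continuous_intros)
 have i: "integ ?m"
  by (rule set_integrable_bounded_cont[OF c, where C = 1]) (auto simp del: of_nat_Suc)
 have "0 < (LO z. ?m z)" by (rule integral_pos[OF c _ i assms]) auto
 thus "(LO z. tent y k z) = 1" unfolding tent_def by (simp only: set_integral_divide_zero) simp
 obtain C where "ALL z:Om. abs (tent y k z) <= C" using tent_bounded by blast
 thus "integ (tent y k)" by (intro set_integrable_bounded_cont tent_continuous) auto
qed

lemma tent_limit:
 assumes y: "y : Om" and i: "!!k. integ (%z. q z * tent y k z)" and q: "isCont q y"
 shows "(%k. LO z. q z * tent y k z) ----> q y"
proof (rule LIMSEQ_I)
 fix s :: real assume s: "0 < s"
 hence s2: "0 < s / 2" by simp
 obtain r where r: "0 < r" "!!z. dist z y < r ==> abs (q z - q y) < s / 2" by (rule isCont_real_eps[OF q s2]) (rule that, assumption+)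
 obtain N :: nat where N: "inverse (real (Suc N)) < r" using reals_Archimedean[OF r(1)] by blast
 have "norm ((LO z. q z * tent y k z) - q y) < s" if k: "N <= k" for k
 proof -
  have it: "integ (%z. c * tent y k z)" for c by (rule set_integrable_mult_right) (rule tent_integral(2)[OF y])
  have e: "(LO z. q z * tent y k z) - q y = (LO z. q z * tent y k z - q y * tent y k z)"
   by (subst set_integral_diff(2)[OF i it]) (simp add: tent_integral(1)[OF y])
  have "abs (LO z. q z * tent y k z - q y * tent y k z) <= (LO z. abs (q z * tent y k z - q y * tent y k z))"
   unfolding set_lebesgue_integral_def using integral_abs_bound[of lborel "%z. ind Om z *\<^sub>R (q z * tent y k z - q y * tent y k z)"] by (simp add: abs_mult)
  also have "... <= (LO z. s / 2 * tent y k z)"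
  proof (rule set_integral_mono[OF set_integrable_abs[OF set_integral_diff(1)[OF i it]] it])
   fix z
   show "abs (q z * tent y k z - q y * tent y k z) <= s / 2 * tent y k z"
   proof (cases "dist z y < r")
    case True
    hence "abs (q z - q y) * tent y k z <= s / 2 * tent y k z" by (intro mult_right_mono tent_nonneg) (use r(2)[OF True] in linarith)
    thus ?thesis by (simp add: left_diff_distrib[symmetric] abs_mult tent_nonneg)
   next
    case False
    have "inverse (real (Suc k)) <= inverse (real (Suc N))" using k by (simp add: field_simps)
    hence "inverse (real (Suc k)) <= dist z y" using False N by linarith
    hence "real (Suc k) * inverse (real (Suc k)) <= real (Suc k) * dist z y" by (rule mult_left_mono) simp
    moreover have "real (Suc k) * inverse (real (Suc k)) = 1" by (rule right_inverse) simp
    ultimately have "tent y k z = 0" unfolding tent_def by simp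
    thus ?thesis by simp
   qed
  qed
  also have "... = s / 2" by (simp add: tent_integral(1)[OF y])
  finally show ?thesis unfolding e using s by simp
 qed
 thus "EX N. ALL k>=N. norm ((LO z. q z * tent y k z) - q y) < s" by blast
qed

lemma green_isCont:
 assumes "biharmonic_green_function gamma Om G" "x : Om" "y : Om" "x ~= y" shows "isCont (G x) y"
proof -
 have "continuous_on {(x, y). x : Om & y : Om & x ~= y} (%(x, y). G x y)"
  using assms(1) unfolding biharmonic_green_function_def by blast
 hence "continuous_on ((%y. (x, y)) ` (Om - {x})) (%(x, y). G x y)" by (rule continuous_on_subset) (use assms(2) in auto)
 from continuous_on_compose[OF continuous_on_Pair[OF continuous_on_const continuous_on_id] this]
 have "continuous_on (Om - {x}) (G x)" by (simp add: o_def)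
 moreover have "open (Om - {x})" using open_dom by auto
 ultimately show ?thesis using assms(3,4) by (auto simp: continuous_on_eq_continuous_at)
qed

lemma green_tent_limit:
 assumes "biharmonic_green_function gamma Om G" "gamma < 1" "x : Om" "y : Om" "x ~= y"
 shows "(%k. gint G (tent y k) x) ----> G x y"
 by (rule tent_limit[OF assms(4) green_integrable[OF assms(1) tent_holder[OF assms(2)] assms(3)] green_isCont[OF assms(1,3,4,5)]])

section \<open>Uniqueness of the Green function\<close>

lemma sol_diff_rhs:
 assumes "sols f u" "sols f v"
 shows "sols (%z. 0) (%z. u z + (-1) * v z)"
proof -
 have uC: "C_k_on 4 Om u" and vC: "C_k_on 4 Om v" using sol_C4 assms by auto
 have le2: "C_k_on 2 Om g" if "C_k_on 4 Om g" for g by (rule C_k_on_le[OF that]) simp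
 have LC: "C_k_on 2 Om (lap g)" if "C_k_on 4 Om g" for g
  using that by (intro C_k_on_laplacian open_dom) (simp add: eval_nat_numeral)
 have mC: "C_k_on k Om (%z. (-1) * g z)" if "C_k_on k Om g" for k and g :: "'a => real" by (rule C_k_on_cmult[OF open_dom that])
 have lin: "lap (%z. a z + (-1) * c z) z = lap a z + (-1) * lap c z" if "C_k_on 2 Om a" "C_k_on 2 Om c" "z : Om" for a c :: "'a => real" and z
  unfolding laplacian_add[OF open_dom that(1) mC[OF that(2)] that(3)] laplacian_cmult[OF open_dom that(2,3)] ..
 have L0: "lap (lap (%z. u z + (-1) * v z)) z = 0" if z: "z : Om" for z
 proof -
  have "lap (lap (%z. u z + (-1) * v z)) z = lap (%z. lap u z + (-1) * lap v z) z"
   by (rule laplacian_cong[OF open_dom z]) (rule lin[OF le2[OF uC] le2[OF vC]])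
  also have "... = 0" unfolding lin[OF LC[OF uC] LC[OF vC] z] by (simp add: sol_eq[OF assms(1) z] sol_eq[OF assms(2) z])
  finally show ?thesis .
 qed
 have lim: "((%z. u z + (-1) * v z) ---> 0) (at p within Om)" if "p : frontier Om" for p
  using tendsto_diff[OF sol_lim[OF assms(1) that] sol_lim[OF assms(2) that]] by simp
 have limp: "(pd c (%z. u z + (-1) * v z) ---> 0) (at p within Om)" if p: "p : frontier Om" and c: "c : Basis" for p c
 proof -
  have 1: "((%z. pd c u z - pd c v z) ---> 0) (at p within Om)"
   using tendsto_diff[OF sol_lim_partial[OF assms(1) p c] sol_lim_partial[OF assms(2) p c]] by simp
  have "pd c (%z. u z + (-1) * v z) z = pd c u z - pd c v z" if z: "z : Om" for z
  proof -
   have "u differentiable (at z)" "v differentiable (at z)" by (rule sol_diff[OF assms(1) z], rule sol_diff[OF assms(2) z])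
   thus ?thesis using partial_deriv_add[of u z "%z. (-1) * v z" c] partial_deriv_cmult[of v z c "-1"] differentiable_mult[OF differentiable_const, of v z UNIV "-1"] by simp
  qed
  hence "\<forall>\<^sub>F z in at p within Om. pd c u z - pd c v z = pd c (%z. u z + (-1) * v z) z"
   by (auto simp: eventually_at_filter)
  with 1 show ?thesis by (rule Lim_transform_eventually)
 qed
 show ?thesis unfolding solves_biharmonic_dirichlet_def using L0 lim limp C_k_on_add[OF open_dom uC mC[OF vC]] by blast
qed

text \<open>Two solutions with the same data differ by a solution of the homogeneous problem, which
  is zero by \<open>green_L1\<close>; tents as data carry this over to the kernels. It is what makes
  the final constants independent of \<open>G\<close>.\<close>

lemma green_unique:
 assumes G: "biharmonic_green_function gamma Om G" and G': "biharmonic_green_function gamma Om G'" and gamma: "gamma < 1"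
  and x: "x : Om" and y: "y : Om" "x ~= y"
 shows "G x y = G' x y"
proof -
 obtain C where C: "!!f u F. sols f u ==> bd f F ==>
  (LO z. abs (u z)) <= C * (LO z. abs (f z) * (d z)^2)" using green_L1[OF G gamma] by blast
 have "gint G (tent y k) x = gint G' (tent y k) x" for k
 proof -
  let ?v = "%z. gint G (tent y k) z + (-1) * gint G' (tent y k) z"
  have sol: "sols (%z. 0) ?v" by (rule sol_diff_rhs[OF green_solves[OF G tent_holder[OF gamma]] green_solves[OF G' tent_holder[OF gamma]]])
  obtain M where M: "ALL z:Om. abs (?v z) <= M" using sol_bounded[OF sol] by blast
  have c: "continuous_on Om (%z. abs (?v z))" by (intro continuous_on_rabs sol_continuous[OF sol])
  have "(LO z. abs (?v z)) <= 0" using C[OF sol, of 0] by (simp add: set_lebesgue_integral_def)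
  hence "\<not> 0 < abs (?v x)" using integral_pos[OF c _ set_integrable_bounded_cont[OF c, of M] x] M by fastforce
  thus ?thesis by simp
 qed
 thus ?thesis using green_tent_limit[OF G gamma x y] green_tent_limit[OF G' gamma x y] LIMSEQ_unique by (metis (no_types, lifting) ext)
qed

end

subsection \<open>Bootstrapping the representation formula\<close>

text \<open>To be read with \<open>a = R x w\<close>, \<open>c = dist w z\<close> and
  \<open>r = R x z\<close>. One of \<open>a\<close> and \<open>c\<close> is at least
  \<open>r / 3\<close>, so one of the two singular factors can be taken out of the integral over
  \<open>w\<close>.\<close>

lemma conv_split_1:
 fixes a c r p :: real
 assumes "0 <= p" "0 < r" "r <= a + 2 * c" "0 <= a" "0 <= c"
 shows "a powr (- p) * c powr (- p) <= (r / 3) powr (- p) * (c powr (- p) + a powr (- p))"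
proof (cases "r / 3 <= a")
 case True
 hence "a powr (- p) <= (r / 3) powr (- p)" using assms by (intro powr_mono2') auto
 hence "a powr (- p) * c powr (- p) <= (r / 3) powr (- p) * c powr (- p)" by (rule mult_right_mono) simp
 thus ?thesis by (rule order_trans) (simp add: mult_left_mono)
next
 case False
 hence "r / 3 <= c" using assms by linarith
 hence "c powr (- p) <= (r / 3) powr (- p)" using assms by (intro powr_mono2') auto
 hence "a powr (- p) * c powr (- p) <= (r / 3) powr (- p) * a powr (- p)" by (simp add: mult.commute mult_left_mono)
 thus ?thesis by (rule order_trans) (simp add: mult_left_mono)
qed

text \<open>The larger of \<open>a\<close> and \<open>c\<close> is at least \<open>r / 2\<close>.
  The smaller one keeps the integrable exponent \<open>- n + 1/2\<close> and the larger one takes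
  the rest; the convolution gains half a power.\<close>

lemma conv_split_2:
 fixes a c r n beta :: real
 assumes "0 < r" "r <= a + c" "0 < a" "0 < c" "1/2 <= beta" "beta <= n - 1/2"
 shows "a powr (- n + 1) * c powr (- n + beta) <= (r / 2) powr (- n + beta + 1/2) * (c powr (- n + 1/2) + a powr (- n + 1/2))"
proof (cases "c <= a")
 case True
 have "a powr (- n + 1) * c powr (- n + beta) = c powr (- n + 1/2) * (a powr (- n + 1) * c powr (beta - 1/2))" by (simp add: powr_add[symmetric])
 also have "... <= c powr (- n + 1/2) * (a powr (- n + 1) * a powr (beta - 1/2))"
  using True assms by (intro mult_left_mono powr_mono2) auto
 also have "a powr (- n + 1) * a powr (beta - 1/2) = a powr (- n + beta + 1/2)" unfolding powr_add[symmetric] by (simp add: algebra_simps)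
 also have "... <= (r / 2) powr (- n + beta + 1/2)" using True assms by (intro powr_mono2') auto
 finally have "a powr (- n + 1) * c powr (- n + beta) <= c powr (- n + 1/2) * (r / 2) powr (- n + beta + 1/2)" by (simp add: mult_left_mono)
 thus ?thesis by (rule order_trans) (simp add: distrib_left mult.commute)
next
 case False
 have "a powr (- n + 1) * c powr (- n + beta) = a powr (- n + 1/2) * (a powr (1/2) * c powr (- n + beta))" by (simp add: powr_add[symmetric])
 also have "... <= a powr (- n + 1/2) * (c powr (1/2) * c powr (- n + beta))"
  using False assms by (intro mult_left_mono mult_right_mono powr_mono2) auto
 also have "c powr (1/2) * c powr (- n + beta) = c powr (- n + beta + 1/2)" unfolding powr_add[symmetric] by (simp add: add_ac)
 also have "... <= (r / 2) powr (- n + beta + 1/2)" using False assms by (intro powr_mono2') auto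
 finally have "a powr (- n + 1) * c powr (- n + beta) <= a powr (- n + 1/2) * (r / 2) powr (- n + beta + 1/2)" by (simp add: mult_left_mono)
 thus ?thesis by (rule order_trans) (simp add: distrib_left mult.commute)
qed

context smooth_bounded_domain
begin

definition kint :: "('a => 'a => real) => ('a => ennreal) => 'a => ennreal" where
 "kint k v x = (NI z. en (k x z) * (v z * indicator Om z))"

lemma kint_measurable:
 assumes [measurable]: "case_prod k : borel_measurable (borel \<Otimes>\<^sub>M borel)" "(%z. v z * indicator Om z) : borel_measurable borel"
 shows "kint k v : borel_measurable borel"
 unfolding kint_def[abs_def] by measurable

lemma kint_mono_AE:
 assumes v: "(%z. v z * indicator Om z) : borel_measurable borel" and k: "k' x : borel_measurable borel"
  and "!!z. z : Om ==> z ~= x ==> k x z <= C * k' x z" "0 <= C" "!!z. 0 <= k' x z"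
 shows "kint k v x <= en C * kint k' v x"
proof -
 have [measurable]: "(%z. v z * indicator Om z) : borel_measurable borel" "k' x : borel_measurable borel" by fact+
 have "kint k v x <= (NI z. en C * (en (k' x z) * (v z * indicator Om z)))"
  unfolding kint_def
 proof (rule nn_integral_mono_AE, use AE_neq[of x] in eventually_elim)
  fix z assume ne: "z ~= x"
  show "en (k x z) * (v z * indicator Om z) <= en C * (en (k' x z) * (v z * indicator Om z))"
  proof (cases "z : Om")
   case True
   have "en (k x z) <= en C * en (k' x z)" using assms(3)[OF True ne] assms(4,5) by (simp add: ennreal_mult[symmetric] ennreal_leI)
   thus ?thesis by (simp add: mult.assoc[symmetric] mult_right_mono)
  qed simp
 qed
 also have "... = en C * kint k' v x" unfolding kint_def by (rule nn_integral_cmult) measurable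
 finally show ?thesis .
qed

text \<open>Fubini reduces the composition of the error operator with a kernel to a pointwise
  inequality, because the bracket on its right-hand side has a bounded integral in \<open>w\<close>.
  The constant is uniform in the kernels.\<close>

lemma Kop_kint:
 fixes C :: real assumes "0 <= C"
 shows "EX C'>0. ALL k k' v x. case_prod k : borel_measurable (borel \<Otimes>\<^sub>M borel) -->
  (%z. v z * indicator Om z) : borel_measurable borel --> x : Om --> (ALL w z. 0 <= k w z & 0 <= k' w z) --> k' x : borel_measurable borel -->
  (ALL w:Om. ALL z:Om. w ~= z --> (d x)^2 * R x w powr (- n - 1) * k w z <= C * k' x z * (dist w z powr (- n + 1/2) + R x w powr (- n + 1/2)))
  --> Kop (kint k v) x <= en C' * kint k' v x"
proof -
 obtain C1 where C1: "0 < C1" "!!x. x : Om ==> (NO z. en (dist z x powr (- n + 1/2))) <= en C1"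
  using nn_integral_dist_dom by blast
 obtain C2 where C2: "0 < C2" "!!x. x : Om ==> (NO z. en (R x z powr (- n + 1/2))) <= en C2"
  using nn_integral_R_dom by blast
 have "Kop (kint k v) x <= en ((C + 1) * (C1 + C2)) * kint k' v x"
  if k [measurable]: "case_prod k : borel_measurable (borel \<Otimes>\<^sub>M borel)" and v [measurable]: "(%z. v z * indicator Om z) : borel_measurable borel"
   and x: "x : Om" and nn: "ALL w z. 0 <= k w z & 0 <= k' w z" and k' [measurable]: "k' x : borel_measurable borel"
   and pt: "ALL w:Om. ALL z:Om. w ~= z --> (d x)^2 * R x w powr (- n - 1) * k w z <= C * k' x z * (dist w z powr (- n + 1/2) + R x w powr (- n + 1/2))"
  for k k' v x
 proof -
  define j where "j w z = en ((d x)^2 * R x w powr (- n - 1)) * (en (k w z) * (v z * indicator Om z)) * indicator Om w" for w z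
  have jm: "case_prod j : borel_measurable (lborel \<Otimes>\<^sub>M lborel)" unfolding j_def[abs_def] by measurable
  have "Kop (kint k v) x = (NI w. NI z. j w z)"
   unfolding Kop_def kint_def j_def
   by (intro nn_integral_cong, subst nn_integral_cmult[symmetric], measurable, subst nn_integral_multc[symmetric], measurable)
  also have "... = (NI z. NI w. j w z)" by (rule lborel_pair.Fubini'[OF jm, symmetric])
  also have "... <= (NI z. en (C * (C1 + C2)) * (en (k' x z) * (v z * indicator Om z)))"
  proof (rule nn_integral_mono)
   fix z
   show "(NI w. j w z) <= en (C * (C1 + C2)) * (en (k' x z) * (v z * indicator Om z))"
   proof (cases "z : Om")
    case True
    have kp: "0 <= k' x z" "0 <= C * k' x z" using nn assms by auto
    have "(NI w. j w z) <= (\<integral>\<^sup>+w. (en (C * k' x z) * (v z * indicator Om z)) *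
      (en (dist w z powr (- n + 1/2)) * indicator Om w + en (R x w powr (- n + 1/2)) * indicator Om w) \<partial>lborel)"
    proof (rule nn_integral_mono_AE, use AE_neq[of z] in eventually_elim)
     fix w assume ne: "w ~= z"
     show "j w z <= (en (C * k' x z) * (v z * indicator Om z)) * (en (dist w z powr (- n + 1/2)) * indicator Om w + en (R x w powr (- n + 1/2)) * indicator Om w)"
     proof (cases "w : Om")
      case wO: True
      have "en ((d x)^2 * R x w powr (- n - 1)) * en (k w z) <= en (C * k' x z) * (en (dist w z powr (- n + 1/2)) + en (R x w powr (- n + 1/2)))"
       using pt wO True ne nn kp by (simp add: ennreal_mult[symmetric] ennreal_plus[symmetric] ennreal_leI del: ennreal_plus)
      from mult_right_mono[OF this, of "v z"] show ?thesis using wO True by (simp add: j_def mult_ac)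
     qed (simp add: j_def)
    qed
    also have "... = (en (C * k' x z) * (v z * indicator Om z)) * ((NO w. en (dist w z powr (- n + 1/2))) + (NO w. en (R x w powr (- n + 1/2))))"
     by (subst nn_integral_cmult, measurable, subst nn_integral_add, measurable)
    also have "... <= (en (C * k' x z) * (v z * indicator Om z)) * (en C1 + en C2)"
     by (intro mult_left_mono add_mono C1(2) C2(2) True x) simp
    also have "... = en (C * (C1 + C2)) * (en (k' x z) * (v z * indicator Om z))"
     using assms kp C1(1) C2(1) by (simp add: ennreal_mult ennreal_plus[symmetric] mult_ac del: ennreal_plus)
    finally show ?thesis .
   qed (simp add: j_def)
  qed
  also have "... = en (C * (C1 + C2)) * kint k' v x" unfolding kint_def by (rule nn_integral_cmult) measurable
  also have "... <= en ((C + 1) * (C1 + C2)) * kint k' v x" using assms C1(1) C2(1) by (intro mult_right_mono ennreal_leI) auto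
  finally show ?thesis .
 qed
 moreover have "0 < (C + 1) * (C1 + C2)" using assms C1(1) C2(1) by simp
 ultimately show ?thesis by blast
qed

text \<open>Half a power of \<open>R\<close> better than
  \<open>(d x)^2 * (d y)^2 * R x y powr (- n)\<close>, to which \<open>P\<close> is bounded below by
  \<open>P_lower\<close>; this margin decides the theorem.\<close>

definition wk :: "'a => 'a => real" where "wk x y = (d x)^2 * (d y)^2 * R x y powr (- n + 1/2)"

lemma wk_nonneg [simp]: "0 <= wk x y" by (simp add: wk_def)

lemma wk_measurable [measurable]: "case_prod wk : borel_measurable (borel \<Otimes>\<^sub>M borel)"
proof -
 have "(%q. wk (fst q) (snd q)) : borel_measurable (borel \<Otimes>\<^sub>M borel)"
  unfolding wk_def by measurable
 thus ?thesis by (simp add: case_prod_beta')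
qed

lemma wk_le_pk:
 assumes "x : Om" "z : Om" "z ~= x" shows "wk x z <= Dm powr (1/2) * pk x z"
proof -
 have "R x z powr (- n + 1/2) = R x z powr (1/2) * (R x z powr (- n + 1/2) * R x z powr (-1/2))" by (simp add: powr_add[symmetric])
 also have "... <= Dm powr (1/2) * (dist x z powr (- n + 1/2) * R x z powr (-1/2))"
  using assms n_ge_1 R_le_Dm[OF assms(1,2)] R_pos[OF assms(1), of z] R_ge(1)[of x z] by (intro mult_mono mult_right_mono powr_mono2 powr_mono2') auto
 finally have "(d x)^2 * (d z)^2 * R x z powr (- n + 1/2) <= (d x)^2 * (d z)^2 * (Dm powr (1/2) * (dist x z powr (- n + 1/2) * R x z powr (-1/2)))"
  by (rule mult_left_mono) simp
 thus ?thesis by (simp add: wk_def pk_def mult_ac)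
qed

text \<open>Of the square of \<open>d w\<close>, the power 3/2 softens
  \<open>R x w powr (- n - 1)\<close> to an integrable exponent, and the power 1/2 compensates
  \<open>R w z powr (-1/2)\<close>. The two remaining singularities are separated by
  \<open>conv_split_1\<close>.\<close>

lemma pk_conv:
 assumes "x : Om" "w : Om" "z : Om"
 shows "(d x)^2 * R x w powr (- n - 1) * pk w z <= 3 powr n * wk x z * (dist w z powr (- n + 1/2) + R x w powr (- n + 1/2))"
proof -
 have dw: "0 < d w" by (rule d_pos[OF assms(2)])
 have "R x w powr (- n - 1) * (d w)^2 * R w z powr (-1/2) = R x w powr (- n - 1) * (d w powr (3/2) * (d w powr (1/2) * R w z powr (-1/2)))"
  using dw by (simp add: powr_add[symmetric] powr_numeral mult.assoc[symmetric])
 also have "... <= R x w powr (- n - 1) * (R x w powr (3/2) * (R w z powr (1/2) * R w z powr (-1/2)))"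
  using dw R_ge(2)[of w z] R_ge(3)[of w x] by (intro mult_left_mono mult_mono mult_right_mono powr_mono2) auto
 also have "... = R x w powr (- n + 1/2)" using assms by (simp add: powr_add[symmetric])
 finally have "R x w powr (- n - 1) * (d w)^2 * R w z powr (-1/2) <= R x w powr (- n + 1/2)" .
 hence "R x w powr (- n - 1) * (d w)^2 * R w z powr (-1/2) * dist w z powr (- n + 1/2) <= R x w powr (- n + 1/2) * dist w z powr (- n + 1/2)"
  by (rule mult_right_mono) simp
 also have "... = R x w powr (- (n - 1/2)) * dist w z powr (- (n - 1/2))" by (simp add: algebra_simps)
 also have "... <= (R x z / 3) powr (- (n - 1/2)) * (dist w z powr (- (n - 1/2)) + R x w powr (- (n - 1/2)))"
  using n_ge_1 R_pos[OF assms(1)] R_triangle'[of x z w] R_pos[OF assms(1), of w] by (intro conv_split_1) (auto intro: less_imp_le)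
 also have "(R x z / 3) powr (- (n - 1/2)) = 3 powr (n - 1/2) * R x z powr (- (n - 1/2))"
  using R_pos[OF assms(1), of z] by (simp add: powr_divide powr_minus divide_simps)
 also have "... <= 3 powr n * R x z powr (- (n - 1/2))" by (intro mult_right_mono) auto
 finally have 1: "R x w powr (- n - 1) * (d w)^2 * R w z powr (-1/2) * dist w z powr (- n + 1/2)
   <= 3 powr n * R x z powr (- n + 1/2) * (dist w z powr (- n + 1/2) + R x w powr (- n + 1/2))" by (simp add: mult_right_mono)
 have "(d x)^2 * (d z)^2 * (R x w powr (- n - 1) * (d w)^2 * R w z powr (-1/2) * dist w z powr (- n + 1/2))
  <= (d x)^2 * (d z)^2 * (3 powr n * R x z powr (- n + 1/2) * (dist w z powr (- n + 1/2) + R x w powr (- n + 1/2)))"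
  by (rule mult_left_mono[OF 1]) simp
 thus ?thesis by (simp add: wk_def pk_def mult_ac)
qed

text \<open>\<open>(d x)^2\<close> softens the error kernel to \<open>R x w powr (- n + 1)\<close>;
  the rest is \<open>conv_split_2\<close> with the triangle inequality for \<open>R\<close>.\<close>

lemma R_conv:
 assumes "x : Om" "w : Om" "z : Om" "w ~= z" "1/2 <= beta" "beta <= n - 1/2"
 shows "(d x)^2 * R x w powr (- n - 1) * R w z powr (- n + beta) <= 2 powr n * R x z powr (- n + beta + 1/2) * (dist w z powr (- n + 1/2) + R x w powr (- n + 1/2))"
proof -
 have "(d x)^2 * R x w powr (- n - 1) <= R x w powr 2 * R x w powr (- n - 1)"
  using R_ge(2)[of x w] R_pos[OF assms(1), of w] by (intro mult_right_mono) (auto simp: powr_numeral power_mono)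
 also have "... = R x w powr (- n + 1)" unfolding powr_add[symmetric] by simp
 finally have "(d x)^2 * R x w powr (- n - 1) * R w z powr (- n + beta) <= R x w powr (- n + 1) * R w z powr (- n + beta)" by (rule mult_right_mono) simp
 also have "... <= (R x z / 2) powr (- n + beta + 1/2) * (R w z powr (- n + 1/2) + R x w powr (- n + 1/2))"
  using assms R_pos R_triangle by (intro conv_split_2) auto
 also have "... <= (2 powr n * R x z powr (- n + beta + 1/2)) * (dist w z powr (- n + 1/2) + R x w powr (- n + 1/2))"
 proof (rule mult_mono)
  have "(R x z / 2) powr (- n + beta + 1/2) = 2 powr (n - beta - 1/2) * R x z powr (- n + beta + 1/2)"
  proof -
   have "(R x z / 2) powr q = 2 powr (- q) * R x z powr q" for q
    using R_pos[OF assms(1), of z] by (simp add: powr_divide powr_minus divide_simps)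
   thus ?thesis by (simp add: algebra_simps)
  qed
  also have "... <= 2 powr n * R x z powr (- n + beta + 1/2)" using assms by (intro mult_right_mono) auto
  finally show "(R x z / 2) powr (- n + beta + 1/2) <= 2 powr n * R x z powr (- n + beta + 1/2)" .
  show "R w z powr (- n + 1/2) + R x w powr (- n + 1/2) <= dist w z powr (- n + 1/2) + R x w powr (- n + 1/2)"
   using R_powr_le_dist[of z w "- n + 1/2"] assms(4) n_ge_1 by (simp add: dist_commute)
 qed auto
 finally show ?thesis .
qed

lemma case_prod_R_powr_measurable: "case_prod (%x z. R x z powr s) : borel_measurable (borel \<Otimes>\<^sub>M borel)"
proof -
 have "(%q. R (fst q) (snd q) powr s) : borel_measurable (borel \<Otimes>\<^sub>M borel)" by measurable
 thus ?thesis by (simp add: case_prod_beta')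
qed

lemma case_prod_pk_measurable: "case_prod pk : borel_measurable (borel \<Otimes>\<^sub>M borel)"
proof -
 have "(%q. pk (fst q) (snd q)) : borel_measurable (borel \<Otimes>\<^sub>M borel)" by measurable
 thus ?thesis by (simp add: case_prod_beta')
qed

lemma pmaj_eq_kint: "pmaj f x = kint pk (%y. en (abs (f y))) x"
 unfolding pmaj_def kint_def by (simp add: ennreal_mult mult.assoc)

lemma Kop_le_Q:
 assumes u: "(%z. u z * indicator Om z) : borel_measurable borel" and x: "x : Om"
 shows "Kop u x <= en (Dm powr (1/2)) * kint (%x z. R x z powr (- n + 1/2)) u x"
proof -
 have "Kop u x = kint (%x z. (d x)^2 * R x z powr (- n - 1)) u x" unfolding Kop_def kint_def by (simp add: mult.assoc)
 also have "... <= en (Dm powr (1/2)) * kint (%x z. R x z powr (- n + 1/2)) u x"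
 proof (rule kint_mono_AE[OF u])
  fix z assume z: "z : Om"
  have "(d x)^2 * R x z powr (- n - 1) <= R x z powr 2 * R x z powr (- n - 1)"
   using R_ge(2)[of x z] R_pos[OF x, of z] by (intro mult_right_mono) (auto simp: powr_numeral power_mono)
  also have "... = R x z powr (1/2) * R x z powr (- n + 1/2)" unfolding powr_add[symmetric] by simp
  also have "... <= Dm powr (1/2) * R x z powr (- n + 1/2)" using R_le_Dm[OF x z] R_pos[OF x, of z] by (intro mult_right_mono powr_mono2) auto
  finally show "(d x)^2 * R x z powr (- n - 1) <= Dm powr (1/2) * R x z powr (- n + 1/2)" .
 qed simp_all
 finally show ?thesis .
qed

text \<open>Each application of the error kernel improves the singularity of the majorant of \<open>u\<close> by
 half a power, starting from \<open>R\<^bsup>1/2 - n\<^esup>\<close>; after \<open>2n - 1\<close> steps only the integral of \<open>\<bar>u\<bar>\<close> is left.\<close>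

theorem sol_estimate:
 "EX C>0. ALL f u F x. sols f u --> bd f F --> x : Om -->
  en (abs (u x - (LO z. P x z * f z) / fsol_const TYPE('a))) <=
   en C * (kint wk (%z. en (abs (f z))) x + (NO z. en (abs (u z))) * en ((d x)^2))"
proof -
 obtain C0 where C0: "0 < C0" "!!f u F x. sols f u ==> bd f F ==> x : Om ==>
  en (abs (u x - (LO z. P x z * f z) / fsol_const TYPE('a))) <= en C0 * Kop (%z. en (abs (u z))) x" using sol_kernel by blast
 obtain L1 where L1: "0 < L1" "!!f u F x. sols f u ==> bd f F ==> x : Om ==>
   en (abs (u x)) <= en L1 * pmaj f x + en L1 * Kop (%z. en (abs (u z))) x" using sol_majorant by blast
 obtain C2 where C2: "0 < C2" "!!x. x : Om ==> Kop (%z. en ((d z)^2)) x <= en C2 * en ((d x)^2)" using Kop_d2 by blast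
 have c3: "0 <= 3 powr n" "0 <= 2 powr n" by simp_all
 obtain C3 where C3: "0 < C3" "!!v x. (%z. v z * indicator Om z) : borel_measurable borel ==> x : Om ==> Kop (kint pk v) x <= en C3 * kint wk v x"
 proof -
  obtain C' where C': "0 < C'" "!!k k' v x. case_prod k : borel_measurable (borel \<Otimes>\<^sub>M borel) ==>
   (%z. v z * indicator Om z) : borel_measurable borel ==> x : Om ==> (ALL w z. 0 <= k w z & 0 <= k' w z) ==> k' x : borel_measurable borel ==>
   (ALL w:Om. ALL z:Om. w ~= z --> (d x)^2 * R x w powr (- n - 1) * k w z <= 3 powr n * k' x z * (dist w z powr (- n + 1/2) + R x w powr (- n + 1/2)))
   ==> Kop (kint k v) x <= en C' * kint k' v x" using Kop_kint[OF c3(1)] by blast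
  have "Kop (kint pk v) x <= en C' * kint wk v x" if "(%z. v z * indicator Om z) : borel_measurable borel" "x : Om" for v x
   by (rule C'(2)[OF case_prod_pk_measurable that]) (use pk_conv[OF that(2)] in "auto simp: wk_def")
  thus thesis using that C'(1) by blast
 qed
 obtain C4 where C4: "0 < C4" "!!v x beta. (%z. v z * indicator Om z) : borel_measurable borel ==> x : Om ==> 1/2 <= beta ==> beta <= n - 1/2 ==>
   Kop (kint (%x z. R x z powr (- n + beta)) v) x <= en C4 * kint (%x z. R x z powr (- n + beta + 1/2)) v x"
 proof -
  obtain C' where C': "0 < C'" "!!k k' v x. case_prod k : borel_measurable (borel \<Otimes>\<^sub>M borel) ==>
   (%z. v z * indicator Om z) : borel_measurable borel ==> x : Om ==> (ALL w z. 0 <= k w z & 0 <= k' w z) ==> k' x : borel_measurable borel ==>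
   (ALL w:Om. ALL z:Om. w ~= z --> (d x)^2 * R x w powr (- n - 1) * k w z <= 2 powr n * k' x z * (dist w z powr (- n + 1/2) + R x w powr (- n + 1/2)))
   ==> Kop (kint k v) x <= en C' * kint k' v x" using Kop_kint[OF c3(2)] by blast
  have "Kop (kint (%x z. R x z powr (- n + beta)) v) x <= en C' * kint (%x z. R x z powr (- n + beta + 1/2)) v x"
   if "(%z. v z * indicator Om z) : borel_measurable borel" "x : Om" "1/2 <= beta" "beta <= n - 1/2" for v x beta
   by (rule C'(2)[OF case_prod_R_powr_measurable that(1,2)]) (use R_conv[OF that(2) _ _ _ that(3,4)] in auto)
  thus thesis using that C'(1) by blast
 qed
 define D where "D = Dm powr (1/2)"
 have D: "0 < D" using Dm_ge_1 by (simp add: D_def)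
 \<comment> \<open>A common constant, so that all hypotheses of the bootstrap lemmas hold with the
   same \<open>L\<close>.\<close>
 define L where "L = 1 + L1 + L1 * D + C3 * D + C4"
 have LL: "0 <= L1 * D" "0 <= C3 * D" using L1(1) C3(1) D by auto
 have L: "1 <= L" "L1 <= L" "L1 * D <= L" "C3 * D <= L" "C4 <= L" using LL L1(1) C3(1) C4(1) unfolding L_def by linarith+
 have L0: "0 <= L" using L by linarith
 have mono: "en a * t <= en L * t" if "a <= L" for a t using that by (intro mult_right_mono ennreal_leI) auto
 \<comment> \<open>\<open>Q k\<close> has the exponent \<open>- n + (k + 1)/2\<close>; at
   \<open>k = 2 * n - 1\<close> this is 0, and \<open>Q k u x\<close> is the integral of
   \<open>|u|\<close>.\<close>
 define Q where "Q k u = kint (%x z. R x z powr (- n + real (Suc k) / 2)) (%z. en (abs (u z)))" for k and u :: "'a => real"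
 define g where "g f x = en L1 * pmaj f x" for f x
 note mu = sol_abs_measurable[OF sol_continuous] and mf = sol_abs_measurable[OF sol_f_continuous]
 have gm: "g f : borel_measurable borel" if "sols f u" for f u
 proof -
  have "kint pk (%y. en (abs (f y))) : borel_measurable borel" by (rule kint_measurable[OF case_prod_pk_measurable mf[OF that]])
  thus ?thesis unfolding g_def[abs_def] pmaj_eq_kint by measurable
 qed
 have Qm: "Q k u : borel_measurable borel" if "sols f u" for f u k
  unfolding Q_def by (rule kint_measurable[OF case_prod_R_powr_measurable mu[OF that]])
 have Kg1: "Kop (g f) x <= en (L1 * C3) * kint wk (%y. en (abs (f y))) x" if "sols f u" "x : Om" for f u x
 proof -
  have m: "kint pk (%y. en (abs (f y))) : borel_measurable borel" by (rule kint_measurable[OF case_prod_pk_measurable mf[OF that(1)]])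
  have "Kop (g f) x = en L1 * Kop (kint pk (%y. en (abs (f y)))) x"
   unfolding g_def[abs_def] pmaj_eq_kint by (rule Kop_cmult[OF m])
  also have "... <= en L1 * (en C3 * kint wk (%y. en (abs (f y))) x)" by (intro mult_left_mono C3(2) mf[OF that(1)] that(2)) simp
  finally show ?thesis using L1(1) C3(1) by (simp add: ennreal_mult mult.assoc)
 qed
 have Kg: "Kop (g f) x <= en L * g f x" if s: "sols f u" and x: "x : Om" for f u x
 proof -
  have pm: "pk x : borel_measurable borel" by measurable
  have "kint wk (%y. en (abs (f y))) x <= en D * kint pk (%y. en (abs (f y))) x"
   unfolding D_def by (rule kint_mono_AE[where k = wk and k' = pk, OF mf[OF s] pm]) (use wk_le_pk[OF x] in auto)
  hence "Kop (g f) x <= en (L1 * C3) * (en D * pmaj f x)"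
   using Kg1[OF s x] unfolding pmaj_eq_kint by (meson mult_left_mono order_trans zero_le)
  also have "... = en (C3 * D) * g f x" using L1(1) C3(1) D by (simp add: g_def ennreal_mult mult_ac)
  also have "... <= en L * g f x" by (rule mono[OF L(4)])
  finally show ?thesis .
 qed
 have u1: "en (abs (u x)) <= g f x + en L * Kop (%z. en (abs (u z))) x"
  if "sols f u" "bd f F" "x : Om" for f u F x
  using L1(2)[OF that] mono[OF L(2)] unfolding g_def by (meson add_left_mono order_trans)
 have iter: "EX A>=1. ALL f u F x. sols f u --> bd f F --> x : Om -->
   en (abs (u x)) <= en A * (g f x + Q k u x)" if "k <= 2 * DIM('a) - 1" for k
  using that
 proof (induction k)
  case 0
  have "en (abs (u x)) <= en L * (g f x + Q 0 u x)"
   if s: "sols f u" "bd f F" and x: "x : Om" for f u F x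
  proof -
   have "Kop (%z. en (abs (u z))) x <= en D * Q 0 u x" using Kop_le_Q[OF mu[OF s(1)] x] by (simp add: Q_def D_def)
   hence "en L1 * Kop (%z. en (abs (u z))) x <= en L1 * (en D * Q 0 u x)" by (rule mult_left_mono) simp
   also have "... = en (L1 * D) * Q 0 u x" using L1(1) D by (simp add: ennreal_mult mult.assoc)
   also have "... <= en L * Q 0 u x" by (rule mono[OF L(3)])
   finally have "en L1 * Kop (%z. en (abs (u z))) x <= en L * Q 0 u x" .
   moreover have "g f x <= en L * g f x" using mono[OF L(1)] by simp
   ultimately show ?thesis using L1(2)[OF s x] unfolding g_def distrib_left by (meson add_mono order_trans)
  qed
  thus ?case using L(1) by blast
 next
  case (Suc k)
  then obtain A where A: "1 <= A" "!!f u F x. sols f u ==> bd f F ==> x : Om ==>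
   en (abs (u x)) <= en A * (g f x + Q k u x)" by (metis Suc_leD)
  have "en (abs (u x)) <= en (1 + L * A * L) * (g f x + Q (Suc k) u x)"
   if s: "sols f u" "bd f F" and x: "x : Om" for f u F x
  proof -
   \<comment> \<open>The limit on \<open>k\<close> keeps the exponent after the step from becoming
     positive, as \<open>conv_split_2\<close> requires.\<close>
   have "Suc k + 1 <= 2 * DIM('a)" using Suc.prems by linarith
   hence "real (Suc k + 1) <= real (2 * DIM('a))" by (simp only: of_nat_le_iff)
   hence b: "1/2 <= real (Suc k) / 2" "real (Suc k) / 2 <= n - 1/2" by (auto simp: n_eq)
   have KQ: "Kop (Q k u) x <= en L * Q (Suc k) u x" if "x : Om" for x
   proof -
    have "Kop (Q k u) x <= en C4 * Q (Suc k) u x"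
     using C4(2)[OF mu[OF s(1)] that b] by (simp add: Q_def add_divide_distrib add_ac)
    also have "... <= en L * Q (Suc k) u x" by (rule mono[OF L(5)])
    finally show ?thesis .
   qed
   have "en (abs (u x)) <= (1 + en L * en A * en L) * (g f x + Q (Suc k) u x)"
    by (rule Kop_bootstrap(1)[OF gm[OF s(1)] Qm[OF s(1)] u1[OF s] Kg[OF s(1)] KQ A(2)[OF s] x])
   also have "1 + en L * en A * en L = en (1 + L * A * L)"
    using L0 A(1) by (simp add: ennreal_mult[symmetric] ennreal_plus[symmetric] flip: ennreal_1 del: ennreal_plus)
   finally show ?thesis .
  qed
  moreover have "1 <= 1 + L * A * L" using L0 A(1) by simp
  ultimately show ?case by blast
 qed
 obtain A where A: "1 <= A" "!!f u F x. sols f u ==> bd f F ==> x : Om ==>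
   en (abs (u x)) <= en A * (g f x + Q (2 * DIM('a) - 1) u x)" using iter[OF order_refl] by blast
 obtain A' where A': "0 < A'" "!!u g M x. g : borel_measurable borel ==> (ALL x:Om. u x <= g x + en L * Kop u x) ==>
  (ALL x:Om. Kop g x <= en L * g x) ==> (ALL x:Om. u x <= g x + M) ==> x : Om ==> u x <= en A' * (g x + M * en ((d x)^2))"
  using Kop_bootstrap_d[OF L0] by blast
 define C where "C = C0 * (A' * (A * (L1 * C3 + C2)))"
 have "en (abs (u x - (LO z. P x z * f z) / fsol_const TYPE('a))) <=
   en C * (kint wk (%z. en (abs (f z))) x + (NO z. en (abs (u z))) * en ((d x)^2))"
  if s: "sols f u" "bd f F" and x: "x : Om" for f u F x
 proof -
  let ?U = "NO z. en (abs (u z))"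
  let ?W = "kint wk (%z. en (abs (f z))) x"
  let ?h = "%x. en A * g f x"
  have gm' [measurable]: "g f : borel_measurable borel" by (rule gm[OF s(1)])
  have hm: "?h : borel_measurable borel" by measurable
  have QU: "Q (2 * DIM('a) - 1) u x = ?U" if "x : Om" for x
  proof -
   have "real (Suc (2 * DIM('a) - 1)) / 2 = n" using DIM_positive[where 'a='a] by (simp add: n_eq del: DIM_positive)
   thus ?thesis unfolding Q_def kint_def by (simp add: that)
  qed
  have A1: "t <= en A * t" for t :: ennreal
  proof -
   have "(1::ennreal) <= en A" using A(1) ennreal_leI[of 1 A] by simp
   from mult_right_mono[OF this, of t] show ?thesis by simp
  qed
  have h1: "ALL x:Om. en (abs (u x)) <= ?h x + en L * Kop (%z. en (abs (u z))) x"
   using u1[OF s] A1 by (meson add_right_mono order_trans)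
  have h2: "ALL x:Om. Kop ?h x <= en L * ?h x"
  proof
   fix x assume "x : Om"
   have "Kop ?h x = en A * Kop (g f) x" by (rule Kop_cmult[OF gm'])
   also have "... <= en A * (en L * g f x)" by (intro mult_left_mono Kg[OF s(1) \<open>x : Om\<close>]) simp
   finally show "Kop ?h x <= en L * ?h x" by (simp add: mult_ac)
  qed
  \<comment> \<open>The integral of \<open>|u|\<close> does not depend on \<open>x\<close>, so it
    can serve as the constant \<open>M\<close> of \<open>Kop_bootstrap_d\<close>, which supplies the
    factor \<open>(d x)^2\<close>.\<close>
  have h3: "ALL x:Om. en (abs (u x)) <= ?h x + en A * ?U"
   using A(2)[OF s] QU by (simp add: distrib_left)
  have fin: "en (abs (u x)) <= en A' * (?h x + (en A * ?U) * en ((d x)^2))" if "x : Om" for x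
   by (rule A'(2)[OF hm h1 h2 h3 that])
  have dm: "(%x. (en A * ?U) * en ((d x)^2)) : borel_measurable borel" by measurable
  \<comment> \<open>The error is bounded by \<open>Kop\<close> of \<open>|u|\<close> and not by
    \<open>|u|\<close>: this one more application of the operator improves the kernel
    \<open>pk\<close> in the bound of \<open>u\<close> to \<open>wk\<close>.\<close>
  have "Kop (%z. en (abs (u z))) x <= Kop (%x. en A' * (?h x + (en A * ?U) * en ((d x)^2))) x"
   by (rule Kop_mono[OF fin])
  also have "... = en A' * Kop (%x. ?h x + (en A * ?U) * en ((d x)^2)) x" by (rule Kop_cmult) measurable
  also have "Kop (%x. ?h x + (en A * ?U) * en ((d x)^2)) x = Kop ?h x + Kop (%x. (en A * ?U) * en ((d x)^2)) x"
   by (rule Kop_add[OF hm dm])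
  also have "Kop ?h x = en A * Kop (g f) x" by (rule Kop_cmult[OF gm'])
  also have "Kop (%x. (en A * ?U) * en ((d x)^2)) x = (en A * ?U) * Kop (%x. en ((d x)^2)) x" by (rule Kop_cmult) measurable
  also have "en A' * (en A * Kop (g f) x + (en A * ?U) * Kop (%x. en ((d x)^2)) x)
   <= en A' * (en A * (en (L1 * C3) * ?W) + (en A * ?U) * (en C2 * en ((d x)^2)))"
   by (intro mult_left_mono add_mono Kg1[OF s(1) x] C2(2)[OF x]) simp_all
  also have "... <= en A' * (en A * (en (L1 * C3 + C2) * ?W) + (en A * ?U) * (en (L1 * C3 + C2) * en ((d x)^2)))"
   using L1(1) C3(1) C2(1) by (intro mult_left_mono add_mono mult_right_mono ennreal_leI) auto
  also have "... = en A' * (en A * (en (L1 * C3 + C2) * (?W + ?U * en ((d x)^2))))"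
   by (simp only: distrib_left mult_ac)
  also have "... = en (A' * (A * (L1 * C3 + C2))) * (?W + ?U * en ((d x)^2))"
   using A'(1) A(1) L1(1) C3(1) C2(1) by (simp add: ennreal_mult mult.assoc)
  finally have k: "Kop (%z. en (abs (u z))) x <= en (A' * (A * (L1 * C3 + C2))) * (?W + ?U * en ((d x)^2))" .
  have "en (abs (u x - (LO z. P x z * f z) / fsol_const TYPE('a))) <= en C0 * Kop (%z. en (abs (u z))) x" by (rule C0(2)[OF s x])
  also have "... <= en C0 * (en (A' * (A * (L1 * C3 + C2))) * (?W + ?U * en ((d x)^2)))" by (rule mult_left_mono[OF k]) simp
  also have "... = en C * (?W + ?U * en ((d x)^2))"
   using C0(1) A'(1) A(1) L1(1) C3(1) C2(1) by (simp add: C_def ennreal_mult mult.assoc)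
  finally show ?thesis .
 qed
 moreover have "0 < C" using C0(1) A'(1) A(1) L1(1) C3(1) C2(1) by (simp add: C_def add_pos_pos)
 ultimately show ?thesis by blast
qed

end

subsection \<open>Comparison of the kernels\<close>

lemma PK_deriv:
 assumes "0 < a" "0 <= c" shows "(PK nu a has_real_derivative c * KK nu 2 (a + c)) (at c)"
proof -
 have p: "0 < a + c" using assms by simp
 have D: "((%c. KK nu j (a + c)) has_real_derivative KK nu (Suc j) (a + c) * 1) (at c)" for j
  by (rule DERIV_chain2[where f = "KK nu j" and g = "%c. a + c", OF KK_deriv[OF p]]) (auto intro!: derivative_eq_intros)
 show ?thesis
  unfolding PK_def[abs_def]
  by (rule DERIV_cong[OF DERIV_add[OF DERIV_diff[OF DERIV_const D[of 0]] DERIV_mult[OF DERIV_ident D[of 1]]]])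
   (simp add: numeral_2_eq_2)
qed

lemma PK_mono:
 assumes "0 < a" "0 <= c" "c <= c'" shows "PK nu a c <= PK nu a c'"
proof (rule DERIV_nonneg_imp_nondecreasing[OF assms(3)])
 fix s assume "c <= s" "s <= c'"
 hence "0 <= s" "0 < a + s" using assms by auto
 thus "EX y. (PK nu a has_real_derivative y) (at s) & 0 <= y" using PK_deriv[OF assms(1), of s nu] by (intro exI[of _ "s * KK nu 2 (a + s)"]) (simp add: KK2)
qed

text \<open>\<open>PK\<close> increases with \<open>c\<close>, so \<open>c\<close> may be replaced
  by the minimum of \<open>a\<close> and \<open>c\<close>, for which \<open>a + c\<close> is
  comparable to \<open>a\<close>. This form matches \<open>H\<close> for
  \<open>n > 4\<close>.\<close>

lemma PK_lower_min:
 assumes "0 < a" "0 < c" "0 <= nu"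
 shows "2 powr (- nu/2) / 4 * min (c^2 * a powr (- nu/2)) (a powr (2 - nu/2)) <= PK nu a c"
proof -
 define m where "m = min a c"
 have m: "0 < m" "m <= a" "m <= c" using assms by (auto simp: m_def)
 have "2 powr (- nu/2) / 4 * min (c^2 * a powr (- nu/2)) (a powr (2 - nu/2)) = m^2 * (2 * a) powr (- nu/2) / 4"
 proof -
  have "a powr (2 - nu/2) = a powr 2 * a powr (- nu/2)" unfolding powr_add[symmetric] by simp
  hence "a powr (2 - nu/2) = a^2 * a powr (- nu/2)" using assms by (simp add: powr_numeral)
  moreover have "min (c^2 * a powr (- nu/2)) (a^2 * a powr (- nu/2)) = m^2 * a powr (- nu/2)"
   using assms by (cases "a <= c") (auto simp: m_def min_def intro!: antisym mult_right_mono power_mono)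
  ultimately show ?thesis using assms by (simp add: powr_mult)
 qed
 also have "... <= m^2 * (a + m) powr (- nu/2) / 4"
  using m assms by (intro divide_right_mono mult_left_mono powr_mono2') auto
 also have "... <= PK nu a m" using PK_ge_1[of a m nu] m assms by simp
 also have "... <= PK nu a c" using m assms by (intro PK_mono) auto
 finally show ?thesis .
qed

text \<open>Here \<open>a + c\<close> is bounded by twice the larger of the two, whichever it is.
  This form matches \<open>H\<close> for \<open>n < 4\<close>.\<close>

lemma PK_lower_max:
 assumes "0 < a" "0 < c" "0 <= nu"
 shows "2 powr (- nu/2) / 4 * min (c^2 * a powr (- nu/2)) (c powr (2 - nu/2)) <= PK nu a c"
proof -
 have e: "c powr (2 - nu/2) = c^2 * c powr (- nu/2)"
 proof -
  have "c powr (2 - nu/2) = c powr 2 * c powr (- nu/2)" unfolding powr_add[symmetric] by simp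
  thus ?thesis using assms by (simp add: powr_numeral)
 qed
 have "min (a powr (- nu/2)) (c powr (- nu/2)) <= (max a c) powr (- nu/2)" by (auto simp: max_def)
 hence "2 powr (- nu/2) * min (a powr (- nu/2)) (c powr (- nu/2)) <= 2 powr (- nu/2) * (max a c) powr (- nu/2)" by (rule mult_left_mono) simp
 also have "... = (2 * max a c) powr (- nu/2)" using assms by (simp add: powr_mult)
 also have "... <= (a + c) powr (- nu/2)" using assms by (intro powr_mono2') auto
 finally have "c^2 * (2 powr (- nu/2) * min (a powr (- nu/2)) (c powr (- nu/2))) / 4 <= c^2 * (a + c) powr (- nu/2) / 4"
  by (intro divide_right_mono mult_left_mono) auto
 also have "... <= PK nu a c" using assms by (intro PK_ge_1) auto
 finally show ?thesis unfolding e min_mult_distrib_left by (simp add: mult_ac)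
qed

text \<open>For \<open>nu > 4\<close> neither \<open>- KK nu 0 (a + c)\<close> nor the derivative
  term is positive, so \<open>PK\<close> is at most the fundamental solution.\<close>

lemma PK_le_KK0:
 assumes "0 < a" "0 <= c" "4 < nu" shows "PK nu a c <= a powr (2 - nu/2) / ((nu - 2) * (nu/2 - 2))"
proof -
 have K0: "KK nu 0 s = s powr (2 - nu/2) / ((nu - 2) * (nu/2 - 2))" for s
 proof -
  have "(2 - nu) * (2 - nu/2) = (nu - 2) * (nu/2 - 2)" by (simp add: field_simps)
  thus ?thesis using assms(3) by (simp add: KK.simps)
 qed
 have "KK nu 1 (a + c) <= 0" unfolding One_nat_def KK.simps using assms by (simp add: divide_nonneg_neg)
 hence "c * KK nu 1 (a + c) <= 0" using assms(2) by (simp add: mult_nonneg_nonpos)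
 moreover have "0 <= KK nu 0 (a + c)" unfolding K0 using assms by simp
 ultimately show ?thesis unfolding PK_def K0[symmetric] by linarith
qed

text \<open>Dropping \<open>a\<close> in the remainder integral leaves
  \<open>theta powr (1 - nu/2)\<close>, which is integrable at 0 because
  \<open>nu < 4\<close>.\<close>

lemma PK_le_c:
 assumes "0 < a" "0 < c" "0 <= nu" "nu < 4" shows "PK nu a c <= c powr (2 - nu/2) / (2 * (2 - nu/2))"
proof -
 have "((%theta. theta powr (1 - nu/2)) has_integral 1 powr (1 - nu/2 + 1) / (1 - nu/2 + 1)) {0..1}"
  using assms by (intro has_integral_powr_from_0) auto
 hence I: "((%theta. (c powr (2 - nu/2) / 2) * theta powr (1 - nu/2)) has_integral (c powr (2 - nu/2) / 2) * (1 / (2 - nu/2))) {0..1}"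
  by (intro has_integral_mult_right) simp
 have "PK nu a c <= (c powr (2 - nu/2) / 2) * (1 / (2 - nu/2))"
 proof (rule has_integral_le[OF PK_has_integral I])
  fix theta :: real assume t: "theta : {0..1}"
  show "c^2 * theta * KK nu 2 (a + theta * c) <= (c powr (2 - nu/2) / 2) * theta powr (1 - nu/2)"
  proof (cases "theta = 0")
   case False
   hence t0: "0 < theta" using t by simp
   have "c^2 * theta * KK nu 2 (a + theta * c) <= c^2 * theta * ((theta * c) powr (- nu/2) / 2)"
    unfolding KK2 using assms t0 by (intro mult_left_mono divide_right_mono powr_mono2') auto
   also have "... = (c powr 2 * c powr (- nu/2)) / 2 * (theta powr 1 * theta powr (- nu/2))" using assms t0 by (simp add: powr_mult powr_numeral)
   also have "... = (c powr (2 - nu/2) / 2) * theta powr (1 - nu/2)" unfolding powr_add[symmetric] by simp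
   finally show ?thesis .
  qed simp
 qed (use assms in auto)
 thus ?thesis by simp
qed

lemma PK_0 [simp]: "PK nu a 0 = 0" by (simp add: PK_def)

text \<open>Derivatives in \<open>c\<close> are compared: that of \<open>PK 4 a\<close> is
  \<open>c / (2 * (a + c)^2)\<close>, that of the logarithm is \<open>2 * c / (a^2 + c^2)\<close>,
  and \<open>(a + c)^2\<close> lies between \<open>a^2 + c^2\<close> and its double.\<close>

lemma PK_4_bounds:
 assumes "0 < a" "0 <= c"
 shows "ln (1 + (c / a)^2) / 8 <= PK 4 a c" "PK 4 a c <= ln (1 + (c / a)^2) / 4"
proof -
 have e: "ln (1 + (c / a)^2) = ln (a^2 + c^2) - ln (a^2)"
 proof -
  have "1 + (c / a)^2 = (a^2 + c^2) / a^2" using assms by (simp add: field_simps power_divide)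
  thus ?thesis using assms by (simp add: ln_div add_pos_nonneg)
 qed
 have D: "((%c. ln (a^2 + c^2)) has_real_derivative 2 * s / (a^2 + s^2)) (at s)" for s
  using assms by (auto intro!: derivative_eq_intros simp: add_pos_nonneg)
 have K: "s * KK 4 2 (a + s) = s / (2 * (a + s)^2)" if "0 <= s" for s
 proof -
  have "KK 4 2 (a + s) = (a + s) powr (- 2) / 2" unfolding KK2 by simp
  also have "(a + s) powr (- 2) = inverse ((a + s) powr 2)" by (rule powr_minus)
  also have "(a + s) powr 2 = (a + s)^2" using assms that by simp
  finally show ?thesis by (simp only: divide_inverse inverse_mult_distrib mult_ac)
 qed
 have *: "0 < a^2 + s^2" "0 < (a + s)^2" "a^2 + s^2 <= (a + s)^2" "(a + s)^2 <= 2 * (a^2 + s^2)" if "0 <= s" for s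
 proof -
  have "(a + s)^2 = a^2 + s^2 + 2 * a * s" by (rule power2_sum)
  moreover have "0 <= 2 * a * s" "0 < a^2" "0 <= s^2" using assms that by auto
  ultimately show "0 < a^2 + s^2" "0 < (a + s)^2" "a^2 + s^2 <= (a + s)^2" by linarith+
  show "(a + s)^2 <= 2 * (a^2 + s^2)" unfolding power2_sum distrib_left using sum_squares_bound[of a s] by argo
 qed
 have "(%c. PK 4 a c - ln (a^2 + c^2) / 8) 0 <= (%c. PK 4 a c - ln (a^2 + c^2) / 8) c"
 proof (rule DERIV_nonneg_imp_nondecreasing[OF assms(2)])
  fix s :: real assume s: "0 <= s"
  have "((%c. PK 4 a c - ln (a^2 + c^2) / 8) has_real_derivative s / (2 * (a + s)^2) - 2 * s / (a^2 + s^2) / 8) (at s)"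
   by (rule DERIV_diff[OF PK_deriv[OF assms(1) s, of 4, unfolded K[OF s]] DERIV_cdivide[OF D]])
  moreover have "2 * s / (a^2 + s^2) / 8 <= s / (2 * (a + s)^2)"
  proof -
   have "s / (2 * (2 * (a^2 + s^2))) <= s / (2 * (a + s)^2)" using *[OF s] s by (intro divide_left_mono) auto
   moreover have "2 * s / X / 8 = s / (2 * (2 * X))" for X :: real by simp
   ultimately show ?thesis by (simp only:)
  qed
  ultimately show "EX y. ((%c. PK 4 a c - ln (a^2 + c^2) / 8) has_real_derivative y) (at s) & 0 <= y" by (intro exI conjI) auto
 qed
 thus "ln (1 + (c / a)^2) / 8 <= PK 4 a c" unfolding e by simp
 have "(%c. ln (a^2 + c^2) / 4 - PK 4 a c) 0 <= (%c. ln (a^2 + c^2) / 4 - PK 4 a c) c"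
 proof (rule DERIV_nonneg_imp_nondecreasing[OF assms(2)])
  fix s :: real assume s: "0 <= s"
  have "((%c. ln (a^2 + c^2) / 4 - PK 4 a c) has_real_derivative 2 * s / (a^2 + s^2) / 4 - s / (2 * (a + s)^2)) (at s)"
   by (rule DERIV_diff[OF DERIV_cdivide[OF D] PK_deriv[OF assms(1) s, of 4, unfolded K[OF s]]])
  moreover have "s / (2 * (a + s)^2) <= 2 * s / (a^2 + s^2) / 4"
  proof -
   have "s / (2 * (a + s)^2) <= s / (2 * (a^2 + s^2))" using *[OF s] s by (intro divide_left_mono) auto
   moreover have "2 * s / X / 4 = s / (2 * X)" for X :: real by simp
   ultimately show ?thesis by (simp only:)
  qed
  ultimately show "EX y. ((%c. ln (a^2 + c^2) / 4 - PK 4 a c) has_real_derivative y) (at s) & 0 <= y" by (intro exI conjI) auto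
 qed
 thus "PK 4 a c <= ln (1 + (c / a)^2) / 4" unfolding e by simp
qed

text \<open>Concavity of \<open>ln\<close>; it moves constants into and out of the logarithm in
  dimension 4.\<close>

lemma ln_1_scale:
 fixes x l :: real assumes "0 <= x" "0 < l" "l <= 1" shows "l * ln (1 + x) <= ln (1 + l * x)"
proof -
 have "(%x. ln (1 + l * x) - l * ln (1 + x)) 0 <= (%x. ln (1 + l * x) - l * ln (1 + x)) x"
 proof (rule DERIV_nonneg_imp_nondecreasing[OF assms(1)])
  fix s :: real assume s: "0 <= s"
  have p: "0 < 1 + l * s" "0 < 1 + s" using s assms by (auto intro: add_pos_nonneg)
  have "((%x. ln (1 + l * x) - l * ln (1 + x)) has_real_derivative l / (1 + l * s) - l / (1 + s)) (at s)"
   using p by (auto intro!: derivative_eq_intros)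
  moreover have "l / (1 + s) <= l / (1 + l * s)" using p s assms by (intro divide_left_mono) (auto intro: mult_left_le_one_le)
  ultimately show "EX y. ((%x. ln (1 + l * x) - l * ln (1 + x)) has_real_derivative y) (at s) & 0 <= y" by (intro exI conjI) auto
 qed
 thus ?thesis by simp
qed

lemma min_scale:
 fixes X Y :: real
 assumes "0 <= X" "0 <= Y" "k <= alpha" "k <= beta" "alpha * X <= X'" "beta * Y <= Y'" "0 <= k" shows "k * min X Y <= min X' Y'"
proof -
 have "k * min X Y <= k * X" "k * min X Y <= k * Y" using assms(7) by (auto intro: mult_left_mono)
 moreover have "k * X <= alpha * X" "k * Y <= beta * Y" using assms by (auto intro: mult_right_mono)
 ultimately show ?thesis using assms(5,6) by auto
qed

context smooth_bounded_domain
begin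

text \<open>\<open>sol_estimate\<close> for tents that concentrate at \<open>y\<close>. Off the
  diagonal \<open>P x\<close> and \<open>G x\<close> are continuous, so the averages converge;
  \<open>green_L1\<close> turns the integral of \<open>|u|\<close> into an average of
  \<open>d^2\<close>, which tends to \<open>(d y)^2\<close>.\<close>

theorem green_kernel_estimate:
 assumes G: "biharmonic_green_function gamma Om G" and gamma: "gamma < 1"
 shows "EX C>0. ALL x:Om. ALL y:Om. x ~= y --> abs (G x y - P x y / fsol_const TYPE('a)) <= C * (wk x y + (d x)^2 * (d y)^2)"
proof -
 obtain C1 where C1: "0 < C1" "!!f u F x. sols f u ==> bd f F ==> x : Om ==>
  en (abs (u x - (LO z. P x z * f z) / fsol_const TYPE('a))) <=
   en C1 * (kint wk (%z. en (abs (f z))) x + (NO z. en (abs (u z))) * en ((d x)^2))"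
  using sol_estimate by blast
 obtain C2 where C2: "0 < C2" "!!f u F. sols f u ==> bd f F ==>
  (LO z. abs (u z)) <= C2 * (LO z. abs (f z) * (d z)^2)" using green_L1[OF G gamma] by blast
 have nn: "(NO z. en (q z)) = en (LO z. q z)" if "integ q" "!!z. z : Om ==> 0 <= q z" for q :: "'a => real"
 proof -
  have "en (q z) * indicator Om z = en (ind Om z *\<^sub>R q z)" for z by (simp add: indicator_def)
  thus ?thesis unfolding set_lebesgue_integral_def
   using that nn_integral_eq_integral[of lborel "%z. ind Om z *\<^sub>R q z"] by (simp add: set_integrable_def indicator_def)
 qed
 have "abs (G x y - P x y / fsol_const TYPE('a)) <= (C1 * (1 + C2)) * (wk x y + (d x)^2 * (d y)^2)" if x: "x : Om" and y: "y : Om" "x ~= y" for x y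
 proof -
  let ?f = "tent y" and ?u = "%k. gint G (tent y k)"
  have wc: "continuous_on Om (wk x)" and dc: "continuous_on Om (%z. (d z)^2)"
   using R_neq_0[OF x] unfolding wk_def[abs_def] R_def[abs_def] bdist_def by (auto intro!: continuous_intros)
  have ic: "isCont q y" if "continuous_on Om q" for q :: "'a => real" using that y open_dom by (simp add: continuous_on_eq_continuous_at)
  have int: "integ (%z. q z * ?f k z)" if "continuous_on Om q" "!!z. z : Om ==> abs (q z) <= K" for q K k
  proof -
   obtain T where T: "ALL z:Om. abs (?f k z) <= T" using tent_bounded by blast
   show ?thesis
    by (rule set_integrable_bounded_cont[where C = "K * T"]) (use that T in "auto simp: abs_mult intro!: continuous_intros tent_continuous mult_mono'")
  qed
  have db: "abs ((d z)^2) <= Dm^2" if "z : Om" for z using R_ge(2)[of z z] R_le_Dm[OF that that] by (auto intro!: power_mono)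
  have wb: "abs (wk x z) <= Dm^2 * Dm^2 * d x powr (- n + 1/2)" if "z : Om" for z
  proof -
   have "wk x z <= Dm^2 * Dm^2 * d x powr (- n + 1/2)"
    unfolding wk_def using db[OF x] db[OF that] d_pos[OF x] R_ge(2)[of x z] n_ge_1 by (intro mult_mono powr_mono2') auto
   thus ?thesis by simp
  qed
  have iw: "integ (%z. wk x z * ?f k z)" for k by (rule int[OF wc wb])
  have id: "integ (%z. (d z)^2 * ?f k z)" for k by (rule int[OF dc db])
  have Pc: "isCont (P x) y"
  proof -
   have "open (Om - {x})" using open_dom by auto
   thus ?thesis using P_continuous[OF x] y by (auto simp: continuous_on_eq_continuous_at)
  qed
  have iP: "integ (%z. P x z * ?f k z)" for k
  proof -
   obtain T where T: "!!z. z : Om ==> abs (?f k z) <= T" using tent_bounded by blast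
   show ?thesis by (rule P_f_integrable[OF x tent_continuous T])
  qed
  let ?a = "%k. abs (?u k x - (LO z. P x z * ?f k z) / fsol_const TYPE('a))"
  let ?b = "%k. C1 * ((LO z. wk x z * ?f k z) + C2 * (LO z. (d z)^2 * ?f k z) * (d x)^2)"
  have le: "?a k <= ?b k" for k
  proof -
   have s: "sols (?f k) (?u k)" by (rule green_solves[OF G tent_holder[OF gamma]])
   obtain T where T: "ALL z:Om. abs (?f k z) <= T" using tent_bounded by blast
   obtain M where M: "ALL z:Om. abs (?u k z) <= M" using sol_bounded[OF s] by blast
   have iu: "integ (%z. abs (?u k z))"
    by (rule set_integrable_bounded_cont[where C = M]) (use M in "auto intro: continuous_on_rabs sol_continuous[OF s]")
   have 1: "kint wk (%z. en (abs (?f k z))) x = en (LO z. wk x z * ?f k z)"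
   proof -
    have "kint wk (%z. en (abs (?f k z))) x = (NO z. en (wk x z * ?f k z))"
     unfolding kint_def by (simp add: ennreal_mult tent_nonneg mult.assoc)
    thus ?thesis using nn[OF iw] by (simp add: tent_nonneg)
   qed
   have 2: "(NO z. en (abs (?u k z))) <= en (C2 * (LO z. (d z)^2 * ?f k z))"
    using C2(2)[OF s T] nn[OF iu] by (simp add: tent_nonneg ennreal_leI mult.commute)
   have n1: "0 <= (LO z. wk x z * ?f k z)" "0 <= (LO z. (d z)^2 * ?f k z)"
    unfolding set_lebesgue_integral_def by (auto intro!: integral_nonneg simp: tent_nonneg)
   have "en (?a k) <= en C1 * (en (LO z. wk x z * ?f k z) + en (C2 * (LO z. (d z)^2 * ?f k z)) * en ((d x)^2))"
    by (rule order_trans[OF C1(2)[OF s T x]]) (unfold 1, intro mult_left_mono add_left_mono mult_right_mono 2, simp_all)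
   also have "... = en (?b k)" using C1(1) C2(1) n1 by (simp add: ennreal_mult[symmetric] ennreal_plus[symmetric] del: ennreal_plus)
   finally show ?thesis using C1(1) C2(1) n1 by (subst (asm) ennreal_le_iff) auto
  qed
  have "?a ----> abs (G x y - P x y / fsol_const TYPE('a))"
   using fsol_const_pos[where 'a='a] by (intro tendsto_intros green_tent_limit[OF G gamma x y] tent_limit[OF y(1) iP Pc]) auto
  moreover have "?b ----> C1 * (wk x y + C2 * (d y)^2 * (d x)^2)"
   by (intro tendsto_intros tent_limit[OF y(1) iw ic[OF wc]] tent_limit[OF y(1) id ic[OF dc]])
  ultimately have "abs (G x y - P x y / fsol_const TYPE('a)) <= C1 * (wk x y + C2 * (d y)^2 * (d x)^2)"
   by (rule LIMSEQ_le) (use le in blast)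
  also have "... <= C1 * ((1 + C2) * (wk x y + (d x)^2 * (d y)^2))"
   using C1(1) C2(1) by (intro mult_left_mono) (auto simp: algebra_simps)
  finally show ?thesis by (simp add: mult.assoc)
 qed
 moreover have "0 < C1 * (1 + C2)" using C1(1) C2(1) by (simp add: add_pos_pos)
 ultimately show ?thesis by blast
qed

section \<open>Two-sided comparison of the parametrix with H\<close>

lemma PK_P_bounds:
 "EX c>0. EX C>0. ALL x:Om. ALL y:Om. x ~= y --> (EX e. c * (d x * d y) <= e & e <= C * (d x * d y) & P x y = PK n ((dist x y)^2) e)"
proof -
 obtain c C where "0 < c" "0 < C" "!!x z. x : Om ==> z : Om ==> c * (d x * d z) <= 4 * t x * rho x z & 4 * t x * rho x z <= C * (d x * d z)"
  using trho_bounds by blast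
 thus ?thesis unfolding P_eq_PK sqdist_dist by blast
qed

lemma P_compare_H:
 assumes "2 <= DIM('a)"
 shows "EX c>0. EX C>0. ALL x:Om. ALL y:Om. x ~= y --> c * H_kernel Om x y <= P x y & P x y <= C * H_kernel Om x y"
proof -
 obtain c C where c: "0 < c" "0 < C" "!!x y. x : Om ==> y : Om ==> x ~= y ==>
  (EX e. c * (d x * d y) <= e & e <= C * (d x * d y) & P x y = PK n ((dist x y)^2) e)" using PK_P_bounds by blast
 have n2: "2 <= n" using assms by (simp add: n_eq)
 let ?k = "2 powr (- n/2) / 4"
 have sq: "(c * D)^2 <= e^2" "e^2 <= (C * D)^2" if "c * D <= e" "e <= C * D" "0 < D" for D e
  using that c mult_pos_pos[OF c(1) that(3)] by (auto intro!: power_mono intro: order_trans[of 0 "c * D" e])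
 have pr: "((r::real)^2) powr p = r powr (2 * p)" if "0 < r" for r p
  using that by (simp add: powr_powr[symmetric] powr_numeral)
 consider "4 < n" | "n = 4" | "n < 4" by linarith
 thus ?thesis
 proof cases
  case 1
  have H: "H_kernel Om x y = min (dist x y powr (4 - n)) ((d x * d y)^2 * dist x y powr (- n))" if "x ~= y" for x y
  proof -
   have r: "0 < dist x y" using that by simp
   have e: "dist x y powr (4 - n) = dist x y ^ 4 * dist x y powr (- n)"
    using r powr_add[of "dist x y" 4 "- n"] by (simp add: powr_numeral)
   have "norm (x - y) powi (4 - int DIM('a)) = dist x y powr (4 - n)"
    using powr_real_of_int'[of "dist x y" "4 - int DIM('a)"] r by (simp add: n_eq dist_norm)
   moreover have "4 < DIM('a)" using 1 by (simp add: n_eq)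
   ultimately have "H_kernel Om x y = dist x y powr (4 - n) * min 1 ((d x)^2 * (d y)^2 / dist x y ^ 4)"
    by (simp add: H_kernel_def Let_def dist_norm)
   also have "... = min (dist x y powr (4 - n)) (dist x y powr (4 - n) * ((d x)^2 * (d y)^2 / dist x y ^ 4))" by (simp add: min_mult_distrib_left)
   also have "dist x y powr (4 - n) * ((d x)^2 * (d y)^2 / dist x y ^ 4) = (d x * d y)^2 * dist x y powr (- n)" unfolding e using r by (simp add: power_mult_distrib)
   finally show ?thesis .
  qed
  let ?K = "1 / ((n - 2) * (n/2 - 2))"
  have K: "0 < ?K" using 1 by simp
  have "?k * min 1 (c^2) * H_kernel Om x y <= P x y & P x y <= max ?K (C^2 / 4) * H_kernel Om x y" if xy: "x : Om" "y : Om" "x ~= y" for x y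
  proof -
   define D r where "D = d x * d y" and "r = dist x y"
   have D: "0 < D" "0 < r" using d_pos xy by (simp_all add: D_def r_def)
   obtain e where e: "c * D <= e" "e <= C * D" "P x y = PK n (r^2) e" using c(3)[OF xy] unfolding D_def r_def by blast
   have e0: "0 < e" using e(1) mult_pos_pos[OF c(1) D(1)] by linarith
   have X: "(r^2) powr (- n/2) = r powr (- n)" "(r^2) powr (2 - n/2) = r powr (4 - n)" using pr[OF D(2)] by simp_all
   have HH: "H_kernel Om x y = min (D^2 * r powr (- n)) (r powr (4 - n))" unfolding H[OF xy(3)] D_def r_def by (rule min.commute)
   have "min 1 (c^2) * min (D^2 * r powr (- n)) (r powr (4 - n)) <= min (e^2 * r powr (- n)) (r powr (4 - n))"
    by (rule min_scale[where alpha = "c^2" and beta = 1]) (use sq(1)[OF e(1,2) D(1)] in "auto simp: power_mult_distrib mult.assoc[symmetric] intro: mult_right_mono")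
   hence "?k * (min 1 (c^2) * H_kernel Om x y) <= ?k * min (e^2 * r powr (- n)) (r powr (4 - n))" unfolding HH by (rule mult_left_mono) simp
   also have "... <= P x y" unfolding e(3) using PK_lower_min[of "r^2" e n] D(2) e0 n2 unfolding X by simp
   finally have lo: "?k * min 1 (c^2) * H_kernel Om x y <= P x y" by (simp add: mult.assoc)
   have "P x y <= e^2 * r powr (- n) / 4" unfolding e(3) using PK_le_1[of "r^2" e n] D(2) e0 n2 unfolding X by simp
   also have "... <= (C * D)^2 * r powr (- n) / 4" using sq(2)[OF e(1,2) D(1)] by (intro divide_right_mono mult_right_mono) auto
   also have "... = C^2 / 4 * (D^2 * r powr (- n))" by (simp add: power_mult_distrib)
   also have "... <= max ?K (C^2 / 4) * (D^2 * r powr (- n))" by (intro mult_right_mono) auto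
   finally have u1: "P x y <= max ?K (C^2 / 4) * (D^2 * r powr (- n))" .
   have "P x y <= ?K * r powr (4 - n)" unfolding e(3) using PK_le_KK0[of "r^2" e n] D(2) e0 1 unfolding X by simp
   also have "... <= max ?K (C^2 / 4) * r powr (4 - n)" by (intro mult_right_mono) auto
   finally have u2: "P x y <= max ?K (C^2 / 4) * r powr (4 - n)" .
   show ?thesis using lo u1 u2 unfolding HH by (auto simp: min_def)
  qed
  moreover have "0 < ?k * min 1 (c^2)" "0 < max ?K (C^2 / 4)" using c K by (auto simp: less_max_iff_disj)
  ultimately show ?thesis by blast
 next
  case 2
  have H: "H_kernel Om x y = ln (1 + (d x * d y / (dist x y)^2)^2)" for x y
  proof -
   have "DIM('a) = 4" using 2 by (simp add: n_eq)
   thus ?thesis by (simp add: H_kernel_def dist_norm power_divide power_mult_distrib power_mult[symmetric])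
  qed
  have "min 1 (c^2) / 8 * H_kernel Om x y <= P x y & P x y <= max 1 (C^2) / 4 * H_kernel Om x y" if xy: "x : Om" "y : Om" "x ~= y" for x y
  proof -
   define D r where "D = d x * d y" and "r = dist x y"
   have D: "0 < D" "0 < r" using d_pos xy by (simp_all add: D_def r_def)
   obtain e where e: "c * D <= e" "e <= C * D" "P x y = PK n (r^2) e" using c(3)[OF xy] unfolding D_def r_def by blast
   have e0: "0 < e" using e(1) mult_pos_pos[OF c(1) D(1)] by linarith
   define q where "q = (D / r^2)^2"
   have q: "0 <= q" by (simp add: q_def)
   have s: "c^2 * q <= (e / r^2)^2" "(e / r^2)^2 <= C^2 * q"
    using sq[OF e(1,2) D(1)] by (simp_all add: q_def power_divide power_mult_distrib divide_right_mono)
   have HH: "H_kernel Om x y = ln (1 + q)" by (simp add: H q_def D_def r_def)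
   have "min 1 (c^2) * ln (1 + q) <= ln (1 + min 1 (c^2) * q)" using q c by (intro ln_1_scale) auto
   also have "... <= ln (1 + (e / r^2)^2)"
   proof -
    have "min 1 (c^2) * q <= c^2 * q" "0 <= min 1 (c^2) * q" using q by (auto intro: mult_right_mono)
    thus ?thesis using s(1) by (subst ln_le_cancel_iff) auto
   qed
   finally have 1: "min 1 (c^2) * ln (1 + q) <= ln (1 + (e / r^2)^2)" .
   define mu where "mu = max 1 (C^2)"
   have m: "1 <= mu" "C^2 <= mu" by (auto simp: mu_def)
   have "(1 / mu) * ln (1 + mu * q) <= ln (1 + (1 / mu) * (mu * q))" using m q by (intro ln_1_scale) auto
   hence "ln (1 + mu * q) <= mu * ln (1 + q)" using m by (simp add: field_simps)
   moreover have "ln (1 + (e / r^2)^2) <= ln (1 + mu * q)"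
   proof -
    have "C^2 * q <= mu * q" using m q by (intro mult_right_mono)
    hence "(e / r^2)^2 <= mu * q" using s(2) by linarith
    moreover have "0 < 1 + (e / r^2)^2" by (simp add: add_pos_nonneg)
    ultimately show ?thesis by simp
   qed
   ultimately have 2: "ln (1 + (e / r^2)^2) <= mu * ln (1 + q)" by linarith
   have n4: "PK n (r^2) e = PK 4 (r^2) e" unfolding \<open>n = 4\<close> ..
   have "0 < r^2" using D by simp
   from PK_4_bounds[OF this less_imp_le[OF e0]] show ?thesis
    using 1 2 unfolding HH trans[OF e(3) n4] mu_def[symmetric] by (simp add: field_simps)
  qed
  moreover have "0 < min 1 (c^2) / 8" "0 < max 1 (C^2) / 4" using c by (auto simp: less_max_iff_disj)
  ultimately show ?thesis by blast
 next
  case 3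
  have H: "H_kernel Om x y = min ((d x * d y) powr (2 - n/2)) ((d x * d y)^2 * dist x y powr (- n))" if xy: "x : Om" "y : Om" "x ~= y" for x y
  proof -
   define D where "D = d x * d y"
   have D: "0 < D" using d_pos xy by (simp add: D_def)
   have r: "0 < dist x y" using xy by simp
   have m: "d x powr p * d y powr p = D powr p" for p by (simp add: D_def powr_mult)
   have "dist x y ^ DIM('a) = dist x y powr n" using r by (simp add: n_eq powr_realpow)
   hence "H_kernel Om x y = D powr (2 - n/2) * min 1 (D powr (n/2) / dist x y powr n)"
    using 3 xy(3) m by (simp add: H_kernel_def Let_def dist_norm n_eq)
   also have "... = min (D powr (2 - n/2)) (D powr (2 - n/2) * (D powr (n/2) / dist x y powr n))" by (simp add: min_mult_distrib_left)
   also have "D powr (2 - n/2) * (D powr (n/2) / dist x y powr n) = (D powr (2 - n/2) * D powr (n/2)) * dist x y powr (- n)" unfolding powr_minus divide_inverse by (rule mult.assoc[symmetric])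
   also have "D powr (2 - n/2) * D powr (n/2) = D^2" unfolding powr_add[symmetric] using D by simp
   finally show ?thesis unfolding D_def .
  qed
  let ?p = "2 - n/2"
  have p: "0 < ?p" using 3 by simp
  let ?K = "C powr ?p / (2 * ?p)"
  have K: "0 < ?K" using p c by simp
  have "?k * min (c^2) (c powr ?p) * H_kernel Om x y <= P x y & P x y <= max ?K (C^2 / 4) * H_kernel Om x y" if xy: "x : Om" "y : Om" "x ~= y" for x y
  proof -
   define D r where "D = d x * d y" and "r = dist x y"
   have D: "0 < D" "0 < r" using d_pos xy by (simp_all add: D_def r_def)
   obtain e where e: "c * D <= e" "e <= C * D" "P x y = PK n (r^2) e" using c(3)[OF xy] unfolding D_def r_def by blast
   have e0: "0 < e" using e(1) mult_pos_pos[OF c(1) D(1)] by linarith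
   have X: "(r^2) powr (- n/2) = r powr (- n)" using pr[OF D(2)] by simp
   have HH: "H_kernel Om x y = min (D^2 * r powr (- n)) (D powr ?p)" unfolding H[OF xy] D_def r_def by (rule min.commute)
   have ep: "c powr ?p * D powr ?p <= e powr ?p" "e powr ?p <= C powr ?p * D powr ?p"
    using e e0 p c D by (auto simp: powr_mult[symmetric] intro!: powr_mono2)
   have "min (c^2) (c powr ?p) * min (D^2 * r powr (- n)) (D powr ?p) <= min (e^2 * r powr (- n)) (e powr ?p)"
    by (rule min_scale[where alpha = "c^2" and beta = "c powr ?p"]) (use sq(1)[OF e(1,2) D(1)] ep in "auto simp: power_mult_distrib mult.assoc[symmetric] intro: mult_right_mono")
   hence "?k * (min (c^2) (c powr ?p) * H_kernel Om x y) <= ?k * min (e^2 * r powr (- n)) (e powr ?p)" unfolding HH by (rule mult_left_mono) simp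
   also have "... <= P x y" unfolding e(3) using PK_lower_max[of "r^2" e n] D(2) e0 n2 unfolding X by simp
   finally have lo: "?k * min (c^2) (c powr ?p) * H_kernel Om x y <= P x y" by (simp add: mult.assoc)
   have "P x y <= e^2 * r powr (- n) / 4" unfolding e(3) using PK_le_1[of "r^2" e n] D(2) e0 n2 unfolding X by simp
   also have "... <= (C * D)^2 * r powr (- n) / 4" using sq(2)[OF e(1,2) D(1)] by (intro divide_right_mono mult_right_mono) auto
   also have "... = C^2 / 4 * (D^2 * r powr (- n))" by (simp add: power_mult_distrib)
   also have "... <= max ?K (C^2 / 4) * (D^2 * r powr (- n))" by (intro mult_right_mono) auto
   finally have u1: "P x y <= max ?K (C^2 / 4) * (D^2 * r powr (- n))" .
   have "P x y <= e powr ?p / (2 * ?p)" unfolding e(3) using D(2) e0 3 n2 by (intro PK_le_c) auto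
   also have "... <= C powr ?p * D powr ?p / (2 * ?p)" using ep(2) p by (intro divide_right_mono) auto
   also have "... = ?K * D powr ?p" by simp
   also have "... <= max ?K (C^2 / 4) * D powr ?p" by (intro mult_right_mono) auto
   finally have u2: "P x y <= max ?K (C^2 / 4) * D powr ?p" .
   show ?thesis using lo u1 u2 unfolding HH by (auto simp: min_def)
  qed
  moreover have "0 < ?k * min (c^2) (c powr ?p)" "0 < max ?K (C^2 / 4)" using c K by (auto simp: less_max_iff_disj)
  ultimately show ?thesis by blast
 qed
qed

lemma green_off_diagonal:
 assumes G: "biharmonic_green_function gamma Om G" and gamma: "gamma < 1" and dim: "2 <= DIM('a)"
 shows "EX c1>=0. EX c2>0. ALL x:Om. ALL y:Om. x ~= y -->
  inverse c2 * H_kernel Om x y <= G x y + c1 * (d x)^2 * (d y)^2 & G x y + c1 * (d x)^2 * (d y)^2 <= c2 * H_kernel Om x y"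
proof -
 let ?kappa = "fsol_const TYPE('a)"
 have kappa: "0 < ?kappa" by (rule fsol_const_pos)
 obtain C where C: "0 < C" "!!x y. x : Om ==> y : Om ==> x ~= y ==> abs (G x y - P x y / ?kappa) <= C * (wk x y + (d x)^2 * (d y)^2)"
  using green_kernel_estimate[OF G gamma] by blast
 obtain p where p: "0 < p" "!!x z. x : Om ==> z : Om ==> z ~= x ==> p * (d x)^2 * (d z)^2 * R x z powr (- n) <= P x z" using P_lower by blast
 obtain h h' where h: "0 < h" "0 < h'" "!!x y. x : Om ==> y : Om ==> x ~= y ==> h * H_kernel Om x y <= P x y & P x y <= h' * H_kernel Om x y"
  using P_compare_H[OF dim] by blast
 \<comment> \<open>Chosen so that \<open>C * wk\<close> is at most half of \<open>P / ?kappa\<close>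
   where \<open>R <= eta\<close>: there \<open>wk\<close> is at most \<open>eta powr (1/2)\<close>
   times \<open>P / p\<close>.\<close>
 define eta where "eta = (p / (2 * ?kappa * C)) powr 2"
 have eta: "0 < eta" "eta powr (1/2) = p / (2 * ?kappa * C)" using p C kappa by (simp_all add: eta_def powr_powr)
 \<comment> \<open>The first summand pays for \<open>C * wk\<close> where \<open>R > eta\<close>,
   the 1 for the term \<open>(d x)^2 * (d y)^2\<close> of the kernel estimate.\<close>
 define c1 where "c1 = C * (eta powr (- n + 1/2) + 1)"
 have c1: "0 < c1" using C by (simp add: c1_def add_nonneg_pos)
 \<comment> \<open>\<open>3 / (2 * ?kappa)\<close> is \<open>1 / ?kappa\<close> plus the absorbed
   half; the other summand bounds two copies of \<open>c1 * Q\<close> by \<open>P\<close>, using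
   \<open>R <= Dm\<close>.\<close>
 define K where "K = (3 / (2 * ?kappa) + 2 * c1 * Dm powr n / p) * h'"
 have K: "0 < K" using kappa c1 p h by (simp add: K_def add_pos_nonneg)
 define c2 where "c2 = max K (2 * ?kappa / h)"
 have c2: "0 < c2" "K <= c2" "2 * ?kappa / h <= c2" using K by (auto simp: c2_def)
 have "inverse c2 * H_kernel Om x y <= G x y + c1 * (d x)^2 * (d y)^2 & G x y + c1 * (d x)^2 * (d y)^2 <= c2 * H_kernel Om x y"
  if x: "x : Om" and y: "y : Om" "x ~= y" for x y
 proof -
  define Q where "Q = (d x)^2 * (d y)^2"
  have Q: "0 <= Q" by (simp add: Q_def)
  have P: "p * (Q * R x y powr (- n)) <= P x y" using p(2)[OF x y(1) y(2)[symmetric]] by (simp add: Q_def mult.assoc)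
  have Rp: "0 < R x y" by (rule R_pos[OF x])
  have w: "C * wk x y <= P x y / (2 * ?kappa) + C * eta powr (- n + 1/2) * Q"
  proof (cases "R x y <= eta")
   case True
   have "wk x y = R x y powr (1/2) * (Q * R x y powr (- n))" by (simp only: wk_def Q_def powr_add[of _ "- n" "1/2"] mult_ac)
   also have "... <= eta powr (1/2) * (Q * R x y powr (- n))" using True Rp Q by (intro mult_right_mono powr_mono2) auto
   also have "... = (p * (Q * R x y powr (- n))) / (2 * ?kappa * C)" unfolding eta(2) by simp
   also have "... <= P x y / (2 * ?kappa * C)" using P C kappa by (intro divide_right_mono) auto
   finally have "C * wk x y <= C * (P x y / (2 * ?kappa * C))" using C by (intro mult_left_mono) auto
   also have "... = P x y / (2 * ?kappa)" using C by simp
   finally show ?thesis using C Q by (simp add: add_increasing2)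
  next
   case False
   hence "R x y powr (- n + 1/2) <= eta powr (- n + 1/2)" using eta n_ge_1 by (intro powr_mono2') auto
   hence "Q * R x y powr (- n + 1/2) <= Q * eta powr (- n + 1/2)" using Q by (rule mult_left_mono)
   hence "C * wk x y <= C * eta powr (- n + 1/2) * Q" using C by (simp add: wk_def Q_def mult_ac)
   moreover have "0 <= P x y" using P_nonneg[OF x y(1)] y(2) by simp
   ultimately show ?thesis using kappa by (simp add: add_increasing)
  qed
  have "abs (G x y - P x y / ?kappa) <= C * wk x y + C * Q" using C(2)[OF x y] by (simp add: Q_def distrib_left)
  also have "... <= P x y / (2 * ?kappa) + c1 * Q" using w by (simp add: c1_def algebra_simps)
  finally have b: "abs (G x y - P x y / ?kappa) <= P x y / (2 * ?kappa) + c1 * Q" .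
  have half: "P x y / ?kappa = P x y / (2 * ?kappa) + P x y / (2 * ?kappa)" using kappa by (simp add: field_simps)
  have H0: "0 <= H_kernel Om x y"
  proof -
   have "0 <= P x y" using P_nonneg[OF x y(1)] y(2) by simp
   hence "0 <= h' * H_kernel Om x y" using h(3)[OF x y] by linarith
   thus ?thesis using h(2) by (simp add: zero_le_mult_iff)
  qed
  have "inverse c2 * H_kernel Om x y <= inverse (2 * ?kappa / h) * H_kernel Om x y"
   using c2 h kappa H0 by (intro mult_right_mono le_imp_inverse_le) auto
  also have "... = (h * H_kernel Om x y) / (2 * ?kappa)" by (simp add: field_simps)
  also have "... <= P x y / (2 * ?kappa)" using h(3)[OF x y] kappa by (intro divide_right_mono) auto
  also have "... <= G x y + c1 * Q" using b half by linarith
  finally have lo: "inverse c2 * H_kernel Om x y <= G x y + c1 * Q" .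
  have Qb: "Q <= Dm powr n / p * P x y"
  proof -
   have "Dm powr (- n) <= R x y powr (- n)" using R_le_Dm[OF x y(1)] Rp n_ge_1 by (intro powr_mono2') auto
   hence "p * (Q * Dm powr (- n)) <= P x y" using P p(1) Q by (meson mult_left_mono less_imp_le order_trans)
   hence "Dm powr n / p * (p * (Q * Dm powr (- n))) <= Dm powr n / p * P x y" using p(1) by (intro mult_left_mono) auto
   moreover have "Dm powr n / p * (p * (Q * Dm powr (- n))) = Q" using p(1) Dm_ge_1 by (simp add: powr_minus)
   ultimately show ?thesis by simp
  qed
  have "3 / (2 * ?kappa) * P x y = 3 * (P x y / (2 * ?kappa))" by simp
  hence "G x y + c1 * Q <= 3 / (2 * ?kappa) * P x y + 2 * c1 * Q" using b half by linarith
  also have "... <= 3 / (2 * ?kappa) * P x y + 2 * c1 * (Dm powr n / p * P x y)" using Qb c1 by (intro add_left_mono mult_left_mono) auto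
  also have "... = (3 / (2 * ?kappa) + 2 * c1 * Dm powr n / p) * P x y" by (simp add: distrib_right)
  also have "... <= (3 / (2 * ?kappa) + 2 * c1 * Dm powr n / p) * (h' * H_kernel Om x y)"
   using h(3)[OF x y] kappa c1 p(1) by (intro mult_left_mono) auto
  also have "... = K * H_kernel Om x y" by (simp add: K_def)
  also have "... <= c2 * H_kernel Om x y" using c2(2) H0 by (rule mult_right_mono)
  finally show ?thesis using lo by (simp add: Q_def mult.assoc)
 qed
 thus ?thesis using c1 c2(1) less_imp_le by blast
qed

text \<open>For \<open>y\<close> close to \<open>x\<close> the minimum in \<open>H\<close> is 1, so
  near the diagonal \<open>H\<close> agrees with a continuous function; the convention at
  \<open>x = y\<close> is the matching value.\<close>

lemma H_kernel_diagonal_limit: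
 assumes "2 <= DIM('a)" "DIM('a) < 4" "x : Om" shows "(H_kernel Om x ---> H_kernel Om x x) (at x)"
proof -
 let ?p = "2 - n/2"
 have dx: "0 < d x" by (rule d_pos[OF assms(3)])
 have Hx: "H_kernel Om x x = d x powr ?p * d x powr ?p" using assms(2) by (simp add: H_kernel_def n_eq Let_def)
 have "\<forall>\<^sub>F y in at x. dist y x < d x / 2" unfolding eventually_at using dx by (intro exI[of _ "d x / 2"]) auto
 hence ev: "\<forall>\<^sub>F y in at x. d x powr ?p * d y powr ?p = H_kernel Om x y"
 proof (rule eventually_mp[rotated], intro always_eventually allI impI)
  fix y assume y: "dist y x < d x / 2"
  have dy: "d x / 2 <= d y" using d_lipschitz[of x y] y by (simp add: dist_commute)
  have "dist x y powr n <= (d x / 2) powr n" using y n_ge_1 by (intro powr_mono2) (auto simp: dist_commute)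
  also have "... = (d x / 2) powr (n/2) * (d x / 2) powr (n/2)" by (simp add: powr_add[symmetric])
  also have "... <= d x powr (n/2) * d y powr (n/2)" using dx dy n_ge_1 by (intro mult_mono powr_mono2) auto
  finally have le: "dist x y powr n <= d x powr (n/2) * d y powr (n/2)" .
  have "min 1 (d x powr (n/2) * d y powr (n/2) / dist x y ^ DIM('a)) = 1" if "x ~= y"
  proof -
   have "0 < dist x y" using that by simp
   moreover have "dist x y ^ DIM('a) = dist x y powr n" using that by (simp add: n_eq powr_realpow)
   ultimately have "1 <= d x powr (n/2) * d y powr (n/2) / dist x y ^ DIM('a)" using le by (simp add: le_divide_eq)
   thus ?thesis by simp
  qed
  thus "d x powr ?p * d y powr ?p = H_kernel Om x y" using assms(2) by (cases "x = y") (auto simp: H_kernel_def Let_def n_eq dist_norm)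
 qed
 have "(d ---> d x) (at x)" unfolding bdist_def by (intro tendsto_intros)
 hence "((%y. d x powr ?p * d y powr ?p) ---> d x powr ?p * d x powr ?p) (at x)" using dx by (intro tendsto_intros) auto
 thus ?thesis unfolding Hx using ev by (rule Lim_transform_eventually)
qed

text \<open>The constants are chosen before \<open>G\<close>, so they are taken from one Green
  function and carried over to every other by uniqueness. On the diagonal, in dimensions 2 and 3,
  the estimate is the limit of \<open>y\<close> tending to \<open>x\<close>.\<close>

theorem green_estimate:
 assumes gamma: "gamma < 1" and dim: "2 <= DIM('a)"
 shows "EX c1 c2. c1 >= 0 & c2 > 0 & (ALL G. biharmonic_green_function gamma Om G -->
   (ALL x:Om. ALL y:Om. (DIM('a) >= 4 --> x ~= y) -->
    inverse c2 * H_kernel Om x y <= G x y + c1 * (d x)^2 * (d y)^2 &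
    G x y + c1 * (d x)^2 * (d y)^2 <= c2 * H_kernel Om x y))"
proof (cases "EX G. biharmonic_green_function gamma Om G")
 \<comment> \<open>Without a Green function the claim is vacuous, and any admissible constants
   do.\<close>
 case False thus ?thesis by (intro exI[of _ 0] exI[of _ 1]) auto
next
 case True
 then obtain G0 where G0: "biharmonic_green_function gamma Om G0" by blast
 obtain c1 c2 where c: "0 <= c1" "0 < c2" "!!x y. x : Om ==> y : Om ==> x ~= y ==>
  inverse c2 * H_kernel Om x y <= G0 x y + c1 * (d x)^2 * (d y)^2 & G0 x y + c1 * (d x)^2 * (d y)^2 <= c2 * H_kernel Om x y"
  using green_off_diagonal[OF G0 gamma dim] by blast
 have "inverse c2 * H_kernel Om x y <= G x y + c1 * (d x)^2 * (d y)^2 & G x y + c1 * (d x)^2 * (d y)^2 <= c2 * H_kernel Om x y"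
  if G: "biharmonic_green_function gamma Om G" and x: "x : Om" and y: "y : Om" and ne: "DIM('a) >= 4 --> x ~= y" for G x y
 proof (cases "x = y")
  case False thus ?thesis using c(3)[OF x y] green_unique[OF G G0 gamma x y] by simp
 next
  case True
  hence n4: "DIM('a) < 4" using ne by force
  hence "DIM('a) : {2, 3}" using dim by auto
  hence "continuous_on (Om \<times> Om) (%(x, y). G x y)" using G unfolding biharmonic_green_function_def by blast
  hence "continuous_on ((%y. (x, y)) ` Om) (%(x, y). G x y)" by (rule continuous_on_subset) (use x in auto)
  from continuous_on_compose[OF continuous_on_Pair[OF continuous_on_const continuous_on_id] this]
  have "continuous_on Om (G x)" by (simp add: o_def)
  hence Gx: "(G x ---> G x x) (at x)" using x open_dom by (simp add: continuous_on_eq_continuous_at isCont_def)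
  have "(d ---> d x) (at x)" unfolding bdist_def by (intro tendsto_intros)
  hence lim: "((%y. G x y + c1 * (d x)^2 * (d y)^2) ---> G x x + c1 * (d x)^2 * (d x)^2) (at x)" by (intro tendsto_intros Gx)
  have H: "((%y. a * H_kernel Om x y) ---> a * H_kernel Om x x) (at x)" for a
   by (rule tendsto_mult_left[OF H_kernel_diagonal_limit[OF dim n4 x]])
  have "\<forall>\<^sub>F y in at x. y : Om & y ~= x" using eventually_at_in_open[OF open_dom x] by simp
  hence ev: "\<forall>\<^sub>F y in at x. inverse c2 * H_kernel Om x y <= G x y + c1 * (d x)^2 * (d y)^2 & G x y + c1 * (d x)^2 * (d y)^2 <= c2 * H_kernel Om x y"
   by eventually_elim (use c(3)[OF x] green_unique[OF G G0 gamma x] in auto)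
  have "inverse c2 * H_kernel Om x x <= G x x + c1 * (d x)^2 * (d x)^2"
   by (rule tendsto_le[OF _ lim H]) (use ev in "auto elim: eventually_mono")
  moreover have "G x x + c1 * (d x)^2 * (d x)^2 <= c2 * H_kernel Om x x"
   by (rule tendsto_le[OF _ H lim]) (use ev in "auto elim: eventually_mono")
  ultimately show ?thesis using True by simp
 qed
 thus ?thesis using c(1,2) by blast
qed

end

theorem theorem1:
 fixes \<Omega> :: "(real ^ 'n) set" and \<gamma> :: real
 assumes "CARD('n) \<ge> 2"
  and "0 < \<gamma>" and "\<gamma> < 1"
  and "bounded \<Omega>"
  and "C_k_holder_domain 4 \<gamma> \<Omega>"
 shows "\<exists>c1 c2. c1 \<ge> 0 \<and> c2 > 0 \<and>
  (\<forall>G. biharmonic_green_function \<gamma> \<Omega> G \<longrightarrow>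
   (\<forall>x\<in>\<Omega>. \<forall>y\<in>\<Omega>. (CARD('n) \<ge> 4 \<longrightarrow> x \<noteq> y) \<longrightarrow>
    inverse c2 * H_kernel \<Omega> x y \<le> G x y + c1 * (bdist \<Omega> x)\<^sup>2 * (bdist \<Omega> y)\<^sup>2 \<and>
    G x y + c1 * (bdist \<Omega> x)\<^sup>2 * (bdist \<Omega> y)\<^sup>2 \<le> c2 * H_kernel \<Omega> x y))"
proof -
 obtain \<phi> c C m where \<phi>: "C_k_on 4 UNIV \<phi> \<and> 0 < c \<and> 0 < C \<and> 0 < m \<and>
   (\<forall>x\<in>\<Omega>. 0 < \<phi> x \<and> c * bdist \<Omega> x \<le> \<phi> x \<and> \<phi> x \<le> C * bdist \<Omega> x) \<and> (\<forall>x\<in>frontier \<Omega>. \<phi> x = 0) \<and>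
   (\<forall>x\<in>\<Omega>. \<phi> x < m \<longrightarrow> m \<le> grad_inner \<phi> \<phi> x)"
  using defining_function[OF assms(2,5,4)] by (elim exE) (rule that)
 have \<Omega>: "open \<Omega>" "\<Omega> \<noteq> {}" using assms(5) by (simp_all add: C_k_holder_domain_def)
 interpret smooth_bounded_domain \<Omega> \<phi> c C m "real DIM(real ^ 'n)"
  unfolding smooth_bounded_domain_def using \<phi> \<Omega> assms(4) by (intro conjI allI impI refl) blast+
 have "DIM(real ^ 'n) = CARD('n)" by simp
 then show ?thesis using green_estimate[OF assms(3)] assms(1) by simp
qed

end
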